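(* Let $n\ge 2$ be an integer and let $\nu_0,\nu_1\in\mathbb{C}$ be arbitrary constants, with $\nu_0=\nu_1$ if $n$ is odd. Let $H_{W(I_2(n))}(\nu)$, $\nu=(\nu_0,\nu_1)$, be the superalgebra of observables of the rational Calogero model based on the root system $I_2(n)$. Then $H_{W(I_2(n))}(\nu)$ has exactly $\left[\frac{n+1}{2}\right]$ independent supertraces; that is, the complex vector space of all supertraces on $H_{W(I_2(n))}(\nu)$ has dimension $\left[\frac{n+1}{2}\right]$, where $[\cdot]$ denotes the integer part.
   Context: Identify $\mathbb{R}^2$ with $\mathbb{C}$, with coordinates $z$ and its complex conjugate $z^*$. The root system $I_2(n)$ consists of the $2n$ vectors $v_k=\exp(\pi i k/n)$, $k=0,1,\dots,2n-1$ (indices of $v_k$ are taken modulo $2n$). Its Coxeter group $W(I_2(n))$ is the finite group of order $2n$ generated by the orthogonal reflections $R_k: z\mapsto -v_k^2 z^*$ in the vectors $v_k$; since $v_{k+n}=-v_k$, the index of $R_k$ is taken in $\mathbb{Z}_n$. The group consists of the $n$ reflections $R_k$ and the $n$ elements $S_k=R_kR_0$, $k\in\mathbb{Z}_n$, with $S_0=1$. Let $\mathbf{C}$ be the space of infinitely differentiable complex-valued functions on $\mathbb{R}^2=\mathbb{C}$ which, together with all their derivatives, have at most polynomial growth at infinity. The group acts on $\mathbf{C}$ by $(R_kf)(z)=f(R_k(z))$, and $z$, $z^*$ act on $\mathbf{C}$ by multiplication, so that as operators $R_k z=-v_k^2 z^*R_k$ and $R_kz^*=-(v_k^* )^2 zR_k$.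 The Dunkl differential-difference operators on $\mathbf{C}$ are $$D_z=2\frac{\partial}{\partial z^*}+\nu_0\sum_{k=0}^{n-1}\frac{v_{2k}}{zv_{2k}^*+z^*v_{2k}}(1-R_{2k})+\nu_1\sum_{k=0}^{n-1}\frac{v_{2k+1}}{zv_{2k+1}^*+z^*v_{2k+1}}(1-R_{2k+1}),$$ $$D_{z^*}=2\frac{\partial}{\partial z}+\nu_0\sum_{k=0}^{n-1}\frac{v_{2k}^*}{zv_{2k}^*+z^*v_{2k}}(1-R_{2k})+\nu_1\sum_{k=0}^{n-1}\frac{v_{2k+1}^*}{zv_{2k+1}^*+z^*v_{2k+1}}(1-R_{2k+1}).$$ These operators are well defined on $\mathbf{C}$ and commute with each other. For $\alpha\in\{0,1\}$ put $$a^\alpha=\tfrac12\bigl(z+(-1)^\alpha D_z\bigr),\qquad b^\alpha=\tfrac12\bigl(z^*+(-1)^\alpha D_{z^*}\bigr).$$ The algebra $H_{W(I_2(n))}(\nu)$ is the associative unital complex algebra of operators on $\mathbf{C}$ generated by $a^0,a^1,b^0,b^1$ and the elements of $W(I_2(n))$; its elements are polynomials in $a^\alpha,b^\alpha$ with coefficients in the group algebra $\mathbb{C}[W(I_2(n))]$. It is a superalgebra ($\mathbb{Z}_2$-graded algebra) with parity $\pi$ determined by $\pi(a^\alpha)=\pi(b^\alpha)=1$ for $\alpha=0,1$ and $\pi(g)=0$ for all $g\in W(I_2(n))$. A supertrace on a superalgebra $\mathcal{A}$ with parity $\pi$ is a linear complex-valued function $str$ on $\mathcal{A}$ such that $str(fg)=(-1)^{\pi(f)\pi(g)}str(gf)$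 for all $f,g\in\mathcal{A}$ with definite parity. *)

theory Defs
  imports "HOL-Analysis.Analysis" "HOL-Library.Function_Algebras"
begin

text \<open>
  The space of test functions. The real plane is the type \<^typ>\<open>complex\<close>, functions on it are not
  assumed holomorphic, and \<^term>\<open>pd u f\<close> is the (real) directional derivative of \<open>f\<close> along \<open>u\<close>.
  A function is smooth iff all its iterated partial derivatives are (real Frechet) differentiable.
\<close>

definition pd :: "complex \<Rightarrow> (complex \<Rightarrow> complex) \<Rightarrow> complex \<Rightarrow> complex" where
  "pd u f z = frechet_derivative f (at z) u"

definition d_z :: "(complex \<Rightarrow> complex) \<Rightarrow> complex \<Rightarrow> complex" where
  "d_z f z = (pd 1 f z - \<i> * pd \<i> f z) / 2"

definition d_zbar :: "(complex \<Rightarrow> complex) \<Rightarrow> complex \<Rightarrow> complex" where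
  "d_zbar f z = (pd 1 f z + \<i> * pd \<i> f z) / 2"

definition poly_growth :: "(complex \<Rightarrow> complex) \<Rightarrow> bool" where
  "poly_growth f \<longleftrightarrow> (\<exists>K N. \<forall>z. norm (f z) \<le> K * (1 + norm z) ^ N)"

definition CC :: "(complex \<Rightarrow> complex) set" where
  "CC = {f. \<forall>us. set us \<subseteq> {1, \<i>} \<longrightarrow>
           (\<forall>z. foldr pd us f differentiable (at z)) \<and> poly_growth (foldr pd us f)}"

definition root_vec :: "nat \<Rightarrow> nat \<Rightarrow> complex" where
  "root_vec n k = cis (pi * real k / real n)"

text \<open>Orthogonal reflection in \<open>v\<close>, provided that \<open>v\<close> has norm 1.\<close>

definition reflection :: "complex \<Rightarrow> complex \<Rightarrow> complex" where
  "reflection v z = - (v\<^sup>2) * cnj z"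

inductive_set coxeter_group :: "nat \<Rightarrow> (complex \<Rightarrow> complex) set" for n :: nat where
  one: "id \<in> coxeter_group n"
| step: "g \<in> coxeter_group n \<Longrightarrow> reflection (root_vec n k) \<circ> g \<in> coxeter_group n"

text \<open>
  \<^term>\<open>refl_quot v f\<close> is the function \<open>(f z - f (R z)) / (z v\<^sup>* + z\<^sup>* v)\<close>, where \<open>R\<close> is the
  reflection in \<open>v\<close>, extended continuously to the mirror of \<open>R\<close>, where the denominator vanishes.
\<close>

definition refl_quot :: "complex \<Rightarrow> (complex \<Rightarrow> complex) \<Rightarrow> complex \<Rightarrow> complex" where
  "refl_quot v f z =
     (let den = (\<lambda>w. w * cnj v + cnj w * v);
          q = (\<lambda>w. (f w - f (reflection v w)) / den w)
      in if den z \<noteq> 0 then q z else Lim (at z within {w. den w \<noteq> 0}) q)"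

definition dunkl_z :: "nat \<Rightarrow> complex \<Rightarrow> complex \<Rightarrow> (complex \<Rightarrow> complex) \<Rightarrow> complex \<Rightarrow> complex" where
  "dunkl_z n \<nu>0 \<nu>1 f z =
     2 * d_zbar f z
     + \<nu>0 * (\<Sum>k<n. root_vec n (2 * k) * refl_quot (root_vec n (2 * k)) f z)
     + \<nu>1 * (\<Sum>k<n. root_vec n (2 * k + 1) * refl_quot (root_vec n (2 * k + 1)) f z)"

definition dunkl_zbar :: "nat \<Rightarrow> complex \<Rightarrow> complex \<Rightarrow> (complex \<Rightarrow> complex) \<Rightarrow> complex \<Rightarrow> complex" where
  "dunkl_zbar n \<nu>0 \<nu>1 f z =
     2 * d_z f z
     + \<nu>0 * (\<Sum>k<n. cnj (root_vec n (2 * k)) * refl_quot (root_vec n (2 * k)) f z)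
     + \<nu>1 * (\<Sum>k<n. cnj (root_vec n (2 * k + 1)) * refl_quot (root_vec n (2 * k + 1)) f z)"

text \<open>
  An operator on \<^const>\<open>CC\<close> is represented by the function on \<^typ>\<open>complex \<Rightarrow> complex\<close> that agrees
  with it on \<^const>\<open>CC\<close> and vanishes outside, so that two operators are equal iff they agree on
  \<^const>\<open>CC\<close>. Products are compositions; sums and scalar multiples are pointwise. In particular the
  unit of the operator algebra is \<^term>\<open>on_CC id\<close>, not \<^const>\<open>id\<close>.
\<close>

type_synonym oper = "(complex \<Rightarrow> complex) \<Rightarrow> (complex \<Rightarrow> complex)"

definition on_CC :: "oper \<Rightarrow> oper" where
  "on_CC T f = (if f \<in> CC then T f else 0)"

definition op_scale :: "complex \<Rightarrow> oper \<Rightarrow> oper" where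
  "op_scale c T = (\<lambda>f z. c * T f z)"

definition grp_op :: "(complex \<Rightarrow> complex) \<Rightarrow> oper" where
  "grp_op g = on_CC (\<lambda>f z. f (g z))"

definition a_op :: "nat \<Rightarrow> complex \<Rightarrow> complex \<Rightarrow> nat \<Rightarrow> oper" where
  "a_op n \<nu>0 \<nu>1 \<alpha> = on_CC (\<lambda>f z. (z * f z + (-1) ^ \<alpha> * dunkl_z n \<nu>0 \<nu>1 f z) / 2)"

definition b_op :: "nat \<Rightarrow> complex \<Rightarrow> complex \<Rightarrow> nat \<Rightarrow> oper" where
  "b_op n \<nu>0 \<nu>1 \<alpha> = on_CC (\<lambda>f z. (cnj z * f z + (-1) ^ \<alpha> * dunkl_zbar n \<nu>0 \<nu>1 f z) / 2)"

inductive_set observables :: "nat \<Rightarrow> complex \<Rightarrow> complex \<Rightarrow> oper set"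
  for n :: nat and \<nu>0 \<nu>1 :: complex where
  gen_a: "\<alpha> \<in> {0, 1} \<Longrightarrow> a_op n \<nu>0 \<nu>1 \<alpha> \<in> observables n \<nu>0 \<nu>1"
| gen_b: "\<alpha> \<in> {0, 1} \<Longrightarrow> b_op n \<nu>0 \<nu>1 \<alpha> \<in> observables n \<nu>0 \<nu>1"
| gen_grp: "g \<in> coxeter_group n \<Longrightarrow> grp_op g \<in> observables n \<nu>0 \<nu>1"
| scale: "S \<in> observables n \<nu>0 \<nu>1 \<Longrightarrow> op_scale c S \<in> observables n \<nu>0 \<nu>1"
| add: "S \<in> observables n \<nu>0 \<nu>1 \<Longrightarrow> T \<in> observables n \<nu>0 \<nu>1 \<Longrightarrow> S + T \<in> observables n \<nu>0 \<nu>1"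
| mult: "S \<in> observables n \<nu>0 \<nu>1 \<Longrightarrow> T \<in> observables n \<nu>0 \<nu>1 \<Longrightarrow> S \<circ> T \<in> observables n \<nu>0 \<nu>1"

text \<open>
  The operators of parity \<open>p\<close> (0 or 1) form the homogeneous component of the grading that makes the
  generators \<open>a\<close>, \<open>b\<close> odd and the group elements even. The two components meet only in 0, because
  conjugation by \<open>f \<mapsto> (\<lambda>z. f (- z))\<close> acts on them as \<open>1\<close> and \<open>- 1\<close>, respectively; 0 has
  both parities, which is harmless below.
\<close>

inductive has_parity :: "nat \<Rightarrow> complex \<Rightarrow> complex \<Rightarrow> oper \<Rightarrow> nat \<Rightarrow> bool"
  for n :: nat and \<nu>0 \<nu>1 :: complex where
  gen_a: "\<alpha> \<in> {0, 1} \<Longrightarrow> has_parity n \<nu>0 \<nu>1 (a_op n \<nu>0 \<nu>1 \<alpha>) 1"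
| gen_b: "\<alpha> \<in> {0, 1} \<Longrightarrow> has_parity n \<nu>0 \<nu>1 (b_op n \<nu>0 \<nu>1 \<alpha>) 1"
| gen_grp: "g \<in> coxeter_group n \<Longrightarrow> has_parity n \<nu>0 \<nu>1 (grp_op g) 0"
| scale: "has_parity n \<nu>0 \<nu>1 S p \<Longrightarrow> has_parity n \<nu>0 \<nu>1 (op_scale c S) p"
| add: "has_parity n \<nu>0 \<nu>1 S p \<Longrightarrow> has_parity n \<nu>0 \<nu>1 T p \<Longrightarrow> has_parity n \<nu>0 \<nu>1 (S + T) p"
| mult: "has_parity n \<nu>0 \<nu>1 S p \<Longrightarrow> has_parity n \<nu>0 \<nu>1 T q \<Longrightarrow>
         has_parity n \<nu>0 \<nu>1 (S \<circ> T) ((p + q) mod 2)"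

lemma has_parity_observables: "has_parity n \<nu>0 \<nu>1 T p \<Longrightarrow> T \<in> observables n \<nu>0 \<nu>1"
  by (induction rule: has_parity.induct) (rule observables.intros; assumption)+

text \<open>
  A functional on the algebra is represented by its extension by 0 to all of \<^typ>\<open>oper\<close>, so that
  distinct elements of \<open>supertraces\<close> are distinct functionals on the algebra.
\<close>

definition is_supertrace :: "nat \<Rightarrow> complex \<Rightarrow> complex \<Rightarrow> (oper \<Rightarrow> complex) \<Rightarrow> bool" where
  "is_supertrace n \<nu>0 \<nu>1 str \<longleftrightarrow>
     (\<forall>S\<in>observables n \<nu>0 \<nu>1. \<forall>T\<in>observables n \<nu>0 \<nu>1. str (S + T) = str S + str T) \<and>
     (\<forall>S\<in>observables n \<nu>0 \<nu>1. \<forall>c. str (op_scale c S) = c * str S) \<and>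
     (\<forall>S T p q. has_parity n \<nu>0 \<nu>1 S p \<longrightarrow> has_parity n \<nu>0 \<nu>1 T q \<longrightarrow>
        str (S \<circ> T) = (-1) ^ (p * q) * str (T \<circ> S))"

definition supertraces :: "nat \<Rightarrow> complex \<Rightarrow> complex \<Rightarrow> (oper \<Rightarrow> complex) set" where
  "supertraces n \<nu>0 \<nu>1 =
     {str. is_supertrace n \<nu>0 \<nu>1 str \<and> (\<forall>T. T \<notin> observables n \<nu>0 \<nu>1 \<longrightarrow> str T = 0)}"

definition fun_scale :: "complex \<Rightarrow> ('a \<Rightarrow> complex) \<Rightarrow> 'a \<Rightarrow> complex" where
  "fun_scale c \<phi> = (\<lambda>x. c * \<phi> x)"

text \<open>
  \<open>cfun.dim\<close> is 0 on infinite-dimensional spaces, so only a positive value of it asserts finite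
  dimension.
\<close>

interpretation cfun: vector_space fun_scale
  by unfold_locales (auto simp: fun_scale_def fun_eq_iff algebra_simps)

lemma is_supertrace_add:
  assumes "is_supertrace n \<nu>0 \<nu>1 x" and "is_supertrace n \<nu>0 \<nu>1 y"
  shows "is_supertrace n \<nu>0 \<nu>1 (x + y)"
  unfolding is_supertrace_def
proof (intro conjI ballI allI impI)
  fix S T assume "S \<in> observables n \<nu>0 \<nu>1" "T \<in> observables n \<nu>0 \<nu>1"
  then have "x (S + T) = x S + x T" "y (S + T) = y S + y T"
    using assms unfolding is_supertrace_def by blast+
  then show "(x + y) (S + T) = (x + y) S + (x + y) T"
    by (simp only: plus_fun_apply[of x y] add.assoc add.left_commute)
next
  fix S c assume "S \<in> observables n \<nu>0 \<nu>1"
  then have "x (op_scale c S) = c * x S" "y (op_scale c S) = c * y S"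
    using assms unfolding is_supertrace_def by blast+
  then show "(x + y) (op_scale c S) = c * (x + y) S"
    by (simp only: plus_fun_apply[of x y] distrib_left)
next
  fix S T p q assume "has_parity n \<nu>0 \<nu>1 S p" "has_parity n \<nu>0 \<nu>1 T q"
  then have "x (S \<circ> T) = (-1) ^ (p * q) * x (T \<circ> S)" "y (S \<circ> T) = (-1) ^ (p * q) * y (T \<circ> S)"
    using assms unfolding is_supertrace_def by blast+
  then show "(x + y) (S \<circ> T) = (-1) ^ (p * q) * (x + y) (T \<circ> S)"
    by (simp only: plus_fun_apply[of x y] distrib_left)
qed

lemma is_supertrace_scale:
  assumes "is_supertrace n \<nu>0 \<nu>1 x"
  shows "is_supertrace n \<nu>0 \<nu>1 (fun_scale d x)"
  unfolding is_supertrace_def fun_scale_def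
proof (intro conjI ballI allI impI)
  fix S T assume "S \<in> observables n \<nu>0 \<nu>1" "T \<in> observables n \<nu>0 \<nu>1"
  then have "x (S + T) = x S + x T"
    using assms unfolding is_supertrace_def by blast
  then show "d * x (S + T) = d * x S + d * x T" by (simp only: distrib_left)
next
  fix S c assume "S \<in> observables n \<nu>0 \<nu>1"
  then have "x (op_scale c S) = c * x S"
    using assms unfolding is_supertrace_def by blast
  then show "d * x (op_scale c S) = c * (d * x S)" by (simp only: mult.left_commute)
next
  fix S T p q assume "has_parity n \<nu>0 \<nu>1 S p" "has_parity n \<nu>0 \<nu>1 T q"
  then have "x (S \<circ> T) = (-1) ^ (p * q) * x (T \<circ> S)"
    using assms unfolding is_supertrace_def by blast
  then show "d * x (S \<circ> T) = (-1) ^ (p * q) * (d * x (T \<circ> S))"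
    by (simp only: mult.left_commute)
qed

lemma subspace_supertraces: "cfun.subspace (supertraces n \<nu>0 \<nu>1)"
proof (rule cfun.subspaceI)
  have "is_supertrace n \<nu>0 \<nu>1 0"
    unfolding is_supertrace_def zero_fun_apply by (intro conjI ballI allI impI; simp only: mult_zero_right add_0)
  then show "0 \<in> supertraces n \<nu>0 \<nu>1"
    by (simp add: supertraces_def)
qed (auto simp: supertraces_def fun_scale_def intro: is_supertrace_add
      is_supertrace_scale[unfolded fun_scale_def])

end

theory Submission
  imports Defs
begin

text \<open>
  With \<open>d = D\<^sub>z / 2\<close> and \<open>db = D\<^sub>z\<^sub>* / 2\<close> the algebra \<open>H\<close> of observables is generated by the odd letters
  \<open>z\<close>, \<open>zb\<close>, \<open>d\<close>, \<open>db\<close> and by the rotations \<open>S k\<close> and reflections \<open>R k\<close>. The operators \<open>E = - z zb\<close>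
  and \<open>F = d db\<close> span, together with their commutator, a copy of \<open>sl2\<close>. It commutes with the group,
  and by commutation it maps the pair \<open>z\<close>, \<open>zb\<close> to the pair \<open>d\<close>, \<open>db\<close> and back. As a representation
  of \<open>sl2\<close> the algebra is a sum of finite-dimensional ones (\<open>alg_PPall\<close>). Hence it is the direct sum
  of its invariants \<open>AA\<close> and of the sum \<open>PP\<close> of its nontrivial constituents. The invariants are generated
  by the group and by the angular momentum \<open>sg = z db - zb d\<close>. The elements of \<open>PP\<close> are
  sums of commutators with the even elements \<open>E\<close> and \<open>F\<close>, so every supertrace vanishes on \<open>PP\<close> and is
  determined by its restriction to \<open>AA\<close>.

  It remains to see which functionals \<open>f\<close> on \<open>AA\<close> extend by \<open>0\<close> on \<open>PP\<close> to a supertrace. Because of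
  the symmetry, the equation \<open>f (a x + x a) = 0\<close> for odd \<open>x\<close> and the four letters \<open>a\<close> needs to be tested
  only on the elements \<open>x\<close> of \<open>z AA + zb AA\<close>. With \<open>rho = (\<Sum>l. c l R l)\<close> put \<open>sm = sg - rho\<close> and
  \<open>sp = sg + rho\<close>. These have the same square \<open>Cc\<close>, which is central in \<open>AA\<close>, and \<open>sm z = z (sp + 1)\<close>.
  The conditions reduce to the list \<open>admissible\<close> (\<open>admissible_extends\<close>, \<open>supertrace_admissible\<close>):
  invariance under \<open>W\<close>, the trace property for \<open>sg\<close>, a formula for \<open>f (R k)\<close>, and for every \<open>k\<close>
  and \<open>j\<close>, with \<open>\<omega> = om n (- k)\<close>,
  \<open>f ((sm - 1) sm ^ j S k) = - \<omega> f ((sp + 1) ^ Suc j S k)\<close>.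
  The last one is a recursion whose leading coefficient is \<open>1 + \<omega>\<close>. Thus, if \<open>\<omega> \<noteq> - 1\<close>, all values
  are determined by \<open>f (S k)\<close>; if \<open>\<omega> = - 1\<close>, the next lower coefficient does not vanish and nothing is
  free (\<open>admissible_unique\<close>). Conversely the exponential generating function of the solutions is the
  derivative of a solution of a linear equation between power series, from which existence and the
  compatibility with \<open>f (S (- k)) = f (S k)\<close> can be read off (\<open>admissible_exists\<close>).

  So supertraces correspond to functions \<open>v\<close> on the rotations that are invariant under
  \<open>k \<mapsto> - k\<close>, except that the rotation by \<open>- 1\<close>, which exists for even \<open>n\<close> only, does not count. These are
  the values at \<open>0 \<le> k < (n + 1) div 2\<close>.

  The existence part needs that the elements \<open>sg ^ i Cc ^ j g\<close> of \<open>AA\<close> with \<open>i < 2\<close> are linearly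
  independent. This is the one place where the operators themselves matter, and not only the relations
  between them: on functions that vanish to order \<open>m\<close> at the points of a free orbit of \<open>W\<close>, the
  operator \<open>sg ^ i Cc ^ j\<close> with \<open>i + 2 j = m\<close> acts to leading order as the \<open>m\<close>-th power of the rotation
  field, because the difference quotients in the Dunkl operators do not lower the order of vanishing
  away from the mirrors (\<open>invariants_independent\<close>).
\<close>

section \<open>Roots of unity\<close>

definition om :: "nat \<Rightarrow> int \<Rightarrow> complex" where
  "om n k = cis (2 * pi * of_int k / real n)"

lemma om_0 [simp]: "om n 0 = 1"
  by (simp add: om_def)

lemma om_add: "om n (k + l) = om n k * om n l"
  by (simp add: om_def cis_mult algebra_simps add_divide_distrib)

lemma om_minus_right [simp]: "om n k * om n (- k) = 1"
  by (simp flip: om_add)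

lemma om_minus_left [simp]: "om n (- k) * om n k = 1"
  by (simp flip: om_add)

lemma om_nonzero [simp]: "om n k \<noteq> 0"
  by (simp add: om_def)

lemma om_period: "n > 0 \<Longrightarrow> om n (k + int n) = om n k"
  by (simp add: om_add) (simp add: om_def)

lemma om_eq_1_iff:
  assumes "n > 0"
  shows "om n k = 1 \<longleftrightarrow> int n dvd k"
proof
  assume "om n k = 1"
  then have "cos (2 * pi * of_int k / real n) = 1"
    by (simp add: om_def complex_eq_iff)
  then obtain m :: int where "2 * pi * of_int k / real n = of_int m * 2 * pi"
    by (auto simp: cos_one_2pi_int)
  then have "real_of_int k = of_int m * real n"
    using assms by (simp add: field_simps)
  then have "k = m * int n"
    by (metis of_int_eq_iff of_int_mult of_int_of_nat_eq)
  then show "int n dvd k" by simp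
next
  assume "int n dvd k"
  then obtain m where "k = int n * m" by blast
  then show "om n k = 1"
    using assms cis_multiple_2pi[of "of_int m"] by (simp add: om_def mult.assoc)
qed

lemma om_minus_eq: "om n (- k) = inverse (om n k)"
  by (metis om_minus_right inverse_unique)

lemma rw_assoc: "a * b = r \<Longrightarrow> a * (b * x) = r * x" for a b r x :: "'a::ring_1"
  by (simp flip: mult.assoc)

section \<open>Relations between the Dunkl operators and the group\<close>

text \<open>
  Here \<open>z\<close>, \<open>zb\<close> stand for the two coordinates, \<open>d\<close>, \<open>db\<close> for half of the Dunkl operators, \<open>cst\<close> for the
  scalars, and \<open>c l\<close> is the coupling constant of the mirror \<open>l\<close>. Indices of group elements are
  integers, and everything is periodic with period \<open>n\<close>. The condition \<open>c_shift\<close> says that mirrors of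
  the same orbit have the same coupling; for odd \<open>n\<close> it forces \<open>c\<close> to be constant.
\<close>

locale dunkl_relations =
  fixes cst :: "complex \<Rightarrow> 'a::ring_1" and z zb d db :: 'a and S R :: "int \<Rightarrow> 'a"
    and n :: nat and c :: "int \<Rightarrow> complex"
  assumes n_ge: "n \<ge> 2"
    and cst_add: "cst (a + b) = cst a + cst b"
    and cst_mult: "cst (a * b) = cst a * cst b"
    and cst_1 [simp]: "cst 1 = 1"
    and cst_comm: "x * cst a = cst a * x"
    and c_shift: "c (l + 2) = c l"
    and c_period: "c (l + int n) = c l"
    and c_minus: "c (- l) = c l"
    and S_0 [simp]: "S 0 = 1"
    and S_S: "S k * S l = S (k + l)" and S_R: "S k * R l = R (k + l)"
    and R_S: "R k * S l = R (k - l)" and R_R: "R k * R l = S (k - l)"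
    and S_period: "S (k + int n) = S k" and R_period: "R (k + int n) = R k"
    and S_z: "S k * z = cst (om n (- k)) * (z * S k)"
    and S_zb: "S k * zb = cst (om n k) * (zb * S k)"
    and S_d: "S k * d = cst (om n (- k)) * (d * S k)"
    and S_db: "S k * db = cst (om n k) * (db * S k)"
    and R_z: "R k * z = - (cst (om n k) * (zb * R k))"
    and R_zb: "R k * zb = - (cst (om n (- k)) * (z * R k))"
    and R_d: "R k * d = - (cst (om n k) * (db * R k))"
    and R_db: "R k * db = - (cst (om n (- k)) * (d * R k))"
    and zb_z: "zb * z = z * zb"
    and d_z: "d * z = z * d + (\<Sum>l\<in>{0..<int n}. cst (c l * om n l) * R l)"
    and d_zb: "d * zb = zb * d + 1 + (\<Sum>l\<in>{0..<int n}. cst (c l) * R l)"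
    and db_z: "db * z = z * db + 1 + (\<Sum>l\<in>{0..<int n}. cst (c l) * R l)"
    and db_zb: "db * zb = zb * db + (\<Sum>l\<in>{0..<int n}. cst (c l * om n (- l)) * R l)"
begin

lemma cst_0 [simp]: "cst 0 = 0"
  using cst_add[of 0 0] by simp

lemma cst_minus: "cst (- a) = - cst a"
  using cst_add[of a "- a"] by (simp add: eq_neg_iff_add_eq_0 add.commute)

lemma cst_cst: "cst a * (cst b * x) = cst (a * b) * x"
  by (simp add: cst_mult mult.assoc)

lemma cst_left: "x * (cst a * y) = cst a * (x * y)"
  by (metis cst_comm mult.assoc)

lemmas cst_l = cst_left[of z] cst_left[of zb] cst_left[of d] cst_left[of db]
  cst_left[of "S k" for k] cst_left[of "R k" for k]

lemma cst_of_nat: "cst (of_nat k) = of_nat k"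
  by (induction k) (auto simp: cst_add)

lemma n_pos: "n > 0" using n_ge by simp

sublocale V: vector_space "\<lambda>a x. cst a * x"
  by unfold_locales (auto simp: algebra_simps cst_add cst_mult)

definition "rho = (\<Sum>l\<in>{0..<int n}. cst (c l) * R l)"
definition "gA = (\<Sum>l\<in>{0..<int n}. cst (c l * om n l) * R l)"
definition "gB = (\<Sum>l\<in>{0..<int n}. cst (c l * om n (- l)) * R l)"

lemma rho_z: "rho * z = - (zb * gA)" and rho_d: "rho * d = - (db * gA)"
  and rho_zb: "rho * zb = - (z * gB)" and rho_db: "rho * db = - (d * gB)"
  unfolding rho_def gA_def gB_def sum_distrib_left sum_distrib_right sum_negf[symmetric]
  by (intro sum.cong refl; simp add: mult.assoc R_z R_zb R_d R_db cst_l cst_cst)+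

lemma A_zb: "gA * zb = - (z * rho)" and A_db: "gA * db = - (d * rho)"
  and B_z: "gB * z = - (zb * rho)" and B_d: "gB * d = - (db * rho)"
  unfolding rho_def gA_def gB_def sum_distrib_left sum_distrib_right sum_negf[symmetric]
  by (intro sum.cong refl; simp add: mult.assoc R_z R_zb R_d R_db cst_l cst_cst)+

lemmas d_z' = d_z[folded gA_def] and d_zb' = d_zb[folded rho_def]
  and db_z' = db_z[folded rho_def] and db_zb' = db_zb[folded gB_def]

lemmas letter_rels = d_z' d_zb' db_z' db_zb' zb_z rho_z rho_d rho_zb rho_db A_zb A_db B_z B_d

text \<open>
  An operator on functions that commutes with both coordinates and kills the constants is 0; this is how
  the Dunkl operators will be seen to commute.
\<close>

lemma commutator_z: "(db * d - d * db) * z = z * (db * d - d * db)"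
  and commutator_zb: "(db * d - d * db) * zb = zb * (db * d - d * db)"
  by (simp_all add: algebra_simps letter_rels letter_rels[THEN rw_assoc])

end

locale dunkl_algebra = dunkl_relations +
  assumes db_d: "db * d = d * db"
begin

lemmas letter_rw = d_z' d_zb' db_z' db_zb' zb_z db_d rho_z rho_d rho_zb rho_db A_zb A_db B_z B_d

text \<open>
  The three elements span a copy of \<open>sl2\<close>, and \<open>dm\<close>, \<open>dp\<close>, \<open>d0\<close> are its lowering, raising and weight
  operators on the algebra.
\<close>

definition "F = d * db"
definition "E = - (z * zb)"
definition "Hh = E * F - F * E"
definition "dm x = F * x - x * F"
definition "dp x = E * x - x * E"
definition "d0 x = Hh * x - x * Hh"

lemma dm_mult: "dm (x * y) = dm x * y + x * dm y"
  and dp_mult: "dp (x * y) = dp x * y + x * dp y"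
  and d0_mult: "d0 (x * y) = d0 x * y + x * d0 y"
  by (simp_all add: dm_def dp_def d0_def algebra_simps)

lemma dm_add: "dm (x + y) = dm x + dm y" and dp_add: "dp (x + y) = dp x + dp y"
  and d0_add: "d0 (x + y) = d0 x + d0 y"
  and dm_diff: "dm (x - y) = dm x - dm y" and dp_diff: "dp (x - y) = dp x - dp y"
  and d0_diff: "d0 (x - y) = d0 x - d0 y"
  and dm_minus: "dm (- x) = - dm x" and dp_minus: "dp (- x) = - dp x"
  and d0_minus: "d0 (- x) = - d0 x"
  and dm_0 [simp]: "dm 0 = 0" and dp_0 [simp]: "dp 0 = 0" and d0_0 [simp]: "d0 0 = 0"
  by (simp_all add: dm_def dp_def d0_def algebra_simps)

lemma dm_cst: "dm (cst a * x) = cst a * dm x" and dp_cst: "dp (cst a * x) = cst a * dp x"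
  and d0_cst: "d0 (cst a * x) = cst a * d0 x"
  by (simp_all add: dm_def dp_def d0_def algebra_simps cst_left)

lemma d0_comm: "d0 x = dp (dm x) - dm (dp x)"
  by (simp add: dm_def dp_def d0_def Hh_def algebra_simps)

lemma dm_z [simp]: "dm z = d" and dm_zb [simp]: "dm zb = db"
  and dm_d [simp]: "dm d = 0" and dm_db [simp]: "dm db = 0"
  and dp_z [simp]: "dp z = 0" and dp_zb [simp]: "dp zb = 0"
  and dp_d [simp]: "dp d = z" and dp_db [simp]: "dp db = zb"
  by (simp_all add: dm_def dp_def F_def E_def algebra_simps letter_rw letter_rw[THEN rw_assoc])

lemma dm_S [simp]: "dm (S k) = 0" and dm_R [simp]: "dm (R k) = 0"
  and dp_S [simp]: "dp (S k) = 0" and dp_R [simp]: "dp (R k) = 0"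
  by (simp_all add: dm_def dp_def F_def E_def mult.assoc
      cst_l cst_cst S_z S_zb S_d S_db R_z R_zb R_d R_db
      S_z[THEN rw_assoc] S_zb[THEN rw_assoc] S_d[THEN rw_assoc] S_db[THEN rw_assoc]
      R_z[THEN rw_assoc] R_zb[THEN rw_assoc] R_d[THEN rw_assoc] R_db[THEN rw_assoc]
      zb_z[THEN rw_assoc] db_d[THEN rw_assoc])

lemma d0_z [simp]: "d0 z = z" and d0_zb [simp]: "d0 zb = zb"
  and d0_d [simp]: "d0 d = - d" and d0_db [simp]: "d0 db = - db"
  and d0_S [simp]: "d0 (S k) = 0" and d0_R [simp]: "d0 (R k) = 0"
  by (simp_all add: d0_comm)

text \<open>
  The angular momentum, the generator of the invariants of \<open>sl2\<close> over the group algebra.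
\<close>

definition "sg = z * db - zb * d"

lemma dm_sg [simp]: "dm sg = 0" and dp_sg [simp]: "dp sg = 0" and d0_sg [simp]: "d0 sg = 0"
  by (simp_all add: d0_comm sg_def dm_diff dp_diff dm_mult dp_mult db_d zb_z)

lemma S_sg: "S k * sg = sg * S k" and R_sg: "R k * sg = - (sg * R k)"
  by (simp_all add: sg_def algebra_simps cst_l cst_cst S_z S_zb S_d S_db R_z R_zb R_d R_db
      S_z[THEN rw_assoc] S_zb[THEN rw_assoc] S_d[THEN rw_assoc] S_db[THEN rw_assoc]
      R_z[THEN rw_assoc] R_zb[THEN rw_assoc] R_d[THEN rw_assoc] R_db[THEN rw_assoc])

lemma rho_sg: "rho * sg = - (sg * rho)"
  by (simp add: rho_def sum_distrib_left sum_distrib_right mult.assoc R_sg cst_left[of sg] sum_negf)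

lemma sg_z: "sg * z = z * sg + z + rho * z + z * rho"
  and sg_zb: "sg * zb = zb * sg - zb - rho * zb - zb * rho"
  by (simp_all add: sg_def algebra_simps letter_rw letter_rw[THEN rw_assoc])

definition "G = range S \<union> range R"

lemma one_G: "1 \<in> G" unfolding G_def by (metis S_0 UnI1 rangeI)

lemma G_mult: "g \<in> G \<Longrightarrow> h \<in> G \<Longrightarrow> g * h \<in> G"
  unfolding G_def by (auto simp: S_S S_R R_S R_R)

lemma dm_G [simp]: "g \<in> G \<Longrightarrow> dm g = 0" and dp_G [simp]: "g \<in> G \<Longrightarrow> dp g = 0"
  and d0_G [simp]: "g \<in> G \<Longrightarrow> d0 g = 0"
  unfolding G_def by auto

text \<open>
  In \<open>(l, w, x) \<in> hom\<close>, \<open>x\<close> is a word of \<open>l\<close> letters followed by a group element, and \<open>w\<close> is its weight under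
  \<open>d0\<close>. Linear combinations of such words exhaust the algebra because group elements can be moved to
  the right.
\<close>

inductive_set hom :: "(nat \<times> int \<times> 'a) set" where
  "g \<in> G \<Longrightarrow> (0, 0, g) \<in> hom"
| "(l, w, x) \<in> hom \<Longrightarrow> (Suc l, w + 1, z * x) \<in> hom"
| "(l, w, x) \<in> hom \<Longrightarrow> (Suc l, w + 1, zb * x) \<in> hom"
| "(l, w, x) \<in> hom \<Longrightarrow> (Suc l, w - 1, d * x) \<in> hom"
| "(l, w, x) \<in> hom \<Longrightarrow> (Suc l, w - 1, db * x) \<in> hom"

lemma hom_d0: "(l, w, x) \<in> hom \<Longrightarrow> d0 x = cst (of_int w) * x"
  by (induction rule: hom.induct) (auto simp: d0_mult algebra_simps cst_l cst_add cst_minus)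

lemma hom_parity: "(l, w, x) \<in> hom \<Longrightarrow> even w \<longleftrightarrow> even l"
  by (induction rule: hom.induct) auto

definition "Hlt m = V.span {x. \<exists>l w. l < m \<and> (l, w, x) \<in> hom}"

definition "alg = V.span {x. \<exists>l w. (l, w, x) \<in> hom}"

lemma Hlt_0: "Hlt 0 = {0}" by (simp add: Hlt_def)

lemma Hlt_mono: "m \<le> m' \<Longrightarrow> x \<in> Hlt m \<Longrightarrow> x \<in> Hlt m'"
  unfolding Hlt_def by (erule V.span_mono[THEN subsetD, rotated]) (use less_le_trans in blast)

lemma Hlt_alg: "x \<in> Hlt m \<Longrightarrow> x \<in> alg"
  unfolding Hlt_def alg_def by (erule V.span_mono[THEN subsetD, rotated]) blast

lemma subspace_Hlt: "V.subspace (Hlt m)" and subspace_alg: "V.subspace alg"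
  unfolding Hlt_def alg_def by (rule V.subspace_span)+

lemma hom_Hlt: "(l, w, x) \<in> hom \<Longrightarrow> x \<in> Hlt (Suc l)"
  unfolding Hlt_def by (rule V.span_base) blast

lemma alg_Hlt: assumes "x \<in> alg" shows "\<exists>m. x \<in> Hlt m"
  using assms unfolding alg_def
proof (induction rule: V.span_induct_alt)
  case base
  then show ?case using V.span_zero Hlt_def by blast
next
  case (step c x y)
  then obtain l w m where "(l, w, x) \<in> hom" "y \<in> Hlt m" by blast
  then have "x \<in> Hlt (max m (Suc l))" "y \<in> Hlt (max m (Suc l))"
    using Hlt_mono hom_Hlt by (meson max.cobounded1 max.cobounded2)+
  then show ?case
    using subspace_Hlt V.subspace_add V.subspace_scale by metis
qed

lemma span_linear_image:
  assumes "x \<in> V.span X" and "\<And>x. x \<in> X \<Longrightarrow> f x \<in> V.span Y"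
    and "\<And>x y. f (x + y) = f x + f y" and "\<And>a x. f (cst a * x) = cst a * f x"
  shows "f x \<in> V.span Y"
  using assms(1)
proof (induction rule: V.span_induct_alt)
  case base
  have "f 0 = 0" using assms(3)[of 0 0] by simp
  then show ?case by (simp add: V.span_zero)
next
  case (step c x y)
  then show ?case using assms(2-4) by (simp add: V.span_add V.span_scale)
qed

lemma Hlt_letter:
  assumes "x \<in> Hlt m" "a \<in> {z, zb, d, db}"
  shows "a * x \<in> Hlt (Suc m)"
  using assms(1) unfolding Hlt_def
  by (rule span_linear_image)
     (use assms(2) in \<open>auto intro!: V.span_base intro: hom.intros Suc_mono simp: algebra_simps cst_left\<close>)

lemma hom_G_left:
  assumes "g \<in> G" "(l, w, x) \<in> hom"
  shows "g * x \<in> Hlt (Suc l)"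
  using assms(2,1)
proof (induction arbitrary: g rule: hom.induct)
  case (1 h)
  then show ?case using G_mult hom.intros(1) hom_Hlt by blast
next
  case (2 l w x)
  show ?case using 2(3) 2(2)[OF 2(3)] Hlt_letter[OF 2(2)[OF 2(3)]] subspace_Hlt unfolding G_def
    by (auto simp: S_z[THEN rw_assoc] R_z[THEN rw_assoc] mult.assoc
        intro!: V.subspace_scale V.subspace_neg)
next
  case (3 l w x)
  show ?case using 3(3) 3(2)[OF 3(3)] Hlt_letter[OF 3(2)[OF 3(3)]] subspace_Hlt unfolding G_def
    by (auto simp: S_zb[THEN rw_assoc] R_zb[THEN rw_assoc] mult.assoc
        intro!: V.subspace_scale V.subspace_neg)
next
  case (4 l w x)
  show ?case using 4(3) 4(2)[OF 4(3)] Hlt_letter[OF 4(2)[OF 4(3)]] subspace_Hlt unfolding G_def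
    by (auto simp: S_d[THEN rw_assoc] R_d[THEN rw_assoc] mult.assoc
        intro!: V.subspace_scale V.subspace_neg)
next
  case (5 l w x)
  show ?case using 5(3) 5(2)[OF 5(3)] Hlt_letter[OF 5(2)[OF 5(3)]] subspace_Hlt unfolding G_def
    by (auto simp: S_db[THEN rw_assoc] R_db[THEN rw_assoc] mult.assoc
        intro!: V.subspace_scale V.subspace_neg)
qed

lemma Hlt_G_left:
  assumes "g \<in> G" "x \<in> Hlt m"
  shows "g * x \<in> Hlt m"
  using assms(2) unfolding Hlt_def
proof (rule span_linear_image)
  fix x assume "x \<in> {x. \<exists>l w. l < m \<and> (l, w, x) \<in> hom}"
  then obtain l w where "l < m" "(l, w, x) \<in> hom" by blast
  then have "g * x \<in> Hlt m" using hom_G_left[OF assms(1)] Hlt_mono Suc_leI by blast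
  then show "g * x \<in> V.span {x. \<exists>l w. l < m \<and> (l, w, x) \<in> hom}" by (simp add: Hlt_def)
qed (auto simp: algebra_simps cst_left)

lemma hom_G_right: "(l, w, x) \<in> hom \<Longrightarrow> g \<in> G \<Longrightarrow> (l, w, x * g) \<in> hom"
  by (induction rule: hom.induct) (auto simp: mult.assoc intro: hom.intros G_mult)

lemma Hlt_G_right:
  assumes "x \<in> Hlt m" "g \<in> G"
  shows "x * g \<in> Hlt m"
  using assms(1) unfolding Hlt_def
  by (rule span_linear_image)
     (use assms(2) in \<open>auto intro!: V.span_base intro: hom_G_right simp: algebra_simps cst_left\<close>)

lemma alg_mult:
  assumes "x \<in> alg" "y \<in> alg"
  shows "x * y \<in> alg"
proof -
  obtain m where m: "y \<in> Hlt m" using alg_Hlt assms by blast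
  have *: "\<exists>m. x * y \<in> Hlt m" if "(l, w, x) \<in> hom" for l w x
    using that by (induction rule: hom.induct) (auto simp: mult.assoc intro: Hlt_letter Hlt_G_left m)
  show ?thesis using assms(1) unfolding alg_def
    by (rule span_linear_image) (use * Hlt_alg[unfolded alg_def] in \<open>blast, auto simp: algebra_simps\<close>)
qed

text \<open>
  Commutators of letters have degree 0; therefore the order of the letters in a word matters only up to
  words that are shorter by two letters.
\<close>

lemma comm_group: 
  assumes "a \<in> {z, zb, d, db}" "b \<in> {z, zb, d, db}"
  shows "a * b - b * a \<in> V.span G"
proof -
  have 1: "R l \<in> V.span G" "1 \<in> V.span G" for l 
    using one_G G_def by (auto intro: V.span_base)
  have "rho \<in> V.span G" "gA \<in> V.span G" "gB \<in> V.span G"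
    unfolding rho_def gA_def gB_def by (intro V.span_sum V.span_scale 1)+
  then have 2: "{0, gA, - gA, gB, - gB, 1 + rho, - (1 + rho)} \<subseteq> V.span G"
    using 1(2) by (simp add: V.span_zero V.span_add V.span_neg V.span_diff)
  have "a * b - b * a \<in> {0, gA, - gA, gB, - gB, 1 + rho, - (1 + rho)}"
    using assms by (elim insertE emptyE) (simp_all add: letter_rw)
  with 2 show ?thesis by blast
qed

lemma Hlt_span_G: 
  assumes "h \<in> V.span G" "x \<in> Hlt m" shows "h * x \<in> Hlt m"
  using assms(1) unfolding Hlt_def
  by (rule span_linear_image)
     (use assms(2) Hlt_G_left in \<open>auto simp: algebra_simps Hlt_def\<close>)

lemma letter_swap:
  assumes "a \<in> {z, zb, d, db}" "b \<in> {z, zb, d, db}" "x \<in> Hlt m"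
  shows "a * (b * x) - b * (a * x) \<in> Hlt m"
  using Hlt_span_G[OF comm_group[OF assms(1,2)] assms(3)] by (simp add: algebra_simps)

lemma letter_pow:
  assumes "a \<in> {z, zb, d, db}" "x \<in> Hlt m"
  shows "a ^ k * x \<in> Hlt (m + k)"
proof (induction k)
  case (Suc k)
  then show ?case using Hlt_letter[OF Suc assms(1)] by (simp add: mult.assoc)
qed (use assms in simp)

lemma letter_pow_swap:
  assumes "a \<in> {z, zb, d, db}" "b \<in> {z, zb, d, db}" "x \<in> Hlt m"
  shows "a * (b ^ k * x) - b ^ k * (a * x) \<in> Hlt (m + k)"
proof (induction k)
  case 0
  then show ?case by (simp add: Hlt_def V.span_zero)
next
  case (Suc k)
  have "a * (b * (b ^ k * x)) - b * (a * (b ^ k * x)) \<in> Hlt (m + k)"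
    by (rule letter_swap[OF assms(1,2) letter_pow[OF assms(2,3)]])
  moreover have "b * (a * (b ^ k * x) - b ^ k * (a * x)) \<in> Hlt (Suc (m + k))"
    by (rule Hlt_letter[OF Suc assms(2)])
  ultimately have "(a * (b * (b ^ k * x)) - b * (a * (b ^ k * x))) + b * (a * (b ^ k * x) - b ^ k * (a * x)) \<in> Hlt (Suc (m + k))"
    using V.subspace_add[OF subspace_Hlt] Hlt_mono[of "m + k" "Suc (m + k)"] by simp
  then show ?case by (simp add: algebra_simps)
qed

definition "mon i j k l = z ^ i * (zb ^ j * (d ^ k * db ^ l))"

lemma one_Hlt: "1 \<in> Hlt 1"
  using hom_Hlt[OF hom.intros(1)[OF one_G]] by simp

lemma pow_Hlt: "a \<in> {z, zb, d, db} \<Longrightarrow> a ^ k \<in> Hlt (Suc k)"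
  using letter_pow[OF _ one_Hlt, of a k] by simp

lemma mon_Hlt: "mon i j k l \<in> Hlt (Suc (i + j + k + l))"
proof -
  have "z ^ i * (zb ^ j * (d ^ k * (db ^ l * 1))) \<in> Hlt (1 + l + k + j + i)"
    by (intro letter_pow one_Hlt) auto
  then show ?thesis by (simp add: mon_def algebra_simps)
qed

lemma z_mon: "z * mon i j k l = mon (Suc i) j k l"
  by (simp add: mon_def mult.assoc)

lemma zb_mon: "zb * mon i j k l = mon i (Suc j) k l"
proof -
  have "zb * z ^ i = z ^ i * zb" by (rule power_commuting_commutes[symmetric]) (rule zb_z[symmetric])
  then have "zb * (z ^ i * x) = z ^ i * (zb * x)" for x by (simp flip: mult.assoc)
  then show ?thesis by (simp add: mon_def mult.assoc)
qed

lemma sub_cong: "x - y \<in> Hlt m \<Longrightarrow> y - w \<in> Hlt m \<Longrightarrow> x - w \<in> Hlt m"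
  using V.subspace_add[OF subspace_Hlt, of "x - y" m "y - w"] by simp

lemma d_mon: "d * mon i j k l - mon i j (Suc k) l \<in> Hlt (Suc (i + j + k + l))"
proof -
  have 1: "db ^ l \<in> Hlt (Suc l)" using pow_Hlt by simp
  have 2: "d ^ k * db ^ l \<in> Hlt (Suc l + k)" using letter_pow[OF _ 1] by simp
  have 3: "zb ^ j * (d ^ k * db ^ l) \<in> Hlt (Suc l + k + j)" using letter_pow[OF _ 2] by simp
  have "d * mon i j k l - z ^ i * (d * (zb ^ j * (d ^ k * db ^ l))) \<in> Hlt (Suc l + k + j + i)"
    unfolding mon_def by (rule letter_pow_swap) (use 3 in auto)
  moreover have "d * (zb ^ j * (d ^ k * db ^ l)) - zb ^ j * (d * (d ^ k * db ^ l)) \<in> Hlt (Suc l + k + j)"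
    by (rule letter_pow_swap) (use 2 in auto)
  then have "z ^ i * (d * (zb ^ j * (d ^ k * db ^ l)) - zb ^ j * (d * (d ^ k * db ^ l))) \<in> Hlt (Suc l + k + j + i)"
    by (rule letter_pow[rotated]) simp
  then have "z ^ i * (d * (zb ^ j * (d ^ k * db ^ l))) - mon i j (Suc k) l \<in> Hlt (Suc l + k + j + i)"
    by (simp add: algebra_simps mon_def)
  ultimately have "d * mon i j k l - mon i j (Suc k) l \<in> Hlt (Suc l + k + j + i)"
    by (rule sub_cong)
  then show ?thesis by (simp add: algebra_simps)
qed

lemma db_mon: "db * mon i j k l - mon i j k (Suc l) \<in> Hlt (Suc (i + j + k + l))"
proof -
  have 1: "db ^ l \<in> Hlt (Suc l)" using pow_Hlt by simp
  have 2: "d ^ k * db ^ l \<in> Hlt (Suc l + k)" using letter_pow[OF _ 1] by simp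
  have 3: "zb ^ j * (d ^ k * db ^ l) \<in> Hlt (Suc l + k + j)" using letter_pow[OF _ 2] by simp
  have "db * mon i j k l - z ^ i * (db * (zb ^ j * (d ^ k * db ^ l))) \<in> Hlt (Suc l + k + j + i)"
    unfolding mon_def by (rule letter_pow_swap) (use 3 in auto)
  moreover have "db * (zb ^ j * (d ^ k * db ^ l)) - zb ^ j * (db * (d ^ k * db ^ l)) \<in> Hlt (Suc l + k + j)"
    by (rule letter_pow_swap) (use 2 in auto)
  then have "z ^ i * (db * (zb ^ j * (d ^ k * db ^ l)) - zb ^ j * (db * (d ^ k * db ^ l))) \<in> Hlt (Suc l + k + j + i)"
    by (rule letter_pow[rotated]) simp
  moreover have "db * (d ^ k * db ^ l) = d ^ k * db ^ Suc l"
  proof -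
    have "db * d ^ k = d ^ k * db" by (rule power_commuting_commutes[symmetric]) (rule db_d[symmetric])
    then show ?thesis by (simp add: mult.assoc flip: mult.assoc[of db])
  qed
  ultimately have "z ^ i * (db * (zb ^ j * (d ^ k * db ^ l))) - mon i j k (Suc l) \<in> Hlt (Suc l + k + j + i)"
    by (simp add: algebra_simps mon_def)
  with \<open>db * mon i j k l - z ^ i * (db * (zb ^ j * (d ^ k * db ^ l))) \<in> _\<close>
  have "db * mon i j k l - mon i j k (Suc l) \<in> Hlt (Suc l + k + j + i)"
    using sub_cong by blast
  then show ?thesis by (simp add: algebra_simps)
qed

text \<open>
  A Poincare-Birkhoff-Witt reduction of words to ordered monomials.
\<close>

lemma hom_mon:
  assumes "(m, w, x) \<in> hom"
  shows "\<exists>i j k l g. i + j + k + l = m \<and> g \<in> G \<and> x - mon i j k l * g \<in> Hlt m"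
  using assms
proof (induction rule: hom.induct)
  case (1 g)
  have "g - mon 0 0 0 0 * g \<in> Hlt 0" by (simp add: mon_def Hlt_0)
  then show ?case using 1 by (metis add_0_left)
next
  case (2 m w x)
  then obtain i j k l g where *: "i + j + k + l = m" "g \<in> G" "x - mon i j k l * g \<in> Hlt m" by blast
  then have "z * x - mon (Suc i) j k l * g \<in> Hlt (Suc m)"
    using Hlt_letter[OF *(3), of z] by (simp add: algebra_simps flip: z_mon)
  then show ?case using * by (metis add_Suc)
next
  case (3 m w x)
  then obtain i j k l g where *: "i + j + k + l = m" "g \<in> G" "x - mon i j k l * g \<in> Hlt m" by blast
  then have "zb * x - mon i (Suc j) k l * g \<in> Hlt (Suc m)"
    using Hlt_letter[OF *(3), of zb] by (simp add: algebra_simps flip: zb_mon)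
  then show ?case using * by (metis add_Suc add_Suc_right)
next
  case (4 m w x)
  then obtain i j k l g where *: "i + j + k + l = m" "g \<in> G" "x - mon i j k l * g \<in> Hlt m" by blast
  have "d * x - d * mon i j k l * g \<in> Hlt (Suc m)"
    using Hlt_letter[OF *(3), of d] by (simp add: algebra_simps)
  moreover have "d * mon i j k l * g - mon i j (Suc k) l * g \<in> Hlt (Suc m)"
    using Hlt_G_right[OF d_mon *(2), of i j k l] *(1) by (simp add: algebra_simps)
  ultimately have "d * x - mon i j (Suc k) l * g \<in> Hlt (Suc m)" by (rule sub_cong)
  then show ?case using * by (metis add_Suc add_Suc_right)
next
  case (5 m w x)
  then obtain i j k l g where *: "i + j + k + l = m" "g \<in> G" "x - mon i j k l * g \<in> Hlt m" by blast
  have "db * x - db * mon i j k l * g \<in> Hlt (Suc m)"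
    using Hlt_letter[OF *(3), of db] by (simp add: algebra_simps)
  moreover have "db * mon i j k l * g - mon i j k (Suc l) * g \<in> Hlt (Suc m)"
    using Hlt_G_right[OF db_mon *(2), of i j k l] *(1) by (simp add: algebra_simps)
  ultimately have "db * x - mon i j k (Suc l) * g \<in> Hlt (Suc m)" by (rule sub_cong)
  then show ?case using * by (metis add_Suc_right)
qed

end

context dunkl_algebra
begin

section \<open>Decomposition under the action of sl2\<close>

lemma dm_pow_0: "dm a = 0 \<Longrightarrow> dm (a ^ k) = 0"
  by (induction k) (auto simp: dm_mult, simp add: dm_def)

lemma dm_1 [simp]: "dm 1 = 0" by (simp add: dm_def)

lemma Hlt_add: "x \<in> Hlt m \<Longrightarrow> y \<in> Hlt m \<Longrightarrow> x + y \<in> Hlt m"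
  using V.subspace_add[OF subspace_Hlt] .
lemma Hlt_diff: "x \<in> Hlt m \<Longrightarrow> y \<in> Hlt m \<Longrightarrow> x - y \<in> Hlt m"
  using V.subspace_diff[OF subspace_Hlt] .
lemma dm_mon:
  "dm (mon i j k l) - (cst (of_nat i) * mon (i - 1) j (Suc k) l + cst (of_nat j) * mon i (j - 1) k (Suc l))
     \<in> Hlt (i + j + k + l)"
proof (induction i)
  case 0
  show ?case
  proof (induction j)
    case 0
    have "dm (mon 0 0 k l) = 0" by (simp add: mon_def dm_mult dm_pow_0)
    then show ?case using V.subspace_0[OF subspace_Hlt] by simp
  next
    case (Suc j)
    define r where "r = dm (mon 0 j k l) - cst (of_nat j) * mon 0 (j - 1) k (Suc l)"
    have r: "zb * r \<in> Hlt (Suc (j + k + l))"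
      using Hlt_letter[of r "j + k + l" zb] Suc by (simp add: r_def)
    have "dm (mon 0 (Suc j) k l) = db * mon 0 j k l + zb * dm (mon 0 j k l)"
      by (simp add: dm_mult flip: zb_mon)
    moreover have "cst (of_nat j) * (zb * mon 0 (j - 1) k (Suc l)) = cst (of_nat j) * mon 0 j k (Suc l)"
      by (cases j) (simp_all add: zb_mon)
    ultimately have "dm (mon 0 (Suc j) k l) - cst (of_nat (Suc j)) * mon 0 j k (Suc l) =
      (db * mon 0 j k l - mon 0 j k (Suc l)) + zb * r"
      by (simp add: r_def algebra_simps cst_l cst_add)
    then show ?case using Hlt_add[OF db_mon[of 0 j k l] ] r by simp
  qed
next
  case (Suc i)
  define r where "r = dm (mon i j k l) - (cst (of_nat i) * mon (i - 1) j (Suc k) l + cst (of_nat j) * mon i (j - 1) k (Suc l))"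
  have r: "z * r \<in> Hlt (Suc (i + j + k + l))"
    using Hlt_letter[of r "i + j + k + l" z] Suc by (simp add: r_def)
  have "dm (mon (Suc i) j k l) = d * mon i j k l + z * dm (mon i j k l)"
    by (simp add: dm_mult flip: z_mon)
  moreover have "cst (of_nat i) * (z * mon (i - 1) j (Suc k) l) = cst (of_nat i) * mon i j (Suc k) l"
    by (cases i) (simp_all add: z_mon)
  ultimately have "dm (mon (Suc i) j k l) - (cst (of_nat (Suc i)) * mon i j (Suc k) l + cst (of_nat j) * mon (Suc i) (j - 1) k (Suc l)) =
      (d * mon i j k l - mon i j (Suc k) l) + z * r"
    by (simp add: r_def algebra_simps cst_l cst_add z_mon[symmetric])
  then show ?case using Hlt_add[OF d_mon[of i j k l] ] r by simp
qed

lemma sg_mon: "sg * mon i j k l - (mon (Suc i) j k (Suc l) - mon i (Suc j) (Suc k) l)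
    \<in> Hlt (Suc (Suc (i + j + k + l)))"
proof -
  have "z * (db * mon i j k l - mon i j k (Suc l)) - zb * (d * mon i j k l - mon i j (Suc k) l)
      \<in> Hlt (Suc (Suc (i + j + k + l)))"
    by (rule Hlt_diff; rule Hlt_letter, (rule d_mon db_mon), simp)
  then show ?thesis by (simp add: sg_def algebra_simps z_mon zb_mon)
qed

text \<open>
  The elements \<open>vv m i j g\<close> are highest weight vectors of weight \<open>i + j\<close>, and \<open>gens P\<close> consists of the
  strings that the lowering operator generates from them. The strings of positive weight span \<open>PP\<close>,
  and those of weight 0, on which the lowering operator vanishes, span \<open>AA\<close>.
\<close>

definition "vv m i j g = sg ^ m * (z ^ i * (zb ^ j * g))"

definition "gens P = {x. \<exists>r m i j g. x = (dm ^^ r) (vv m i j g) \<and> g \<in> G \<and> P i j}"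

definition "PPall = V.span (gens (\<lambda>i j. True))"
definition "PP = V.span (gens (\<lambda>i j. i + j > 0))"
definition "AA = V.span {x. \<exists>m g. x = sg ^ m * g \<and> g \<in> G}"

lemma subspace_PPall: "V.subspace PPall" and subspace_PP: "V.subspace PP"
  and subspace_AA: "V.subspace AA"
  unfolding PPall_def PP_def AA_def by (rule V.subspace_span)+

lemma dm_gens: "x \<in> V.span (gens P) \<Longrightarrow> dm x \<in> V.span (gens P)"
proof (rule span_linear_image[where f = dm])
  fix x assume "x \<in> gens P"
  then obtain r m i j g where "x = (dm ^^ r) (vv m i j g)" "g \<in> G" "P i j" 
    unfolding gens_def by blast
  then have "dm x = (dm ^^ Suc r) (vv m i j g)" "g \<in> G" "P i j" by simp_all
  then show "dm x \<in> V.span (gens P)" unfolding gens_def by (intro V.span_base) blast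
qed (auto simp: dm_add dm_cst)

lemma dm_pow_sg: "(dm ^^ r) (sg * x) = sg * (dm ^^ r) x"
  by (induction r) (simp_all add: dm_mult)

lemma sg_gens: "x \<in> V.span (gens P) \<Longrightarrow> sg * x \<in> V.span (gens P)"
proof (rule span_linear_image[where f = "\<lambda>x. sg * x"])
  fix x assume "x \<in> gens P"
  then obtain r m i j g where "x = (dm ^^ r) (vv m i j g)" "g \<in> G" "P i j" 
    unfolding gens_def by blast
  then have "sg * x = (dm ^^ r) (vv (Suc m) i j g)" "g \<in> G" "P i j" 
    by (simp_all add: vv_def mult.assoc dm_pow_sg)
  then show "sg * x \<in> V.span (gens P)" unfolding gens_def by (intro V.span_base) blast
qed (auto simp: algebra_simps cst_left[of sg])

text \<open>
  Induction on the degree, and for a fixed degree on the number of letters \<open>d\<close> and \<open>db\<close> in an ordered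
  monomial. Up to shorter words, \<open>dm\<close> of a monomial with one \<open>d\<close> replaced by \<open>z\<close> produces a nonzero
  multiple of that monomial and a term with the factor \<open>sg\<close>, which has lower degree in the letters that
  remain.
\<close>

lemma Hlt_PPall: "x \<in> Hlt M \<Longrightarrow> x \<in> PPall"
proof (induction M arbitrary: x)
  case 0
  then show ?case using V.subspace_0[OF subspace_PPall] by (simp add: Hlt_0)
next
  case (Suc M)
  have mod: "y \<in> PPall" if "x \<in> PPall" "x - y \<in> Hlt M" for x y
    using V.subspace_diff[OF subspace_PPall that(1) Suc.IH[OF that(2)]] by simp
  have div: "y \<in> PPall" if "cst a * y \<in> PPall" "a \<noteq> 0" for a y
    using V.subspace_scale[OF subspace_PPall that(1), of "inverse a"] that(2) by (simp add: cst_cst)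
  have mon: "mon i j k l * g \<in> PPall" if "i + j + k + l = M" "g \<in> G" for i j k l g
    using that(1)
  proof (induction "k + l" arbitrary: i j k l)
    case 0
    then have "mon i j k l * g = (dm ^^ 0) (vv 0 i j g)" by (simp add: mon_def vv_def mult.assoc)
    then show ?case using that(2) unfolding PPall_def gens_def by (intro V.span_base) blast
  next
    case (Suc N)
    show ?case
    proof (cases k)
      case k: (Suc k')
      let ?X = "mon i j k l * g" and ?Y = "mon (Suc i) (j - 1) k' (Suc l) * g"
      have "mon (Suc i) j k' l * g \<in> PPall" using Suc k by simp
      then have 1: "dm (mon (Suc i) j k' l * g) \<in> PPall" unfolding PPall_def by (rule dm_gens)
      have "dm (mon (Suc i) j k' l * g) - (cst (of_nat (Suc i)) * ?X + cst (of_nat j) * ?Y) \<in> Hlt M"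
        using Hlt_G_right[OF dm_mon[of "Suc i" j k' l] that(2)] Suc.prems k that(2)
        by (simp add: algebra_simps dm_mult)
      with 1 have 2: "cst (of_nat (Suc i)) * ?X + cst (of_nat j) * ?Y \<in> PPall" by (rule mod)
      show ?thesis
      proof (cases j)
        case 0
        then show ?thesis using 2 div[of "of_nat (Suc i)" ?X] by (simp del: of_nat_Suc)
      next
        case j: (Suc j')
        have "mon i j' k' l * g \<in> Hlt (Suc (i + j' + k' + l))" 
          using Hlt_G_right[OF mon_Hlt that(2)] .
        then have "mon i j' k' l * g \<in> Hlt M" by (rule Hlt_mono[rotated]) (use Suc.prems k j in simp)
        then have 3: "sg * (mon i j' k' l * g) \<in> PPall" 
          using \<open>\<And>x. x \<in> Hlt M \<Longrightarrow> x \<in> PPall\<close> unfolding PPall_def by (intro sg_gens)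
        have "sg * (mon i j' k' l * g) - (?Y - ?X) \<in> Hlt M"
          using Hlt_G_right[OF sg_mon[of i j' k' l] that(2)] Suc.prems k j by (simp add: algebra_simps)
        with 3 have 4: "?Y - ?X \<in> PPall" by (rule mod)
        have "cst (of_nat (Suc i + j)) * ?X = 
            (cst (of_nat (Suc i)) * ?X + cst (of_nat j) * ?Y) - cst (of_nat j) * (?Y - ?X)"
          by (simp add: algebra_simps cst_add)
        then have "cst (of_nat (Suc i + j)) * ?X \<in> PPall"
          using V.subspace_diff[OF subspace_PPall 2 V.subspace_scale[OF subspace_PPall 4]] by simp
        then show ?thesis using div[of "of_nat (Suc i + j)" ?X] by (simp del: of_nat_Suc of_nat_add)
      qed
    next
      case k: 0
      then obtain l' where l: "l = Suc l'" using Suc by (cases l) auto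
      let ?X = "mon i j 0 l * g" and ?Y = "mon (i - 1) (Suc j) (Suc 0) l' * g"
      have "mon i (Suc j) 0 l' * g \<in> PPall" using Suc k l by simp
      then have 1: "dm (mon i (Suc j) 0 l' * g) \<in> PPall" unfolding PPall_def by (rule dm_gens)
      have "dm (mon i (Suc j) 0 l' * g) - (cst (of_nat i) * ?Y + cst (of_nat (Suc j)) * ?X) \<in> Hlt M"
        using Hlt_G_right[OF dm_mon[of i "Suc j" 0 l'] that(2)] Suc.prems k l that(2)
        by (simp add: algebra_simps dm_mult)
      with 1 have 2: "cst (of_nat i) * ?Y + cst (of_nat (Suc j)) * ?X \<in> PPall" by (rule mod)
      have "?X \<in> PPall"
      proof (cases i)
        case 0
        then show ?thesis using 2 div[of "of_nat (Suc j)" ?X] by (simp del: of_nat_Suc)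
      next
        case i: (Suc i')
        have "mon i' j 0 l' * g \<in> Hlt (Suc (i' + j + 0 + l'))" 
          using Hlt_G_right[OF mon_Hlt that(2)] .
        then have "mon i' j 0 l' * g \<in> Hlt M" by (rule Hlt_mono[rotated]) (use Suc.prems k l i in simp)
        then have 3: "sg * (mon i' j 0 l' * g) \<in> PPall" 
          using \<open>\<And>x. x \<in> Hlt M \<Longrightarrow> x \<in> PPall\<close> unfolding PPall_def by (intro sg_gens)
        have "sg * (mon i' j 0 l' * g) - (?X - ?Y) \<in> Hlt M"
          using Hlt_G_right[OF sg_mon[of i' j 0 l'] that(2)] Suc.prems k l i by (simp add: algebra_simps)
        with 3 have 4: "?X - ?Y \<in> PPall" by (rule mod)
        have "cst (of_nat (Suc j + i)) * ?X = 
            (cst (of_nat i) * ?Y + cst (of_nat (Suc j)) * ?X) + cst (of_nat i) * (?X - ?Y)"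
          by (simp add: algebra_simps cst_add)
        then have "cst (of_nat (Suc j + i)) * ?X \<in> PPall"
          using V.subspace_add[OF subspace_PPall 2 V.subspace_scale[OF subspace_PPall 4]] by simp
        then show ?thesis using div[of "of_nat (Suc j + i)" ?X] by (simp del: of_nat_Suc of_nat_add)
      qed
      then show ?thesis using k by simp
    qed
  qed
  from Suc.prems show ?case
    unfolding Hlt_def
  proof (induction rule: V.span_induct_alt)
    case base
    then show ?case using V.subspace_0[OF subspace_PPall] .
  next
    case (step a x y)
    then obtain l w where l: "l < Suc M" "(l, w, x) \<in> hom" by blast
    have "x \<in> PPall"
    proof (cases "l < M")
      case True
      then have "x \<in> Hlt M" using l unfolding Hlt_def by (intro V.span_base) blast
      then show ?thesis by (rule Suc.IH)
    next
      case False
      then have "(M, w, x) \<in> hom" using l by (metis less_antisym)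
      then obtain i j k l g where "i + j + k + l = M" "g \<in> G" "x - mon i j k l * g \<in> Hlt M"
        using hom_mon by blast
      then show ?thesis using V.subspace_add[OF subspace_PPall mon Suc.IH, of i j k l g "x - mon i j k l * g"] 
        by simp
    qed
    then show ?case using step(2) 
      using V.subspace_add[OF subspace_PPall V.subspace_scale[OF subspace_PPall]] by blast
  qed
qed

lemma alg_PPall: "x \<in> alg \<Longrightarrow> x \<in> PPall"
  using alg_Hlt Hlt_PPall by blast

lemma dp_pow_0: "dp a = 0 \<Longrightarrow> dp (a ^ k) = 0"
  by (induction k) (auto simp: dp_mult, simp add: dp_def)

lemma d0_pow: "d0 a = cst e * a \<Longrightarrow> d0 (a ^ k) = cst (of_nat k * e) * a ^ k"
proof (induction k)
  case 0
  then show ?case by (simp add: d0_def)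
next
  case (Suc k)
  then show ?case by (simp add: d0_mult cst_left mult.assoc algebra_simps cst_add)
qed

lemma dp_vv: "g \<in> G \<Longrightarrow> dp (vv m i j g) = 0"
  by (simp add: vv_def dp_mult dp_pow_0)

lemma d0_vv: "g \<in> G \<Longrightarrow> d0 (vv m i j g) = cst (of_nat (i + j)) * vv m i j g"
proof -
  assume g: "g \<in> G"
  have "d0 (sg ^ m) = 0" "d0 (z ^ i) = cst (of_nat i) * z ^ i" "d0 (zb ^ j) = cst (of_nat j) * zb ^ j"
    using d0_pow[of sg 0 m] d0_pow[of z 1 i] d0_pow[of zb 1 j] by simp_all
  then show ?thesis using g
    by (simp add: vv_def d0_mult mult.assoc cst_left algebra_simps cst_add)
qed

lemma d0_F: "d0 F = - F - F"
  by (simp add: F_def d0_mult)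

lemma d0_dm: "d0 (dm x) = dm (d0 x) - dm x - dm x"
  unfolding dm_def by (simp add: d0_diff d0_mult d0_F algebra_simps)

lemma d0_dm_pow:
  assumes "d0 v = cst w * v"
  shows "d0 ((dm ^^ r) v) = cst (w - 2 * of_nat r) * (dm ^^ r) v"
proof (induction r)
  case 0
  then show ?case using assms by simp
next
  case (Suc r)
  have "cst (w - 2 * of_nat (Suc r)) = cst (w - 2 * of_nat r) - 1 - 1"
  proof -
    have "w - 2 * of_nat (Suc r) = (w - 2 * of_nat r) + (- 1) + (- 1)" by simp
    then show ?thesis by (simp only: cst_add) (simp add: cst_minus)
  qed
  then have "cst (w - 2 * of_nat (Suc r)) * (dm ^^ Suc r) v =
      cst (w - 2 * of_nat r) * dm ((dm ^^ r) v) - dm ((dm ^^ r) v) - dm ((dm ^^ r) v)"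
    by (simp only: left_diff_distrib) simp
  also have "\<dots> = d0 ((dm ^^ Suc r) v)"
    using Suc by (simp add: d0_dm flip: dm_cst)
  finally show ?case ..
qed

lemma dp_dm: "dp (dm x) = dm (dp x) + d0 x"
  by (simp add: d0_comm)

lemma dp_dm_pow:
  assumes "dp v = 0" "d0 v = cst w * v"
  shows "dp ((dm ^^ Suc r) v) = cst (of_nat (Suc r) * (w - of_nat r)) * (dm ^^ r) v"
proof (induction r)
  case 0
  then show ?case using assms by (simp add: dp_dm)
next
  case (Suc r)
  have "dp ((dm ^^ Suc (Suc r)) v) = dm (dp ((dm ^^ Suc r) v)) + d0 ((dm ^^ Suc r) v)"
    by (simp add: dp_dm)
  also have "\<dots> = cst (of_nat (Suc r) * (w - of_nat r) + (w - 2 * of_nat (Suc r))) * (dm ^^ Suc r) v"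
    by (simp only: Suc dm_cst d0_dm_pow[OF assms(2)] cst_add distrib_right) simp
  also have "of_nat (Suc r) * (w - of_nat r) + (w - 2 * of_nat (Suc r)) = of_nat (Suc (Suc r)) * (w - of_nat (Suc r))"
    by (simp add: algebra_simps)
  finally show ?case .
qed

text \<open>
  Four times the Casimir operator of the action of \<open>sl2\<close>; it has the eigenvalue \<open>w (w + 2)\<close> on a
  representation of highest weight \<open>w\<close>.
\<close>

definition "Om4 x = cst 4 * dm (dp x) + d0 (d0 x) + cst 2 * d0 x"

lemma Om4_gen:
  assumes "dp v = 0" "d0 v = cst w * v"
  shows "Om4 ((dm ^^ r) v) = cst (w * (w + 2)) * (dm ^^ r) v"
proof (cases r)
  case 0
  have "Om4 v = cst (w * w + 2 * w) * v"
    by (simp only: cst_add distrib_right) (simp add: Om4_def assms d0_cst cst_cst)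
  also have "w * w + 2 * w = w * (w + 2)" by (simp add: algebra_simps)
  finally show ?thesis using 0 by simp
next
  case (Suc q)
  have "Om4 ((dm ^^ r) v) = cst (4 * (of_nat (Suc q) * (w - of_nat q)) + (w - 2 * of_nat r) * (w - 2 * of_nat r) + 2 * (w - 2 * of_nat r)) * (dm ^^ r) v"
    unfolding Om4_def d0_dm_pow[OF assms(2)] d0_cst Suc dp_dm_pow[OF assms] dm_cst
    by (simp only: cst_add distrib_right cst_cst) simp
  also have "4 * (of_nat (Suc q) * (w - of_nat q)) + (w - 2 * of_nat r) * (w - 2 * of_nat r) + 2 * (w - 2 * of_nat r) = w * (w + 2)"
    using Suc by (simp add: algebra_simps)
  finally show ?thesis .
qed

lemma Om4_add: "Om4 (x + y) = Om4 x + Om4 y"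
  by (simp add: Om4_def dm_add dp_add d0_add algebra_simps)
lemma Om4_cst: "Om4 (cst a * x) = cst a * Om4 x"
  by (simp add: Om4_def dm_cst dp_cst d0_cst algebra_simps cst_cst mult.commute)
lemma Om4_diff: "Om4 (x - y) = Om4 x - Om4 y"
  by (metis Om4_add add_diff_cancel diff_add_cancel)

definition "Tm e y = Om4 y - cst e * y"

lemma Tm_add: "Tm e (x + y) = Tm e x + Tm e y"
  and Tm_cst: "Tm e (cst a * x) = cst a * Tm e x"
  and Tm_comm: "Tm e (Tm e' x) = Tm e' (Tm e x)"
  by (simp_all add: Tm_def Om4_add Om4_cst Om4_diff algebra_simps cst_cst)
    
lemma Tm_0: "Tm e 0 = 0"
  using Tm_add[of e 0 0] by simp

lemma Tm_fold_add: "foldr Tm es (x + y) = foldr Tm es x + foldr Tm es y"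
  and Tm_fold_cst: "foldr Tm es (cst a * x) = cst a * foldr Tm es x"
  and Tm_fold_0: "foldr Tm es 0 = 0"
  by (induction es) (auto simp: Tm_add Tm_cst Tm_0)

lemma Tm_fold_comm: "foldr Tm es (foldr Tm es' x) = foldr Tm es' (foldr Tm es x)"
proof -
  have 1: "foldr Tm es (Tm e x) = Tm e (foldr Tm es x)" for e x es
    by (induction es) (auto simp: Tm_comm[of e])
  show ?thesis by (induction es) (auto simp: 1)
qed

text \<open>
  A product of factors \<open>Om4 - e\<close>, each with a nonzero Casimir eigenvalue \<open>e\<close>, kills a given element of \<open>PP\<close>.
\<close>

lemma PP_killed:
  assumes "x \<in> PP"
  shows "\<exists>es. 0 \<notin> set es \<and> foldr Tm es x = 0"
  using assms unfolding PP_def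
proof (induction rule: V.span_induct_alt)
  case base
  then show ?case by (intro exI[of _ "[]"]) simp
next
  case (step a x y)
  obtain r m i j g where x: "x = (dm ^^ r) (vv m i j g)" "g \<in> G" "i + j > 0"
    using step(1) unfolding gens_def by blast
  define e :: complex where "e = of_nat (i + j) * (of_nat (i + j) + 2)"
  have "e = of_nat ((i + j) * (i + j + 2))" by (simp add: e_def algebra_simps)
  then have e: "e \<noteq> 0" using x(3) by (metis of_nat_eq_0_iff mult_eq_0_iff add_is_0 neq0_conv zero_neq_numeral)
  have "Tm e x = 0"
    unfolding x(1) Tm_def Om4_gen[OF dp_vv[OF x(2)] d0_vv[OF x(2)]] e_def by simp
  moreover obtain es where es: "0 \<notin> set es" "foldr Tm es y = 0" using step(2) by blast
  ultimately have "foldr Tm (e # es) (cst a * x + y) = 0"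
    using Tm_fold_comm[of "[e]" es "cst a * x"] 
    by (simp add: Tm_fold_add Tm_fold_cst Tm_0 Tm_cst Tm_add Tm_fold_0)
  then show ?case using e es by (intro exI[of _ "e # es"]) auto
qed

lemma AA_dm: "x \<in> AA \<Longrightarrow> dm x = 0" and AA_dp: "x \<in> AA \<Longrightarrow> dp x = 0"
proof -
  have 1: "dm (sg ^ m * g) = 0" "dp (sg ^ m * g) = 0" if "g \<in> G" for m g
    using that by (simp_all add: dm_mult dm_pow_0 dp_mult dp_pow_0)
  show "x \<in> AA \<Longrightarrow> dm x = 0" unfolding AA_def
    by (induction rule: V.span_induct_alt) (use 1 in \<open>auto simp: dm_add dm_cst simp del: dm_mult\<close>)
  show "x \<in> AA \<Longrightarrow> dp x = 0" unfolding AA_def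
    by (induction rule: V.span_induct_alt) (use 1 in \<open>auto simp: dp_add dp_cst simp del: dp_mult\<close>)
qed

text \<open>
  The Casimir operator vanishes on \<open>AA\<close>, so the product that kills an element of \<open>PP\<close> acts on \<open>AA\<close> as a
  nonzero scalar.
\<close>

lemma AA_PP:
  assumes "x \<in> AA" "x \<in> PP"
  shows "x = 0"
proof -
  obtain es where es: "0 \<notin> set es" "foldr Tm es x = 0" using PP_killed[OF assms(2)] by blast
  have 1: "Tm e x = cst (- e) * x" for e
    using AA_dm[OF assms(1)] AA_dp[OF assms(1)] by (simp add: Tm_def Om4_def d0_comm cst_minus)
  have "foldr Tm es x = cst (prod_list (map uminus es)) * x"
    by (induction es) (simp_all add: Tm_cst 1 cst_cst mult.commute)
  with es have "cst (prod_list (map uminus es)) * x = 0" by simp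
  moreover have "prod_list (map uminus es) \<noteq> 0" using es(1) by (induction es) auto
  ultimately show ?thesis using V.scale_eq_0_iff by blast
qed

lemma PPall_split:
  assumes "x \<in> PPall"
  shows "\<exists>a p. x = a + p \<and> a \<in> AA \<and> p \<in> PP"
  using assms unfolding PPall_def
proof (induction rule: V.span_induct_alt)
  case base
  then show ?case using V.subspace_0[OF subspace_AA] V.subspace_0[OF subspace_PP] 
    by (intro exI[of _ 0]) simp
next
  case (step e x y)
  obtain r m i j g where x: "x = (dm ^^ r) (vv m i j g)" "g \<in> G"
    using step(1) unfolding gens_def by blast
  obtain a p where ap: "y = a + p" "a \<in> AA" "p \<in> PP" using step(2) by blast
  show ?case
  proof (cases "i + j > 0")
    case True
    then have "x \<in> PP" using x unfolding PP_def gens_def by (intro V.span_base) blast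
    then have "cst e * x + p \<in> PP" using ap V.subspace_add[OF subspace_PP V.subspace_scale[OF subspace_PP]] by blast
    then show ?thesis using ap by (intro exI[of _ a] exI[of _ "cst e * x + p"]) (simp add: algebra_simps)
  next
    case False
    then have v: "vv m i j g \<in> AA" using x(2) unfolding AA_def vv_def by (intro V.span_base) auto
    have "x \<in> AA"
    proof (cases r)
      case (Suc q)
      have "(dm ^^ q) 0 = 0" by (induction q) auto
      then have "x = 0" using AA_dm[OF v] x(1) Suc by (simp add: funpow_swap1)
      then show ?thesis using V.subspace_0[OF subspace_AA] by simp
    qed (use x v in simp)
    then have "cst e * x + a \<in> AA" using ap V.subspace_add[OF subspace_AA V.subspace_scale[OF subspace_AA]] by blast
    then show ?thesis using ap by (intro exI[of _ "cst e * x + a"] exI[of _ p]) (simp add: algebra_simps)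
  qed
qed

lemma PP_dm: "x \<in> PP \<Longrightarrow> dm x \<in> PP"
  unfolding PP_def by (rule dm_gens)

lemma PP_dp: "x \<in> PP \<Longrightarrow> dp x \<in> PP"
  unfolding PP_def
proof (rule span_linear_image[where f = dp])
  fix x assume "x \<in> gens (\<lambda>i j. i + j > 0)"
  then obtain r m i j g where x: "x = (dm ^^ r) (vv m i j g)" "g \<in> G" "i + j > 0" 
    unfolding gens_def by blast
  show "dp x \<in> V.span (gens (\<lambda>i j. i + j > 0))"
  proof (cases r)
    case 0
    then show ?thesis using x dp_vv V.span_zero by simp
  next
    case (Suc q)
    have "(dm ^^ q) (vv m i j g) \<in> V.span (gens (\<lambda>i j. i + j > 0))"
      using x(2,3) unfolding gens_def by (intro V.span_base) blast
    then show ?thesis unfolding x(1) Suc dp_dm_pow[OF dp_vv[OF x(2)] d0_vv[OF x(2)]]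
      by (rule V.span_scale)
  qed
qed (auto simp: dp_add dp_cst)

lemma PPall_dm_PP: "x \<in> PPall \<Longrightarrow> dm x \<in> PP"
  using PPall_split[of x] AA_dm PP_dm by (force simp: dm_add)

lemma PPall_dp_PP: "x \<in> PPall \<Longrightarrow> dp x \<in> PP"
  using PPall_split[of x] AA_dp PP_dp by (force simp: dp_add)

lemma alg_d0_PP: "x \<in> alg \<Longrightarrow> d0 x \<in> PP"
  using alg_PPall PPall_dm_PP PPall_dp_PP PP_dm PP_dp V.subspace_diff[OF subspace_PP] d0_comm by metis

definition "lin f \<longleftrightarrow> (\<forall>x y. f (x + y) = f x + f y) \<and> (\<forall>a x. f (cst a * x) = a * (f x :: complex))"

lemma lin_add: "lin f \<Longrightarrow> f (x + y) = f x + f y" and lin_cst: "lin f \<Longrightarrow> f (cst a * x) = a * f x"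
  by (auto simp: lin_def)

lemma lin_0: "lin f \<Longrightarrow> f 0 = 0" using lin_add[of f 0 0] by simp

lemma lin_minus: "lin f \<Longrightarrow> f (- x) = - f x" 
  using lin_cst[of f "- 1" x] by (simp add: cst_minus)

lemma lin_diff: "lin f \<Longrightarrow> f (x - y) = f x - f y" 
  using lin_add[of f x "- y"] lin_minus by simp

lemma lin_sum: "lin f \<Longrightarrow> f (sum g A) = (\<Sum>x\<in>A. f (g x))"
  by (induction A rule: infinite_finite_induct) (auto simp: lin_0 lin_add)

lemma lin_span_eq: 
  assumes "lin f" "lin g" "x \<in> V.span X" "\<And>x. x \<in> X \<Longrightarrow> f x = g x"
  shows "f x = g x"
  using assms(3) by (induction rule: V.span_induct_alt) (auto simp: assms lin_0 lin_add lin_cst)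

lemma lin_extend:
  assumes "V.independent B"
  shows "\<exists>f. lin f \<and> (\<forall>b\<in>B. f b = h b)"
proof -
  interpret C: vector_space "(*) :: complex \<Rightarrow> complex \<Rightarrow> complex"
    by unfold_locales (auto simp: algebra_simps)
  interpret P: vector_space_pair "\<lambda>a x. cst a * x" "(*) :: complex \<Rightarrow> complex \<Rightarrow> complex" ..
  obtain f where f: "Vector_Spaces.linear (\<lambda>a x. cst a * x) (*) f" "\<forall>b\<in>B. f b = h b"
    using P.linear_independent_extend[OF assms] by blast
  interpret f: Vector_Spaces.linear "\<lambda>a x. cst a * x" "(*) :: complex \<Rightarrow> complex \<Rightarrow> complex" f by fact
  have "lin f" unfolding lin_def using f.add f.scale by blast
  then show ?thesis using f(2) by blast
qed

lemma independent_Un: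
  assumes A: "V.independent A" and B: "V.independent B" and "\<And>x. x \<in> V.span A \<Longrightarrow> x \<in> V.span B \<Longrightarrow> x = 0"
  shows "V.independent (A \<union> B)"
proof
  assume "V.dependent (A \<union> B)"
  then obtain X u v0 where X: "finite X" "X \<subseteq> A \<union> B" "v0 \<in> X" "u v0 \<noteq> 0"
    and s: "(\<Sum>v\<in>X. cst (u v) * v) = 0"
    unfolding V.dependent_explicit by auto
  let ?a = "\<Sum>v\<in>X \<inter> A. cst (u v) * v" and ?b = "\<Sum>v\<in>X - A. cst (u v) * v"
  have "?a + ?b = (\<Sum>v\<in>X. cst (u v) * v)" by (rule sum.Int_Diff[OF X(1), symmetric])
  also note s
  finally have ab: "?a + ?b = 0" .
  have a: "?a \<in> V.span A" by (intro V.span_sum V.span_scale V.span_base) blast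
  have b: "?b \<in> V.span B" using X(2) by (intro V.span_sum V.span_scale V.span_base) blast
  have "?a = - ?b" using ab by (rule eq_neg_iff_add_eq_0[THEN iffD2])
  then have "?a \<in> V.span B" using V.span_neg[OF b] by (simp only:)
  then have a0: "?a = 0" using assms(3)[OF a] by blast
  have b0: "?b = 0" using ab unfolding a0 by (simp only: add_0_left)
  show False
  proof (cases "v0 \<in> A")
    case True
    then show False using V.independentD[OF A _ _ a0, of v0] X(1,3,4) by simp
  next
    case False
    then show False using V.independentD[OF B _ _ b0, of v0] X by auto
  qed
qed

text \<open>
  Possible since \<open>AA\<close> and \<open>PP\<close> meet only in 0.
\<close>

lemma lin_extend_zero:
  assumes "lin f"
  shows "\<exists>h. lin h \<and> (\<forall>x\<in>AA. h x = f x) \<and> (\<forall>x\<in>PP. h x = 0)"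
proof -
  obtain A where A: "A \<subseteq> AA" "V.independent A" "AA \<subseteq> V.span A"
    using V.maximal_independent_subset[of AA] by blast
  obtain B where B: "B \<subseteq> PP" "V.independent B" "PP \<subseteq> V.span B"
    using V.maximal_independent_subset[of PP] by blast
  have sA: "V.span A = AA" and sB: "V.span B = PP"
    using A B V.span_minimal subspace_AA subspace_PP by blast+
  have ind: "V.independent (A \<union> B)"
    by (rule independent_Un[OF A(2) B(2)]) (auto simp: sA sB intro: AA_PP)
  obtain h where h: "lin h" "\<forall>b\<in>A \<union> B. h b = (if b \<in> A then f b else 0)"
    using lin_extend[OF ind, of "\<lambda>b. if b \<in> A then f b else 0"] by blast
  have "b \<notin> A" if "b \<in> B" for b
  proof
    assume "b \<in> A"
    then have "b = 0" using A(1) B(1) that AA_PP by blast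
    then show False using V.dependent_zero[of B] B(2) that by simp
  qed
  then have hB: "h b = 0" if "b \<in> B" for b using h(2) that by auto
  have "lin (\<lambda>x. 0)" by (simp add: lin_def)
  then have "\<forall>x\<in>PP. h x = 0" using lin_span_eq[OF h(1) \<open>lin (\<lambda>x. 0)\<close>, of _ B] hB unfolding sB by blast
  moreover have "\<forall>x\<in>AA. h x = f x" using lin_span_eq[OF h(1) assms, of _ A] h(2) unfolding sA by simp
  ultimately show ?thesis using h(1) by blast
qed

end

section \<open>The algebra of invariants\<close>

lemma mod_periodic:
  fixes f :: "int \<Rightarrow> 'b"
  assumes "\<And>l. f (l + int n) = f l"
  shows "f (l mod int n) = f l"
proof -
  have 1: "f (l + int k * int n) = f l" for l k
  proof (induction k)
    case (Suc k)
    then show ?case using assms[of "l + int k * int n"] by (simp add: algebra_simps)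
  qed simp
  have "f (l + m * int n) = f l" for m
  proof (cases "m \<ge> 0")
    case True
    then show ?thesis using 1[of l "nat m"] by simp
  next
    case False
    then show ?thesis using 1[of "l + m * int n" "nat (- m)"] by simp
  qed
  from this[of "- (l div int n)"] show ?thesis by (simp add: minus_div_mult_eq_mod)
qed

lemma sum_periodic_shift:
  fixes f :: "int \<Rightarrow> 'b :: comm_monoid_add"
  assumes "n > 0" "\<And>l. f (l + int n) = f l"
  shows "(\<Sum>l\<in>{0..<int n}. f (l + a)) = (\<Sum>l\<in>{0..<int n}. f l)"
  by (rule sum.reindex_bij_witness[where i = "\<lambda>l. (l - a) mod int n" and j = "\<lambda>l. (l + a) mod int n"])
     (use assms(1) in \<open>auto simp: mod_simps mod_periodic[of f, OF assms(2)]\<close>)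

lemma sum_periodic_reflect:
  fixes f :: "int \<Rightarrow> 'b :: comm_monoid_add"
  assumes "n > 0" "\<And>l. f (l + int n) = f l"
  shows "(\<Sum>l\<in>{0..<int n}. f (a - l)) = (\<Sum>l\<in>{0..<int n}. f l)"
  by (rule sum.reindex_bij_witness[where i = "\<lambda>l. (a - l) mod int n" and j = "\<lambda>l. (a - l) mod int n"])
     (use assms(1) in \<open>auto simp: mod_simps mod_periodic[of f, OF assms(2)]\<close>)

context dunkl_algebra
begin

lemma om_n: "om n (k + int n) = om n k" using om_period n_pos .
lemma om_n': "om n (k - int n) = om n k" using om_n[of "k - int n"] by simp

lemma c_shift_mult: "c (l + 2 * k) = c l"
proof -
  have 1: "c (l + 2 * int k) = c l" for l k
  proof (induction k)
    case (Suc k)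
    then show ?case using c_shift[of "l + 2 * int k"] by (simp add: algebra_simps)
  qed simp
  show ?thesis
  proof (cases "k \<ge> 0")
    case True
    then show ?thesis using 1[of l "nat k"] by simp
  next
    case False
    then show ?thesis using 1[of "l + 2 * k" "nat (- k)"] by simp
  qed
qed

lemma c_reflect: "c (2 * k - l) = c l"
  using c_shift_mult[of "- l" k] c_minus by (simp add: algebra_simps)

lemma c_reflect': "c (k * 2 - l) = c l" and c_shift_mult': "c (l + k * 2) = c l"
  using c_reflect[of k l] c_shift_mult[of l k] by (simp_all add: mult.commute)

lemma S_n': "S (k - int n) = S k" using S_period[of "k - int n"] by simp
lemma R_n': "R (k - int n) = R k" using R_period[of "k - int n"] by simp
lemma c_n': "c (k - int n) = c k" using c_period[of "k - int n"] by simp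

lemmas per = om_n om_n' S_period S_n' R_period R_n' c_period c_n'

text \<open>
  The range of summation is a full period, so the index of a periodic summand may be shifted or reflected.
\<close>

definition "psum f = (\<Sum>l\<in>{0..<int n}. f l)"

lemma psum_shift: "(\<And>l. f (l + int n) = f l) \<Longrightarrow> psum (\<lambda>l. f (l + a)) = psum f"
  unfolding psum_def by (rule sum_periodic_shift[OF n_pos])
lemma psum_reflect: "(\<And>l. f (l + int n) = f l) \<Longrightarrow> psum (\<lambda>l. f (a - l)) = psum f"
  unfolding psum_def by (rule sum_periodic_reflect[OF n_pos])

lemma rho_psum: "rho = psum (\<lambda>l. cst (c l) * R l)"
  and gA_psum: "gA = psum (\<lambda>l. cst (c l * om n l) * R l)"
  and gB_psum: "gB = psum (\<lambda>l. cst (c l * om n (- l)) * R l)"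
  by (simp_all add: rho_def gA_def gB_def psum_def)

lemma psum_left: "(x :: 'a) * psum f = psum (\<lambda>l. x * f l)"
  and psum_right: "psum f * (x :: 'a) = psum (\<lambda>l. f l * x)"
  by (simp_all add: psum_def sum_distrib_left sum_distrib_right)

lemma psum_cong: "(\<And>l. f l = g l) \<Longrightarrow> psum f = psum g"
  by (simp add: psum_def)

lemma R_rho: "R k * rho = psum (\<lambda>l. cst (c l) * S (k - l))"
  by (simp add: rho_psum psum_left cst_l R_R)

lemma rho_R: "rho * R k = psum (\<lambda>l. cst (c l) * S (l - k))"
  by (simp add: rho_psum psum_right mult.assoc R_R)

lemma R_rho_comm: "R k * rho = rho * R k"
proof -
  have "psum (\<lambda>l. (\<lambda>l. cst (c l) * S (k - l)) (2 * k - l)) = psum (\<lambda>l. cst (c l) * S (k - l))"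
    by (rule psum_reflect) (use S_n'[of "k - l" for l] in \<open>simp add: per algebra_simps\<close>)
  then show ?thesis unfolding R_rho rho_R by (simp add: c_reflect' algebra_simps)
qed

lemma S_rho_comm: "S k * rho = rho * S k"
proof -
  have "psum (\<lambda>l. (\<lambda>l. cst (c l) * R (l - k)) (l + 2 * k)) = psum (\<lambda>l. cst (c l) * R (l - k))"
    by (rule psum_shift) (use R_period[of "l - k" for l] in \<open>simp add: per algebra_simps\<close>)
  then show ?thesis
    by (simp add: rho_psum psum_left psum_right cst_l S_R R_S mult.assoc c_shift_mult' algebra_simps)
qed

text \<open>
  Since \<open>sg\<close> and \<open>rho\<close> anticommute, \<open>sm\<close> and \<open>sp\<close> have the same square. The point of these combinations
  is that they can be moved past \<open>z\<close> and \<open>zb\<close> with a mere shift by one.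
\<close>

definition "sm = sg - rho"
definition "sp = sg + rho"
definition "Cc = sg * sg + rho * rho"

lemma sm_sq: "sm * sm = Cc" and sp_sq: "sp * sp = Cc"
  by (simp_all add: sm_def sp_def Cc_def algebra_simps rho_sg)

lemma S_sm: "S k * sm = sm * S k" and S_sp: "S k * sp = sp * S k"
  and R_sm: "R k * sm = - (sp * R k)" and R_sp: "R k * sp = - (sm * R k)"
  by (simp_all add: sm_def sp_def algebra_simps S_sg R_sg R_rho_comm S_rho_comm)

lemma sm_z: "sm * z = z * (sp + 1)"
  by (simp_all add: sm_def sp_def algebra_simps sg_z sg_zb)

lemma sg_Cc: "sg * Cc = Cc * sg"
proof -
  have "rho * (rho * sg) = sg * (rho * rho)" by (simp add: rho_sg rho_sg[THEN rw_assoc] mult.assoc)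
  then show ?thesis by (simp add: Cc_def algebra_simps)
qed

lemma rho_Cc: "rho * Cc = Cc * rho"
  by (simp add: Cc_def algebra_simps rho_sg rho_sg[THEN rw_assoc])

lemma G_Cc: "g \<in> G \<Longrightarrow> g * Cc = Cc * g"
  unfolding G_def
  by (auto simp: Cc_def algebra_simps R_sg R_sg[THEN rw_assoc] S_sg S_sg[THEN rw_assoc]
      R_rho_comm R_rho_comm[THEN rw_assoc] S_rho_comm S_rho_comm[THEN rw_assoc])

lemma comm_pow: "a * b = b * a \<Longrightarrow> a * b ^ k = b ^ k * a" for a b :: 'a
  using power_commuting_commutes[of b a k] by simp

lemma S_sm_pow: "S k * sm ^ j = sm ^ j * S k" by (rule comm_pow[OF S_sm])

lemma sp_neg_pow: "R k * sm ^ j = (- sp) ^ j * R k"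
  by (induction j) (auto simp: R_sm[THEN rw_assoc] mult.assoc)

lemma AA_G: "g \<in> G \<Longrightarrow> g \<in> AA"
  unfolding AA_def by (rule V.span_base) (metis (mono_tags, lifting) mem_Collect_eq mult_1 power_0)

lemma AA_add: "x \<in> AA \<Longrightarrow> y \<in> AA \<Longrightarrow> x + y \<in> AA" and AA_cst: "x \<in> AA \<Longrightarrow> cst a * x \<in> AA"
  and AA_minus: "x \<in> AA \<Longrightarrow> - x \<in> AA" and AA_diff: "x \<in> AA \<Longrightarrow> y \<in> AA \<Longrightarrow> x - y \<in> AA"
  and AA_0: "0 \<in> AA"
  using subspace_AA by (auto intro: V.subspace_add V.subspace_scale V.subspace_neg V.subspace_diff V.subspace_0)

lemma AA_psum: "(\<And>l. f l \<in> AA) \<Longrightarrow> psum f \<in> AA"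
  unfolding psum_def by (intro V.subspace_sum[OF subspace_AA]) auto

lemma AA_sg_left: "x \<in> AA \<Longrightarrow> sg * x \<in> AA"
  unfolding AA_def
proof (rule span_linear_image[where f = "\<lambda>x. sg * x"])
  fix x assume "x \<in> {x. \<exists>m g. x = sg ^ m * g \<and> g \<in> G}"
  then obtain m g where "x = sg ^ m * g" "g \<in> G" by blast
  then have "sg * x = sg ^ Suc m * g" by (simp add: mult.assoc)
  then show "sg * x \<in> V.span {x. \<exists>m g. x = sg ^ m * g \<and> g \<in> G}"
    using \<open>g \<in> G\<close> by (intro V.span_base) blast
qed (auto simp: algebra_simps cst_left[of sg])

lemma AA_sg_pow_left: "x \<in> AA \<Longrightarrow> sg ^ m * x \<in> AA"
  by (induction m) (auto simp: mult.assoc AA_sg_left)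

lemma G_sg_pow: "g \<in> G \<Longrightarrow> \<exists>e. g * sg ^ m = cst e * (sg ^ m * g)"
proof (induction m)
  case 0
  then show ?case by (intro exI[of _ 1]) simp
next
  case (Suc m)
  have "g * sg = cst 1 * (sg * g) \<or> g * sg = cst (- 1) * (sg * g)"
    using Suc.prems unfolding G_def by (auto simp: S_sg R_sg cst_minus)
  then obtain a where a: "g * sg = cst a * (sg * g)" by blast
  obtain b where b: "g * sg ^ m = cst b * (sg ^ m * g)" using Suc by blast
  have "g * sg ^ Suc m = cst a * (sg * (g * sg ^ m))"
    unfolding power_Suc mult.assoc[symmetric] a ..
  also have "\<dots> = cst (a * b) * (sg ^ Suc m * g)"
    unfolding b by (simp add: cst_left[of sg] cst_cst mult.assoc)
  finally show ?case by blast
qed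

lemma AA_mult:
  assumes "x \<in> AA" "y \<in> AA"
  shows "x * y \<in> AA"
proof -
  have 1: "g * y \<in> AA" if gG: "g \<in> G" for g
    using assms(2) unfolding AA_def
  proof (rule span_linear_image[where f = "\<lambda>y. g * y"])
    fix x assume "x \<in> {x. \<exists>m g. x = sg ^ m * g \<and> g \<in> G}"
    then obtain m h where x: "x = sg ^ m * h" "h \<in> G" by blast
    obtain e where e: "g * sg ^ m = cst e * (sg ^ m * g)" using G_sg_pow[OF gG] by blast
    have "g * x = cst e * (sg ^ m * (g * h))"
      unfolding x(1) mult.assoc[symmetric] e ..
    moreover have "cst e * (sg ^ m * (g * h)) \<in> AA" by (intro AA_cst AA_sg_pow_left AA_G G_mult gG x)
    ultimately show "g * x \<in> V.span {x. \<exists>m g. x = sg ^ m * g \<and> g \<in> G}"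
      unfolding AA_def by simp
  qed (auto simp: algebra_simps cst_left)
  show ?thesis using assms(1) unfolding AA_def
    by (rule span_linear_image[where f = "\<lambda>x. x * y"])
       (use 1 AA_sg_pow_left in \<open>auto simp: algebra_simps AA_def[symmetric]\<close>)
qed

lemma AA_1: "1 \<in> AA" using AA_G one_G by blast
lemma AA_pow: "x \<in> AA \<Longrightarrow> x ^ k \<in> AA" by (induction k) (auto intro: AA_1 AA_mult)
lemma AA_S [simp]: "S k \<in> AA" and AA_R [simp]: "R k \<in> AA" using AA_G by (auto simp: G_def)
lemma AA_sg: "sg \<in> AA" using AA_sg_left[OF AA_1] by simp
lemma AA_rho: "rho \<in> AA" and AA_gA: "gA \<in> AA" and AA_gB: "gB \<in> AA"
  unfolding rho_psum gA_psum gB_psum by (intro AA_psum AA_cst AA_R)+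
lemma AA_sm: "sm \<in> AA" and AA_sp: "sp \<in> AA" and AA_Cc: "Cc \<in> AA"
  unfolding sm_def sp_def Cc_def by (intro AA_add AA_diff AA_mult AA_sg AA_rho)+

lemmas AA_intros = AA_add AA_diff AA_minus AA_mult AA_cst AA_sg AA_rho AA_gA AA_gB AA_sm AA_sp
  AA_Cc AA_S AA_R AA_1 AA_pow AA_psum

text \<open>
  Powers of \<open>sm\<close> may replace those of \<open>sg\<close>: the difference is \<open>rho\<close>, which lies in the group algebra. Rotations
  commute with \<open>sm\<close>, whereas reflections exchange it with \<open>- sp\<close>, whence the different position of
  the powers.
\<close>

lemma AA_sm_span: 
  assumes "x \<in> AA"
  shows "x \<in> V.span ({x. \<exists>j k. x = sm ^ j * S k} \<union> {x. \<exists>j k. x = R k * sm ^ j})" (is "x \<in> V.span ?X")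
proof -
  have psum_in: "psum f \<in> V.span ?X" if "\<And>l. f l \<in> V.span ?X" for f
    unfolding psum_def by (intro V.span_sum that)
  have S1: "sm ^ j * S k \<in> V.span ?X" and R1: "R k * sm ^ j \<in> V.span ?X" for j k
    by (rule V.span_base, blast)+
  have sgX: "sg * x \<in> V.span ?X" if "x \<in> V.span ?X" for x
    using that
  proof (rule span_linear_image[where f = "\<lambda>x. sg * x"])
    fix x assume "x \<in> ?X"
    then consider j k where "x = sm ^ j * S k" | j k where "x = R k * sm ^ j" by blast
    then show "sg * x \<in> V.span ?X"
    proof cases
      case 1
      have "rho * (sm ^ j * S k) = psum (\<lambda>l. cst (c l) * (R (l - k) * sm ^ j))"
        by (simp add: rho_psum psum_right mult.assoc R_S[THEN rw_assoc] flip: S_sm_pow)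
      moreover have "sg * x = sm ^ Suc j * S k + rho * (sm ^ j * S k)"
        by (simp add: 1 sm_def algebra_simps)
      ultimately show ?thesis
        by (simp only:) (intro V.span_add V.span_scale psum_in S1 R1)
    next
      case 2
      have "R k * rho * sm ^ j = psum (\<lambda>l. cst (c l) * (sm ^ j * S (k - l)))"
        by (simp add: R_rho psum_right mult.assoc flip: S_sm_pow)
      moreover have "sg * x = - (R k * sm ^ Suc j) - R k * rho * sm ^ j"
      proof -
        have "sg * R k = - (R k * sg)" by (simp add: R_sg)
        then have "sg * x = - (R k * sg * sm ^ j)" unfolding 2 mult.assoc[symmetric] by simp
        also have "R k * sg = R k * (sm + rho)" by (simp add: sm_def)
        also have "- (R k * (sm + rho) * sm ^ j) = - (R k * sm ^ Suc j) - R k * rho * sm ^ j"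
          by (simp add: algebra_simps)
        finally show ?thesis .
      qed
      ultimately show ?thesis
        by (simp only:) (intro V.span_diff V.span_neg V.span_scale psum_in S1 R1)
    qed
  qed (auto simp: algebra_simps cst_left[of sg])
  have "sg ^ m * g \<in> V.span ?X" if "g \<in> G" for m g
  proof (induction m)
    case 0
    then show ?case using that S1[of 0] R1[of _ 0] by (auto simp: G_def)
  next
    case (Suc m)
    then show ?case using sgX by (simp add: mult.assoc)
  qed
  then have "AA \<subseteq> V.span ?X" unfolding AA_def by (intro V.span_minimal V.subspace_span) auto
  then show ?thesis using assms by blast
qed

text \<open>
  The pairs \<open>(p (sm), p (sp + 1))\<close> for polynomials \<open>p\<close>. Such a pair satisfies \<open>p (sm) z = z p (sp + 1)\<close>, so
  \<open>Q\<close> describes how invariants are carried across the letter \<open>z\<close>.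
\<close>

inductive Q :: "'a \<Rightarrow> 'a \<Rightarrow> bool" where
  Q_pow: "Q (sm ^ j) ((sp + 1) ^ j)"
| Q_add: "Q p q \<Longrightarrow> Q p' q' \<Longrightarrow> Q (p + p') (q + q')"
| Q_cst: "Q p q \<Longrightarrow> Q (cst a * p) (cst a * q)"

lemma Q_mult: "Q p q \<Longrightarrow> Q (sm * p) ((sp + 1) * q)"
proof (induction rule: Q.induct)
  case (Q_pow j)
  then show ?case using Q.Q_pow[of "Suc j"] by simp
next
  case (Q_add p q p' q')
  then show ?case using Q.Q_add by (simp only: distrib_left)
next
  case (Q_cst p q a)
  then show ?case using Q.Q_cst by (simp only: cst_left)
qed

lemma Q_diff: "Q p q \<Longrightarrow> Q p' q' \<Longrightarrow> Q (p - p') (q - q')"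
  using Q_add[OF _ Q_cst[of p' q' "- 1"], of p q] by (simp add: cst_minus)

lemma Q_AA: "Q p q \<Longrightarrow> p \<in> AA \<and> q \<in> AA"
  by (induction rule: Q.induct) (auto intro!: AA_intros)

lemma Q_S: "Q p q \<Longrightarrow> S k * p = p * S k \<and> S k * q = q * S k"
proof (induction rule: Q.induct)
  case (Q_pow j)
  have "S k * (sp + 1) = (sp + 1) * S k" by (simp add: algebra_simps S_sp)
  then show ?case using S_sm_pow comm_pow by blast
qed (auto simp: algebra_simps cst_left)

lemma Q_z: "Q p q \<Longrightarrow> p * z = z * q"
proof (induction rule: Q.induct)
  case (Q_pow j)
  show ?case by (induction j) (simp_all add: mult.assoc sm_z[THEN rw_assoc])
qed (auto simp: algebra_simps cst_left[of z])

end

context dunkl_algebra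
begin

section \<open>Extension of functionals from the invariants\<close>

lemma psum_add: "psum f + psum g = psum (\<lambda>l. f l + g l)"
  and psum_minus: "- psum f' = psum (\<lambda>l. - f' l :: 'c :: ab_group_add)"
  by (simp_all add: psum_def sum.distrib sum_negf)

lemma psum_scale: "x * psum f = psum (\<lambda>l. x * f l)" for x :: complex
  by (simp add: psum_def sum_distrib_left)

lemma lin_psum: "lin f \<Longrightarrow> f (psum g) = psum (\<lambda>l. f (g l))"
  by (simp add: psum_def lin_sum)

lemma G_inverse: "g \<in> G \<Longrightarrow> \<exists>g' \<in> G. g * g' = 1 \<and> g' * g = 1"
proof -
  assume "g \<in> G"
  then consider k where "g = S k" | k where "g = R k" by (auto simp: G_def)
  then show ?thesis
  proof cases
    case (1 k)
    then show ?thesis by (intro bexI[of _ "S (- k)"]) (auto simp: S_S G_def)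
  next
    case (2 k)
    then show ?thesis by (intro bexI[of _ "R k"]) (auto simp: R_R G_def)
  qed
qed

lemma S_one_p: "S k * (sp + 1) = (sp + 1) * S k"
  by (simp add: algebra_simps S_sp)

lemma S_one_p_pow: "S k * (sp + 1) ^ j = (sp + 1) ^ j * S k"
  by (rule comm_pow[OF S_one_p])

lemma Q_sm: "Q p q \<Longrightarrow> p * sm = sm * p"
  by (induction rule: Q.induct) (auto simp: algebra_simps cst_left[of sm] power_commutes)

lemma gA_R: "gA * R k = psum (\<lambda>l. cst (c l * om n l) * S (l - k))"
  and gB_R: "gB * R k = psum (\<lambda>l. cst (c l * om n (- l)) * S (l - k))"
  and gA_S: "gA * S k = psum (\<lambda>l. cst (c l * om n l) * R (l - k))"
  by (simp_all add: gA_psum gB_psum psum_right mult.assoc R_R R_S)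

text \<open>
  The conditions under which a functional on \<open>AA\<close>, extended by 0 to \<open>PP\<close>, is a supertrace. The last two
  come from the vanishing of the supertrace on \<open>d x + x d\<close> for elements \<open>x\<close> of \<open>zb AA\<close> that end with a rotation, or
  with a reflection and no power of \<open>sm\<close>; the remaining conditions of this kind are consequences.
\<close>

definition "admissible f \<longleftrightarrow> lin f \<and>
  (\<forall>k. \<forall>x\<in>AA. f (S k * x * S (- k)) = f x) \<and> (\<forall>k. \<forall>x\<in>AA. f (R k * x * R k) = f x) \<and>
  (\<forall>x\<in>AA. f (sg * x) = f (x * sg)) \<and>
  (\<forall>k j. f ((sm - 1) * sm ^ j * S k) = - om n (- k) * f ((sp + 1) ^ Suc j * S k)) \<and>
  (\<forall>k. f (R k) = - psum (\<lambda>l. c l * (1 + om n (k - l)) * f (S (l - k))))"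

context
  fixes f assumes adm: "admissible f"
begin

lemma f_lin: "lin f" using adm by (simp add: admissible_def)
lemma f_S: "x \<in> AA \<Longrightarrow> f (S k * x * S (- k)) = f x" 
  and f_R: "x \<in> AA \<Longrightarrow> f (R k * x * R k) = f x"
  and f_sg: "x \<in> AA \<Longrightarrow> f (sg * x) = f (x * sg)"
  and f_E1: "f ((sm - 1) * sm ^ j * S k) = - om n (- k) * f ((sp + 1) ^ Suc j * S k)"
  and f_ground: "f (R k) = - psum (\<lambda>l. c l * (1 + om n (k - l)) * f (S (l - k)))"
  using adm by (auto simp: admissible_def)

lemmas f_simps = lin_add[OF f_lin] lin_cst[OF f_lin] lin_minus[OF f_lin] lin_diff[OF f_lin] lin_0[OF f_lin]

lemma f_G: "x \<in> AA \<Longrightarrow> g \<in> G \<Longrightarrow> f (x * g) = f (g * x)"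
proof -
  assume x: "x \<in> AA" and "g \<in> G"
  then consider k where "g = S k" | k where "g = R k" by (auto simp: G_def)
  then show ?thesis
  proof cases
    case (1 k)
    show ?thesis using f_S[of "x * g" k] x by (simp add: AA_intros 1 mult.assoc S_S)
  next
    case (2 k)
    show ?thesis using f_R[of "x * g" k] x by (simp add: AA_intros 2 mult.assoc R_R)
  qed
qed

lemma f_sg_pow: "x \<in> AA \<Longrightarrow> f (x * sg ^ m) = f (sg ^ m * x)"
proof (induction m arbitrary: x)
  case (Suc m)
  have "f (x * sg ^ Suc m) = f (sg ^ m * (x * sg))" using Suc by (simp add: mult.assoc AA_intros flip: Suc.IH)
  also have "\<dots> = f ((sg ^ m * x) * sg)" by (simp add: mult.assoc)
  also have "\<dots> = f (sg * (sg ^ m * x))" using f_sg[of "sg ^ m * x"] Suc by (simp add: AA_intros)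
  finally show ?case by (simp add: mult.assoc)
qed simp

lemma f_trace:
  assumes "x \<in> AA" "y \<in> AA"
  shows "f (x * y) = f (y * x)"
proof (rule lin_span_eq[of "\<lambda>y. f (x * y)" "\<lambda>y. f (y * x)" y, OF _ _ assms(2)[unfolded AA_def]])
  fix y assume "y \<in> {x. \<exists>m g. x = sg ^ m * g \<and> g \<in> G}"
  then obtain m g where y: "y = sg ^ m * g" "g \<in> G" by blast
  have "f (x * y) = f (g * (x * sg ^ m))" 
    using f_G[of "x * sg ^ m" g] y assms by (simp add: AA_intros mult.assoc)
  also have "\<dots> = f ((g * x) * sg ^ m)" by (simp add: mult.assoc)
  also have "\<dots> = f (sg ^ m * (g * x))" by (rule f_sg_pow) (intro AA_mult AA_G y assms)
  finally show "f (x * y) = f (y * x)" by (simp add: y mult.assoc)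
qed (auto simp: lin_def algebra_simps f_simps cst_left[of x])

lemma f_conj_R: "x \<in> AA \<Longrightarrow> f (R k * x) = f (x * R k)"
  using f_trace by simp

lemma f_S_neg: "f (S (- k)) = f (S k)"
  using f_R[of "S k" 0] by (simp add: R_S R_R)

text \<open>
  Moving \<open>sg\<close> around the trace yields a sign, because it anticommutes with reflections.
\<close>

lemma f_R_sg: 
  assumes "y \<in> AA" "sg * y = y * sg"
  shows "f (R k * (sg * y)) = 0"
proof -
  have "f (R k * (sg * y)) = - f (sg * (R k * y))"
    by (simp add: R_sg[THEN rw_assoc] f_simps mult.assoc)
  also have "\<dots> = - f (R k * y * sg)" using f_sg[of "R k * y"] assms(1) by (simp add: AA_intros)
  also have "\<dots> = - f (R k * (sg * y))" by (simp add: assms(2) mult.assoc)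
  finally show ?thesis by simp
qed

lemma sg_Cc_pow: "sg * Cc ^ i = Cc ^ i * sg" by (rule comm_pow[OF sg_Cc])

lemma f_R_sg_Cc: "f (R k * (sg * Cc ^ i)) = 0" "f (R k * (sg * (sg * Cc ^ i))) = 0"
  by (rule f_R_sg; simp add: AA_intros sg_Cc_pow mult.assoc sg_Cc_pow[THEN rw_assoc])+

lemma f_R_sg_rho: "f (R k * (sg * (rho * Cc ^ i))) = 0"
proof -
  let ?w = "R k * (sg * (rho * Cc ^ i))"
  have CR: "Cc ^ i * R k = R k * Cc ^ i" using comm_pow[of "R k" Cc] G_Cc[of "R k"] by (simp add: G_def)
  have "R k * ?w * R k = sg * (rho * (Cc ^ i * R k))" 
    by (simp add: mult.assoc R_R[THEN rw_assoc])
  also have "\<dots> = - ?w"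
    unfolding CR by (simp add: R_rho_comm[symmetric, THEN rw_assoc] R_sg[THEN rw_assoc] mult.assoc)
  finally have "f (- ?w) = f ?w" using f_R[of ?w k] by (simp add: AA_intros)
  then show ?thesis by (simp add: f_simps)
qed

lemma sm_even: "sm ^ (2 * i) = Cc ^ i" and sp_even: "sp ^ (2 * i) = Cc ^ i"
  by (simp_all add: power_mult power2_eq_square sm_sq sp_sq)

lemma f_R_sg_sm: "f (R k * (sg * sm ^ j)) = 0" and f_R_sg_sp: "f (R k * (sg * sp ^ j)) = 0"
proof -
  have "f (R k * (sg * sm ^ j)) = 0 \<and> f (R k * (sg * sp ^ j)) = 0"
  proof (cases "even j")
    case True
    then show ?thesis by (auto elim!: evenE simp: sm_even sp_even f_R_sg_Cc)
  next
    case False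
    then obtain i where j: "j = Suc (2 * i)" by (auto elim!: oddE)
    have 1: "sm ^ j = sg * Cc ^ i - rho * Cc ^ i" "sp ^ j = sg * Cc ^ i + rho * Cc ^ i"
      unfolding j power_Suc sm_even sp_even by (simp_all add: sm_def sp_def algebra_simps)
    show ?thesis unfolding 1 by (simp add: distrib_left right_diff_distrib f_simps f_R_sg_Cc f_R_sg_rho)
  qed
  then show "f (R k * (sg * sm ^ j)) = 0" "f (R k * (sg * sp ^ j)) = 0" by auto
qed

lemma f_R_sg_Q: "Q p q \<Longrightarrow> f (R k * (sg * q)) = 0"
proof (induction rule: Q.induct)
  case (Q_pow j)
  have "(sp + 1) ^ j \<in> V.span (range (\<lambda>i. sp ^ i))"
  proof (induction j)
    case 0
    have "sp ^ 0 \<in> V.span (range (\<lambda>i. sp ^ i))" by (rule V.span_base) blast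
    then show ?case by simp
  next
    case (Suc j)
    have "sp * (sp + 1) ^ j \<in> V.span (range (\<lambda>i. sp ^ i))"
      using Suc
    proof (rule span_linear_image[where f = "\<lambda>x. sp * x"])
      fix x assume "x \<in> range (\<lambda>i. sp ^ i)"
      then obtain i where "x = sp ^ i" by blast
      then have "sp * x = sp ^ Suc i" by simp
      then show "sp * x \<in> V.span (range (\<lambda>i. sp ^ i))" by (metis V.span_base rangeI)
    qed (auto simp: distrib_left cst_left[of sp])
    then show ?case using V.span_add[OF _ Suc] by (simp add: distrib_right)
  qed
  then show ?case
    using lin_span_eq[of "\<lambda>x. f (R k * (sg * x))" "\<lambda>x. 0" "(sp + 1) ^ j" "range (\<lambda>i. sp ^ i)"] f_R_sg_sp
    by (auto simp: lin_def algebra_simps f_simps cst_left[of sg] cst_l)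
qed (simp_all add: distrib_left f_simps cst_left[of sg] cst_l)

lemma f_E1_Q: "Q p q \<Longrightarrow> f ((sm - 1) * (p * S k)) = - om n (- k) * f ((sp + 1) * (q * S k))"
proof (induction rule: Q.induct)
  case (Q_pow j)
  then show ?case using f_E1[of j k] by (simp add: mult.assoc)
next
  case (Q_add p q p' q')
  then show ?case by (simp add: distrib_right distrib_left f_simps)
next
  case (Q_cst p q a)
  then show ?case by (simp add: mult.assoc cst_left[of "sm - 1"] cst_left[of "sp + 1"] f_simps)
qed

lemma f_ground': "f (R k * (sm - 1)) = psum (\<lambda>l. c l * om n (k - l) * f (S (l - k)))"
proof -
  have 1: "f (R k * rho) = psum (\<lambda>l. c l * f (S (l - k)))"
    unfolding R_rho lin_psum[OF f_lin] using f_S_neg[of "l - k" for l] by (simp add: f_simps)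
  have "R k * (sm - 1) = R k * sg - R k * rho - R k" by (simp add: sm_def algebra_simps)
  then have "f (R k * (sm - 1)) = - f (R k * rho) - f (R k)"
    using f_R_sg_sm[of k 0] by (simp add: f_simps)
  also have "\<dots> = psum (\<lambda>l. c l * om n (k - l) * f (S (l - k)))"
    unfolding 1 f_ground by (simp add: psum_def sum_negf sum.distrib algebra_simps)
  finally show ?thesis .
qed

text \<open>
  The recursion for rotations implies the one for reflections: substitute \<open>sm = sg - rho\<close> and use that
  the terms with \<open>R k\<close> and \<open>sg\<close> vanish, so that only products of two reflections remain.
\<close>

lemma f_E2: "f (R k * ((sm - 1) * sm ^ j)) = psum (\<lambda>l. c l * om n (k - l) * f (S (l - k) * (sp + 1) ^ j))"
proof (cases j)
  case 0
  then show ?thesis using f_ground' by simp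
next
  case (Suc i)
  let ?y = "(sm - 1) * sm ^ i"
  have y: "sm * ?y = (sm - 1) * sm ^ j" by (simp add: Suc algebra_simps)
  have "f (R k * ((sm - 1) * sm ^ j)) = f (R k * (sg * ?y)) - f (R k * rho * ?y)"
    unfolding y[symmetric]
    by (subst (1) sm_def) (simp only: left_diff_distrib right_diff_distrib f_simps mult.assoc, simp)
  also have "f (R k * (sg * ?y)) = 0"
    using f_R_sg_sm[of k i] f_R_sg_sm[of k "Suc i"] by (simp add: left_diff_distrib right_diff_distrib f_simps)
  also have "f (R k * rho * ?y) = psum (\<lambda>l. c l * f (S (k - l) * ?y))"
    by (simp add: R_rho psum_right lin_psum[OF f_lin] mult.assoc f_simps)
  also have "\<dots> = psum (\<lambda>l. c l * (- om n (l - k) * f ((sp + 1) ^ j * S (k - l))))"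
  proof (rule psum_cong)
    fix l
    have "S (k - l) * ?y = ?y * S (k - l)"
      using S_sm[of "k - l"] S_sm_pow[of "k - l"] 
      by (simp add: left_diff_distrib right_diff_distrib mult.assoc[symmetric]) (simp add: mult.assoc)
    then show "c l * f (S (k - l) * ?y) = c l * (- om n (l - k) * f ((sp + 1) ^ j * S (k - l)))"
      using f_E1[of i "k - l"] by (simp add: Suc)
  qed
  also have "0 - \<dots> = psum (\<lambda>l. c l * om n (l - k) * f ((sp + 1) ^ j * S (k - l)))"
    by (simp add: psum_minus mult.assoc)
  also have "\<dots> = psum (\<lambda>l. (\<lambda>l. c l * om n (l - k) * f ((sp + 1) ^ j * S (k - l))) (2 * k - l))"
    by (rule psum_reflect[symmetric]) 
       (use S_n'[of "k - l" for l] om_n[of "l - k" for l] in \<open>simp add: per algebra_simps\<close>)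
  also have "\<dots> = psum (\<lambda>l. c l * om n (k - l) * f (S (l - k) * (sp + 1) ^ j))"
    by (simp add: c_reflect S_one_p_pow) 
  finally show ?thesis .
qed

lemma f_E2_Q: "Q p q \<Longrightarrow> f (R k * ((sm - 1) * p)) = psum (\<lambda>l. c l * om n (k - l) * f (S (l - k) * q))"
proof (induction rule: Q.induct)
  case (Q_pow j)
  then show ?case by (rule f_E2)
next
  case (Q_add p q p' q')
  then show ?case by (simp add: distrib_left f_simps psum_add)
next
  case (Q_cst p q a)
  have "R k * ((sm - 1) * (cst a * p)) = cst a * (R k * ((sm - 1) * p))"
    by (simp only: cst_left[of "sm - 1"] cst_l)
  then show ?case unfolding Q_cst.IH psum_scale f_simps
    by (simp add: f_simps Q_cst.IH psum_scale cst_l mult.left_commute)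
qed

lemma f_D2: "Q p q \<Longrightarrow> f ((sm - 1) * (R k * p)) = om n k * f (gB * (R k * q))"
proof -
  assume Q: "Q p q"
  have "f ((sm - 1) * (R k * p)) = f (R k * p * (sm - 1))"
    by (rule f_trace) (use Q_AA[OF Q] in \<open>auto intro!: AA_intros\<close>)
  also have "R k * p * (sm - 1) = R k * ((sm - 1) * p)" 
    using Q_sm[OF Q] by (simp add: algebra_simps)
  finally have 1: "f ((sm - 1) * (R k * p)) = psum (\<lambda>l. c l * om n (k - l) * f (S (l - k) * q))"
    using f_E2_Q[OF Q] by simp
  have "gB * (R k * q) = psum (\<lambda>l. cst (c l * om n (- l)) * (S (l - k) * q))"
    by (simp add: gB_R[THEN rw_assoc] psum_right mult.assoc)
  then have "om n k * f (gB * (R k * q)) = psum (\<lambda>l. om n k * (c l * om n (- l) * f (S (l - k) * q)))"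
    by (simp add: lin_psum[OF f_lin] f_simps psum_scale)
  also have "\<dots> = psum (\<lambda>l. c l * om n (k - l) * f (S (l - k) * q))"
    by (rule psum_cong) (use om_add[of n k "- l" for l] in simp)
  finally show ?thesis using 1 by simp
qed

lemma f_D4_pow: "f (gA * (R k * sm ^ j)) = om n k * f ((sm - 1) * (R k * (sp + 1) ^ j))"
proof -
  have Q': "Q ((1 - sm) ^ j) ((- sp) ^ j)"
  proof (induction j)
    case 0
    then show ?case using Q_pow[of 0] by simp
  next
    case (Suc j)
    show ?case using Q_diff[OF Suc Q_mult[OF Suc]] by (simp add: algebra_simps)
  qed
  have 1: "(sp + 1) ^ i * R k = R k * (1 - sm) ^ i" for i
  proof (induction i)
    case (Suc i)
    have 2: "(sp + 1) * R k = R k * (1 - sm)" by (simp add: algebra_simps R_sm)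
    have "(sp + 1) ^ Suc i * R k = (sp + 1) * ((sp + 1) ^ i * R k)" by (simp add: mult.assoc)
    also have "\<dots> = (sp + 1) * R k * (1 - sm) ^ i" unfolding Suc by (simp add: mult.assoc)
    also have "\<dots> = R k * (1 - sm) ^ Suc i" unfolding 2 by (simp add: mult.assoc)
    finally show ?case .
  qed simp
  have "(sm - 1) * (R k * (sp + 1) ^ j) = - (R k * (sp + 1) ^ Suc j)"
  proof -
    have "(sm - 1) * R k = - (R k * (sp + 1))" by (simp add: algebra_simps R_sp)
    from this[THEN rw_assoc] show ?thesis by (simp add: mult.assoc)
  qed
  then have "f ((sm - 1) * (R k * (sp + 1) ^ j)) = - f (R k * (sp + 1) ^ Suc j)" by (simp only: f_simps)
  also have "\<dots> = - f ((sp + 1) ^ Suc j * R k)" by (subst f_conj_R) (auto intro!: AA_intros)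
  also have "\<dots> = f (R k * ((sm - 1) * (1 - sm) ^ j))"
  proof -
    have "- (R k * (1 - sm) ^ Suc j) = R k * ((sm - 1) * (1 - sm) ^ j)" by (simp add: algebra_simps)
    then show ?thesis by (simp only: 1 lin_minus[OF f_lin, symmetric])
  qed
  also have "\<dots> = psum (\<lambda>l. c l * om n (k - l) * f (S (l - k) * (- sp) ^ j))" by (rule f_E2_Q[OF Q'])
  also have "\<dots> = psum (\<lambda>l. c l * om n (k - l) * f (S (k - l) * sm ^ j))"
  proof (rule psum_cong)
    fix l
    have "R 0 * (S (k - l) * sm ^ j) * R 0 = S (l - k) * (R 0 * sm ^ j) * R 0"
      by (simp add: R_S[THEN rw_assoc] mult.assoc S_R[THEN rw_assoc])
    also have "\<dots> = S (l - k) * (- sp) ^ j"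
      unfolding sp_neg_pow by (simp add: mult.assoc R_R)
    finally show "c l * om n (k - l) * f (S (l - k) * (- sp) ^ j) = c l * om n (k - l) * f (S (k - l) * sm ^ j)"
      using f_R[of "S (k - l) * sm ^ j" 0] by (simp add: AA_intros)
  qed
  finally have "om n k * f ((sm - 1) * (R k * (sp + 1) ^ j)) = psum (\<lambda>l. c l * om n (2 * k - l) * f (S (k - l) * sm ^ j))"
    using om_add[of n k "k - l" for l] by (simp add: psum_scale mult.left_commute mult.assoc algebra_simps)
  also have "\<dots> = psum (\<lambda>l. (\<lambda>l. c l * om n l * f (S (l - k) * sm ^ j)) (2 * k - l))"
    by (simp add: c_reflect)
  also have "\<dots> = psum (\<lambda>l. c l * om n l * f (S (l - k) * sm ^ j))"
    by (rule psum_reflect) (use S_period[of "l - k" for l] in \<open>simp add: per algebra_simps\<close>)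
  also have "\<dots> = f (gA * (R k * sm ^ j))"
    by (simp add: gA_R[THEN rw_assoc] psum_right mult.assoc lin_psum[OF f_lin] f_simps)
  finally show ?thesis ..
qed

text \<open>
  Conjugation with \<open>S 1\<close> preserves the value and multiplies \<open>gA\<close> by \<open>om n (- 2)\<close>, which differs from 1 unless \<open>n = 2\<close>.
\<close>

lemma f_gA_0:
  assumes "n > 2" "x \<in> AA" "S 1 * x = x * S 1"
  shows "f (gA * (x * S k)) = 0"
proof -
  have "S 1 * gA * S (- 1) = psum (\<lambda>l. cst (c l * om n l) * R (l + 2))"
    by (simp add: gA_psum psum_left psum_right mult.assoc cst_l S_R R_S add.commute)
  also have "\<dots> = psum (\<lambda>l. (\<lambda>l. cst (c l * om n (l - 2)) * R l) (l + 2))"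
    by (simp add: c_shift)
  also have "\<dots> = psum (\<lambda>l. cst (c l * om n (l - 2)) * R l)"
    by (rule psum_shift) (use om_n[of "l - 2" for l] in \<open>simp add: per algebra_simps\<close>)
  also have "\<dots> = cst (om n (- 2)) * gA"
    unfolding gA_psum psum_left by (rule psum_cong) (use om_add[of n "- 2" l for l] in \<open>simp add: cst_cst algebra_simps\<close>)
  finally have 1: "S 1 * gA * S (- 1) = cst (om n (- 2)) * gA" .
  have "S 1 * (gA * (x * S k)) * S (- 1) = (S 1 * gA * S (- 1)) * (S 1 * x * S (- 1)) * (S 1 * S k * S (- 1))"
    by (simp add: mult.assoc S_S[THEN rw_assoc])
  also have "S 1 * x * S (- 1) = x" by (simp add: assms(3) mult.assoc S_S)
  also have "S 1 * S k * S (- 1) = S k" by (simp add: S_S)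
  finally have "f (cst (om n (- 2)) * (gA * (x * S k))) = f (gA * (x * S k))"
    using f_S[of "gA * (x * S k)" 1] assms(2) unfolding 1 by (simp add: AA_intros mult.assoc)
  then have "(om n (- 2) - 1) * f (gA * (x * S k)) = 0" by (simp add: f_simps algebra_simps)
  moreover have "om n (- 2) \<noteq> 1"
    using om_eq_1_iff[OF n_pos, of "- 2"] assms(1) zdvd_imp_le[of "int n" 2] by auto
  ultimately show ?thesis by simp
qed

lemma f_D3_two:
  assumes n2: "n = 2" and Q: "Q p q"
  shows "f (gA * ((sm - 1) * p * S k)) = om n (- k) * f (gA * (sp * q * S k))"
proof -
  have omm: "om n (- j) = om n j" for j
  proof -
    have "om n (2 * j) = 1" using om_eq_1_iff[OF n_pos, of "2 * j"] n2 by simp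
    then show ?thesis using om_add[of n "2 * j" "- j"] by simp
  qed
  have Sm: "S (- j) = S j" for j
  proof -
    have "S (j + 2 * int i) = S j" for i j
    proof (induction i)
      case (Suc i)
      then show ?case using S_period[of "j + 2 * int i"] n2 by (simp add: algebra_simps)
    qed simp
    from this[of "- j" "nat j"] this[of j "nat (- j)"] show ?thesis by (cases "j \<ge> 0") auto
  qed
  note comm = Q_S[OF Q, THEN conjunct1] Q_S[OF Q, THEN conjunct2]
  have c1: "(sm - 1) * p * S k = S k * ((sm - 1) * p)"
  proof -
    have "S k * ((sm - 1) * p) = (S k * sm - S k) * p" by (simp add: algebra_simps)
    also have "\<dots> = (sm - 1) * (S k * p)" by (simp add: S_sm algebra_simps)
    finally show ?thesis by (simp add: comm mult.assoc)
  qed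
  have c2: "sp * q * S k = S k * (sp * q)"
    by (simp add: S_sp[THEN rw_assoc] comm mult.assoc)
  have "f (gA * ((sm - 1) * p * S k)) = psum (\<lambda>l. c l * om n l * f (R (l - k) * ((sm - 1) * p)))"
    by (simp only: c1 gA_S[THEN rw_assoc] psum_right lin_psum[OF f_lin] mult.assoc[of "cst _"] f_simps)
  also have "\<dots> = psum (\<lambda>l. psum (\<lambda>m. c l * c m * om n (k + m) * f (S (l + m + k) * q)))"
  proof (rule psum_cong)
    fix l
    show "c l * om n l * f (R (l - k) * ((sm - 1) * p)) = psum (\<lambda>m. c l * c m * om n (k + m) * f (S (l + m + k) * q))"
      unfolding f_E2_Q[OF Q] psum_scale
    proof (rule psum_cong)
      fix m
      have 1: "S (m - (l - k)) = S (l + m + k)"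
      proof -
        have "S (m - (l - k)) = S (m + k) * S (- l)" by (simp add: S_S algebra_simps)
        then show ?thesis unfolding Sm by (simp add: S_S algebra_simps)
      qed
      have 2: "om n l * om n (l - k - m) = om n (k + m)"
      proof -
        have "om n (l - k - m) = om n (- (- l)) * om n (- (k + m))"
          by (simp add: algebra_simps flip: om_add)
        also have "\<dots> = om n (- l) * om n (k + m)" by (simp only: omm)
        finally show ?thesis by (simp add: mult.assoc[symmetric])
      qed
      have "c l * om n l * (c m * om n (l - k - m) * f (S (m - (l - k)) * q)) = 
         c l * c m * (om n l * om n (l - k - m)) * f (S (m - (l - k)) * q)" by (simp add: algebra_simps)
      then show "c l * om n l * (c m * om n (l - k - m) * f (S (m - (l - k)) * q)) = 
         c l * c m * om n (k + m) * f (S (l + m + k) * q)" unfolding 1 2 .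
    qed
  qed
  also have "\<dots> = psum (\<lambda>m. psum (\<lambda>l. c l * c m * om n (k + m) * f (S (l + m + k) * q)))"
    unfolding psum_def by (rule sum.swap)
  also have "\<dots> = psum (\<lambda>l. om n k * (c l * om n l * f (R (l - k) * (sp * q))))"
  proof (rule psum_cong)
    fix l
    have "f (R (l - k) * (sp * q)) = f (R (l - k) * (sg * q)) + f (R (l - k) * rho * q)"
      by (simp add: sp_def algebra_simps f_simps)
    also have "\<dots> = psum (\<lambda>m. c m * f (S (l - k - m) * q))"
      by (simp add: f_R_sg_Q[OF Q] R_rho psum_right lin_psum[OF f_lin] mult.assoc f_simps)
    also have "\<dots> = psum (\<lambda>m. c m * f (S (m + l + k) * q))"
    proof (rule psum_cong)
      fix m
      have "S (l - k - m) = S l * S (- (k + m))" by (simp add: S_S algebra_simps)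
      then show "c m * f (S (l - k - m) * q) = c m * f (S (m + l + k) * q)" 
        unfolding Sm by (simp add: S_S algebra_simps)
    qed
    finally show "psum (\<lambda>m. c m * c l * om n (k + l) * f (S (m + l + k) * q)) = om n k * (c l * om n l * f (R (l - k) * (sp * q)))"
      by (simp add: psum_scale om_add algebra_simps)
  qed
  also have "\<dots> = om n (- k) * f (gA * (sp * q * S k))"
    by (simp only: omm c2 gA_S[THEN rw_assoc] psum_right lin_psum[OF f_lin] mult.assoc[of "cst _"] f_simps psum_scale)
  finally show ?thesis .
qed

lemma f_D3_one: "f (gA * S k) = om n (- k) * f (gA * S k)"
proof (cases "n > 2")
  case True
  then show ?thesis using f_gA_0[OF True AA_1, of k] by simp
next
  case False
  then have n2: "n = 2" using n_ge by simp
  have iv: "{0..<int n} = {0, 1}" using n2 by auto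
  show ?thesis
  proof (cases "even k")
    case True
    then have "om n (- k) = 1" using om_eq_1_iff[OF n_pos, of "- k"] n2 by simp
    then show ?thesis by simp
  next
    case False
    have om1: "om n 1 = - 1" "om n (- 1) = - 1" by (simp_all add: om_def n2 complex_eq_iff)
    obtain i where i: "k = 2 * i + 1" using False by (auto elim!: oddE)
    have R2: "R (l + 2 * j) = R l" for l j
      using mod_periodic[of R n l, OF R_period] mod_periodic[of R n "l + 2 * j", OF R_period] n2 by simp
    have "R (- k) = R 1" "R (1 - k) = R 0" using R2[of 1 "- i - 1"] R2[of 0 "- i"] i by (simp_all add: algebra_simps)
    then have "f (gA * S k) = c 0 * f (R 1) - c 1 * f (R 0)"
      unfolding gA_S lin_psum[OF f_lin] by (simp add: psum_def iv f_simps om1)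
    also have "f (R 1) = - (c 1 * 2 * f (S 0))" unfolding f_ground psum_def by (simp add: iv om1)
    also have "f (R 0) = - (c 0 * 2 * f (S 0))" unfolding f_ground psum_def by (simp add: iv om1)
    finally show ?thesis by simp
  qed
qed

lemma f_D3_pow: "f (gA * (sm ^ j * S k)) = om n (- k) * f (gA * ((sp + 1) ^ j * S k))"
proof (cases "n > 2")
  case True
  show ?thesis 
    using f_gA_0[OF True, of "sm ^ j" k] f_gA_0[OF True, of "(sp + 1) ^ j" k] S_sm_pow S_one_p_pow
    by (simp add: AA_intros)
next
  case False
  then have n2: "n = 2" using n_ge by simp
  show ?thesis
  proof (induction j)
    case 0
    then show ?case using f_D3_one by simp
  next
    case (Suc j)
    have 1: "sm ^ Suc j * S k = (sm - 1) * sm ^ j * S k + sm ^ j * S k" by (simp add: algebra_simps)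
    have 2: "(sp + 1) ^ Suc j * S k = sp * (sp + 1) ^ j * S k + (sp + 1) ^ j * S k" by (simp add: algebra_simps)
    show ?case unfolding 1 2 distrib_left f_simps Suc f_D3_two[OF n2 Q_pow] by simp
  qed
qed

end

lemma alg_letter: "a \<in> {z, zb, d, db} \<Longrightarrow> a \<in> alg"
  using pow_Hlt[of a 1] Hlt_alg by simp

lemma alg_G: "g \<in> G \<Longrightarrow> g \<in> alg"
  using hom_Hlt[OF hom.intros(1)] Hlt_alg by blast

lemma alg_add: "x \<in> alg \<Longrightarrow> y \<in> alg \<Longrightarrow> x + y \<in> alg" and alg_cst: "x \<in> alg \<Longrightarrow> cst a * x \<in> alg"
  and alg_minus: "x \<in> alg \<Longrightarrow> - x \<in> alg" and alg_diff: "x \<in> alg \<Longrightarrow> y \<in> alg \<Longrightarrow> x - y \<in> alg"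
  using subspace_alg by (auto intro: V.subspace_add V.subspace_scale V.subspace_neg V.subspace_diff)

lemma alg_let: "z \<in> alg" "zb \<in> alg" "d \<in> alg" "db \<in> alg" by (rule alg_letter; simp)+

lemma alg_sg: "sg \<in> alg" and alg_E: "E \<in> alg" and alg_F: "F \<in> alg"
  unfolding sg_def E_def F_def by (intro alg_diff alg_minus alg_mult alg_let)+

lemma alg_pow: "x \<in> alg \<Longrightarrow> x ^ k \<in> alg" 
  by (induction k) (auto intro: alg_mult alg_G one_G)

lemma AA_alg: "x \<in> AA \<Longrightarrow> x \<in> alg"
proof -
  have "AA \<subseteq> alg" unfolding AA_def
    by (rule V.span_minimal[OF _ subspace_alg]) (auto intro: alg_mult alg_pow alg_sg alg_G)
  then show "x \<in> AA \<Longrightarrow> x \<in> alg" by blast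
qed

lemma alg_dm: "x \<in> alg \<Longrightarrow> dm x \<in> alg" and alg_dp: "x \<in> alg \<Longrightarrow> dp x \<in> alg"
  unfolding dm_def dp_def by (intro alg_diff alg_mult alg_E alg_F; assumption)+

lemma alg_vv: "g \<in> G \<Longrightarrow> vv m i j g \<in> alg"
  unfolding vv_def by (intro alg_mult alg_pow alg_sg alg_let alg_G)

text \<open>
  In an irreducible representation of positive highest weight every vector lies in the image of the
  lowering or of the raising operator.
\<close>

lemma PP_N: "x \<in> PP \<Longrightarrow> \<exists>y\<in>alg. \<exists>y'\<in>alg. x = dm y + dp y'"
  unfolding PP_def
proof (induction rule: V.span_induct_alt)
  case base
  show ?case by (rule bexI[of _ 0], rule bexI[of _ 0]) (use V.subspace_0[OF subspace_alg] in auto)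
next
  case (step a x y)
  obtain r m i j g where x: "x = (dm ^^ r) (vv m i j g)" "g \<in> G" "i + j > 0"
    using step(1) unfolding gens_def by blast
  have pow: "(dm ^^ q) (vv m i j g) \<in> alg" for q
    by (induction q) (auto intro: alg_vv alg_dm x)
  have "\<exists>u\<in>alg. \<exists>u'\<in>alg. x = dm u + dp u'"
  proof (cases r)
    case 0
    have ij: "complex_of_nat (i + j) \<noteq> 0" using x(3) by (simp only: of_nat_eq_0_iff)
    have "cst (of_nat (i + j)) * x = dp (dm x)" 
      using dp_vv[OF x(2)] d0_vv[OF x(2)] 0 x(1) by (simp add: d0_comm)
    then have "cst (inverse (of_nat (i + j))) * (cst (of_nat (i + j)) * x) = cst (inverse (of_nat (i + j))) * dp (dm x)"
      by (simp only:)
    then have "x = dm 0 + dp (cst (inverse (of_nat (i + j))) * dm x)"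
      using ij by (simp only: cst_cst dp_cst left_inverse) simp
    then show ?thesis using alg_cst[OF alg_dm] pow[of 0] 0 x(1) V.subspace_0[OF subspace_alg]
      by (metis funpow_0)
  next
    case (Suc q)
    have "x = dm ((dm ^^ q) (vv m i j g)) + dp 0" using x(1) Suc by simp
    then show ?thesis using pow V.subspace_0[OF subspace_alg] by blast
  qed
  then obtain u u' v v' where uv: "u \<in> alg" "u' \<in> alg" "x = dm u + dp u'" "v \<in> alg" "v' \<in> alg" "y = dm v + dp v'"
    using step(2) by blast
  have "cst a * x + y = dm (cst a * u + v) + dp (cst a * u' + v')"
    unfolding uv by (simp add: dm_add dp_add dm_cst dp_cst algebra_simps)
  then show ?case using uv alg_add alg_cst by blast
qed

lemma N_PP: "x \<in> alg \<Longrightarrow> dm x \<in> PP" "x \<in> alg \<Longrightarrow> dp x \<in> PP"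
  using alg_PPall PPall_dm_PP PPall_dp_PP by blast+

text \<open>
  The highest weight vectors of weight 1, the partners of the pair \<open>z\<close>, \<open>zb\<close> in the supercommutators that
  can have a component in \<open>AA\<close>.
\<close>

definition "BB = {x. \<exists>a\<in>AA. \<exists>b\<in>AA. x = z * a + zb * b}"

lemma BB_sg: "x \<in> BB \<Longrightarrow> sg * x \<in> BB"
proof -
  assume "x \<in> BB"
  then obtain a b where ab: "a \<in> AA" "b \<in> AA" "x = z * a + zb * b" by (auto simp: BB_def)
  have "sg * x = z * (sg * a + a + rho * a + gB * b) + zb * (sg * b - b - rho * b - gA * a)"
    unfolding ab(3) by (simp add: distrib_left right_diff_distrib sg_z[THEN rw_assoc] sg_zb[THEN rw_assoc] 
        distrib_right left_diff_distrib mult.assoc rho_z[THEN rw_assoc] rho_zb[THEN rw_assoc])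
  then show ?thesis using ab unfolding BB_def by (blast intro: AA_intros)
qed

lemma BB_vv: "i + j = 1 \<Longrightarrow> g \<in> G \<Longrightarrow> vv m i j g \<in> BB"
proof (induction m)
  case 0
  then have "vv 0 i j g = z * g + zb * 0 \<or> vv 0 i j g = z * 0 + zb * g"
    by (cases i) (auto simp: vv_def)
  then show ?case using 0 AA_G AA_0 unfolding BB_def by blast
next
  case (Suc m)
  then show ?case using BB_sg by (simp add: vv_def mult.assoc)
qed

lemma S_cst_z: "x * z = z * y \<Longrightarrow> x \<in> AA \<Longrightarrow> y \<in> AA \<Longrightarrow> x * d = d * y"
proof -
  assume a: "x * z = z * y" "x \<in> AA" "y \<in> AA"
  have "dm (x * z) = dm (z * y)" by (rule arg_cong[OF a(1)])
  then show ?thesis using AA_dm[OF a(2)] AA_dm[OF a(3)] by (simp add: dm_mult)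
qed

lemma R_cst_z: "x * z = zb * y \<Longrightarrow> x \<in> AA \<Longrightarrow> y \<in> AA \<Longrightarrow> x * d = db * y"
proof -
  assume a: "x * z = zb * y" "x \<in> AA" "y \<in> AA"
  have "dm (x * z) = dm (zb * y)" by (rule arg_cong[OF a(1)])
  then show ?thesis using AA_dm[OF a(2)] AA_dm[OF a(3)] by (simp add: dm_mult)
qed

text \<open>
  By weight reasons and because commutators with \<open>E\<close> and \<open>F\<close> are killed, \<open>a x + x a\<close> can have a nonzero
  value only if \<open>x\<close> lies in a representation of dimension 2, and for those it suffices to take \<open>a = d\<close>
  or \<open>a = db\<close> and \<open>x\<close> of highest weight. Reflections exchange the cases \<open>d\<close> and \<open>db\<close>.
\<close>

theorem admissible_extends:
  assumes adm: "admissible f"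
  shows "\<exists>h. lin h \<and> (\<forall>x\<in>AA. h x = f x) \<and> (\<forall>x\<in>alg. \<forall>g\<in>G. h (g * x) = h (x * g)) \<and>
    (\<forall>x\<in>alg. \<forall>a\<in>{z, zb, d, db}. h (a * x + x * a) = 0) \<and> (\<forall>l w x. (l, w, x) \<in> hom \<longrightarrow> odd l \<longrightarrow> h x = 0)"
proof -
  note fl = f_lin[OF adm]
  obtain h where h: "lin h" "\<forall>x\<in>AA. h x = f x" "\<forall>x\<in>PP. h x = 0"
    using lin_extend_zero[OF fl] by blast
  note hs = lin_add[OF h(1)] lin_cst[OF h(1)] lin_minus[OF h(1)] lin_diff[OF h(1)] lin_0[OF h(1)]
  have hdm: "h (dm x) = 0" and hdp: "h (dp x) = 0" if "x \<in> alg" for x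
    using N_PP[OF that] h(3) by auto
  have weight: "h x = 0" if "x \<in> alg" "d0 x = cst w * x" "w \<noteq> 0" for x w
  proof -
    have "h (d0 x) = 0" using alg_d0_PP[OF that(1)] h(3) by blast
    then show ?thesis using that by (simp add: hs)
  qed
  have two: "2 * h (d * x + x * d) = h (d * x - z * dm x) + h (x * d - dm x * z)" if "x \<in> alg" for x
  proof -
    have "h (dm (z * x)) = 0" "h (dm (x * z)) = 0" by (intro hdm alg_mult alg_let that)+
    then have "h (d * x) + h (z * dm x) = 0" "h (dm x * z) + h (x * d) = 0"
      by (simp_all add: dm_mult hs)
    then show ?thesis unfolding hs by algebra
  qed
  have hA: "h y = f y" if "y \<in> AA" for y using h(2) that by blast
  have mem: "z * x \<in> alg" "zb * x \<in> alg" if "x \<in> AA" for x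
    by (intro alg_mult alg_let AA_alg that)+
  have mA: "(sm - 1) * x \<in> AA" "(sp + 1) * x \<in> AA" "gA * x \<in> AA" "gB * x \<in> AA" if "x \<in> AA" for x
    by (intro AA_intros that)+
  have e1: "z * db - d * zb = sm - 1" and e2: "zb * d - db * z = - (sp + 1)" 
    and e3: "zb * db - db * zb = - gB" and e4: "d * z - z * d = gA"
    by (simp_all add: sm_def sp_def sg_def letter_rw)
  have key: "h (d * (zb * x) + (zb * x) * d) = 0 \<and> h (d * (z * x) + (z * x) * d) = 0" if "x \<in> AA" for x
    using AA_sm_span[OF that]
  proof (induction rule: V.span_induct_alt)
    case base
    then show ?case by (simp add: hs)
  next
    case (step a x y)
    have "h (d * (zb * x) + (zb * x) * d) = 0 \<and> h (d * (z * x) + (z * x) * d) = 0"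
      using step(1)
    proof
      assume "x \<in> {x. \<exists>j k. x = sm ^ j * S k}"
      then obtain j k where x: "x = sm ^ j * S k" by blast
      let ?y = "cst (om n (- k)) * ((sp + 1) ^ j * S k)"
      have AA: "x \<in> AA" "?y \<in> AA" unfolding x by (auto intro!: AA_intros)
      have xz: "x * z = z * ?y"
      proof -
        have "x * z = cst (om n (- k)) * (sm ^ j * z * S k)"
          by (simp add: x mult.assoc S_z cst_left[of "sm ^ j"])
        then show ?thesis using Q_z[OF Q_pow, of j] by (simp add: mult.assoc cst_l)
      qed
      have xd: "x * d = d * ?y" by (rule S_cst_z[OF xz AA])
      have "d * (zb * x) - z * dm (zb * x) = - ((z * db - d * zb) * x)"
        by (simp add: dm_mult AA_dm[OF AA(1)] left_diff_distrib mult.assoc)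
      moreover have "zb * x * d - dm (zb * x) * z = (zb * d - db * z) * ?y"
        by (simp add: dm_mult AA_dm[OF AA(1)] left_diff_distrib mult.assoc xz xd del: mult_cancel_left)
      ultimately have "2 * h (d * (zb * x) + (zb * x) * d) = - f ((sm - 1) * x) - f ((sp + 1) * ?y)"
        unfolding two[OF mem(2)[OF AA(1)]] by (simp only: e1 e2 mult_minus_left hs hA mA AA) simp
      also have "\<dots> = 0"
        using f_E1_Q[OF adm Q_pow, of j k] by (simp add: x cst_left[of "sp + 1"] lin_cst[OF fl] lin_minus[OF fl])
      finally have 1: "h (d * (zb * x) + (zb * x) * d) = 0" by simp
      have "d * (z * x) - z * dm (z * x) = (d * z - z * d) * x"
        by (simp add: dm_mult AA_dm[OF AA(1)] left_diff_distrib mult.assoc)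
      moreover have "z * x * d - dm (z * x) * z = - ((d * z - z * d) * ?y)"
        by (simp add: dm_mult AA_dm[OF AA(1)] left_diff_distrib mult.assoc xz xd del: mult_cancel_left)
      ultimately have "2 * h (d * (z * x) + (z * x) * d) = f (gA * x) - f (gA * ?y)"
        unfolding two[OF mem(1)[OF AA(1)]] by (simp only: e4 mult_minus_left hs hA mA AA) simp
      also have "\<dots> = 0"
        using f_D3_pow[OF adm, of j k] by (simp add: x cst_left[of gA] lin_cst[OF fl] lin_minus[OF fl])
      finally show ?thesis using 1 by simp
    next
      assume "x \<in> {x. \<exists>j k. x = R k * sm ^ j}"
      then obtain j k where x: "x = R k * sm ^ j" by blast
      let ?y = "cst (- om n k) * (R k * (sp + 1) ^ j)"
      have AA: "x \<in> AA" "?y \<in> AA" unfolding x by (auto intro!: AA_intros)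
      have xz: "x * z = zb * ?y"
      proof -
        have "x * z = R k * (z * (sp + 1) ^ j)" using Q_z[OF Q_pow, of j] by (simp add: x mult.assoc)
        then show ?thesis by (simp add: R_z[THEN rw_assoc] mult.assoc cst_l cst_minus)
      qed
      have xd: "x * d = db * ?y" by (rule R_cst_z[OF xz AA])
      have "d * (zb * x) - z * dm (zb * x) = - ((z * db - d * zb) * x)"
        by (simp add: dm_mult AA_dm[OF AA(1)] left_diff_distrib mult.assoc)
      moreover have "zb * x * d - dm (zb * x) * z = (zb * db - db * zb) * ?y"
        by (simp add: dm_mult AA_dm[OF AA(1)] left_diff_distrib mult.assoc xz xd del: mult_cancel_left)
      ultimately have "2 * h (d * (zb * x) + (zb * x) * d) = - f ((sm - 1) * x) - f (gB * ?y)"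
        unfolding two[OF mem(2)[OF AA(1)]] by (simp only: e1 e3 mult_minus_left hs hA mA AA) simp
      also have "\<dots> = 0"
        using f_D2[OF adm Q_pow, of k j] by (simp add: x cst_left[of gB] lin_cst[OF fl] lin_minus[OF fl])
      finally have 1: "h (d * (zb * x) + (zb * x) * d) = 0" by simp
      have "d * (z * x) - z * dm (z * x) = (d * z - z * d) * x"
        by (simp add: dm_mult AA_dm[OF AA(1)] left_diff_distrib mult.assoc)
      moreover have "z * x * d - dm (z * x) * z = (z * db - d * zb) * ?y"
        by (simp add: dm_mult AA_dm[OF AA(1)] left_diff_distrib mult.assoc xz xd del: mult_cancel_left)
      ultimately have "2 * h (d * (z * x) + (z * x) * d) = f (gA * x) + f ((sm - 1) * ?y)"
        unfolding two[OF mem(1)[OF AA(1)]] by (simp only: e1 e4 mult_minus_left hs hA mA AA)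
      also have "\<dots> = 0"
        using f_D4_pow[OF adm, of k j] by (simp add: x cst_left[of "sm - 1"] lin_cst[OF fl] lin_minus[OF fl])
      finally show ?thesis using 1 by simp
    qed
    moreover have "h (d * (u * (cst a * x + y)) + (u * (cst a * x + y)) * d) =
        a * h (d * (u * x) + (u * x) * d) + h (d * (u * y) + (u * y) * d)" for u
    proof -
      have "d * (u * (cst a * x + y)) + (u * (cst a * x + y)) * d =
          cst a * (d * (u * x) + (u * x) * d) + (d * (u * y) + (u * y) * d)"
        by (simp add: distrib_left distrib_right cst_left[of u] cst_left[of d] mult.assoc)
      then show ?thesis by (simp only: lin_add[OF h(1), of "cst a * (d * (u * x) + (u * x) * d)"] lin_cst[OF h(1)])
    qed
    ultimately show ?case using step(2) by (simp only: mult_zero_right add_0_left)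
  qed
  have BB0: "h (d * x + x * d) = 0" if "x \<in> BB" for x
  proof -
    obtain a b where ab: "a \<in> AA" "b \<in> AA" "x = z * a + zb * b" using \<open>x \<in> BB\<close> by (auto simp: BB_def)
    have "d * x + x * d = (d * (z * a) + z * a * d) + (d * (zb * b) + zb * b * d)"
      unfolding ab(3) by (simp add: algebra_simps)
    then show ?thesis using key[OF ab(1)] key[OF ab(2)] by (simp only: hs) simp
  qed
  have dx: "h (d * x + x * d) = 0" if "x \<in> alg" for x
    using alg_PPall[OF that] unfolding PPall_def
  proof (induction rule: V.span_induct_alt)
    case base
    then show ?case by (simp add: hs)
  next
    case (step a x y)
    obtain r m i j g where x: "x = (dm ^^ r) (vv m i j g)" "g \<in> G" using step(1) unfolding gens_def by blast
    have pow: "(dm ^^ q) (vv m i j g) \<in> alg" for q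
      by (induction q) (auto intro: alg_vv alg_dm x)
    have "h (d * x + x * d) = 0"
    proof (cases r)
      case (Suc q)
      let ?y = "(dm ^^ q) (vv m i j g)"
      have "d * x + x * d = dm (d * ?y + ?y * d)" by (simp add: x Suc dm_add dm_mult)
      then show ?thesis using hdm[OF alg_add[OF alg_mult alg_mult], OF alg_let(3) pow pow alg_let(3)] by simp
    next
      case 0
      then have xv: "x = vv m i j g" using x by simp
      show ?thesis
      proof (cases "i + j = 1")
        case True
        then show ?thesis using BB0[OF BB_vv[OF True x(2)]] xv by simp
      next
        case False
        have "d0 (d * x + x * d) = cst (of_nat (i + j) - 1) * (d * x + x * d)"
          unfolding xv by (simp add: d0_add d0_mult d0_vv[OF x(2)] algebra_simps cst_left[of d] cst_add cst_minus)
        moreover have "complex_of_nat (i + j) - 1 \<noteq> 0" using False by (metis eq_iff_diff_eq_0 of_nat_eq_1_iff)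
        ultimately show ?thesis using alg_vv[OF x(2)] alg_let xv
          by (intro weight) (auto intro!: alg_add alg_mult)
      qed
    qed
    moreover have "d * (cst a * x + y) + (cst a * x + y) * d = cst a * (d * x + x * d) + (d * y + y * d)"
      by (simp add: distrib_left distrib_right cst_left[of d] mult.assoc)
    ultimately show ?case using step(2) lin_add[OF h(1), of "cst a * (d * x + x * d)" "d * y + y * d"]
        lin_cst[OF h(1), of a "d * x + x * d"] by (simp only: mult_zero_right add_0_left)
  qed
  have zx: "h (z * x + x * z) = 0" if "x \<in> alg" for x
  proof -
    have "z * x + x * z = dp (d * x + x * d) - (d * dp x + dp x * d)" by (simp add: dp_add dp_mult)
    then show ?thesis using dx[OF alg_dp[OF that]] hdp[OF alg_add[OF alg_mult alg_mult], OF alg_let(3) that that alg_let(3)]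
      by (simp add: hs)
  qed
  have conj: "h (g * x * g') = h x" if g: "g \<in> G" "g' \<in> G" "g * g' = 1" "g' * g = 1" and x: "x \<in> alg" for g g' x
  proof -
    obtain a p where ap: "x = a + p" "a \<in> AA" "p \<in> PP" using PPall_split[OF alg_PPall[OF x]] by blast
    have a: "h (g * a * g') = h a"
    proof -
      have "f (g * a * g') = f (g' * (g * a))" using f_trace[OF adm, of "g * a" g'] AA_mult AA_G g ap by simp
      then show ?thesis using h(2) ap AA_mult AA_G g by (simp add: rw_assoc[OF g(4)])
    qed
    obtain y y' where y: "y \<in> alg" "y' \<in> alg" "p = dm y + dp y'" using PP_N[OF ap(3)] by blast
    have "g * p * g' = dm (g * y * g') + dp (g * y' * g')"
      unfolding y(3) using g by (simp add: dm_mult dp_mult distrib_left distrib_right)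
    moreover have "g * y * g' \<in> alg" "g * y' * g' \<in> alg" using y g alg_mult alg_G by blast+
    ultimately have "h (g * p * g') = 0" using hdm hdp by (simp add: hs)
    then show ?thesis using a ap h(3) by (simp add: distrib_left distrib_right hs)
  qed
  have Gx: "h (g * x) = h (x * g)" if gx: "g \<in> G" "x \<in> alg" for g x
  proof -
    obtain g' where g': "g' \<in> G" "g * g' = 1" "g' * g = 1" using G_inverse[OF gx(1)] by blast
    have "h (g * (x * g) * g') = h (x * g)" by (rule conj) (use gx g' alg_mult alg_G in auto)
    then show ?thesis by (simp add: mult.assoc g')
  qed
  have refl: "h (a * x + x * a) = 0" if a: "R 0 * b * R 0 = - a" "b \<in> alg" and b: "\<And>x. x \<in> alg \<Longrightarrow> h (b * x + x * b) = 0" and x: "x \<in> alg" for a b x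
  proof -
    let ?x = "R 0 * x * R 0"
    have RG: "R 0 \<in> G" by (simp add: G_def)
    have RR: "R 0 * R 0 = 1" by (simp add: R_R)
    have xa: "?x \<in> alg" using x RG alg_mult alg_G by blast
    have "R 0 * (b * ?x + ?x * b) * R 0 = (R 0 * b * R 0) * x + x * (R 0 * b * R 0)"
      by (simp add: distrib_left distrib_right mult.assoc RR rw_assoc[OF RR])
    then have "R 0 * (b * ?x + ?x * b) * R 0 = - (a * x + x * a)" unfolding a(1) by simp
    moreover have "h (R 0 * (b * ?x + ?x * b) * R 0) = 0"
      using conj[OF RG RG RR RR, of "b * ?x + ?x * b"] b[OF xa] a(2) xa by (simp add: alg_add alg_mult)
    ultimately have "h (- (a * x + x * a)) = 0" by (simp only:)
    then show ?thesis unfolding lin_minus[OF h(1)] by (simp only: neg_equal_0_iff_equal)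
  qed
  have dbx: "h (db * x + x * db) = 0" and zbx: "h (zb * x + x * zb) = 0" if "x \<in> alg" for x
    by (rule refl[of d], simp_all add: R_d R_R mult.assoc alg_let dx that)
       (rule refl[of z], simp_all add: R_z R_R mult.assoc alg_let zx that)
  have odd: "h x = 0" if "(l, w, x) \<in> hom" "odd l" for l w x
  proof (rule weight)
    show "x \<in> alg" using hom_Hlt[OF that(1)] Hlt_alg by blast
    show "d0 x = cst (of_int w) * x" by (rule hom_d0[OF that(1)])
    show "(of_int w :: complex) \<noteq> 0" using hom_parity[OF that(1)] that(2) by auto
  qed
  show ?thesis using h(1,2) Gx dx zx dbx zbx odd by (intro exI[of _ h]) blast
qed

end

section \<open>Generating functions\<close>

definition fps_neg_arg :: "complex fps \<Rightarrow> complex fps" where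
  "fps_neg_arg f = Abs_fps (\<lambda>j. (- 1) ^ j * fps_nth f j)"

lemma fps_neg_arg_nth [simp]: "fps_nth (fps_neg_arg f) j = (- 1) ^ j * fps_nth f j"
  by (simp add: fps_neg_arg_def)

lemma fps_neg_arg_add: "fps_neg_arg (f + g) = fps_neg_arg f + fps_neg_arg g"
  and fps_neg_arg_diff: "fps_neg_arg (f - g) = fps_neg_arg f - fps_neg_arg g"
  and fps_neg_arg_const [simp]: "fps_neg_arg (fps_const a) = fps_const a"
  by (auto simp: fps_eq_iff algebra_simps)

lemma fps_neg_arg_mult: "fps_neg_arg (f * g) = fps_neg_arg f * fps_neg_arg g"
proof (rule fps_ext)
  fix j
  have 1: "(- 1 :: complex) ^ j * (fps_nth f i * fps_nth g (j - i)) = 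
      ((- 1) ^ i * fps_nth f i) * ((- 1) ^ (j - i) * fps_nth g (j - i))" if "i \<in> {0..j}" for i
  proof -
    have "(- 1 :: complex) ^ j = (- 1) ^ i * (- 1) ^ (j - i)" using that by (simp flip: power_add)
    then show ?thesis by simp
  qed
  show "fps_nth (fps_neg_arg (f * g)) j = fps_nth (fps_neg_arg f * fps_neg_arg g) j"
    unfolding fps_neg_arg_nth fps_mult_nth sum_distrib_left by (rule sum.cong[OF refl 1])
qed

lemma fps_neg_arg_exp: "fps_neg_arg (fps_exp a) = fps_exp (- a)"
  by (rule fps_ext) (simp add: power_minus[of a])

lemma exp_inverse: "fps_exp 1 * fps_exp (- 1) = (1 :: complex fps)"
  using fps_exp_add_mult[of 1 "- 1 :: complex"] by simp

text \<open>
  The derivative of this series, with \<open>\<zeta> = om n (- k)\<close>, is the exponential generating function of the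
  values \<open>f (sm ^ j S k)\<close> of an admissible functional. The series \<open>\<Psi>\<close> carries the contribution of
  the difference between \<open>sp\<close> and \<open>sm\<close>. For \<open>\<zeta> = - 1\<close> the factor of \<open>g\<close> has no constant term, and a solution
  exists because then the right-hand side has none either.
\<close>

definition Gsol :: "complex \<Rightarrow> complex \<Rightarrow> complex fps \<Rightarrow> complex fps" where
  "Gsol \<zeta> \<beta> \<Psi> = (SOME g. g * (fps_exp (- 1) + fps_const \<zeta>) = fps_const \<beta> - fps_const \<zeta> * \<Psi>)"

lemma Gsol:
  assumes "\<zeta> = - 1 \<Longrightarrow> \<beta> = 0" "fps_nth \<Psi> 0 = 0"
  shows "Gsol \<zeta> \<beta> \<Psi> * (fps_exp (- 1) + fps_const \<zeta>) = fps_const \<beta> - fps_const \<zeta> * \<Psi>"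
proof -
  have "\<exists>g. g * (fps_exp (- 1) + fps_const \<zeta>) = fps_const \<beta> - fps_const \<zeta> * \<Psi>"
  proof (cases "\<zeta> = - 1")
    case False
    then have "fps_nth (fps_exp (- 1) + fps_const \<zeta>) 0 \<noteq> 0" by (simp add: add_eq_0_iff)
    then show ?thesis
      by (intro exI[of _ "(fps_const \<beta> - fps_const \<zeta> * \<Psi>) * inverse (fps_exp (- 1) + fps_const \<zeta>)"])
         (simp only: mult.assoc inverse_mult_eq_1[OF \<open>fps_nth _ 0 \<noteq> 0\<close>] mult_1_right)
  next
    case True
    let ?D = "fps_exp (- 1) + fps_const \<zeta> :: complex fps"
    have shift: "g = fps_shift 1 g * fps_X" if "fps_nth g 0 = 0" for g :: "complex fps"
      using that by (simp add: fps_eq_iff)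
    have D: "?D = fps_shift 1 ?D * fps_X" by (rule shift) (simp add: True)
    have P: "\<Psi> = fps_shift 1 \<Psi> * fps_X" by (rule shift[OF assms(2)])
    have nz: "fps_nth (fps_shift 1 ?D) 0 \<noteq> 0" using True by simp
    have "fps_shift 1 \<Psi> * inverse (fps_shift 1 ?D) * (fps_shift 1 ?D * fps_X) = 
        fps_shift 1 \<Psi> * (inverse (fps_shift 1 ?D) * fps_shift 1 ?D) * fps_X"
      by (simp only: mult.assoc)
    also have "\<dots> = fps_shift 1 \<Psi> * fps_X" by (simp only: inverse_mult_eq_1[OF nz] mult_1_right)
    finally have "fps_shift 1 \<Psi> * inverse (fps_shift 1 ?D) * ?D = \<Psi>"
      by (simp only: D[symmetric] P[symmetric])
    then show ?thesis using True assms(1)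
      by (intro exI[of _ "fps_shift 1 \<Psi> * inverse (fps_shift 1 ?D)"]) (simp flip: fps_const_neg)
  qed
  then show ?thesis unfolding Gsol_def by (rule someI_ex)
qed

lemma exp_const_nonzero: "fps_exp (- 1) + fps_const \<zeta> \<noteq> (0 :: complex fps)"
proof
  assume "fps_exp (- 1) + fps_const \<zeta> = (0 :: complex fps)"
  then have "fps_nth (fps_exp (- 1) + fps_const \<zeta>) 1 = 0" by simp
  then show False by simp
qed

text \<open>
  Both sides become equal after multiplication by \<open>exp (- t) + \<zeta>\<close>, and this factor can be cancelled. The
  identity yields the compatibility of the values at \<open>k\<close> and at \<open>- k\<close>.
\<close>

lemma Gsol_symmetric:
  assumes z: "\<zeta> \<noteq> 0" and b: "\<zeta> = - 1 \<Longrightarrow> \<beta> = 0" and P: "fps_nth \<Psi> 0 = 0" "fps_neg_arg \<Psi> = \<Psi>"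
  shows "Gsol \<zeta> \<beta> \<Psi> + fps_neg_arg (Gsol (inverse \<zeta>) (\<beta> / \<zeta>\<^sup>2) \<Psi>) = fps_const (\<beta> / \<zeta>) - \<Psi>"
proof -
  define G1 where "G1 = Gsol \<zeta> \<beta> \<Psi>"
  define G2 where "G2 = fps_neg_arg (Gsol (inverse \<zeta>) (\<beta> / \<zeta>\<^sup>2) \<Psi>)"
  define e :: "complex fps" where "e = fps_exp 1"
  define e' :: "complex fps" where "e' = fps_exp (- 1)"
  define Z where "Z = fps_const \<zeta>"
  define Z' where "Z' = fps_const (inverse \<zeta>)"
  define B where "B = fps_const \<beta>"
  have ee: "e * e' = 1" unfolding e_def e'_def by (rule exp_inverse)
  have ZZ: "Z * Z' = 1" using z by (simp add: Z_def Z'_def)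
  have 1: "G1 * (e' + Z) = B - Z * \<Psi>"
    unfolding G1_def e'_def Z_def B_def by (rule Gsol) (use assms in auto)
  have "Gsol (inverse \<zeta>) (\<beta> / \<zeta>\<^sup>2) \<Psi> * (fps_exp (- 1) + fps_const (inverse \<zeta>)) =
      fps_const (\<beta> / \<zeta>\<^sup>2) - fps_const (inverse \<zeta>) * \<Psi>"
  proof (rule Gsol)
    assume "inverse \<zeta> = - 1"
    then have "inverse (inverse \<zeta>) = - 1" by simp
    then show "\<beta> / \<zeta>\<^sup>2 = 0" using b by simp
  qed (rule P)
  from arg_cong[OF this, of fps_neg_arg]
  have 2: "G2 * (e + Z') = Z' * Z' * B - Z' * \<Psi>"
    unfolding G2_def e_def Z'_def B_def fps_neg_arg_mult fps_neg_arg_add fps_neg_arg_diff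
    by (simp add: fps_neg_arg_exp P power2_eq_square field_simps)
  have "G2 * (Z + e') = Z * e' * (G2 * (e + Z'))"
  proof -
    have "Z * e' * (G2 * (e + Z')) = G2 * (Z * (e * e') + e' * (Z * Z'))" by (simp add: algebra_simps)
    then show ?thesis by (simp only: ee ZZ mult_1_right)
  qed
  also have "\<dots> = e' * Z' * B - e' * \<Psi>"
  proof -
    have "Z * e' * (Z' * Z' * B - Z' * \<Psi>) = e' * (Z * Z') * Z' * B - e' * (Z * Z') * \<Psi>" by (simp add: algebra_simps)
    then show ?thesis unfolding 2 by (simp only: ZZ mult_1_right)
  qed
  finally have "(G1 + G2) * (e' + Z) = B - Z * \<Psi> + (e' * Z' * B - e' * \<Psi>)"
    using 1 by (simp add: algebra_simps)
  also have "\<dots> = (Z' * B - \<Psi>) * (e' + Z)"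
  proof -
    have "(Z' * B - \<Psi>) * (e' + Z) = (Z * Z') * B - Z * \<Psi> + (e' * Z' * B - e' * \<Psi>)" by (simp add: algebra_simps)
    then show ?thesis by (simp only: ZZ mult_1_left)
  qed
  finally have "G1 + G2 = Z' * B - \<Psi>"
    by (rule mult_right_cancel[OF exp_const_nonzero[of \<zeta>, folded e'_def Z_def], THEN iffD1])
  then show ?thesis by (simp add: G1_def G2_def Z'_def B_def field_simps)
qed

text \<open>
  Differentiate the defining equation, multiply by \<open>exp t\<close> and differentiate again.
\<close>

lemma Gsol_ode:
  assumes b: "\<zeta> = - 1 \<Longrightarrow> \<beta> = 0" and P: "fps_nth \<Psi> 0 = 0"
  defines "f \<equiv> fps_deriv (Gsol \<zeta> \<beta> \<Psi>)"
  shows "fps_deriv f - f + fps_const \<zeta> * fps_deriv (fps_exp 1 * (f + fps_deriv \<Psi>)) = 0"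
proof -
  define g where "g = Gsol \<zeta> \<beta> \<Psi>"
  define Y where "Y = fps_const \<zeta> * (fps_exp 1 * (g + \<Psi>))"
  have 1: "g * (fps_exp (- 1) + fps_const \<zeta>) = fps_const \<beta> - fps_const \<zeta> * \<Psi>"
    unfolding g_def by (rule Gsol[OF assms(1,2)])
  have "g + Y = fps_exp 1 * (g * (fps_exp (- 1) + fps_const \<zeta>)) + fps_exp 1 * (fps_const \<zeta> * \<Psi>)"
  proof -
    have "fps_exp 1 * (g * (fps_exp (- 1) + fps_const \<zeta>)) + fps_exp 1 * (fps_const \<zeta> * \<Psi>) = 
        g * (fps_exp 1 * fps_exp (- 1)) + Y"
      unfolding Y_def by (simp only: distrib_left distrib_right ac_simps)
    then show ?thesis by (simp only: exp_inverse mult_1_right)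
  qed
  also have "\<dots> = fps_const \<beta> * fps_exp 1" unfolding 1 by (simp add: algebra_simps)
  finally have 2: "g + Y = fps_const \<beta> * fps_exp 1" .
  have "fps_deriv (g + Y) = g + Y" unfolding 2 by simp
  then have 3: "fps_deriv g + fps_deriv Y = g + Y" by simp
  from arg_cong[OF this, of fps_deriv] have 4: "fps_deriv f - f + (fps_deriv (fps_deriv Y - Y)) = 0"
    by (simp add: f_def g_def[symmetric] algebra_simps)
  have "fps_deriv Y - Y = fps_const \<zeta> * (fps_exp 1 * (f + fps_deriv \<Psi>))"
    unfolding Y_def f_def g_def[symmetric] by (simp add: algebra_simps)
  then have "fps_deriv (fps_deriv Y - Y) = fps_const \<zeta> * fps_deriv (fps_exp 1 * (f + fps_deriv \<Psi>))"
    by simp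
  then show ?thesis using 4 by simp
qed

lemma Gsol_initial:
  assumes "\<zeta> \<noteq> - 1" and P: "fps_nth \<Psi> 0 = 0" "fps_nth \<Psi> 1 = 0"
  shows "fps_nth (fps_deriv (Gsol \<zeta> ((1 + \<zeta>)\<^sup>2 * v) \<Psi>)) 0 = v"
proof -
  define g where "g = Gsol \<zeta> ((1 + \<zeta>)\<^sup>2 * v) \<Psi>"
  have 1: "g * (fps_exp (- 1) + fps_const \<zeta>) = fps_const ((1 + \<zeta>)\<^sup>2 * v) - fps_const \<zeta> * \<Psi>"
    unfolding g_def by (rule Gsol) (use assms in auto)
  have nz: "1 + \<zeta> \<noteq> 0" using assms(1) by (simp add: add_eq_0_iff)
  from arg_cong[OF 1, of "\<lambda>f. fps_nth f 0"] have "fps_nth g 0 * (1 + \<zeta>) = (1 + \<zeta>)\<^sup>2 * v"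
    using P by simp
  then have g0: "fps_nth g 0 = (1 + \<zeta>) * v" using nz by (simp add: power2_eq_square)
  from arg_cong[OF 1, of "\<lambda>f. fps_nth f 1"] have "fps_nth g 1 * (1 + \<zeta>) - fps_nth g 0 = 0"
    using P by (simp add: fps_mult_nth algebra_simps)
  then have "fps_nth g 1 * (1 + \<zeta>) = v * (1 + \<zeta>)" using g0 by simp
  then have "fps_nth g 1 = v" using nz by simp
  then show ?thesis by (simp add: g_def)
qed

lemma fps_exp_mult_nth:
  "fact j * fps_nth (fps_exp 1 * f) j = (\<Sum>i\<le>j. of_nat (j choose i) * (fact i * fps_nth f i :: complex))"
proof -
  have "fps_nth (fps_exp 1 * f) j = (\<Sum>i\<le>j. fps_nth f i / fact (j - i))"
    by (subst mult.commute) (simp add: fps_mult_nth atLeast0AtMost)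
  then have "fact j * fps_nth (fps_exp 1 * f) j = (\<Sum>i\<le>j. fact j * (fps_nth f i / fact (j - i)))"
    by (simp add: sum_distrib_left)
  also have "\<dots> = (\<Sum>i\<le>j. of_nat (j choose i) * (fact i * fps_nth f i))"
    by (rule sum.cong) (simp_all add: binomial_fact field_simps)
  finally show ?thesis .
qed

context dunkl_algebra
begin

section \<open>Uniqueness of admissible functionals\<close>

lemma sm_pow_odd: "sm ^ Suc (2 * i) = sg * Cc ^ i - rho * Cc ^ i"
  and sp_pow_odd: "sp ^ Suc (2 * i) = sg * Cc ^ i + rho * Cc ^ i"
  and sm_pow_even: "sm ^ (2 * i) = Cc ^ i" and sp_pow_even: "sp ^ (2 * i) = Cc ^ i"
proof -
  show "sm ^ (2 * i) = Cc ^ i" "sp ^ (2 * i) = Cc ^ i"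
    by (simp_all add: power_mult power2_eq_square sm_sq sp_sq)
  then show "sm ^ Suc (2 * i) = sg * Cc ^ i - rho * Cc ^ i" "sp ^ Suc (2 * i) = sg * Cc ^ i + rho * Cc ^ i"
    unfolding power_Suc by (simp_all only: sm_def[symmetric] sp_def[symmetric] left_diff_distrib[symmetric] distrib_right[symmetric])
qed

lemma rho_S: "rho * S k = psum (\<lambda>l. cst (c l) * R (l - k))"
  by (simp add: rho_psum psum_right mult.assoc R_S)

lemma rho_rho_R: "rho * (rho * R k) = psum (\<lambda>l. psum (\<lambda>l'. cst (c l * c l') * R (k + l' - l)))"
proof -
  have 1: "l' - (l - k) = k + l' - l" for l l' :: int by simp
  show ?thesis unfolding rho_R psum_left cst_left[of rho] rho_S cst_cst 1 ..
qed

lemma sp_binomial: "(sp + 1) ^ m = (\<Sum>i\<le>m. of_nat (m choose i) * sp ^ i)"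
  proof -
    have "(sp + 1) ^ m = (\<Sum>i\<le>m. of_nat (m choose i) * sp ^ i * 1 ^ (m - i))"
    proof (induction m)
      case (Suc m)
      have "(sp + 1) ^ Suc m = sp * (sp + 1) ^ m + (sp + 1) ^ m" by (simp add: distrib_right)
      also have "sp * (sp + 1) ^ m = (\<Sum>i\<le>m. of_nat (m choose i) * sp ^ Suc i)"
        unfolding Suc sum_distrib_left by (intro sum.cong) (simp_all add: cst_left[of sp] flip: cst_of_nat)
      also have "\<dots> = (\<Sum>i\<le>Suc m. of_nat (if i = 0 then 0 else m choose (i - 1)) * sp ^ i)"
        by (subst sum.atMost_Suc_shift) simp
      also have "(sp + 1) ^ m = (\<Sum>i\<le>Suc m. of_nat (m choose i) * sp ^ i)"
        unfolding Suc by (simp add: binomial_eq_0)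
      also have "(\<Sum>i\<le>Suc m. of_nat (if i = 0 then 0 else m choose (i - 1)) * sp ^ i) + (\<Sum>i\<le>Suc m. of_nat (m choose i) * sp ^ i) =
          (\<Sum>i\<le>Suc m. of_nat (Suc m choose i) * sp ^ i * 1 ^ (Suc m - i))"
        unfolding sum.distrib[symmetric] 
        by (intro sum.cong refl) (auto simp: distrib_right[symmetric] of_nat_add[symmetric] choose_reduce_nat simp del: of_nat_add)
      finally show ?case .
    qed simp
    then show ?thesis by simp
  qed

definition "refl_part = V.span {x. \<exists>m k. x = sg ^ m * R k}"

lemma rho_rho_sg_pow: "rho * (rho * sg ^ m) = sg ^ m * (rho * rho)"
proof -
  have "(rho * rho) * sg = sg * (rho * rho)" by (simp add: rho_sg rho_sg[THEN rw_assoc] mult.assoc)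
  from comm_pow[OF this] show ?thesis by (simp add: mult.assoc)
qed

lemma refl_part_Cc: "x \<in> refl_part \<Longrightarrow> Cc * x \<in> refl_part"
  unfolding refl_part_def
proof (rule span_linear_image[where f = "\<lambda>x. Cc * x"])
  fix x assume "x \<in> {x. \<exists>m k. x = sg ^ m * R k}"
  then obtain m k where x: "x = sg ^ m * R k" by blast
  have "rho * (rho * (sg ^ m * R k)) = sg ^ m * (rho * (rho * R k))"
    using arg_cong[OF rho_rho_sg_pow[of m], of "\<lambda>x. x * R k"] by (simp add: mult.assoc)
  then have "Cc * x = sg ^ Suc (Suc m) * R k + sg ^ m * (rho * (rho * R k))"
    by (simp add: x Cc_def distrib_right mult.assoc)
  also have "sg ^ m * (rho * (rho * R k)) = psum (\<lambda>l. psum (\<lambda>l'. cst (c l * c l') * (sg ^ m * R (k + l' - l))))"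
    by (simp add: rho_rho_R psum_left cst_left[of "sg ^ m"])
  also have "sg ^ Suc (Suc m) * R k + psum (\<lambda>l. psum (\<lambda>l'. cst (c l * c l') * (sg ^ m * R (k + l' - l)))) 
      \<in> V.span {x. \<exists>m k. x = sg ^ m * R k}"
    unfolding psum_def by (intro V.span_add V.span_sum V.span_scale V.span_base) blast+
  finally show "Cc * x \<in> V.span {x. \<exists>m k. x = sg ^ m * R k}" .
qed (auto simp: distrib_left cst_left[of Cc])

lemma refl_part_Cc_pow: "Cc ^ i * R k \<in> refl_part"
proof (induction i)
  case 0
  have "sg ^ 0 * R k \<in> refl_part" unfolding refl_part_def by (rule V.span_base) blast
  then show ?case by simp
next
  case (Suc i)
  then show ?case using refl_part_Cc by (simp add: mult.assoc)
qed

text \<open>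
  Induction on the power of \<open>sm\<close>. Expanded by the binomial theorem, the recursion determines the value at
  \<open>sm ^ Suc j S k\<close> from lower ones if \<open>om n (- k) \<noteq> - 1\<close>; if \<open>om n (- k) = - 1\<close> the leading terms cancel and the
  next coefficient, a positive integer, determines the value at \<open>sm ^ j S k\<close>. Invariants
  with a reflection are reduced to \<open>R k\<close> itself by means of \<open>f_R_sg\<close>.
\<close>

theorem admissible_unique:
  assumes adm: "admissible f" and 0: "\<And>k. om n k \<noteq> - 1 \<Longrightarrow> f (S k) = 0" and x: "x \<in> AA"
  shows "f x = 0"
proof -
  note fl = f_lin[OF adm]
  note fs = lin_add[OF fl] lin_cst[OF fl] lin_minus[OF fl] lin_diff[OF fl] lin_0[OF fl]
  have R0: "f (R k) = 0" for k
  proof -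
    have 1: "(1 + om n (k - l)) * f (S (l - k)) = 0" for l
    proof (cases "om n (l - k) = - 1")
      case True
      then have "om n (k - l) = - 1" using om_minus_eq[of n "l - k"] by simp
      then show ?thesis by simp
    qed (use 0 in simp)
    have "psum (\<lambda>l. c l * (1 + om n (k - l)) * f (S (l - k))) = 0"
      unfolding mult.assoc 1 by (simp add: psum_def)
    then show ?thesis unfolding f_ground[OF adm] by simp
  qed
  have sgR: "f (sg ^ m * R k) = 0" for m k
  proof (cases m)
    case (Suc i)
    have "f (R k * (sg * sg ^ i)) = 0" 
      by (rule f_R_sg[OF adm]) (simp_all add: AA_intros power_commutes)
    then show ?thesis using f_conj_R[OF adm, of "sg ^ m" k] Suc by (simp add: AA_intros)
  qed (use R0 in simp)
  have refl0: "f y = 0" if "y \<in> refl_part" for y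
    using lin_span_eq[OF fl, of "\<lambda>x. 0" y "{x. \<exists>m k. x = sg ^ m * R k}"] that sgR
    unfolding refl_part_def by (auto simp: lin_def)
  have rho0: "f (rho * Cc ^ i * S k) = 0" for i k
  proof -
    have "rho * Cc ^ i * S k = Cc ^ i * (rho * S k)"
      using comm_pow[OF rho_Cc, of i] by (simp add: mult.assoc)
    also have "\<dots> = psum (\<lambda>l. cst (c l) * (Cc ^ i * R (l - k)))"
      by (simp add: rho_psum psum_right psum_left mult.assoc R_S cst_left[of "Cc ^ i"])
    finally have e: "rho * Cc ^ i * S k = psum (\<lambda>l. cst (c l) * (Cc ^ i * R (l - k)))" .
    show ?thesis unfolding e lin_psum[OF fl] fs refl0[OF refl_part_Cc_pow] by (simp add: psum_def)
  qed
  have sp_sm: "f (sp ^ m * S k) = f (sm ^ m * S k)" for m k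
  proof (cases "even m")
    case True
    then show ?thesis by (auto elim!: evenE simp: sm_pow_even sp_pow_even)
  next
    case False
    then obtain i where m: "m = Suc (2 * i)" by (auto elim!: oddE)
    show ?thesis unfolding m sm_pow_odd sp_pow_odd by (simp add: distrib_right left_diff_distrib fs rho0)
  qed
  have rec: "f (sm ^ Suc j * S k) - f (sm ^ j * S k) = - om n (- k) * (\<Sum>i\<le>Suc j. of_nat (Suc j choose i) * f (sm ^ i * S k))" for j k
  proof -
    have "f ((sp + 1) ^ Suc j * S k) = (\<Sum>i\<le>Suc j. of_nat (Suc j choose i) * f (sp ^ i * S k))"
      unfolding sp_binomial sum_distrib_right lin_sum[OF fl] mult.assoc
      by (simp only: cst_of_nat[symmetric] fs)
    then show ?thesis using f_E1[OF adm, of j k] by (simp add: left_diff_distrib fs sp_sm mult.assoc)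
  qed
  have Fz: "f (sm ^ m * S k) = 0" for m k
  proof (induction m rule: less_induct)
    case (less m)
    show ?case
    proof (cases "om n (- k) = - 1")
      case False
      show ?thesis
      proof (cases m)
        case 0
        have "om n k \<noteq> - 1" using False om_minus_eq[of n k] by auto
        then show ?thesis using 0 \<open>\<And>k. om n k \<noteq> - 1 \<Longrightarrow> f (S k) = 0\<close> by simp
      next
        case (Suc j)
        then have "(\<Sum>i\<le>j. of_nat (Suc j choose i) * f (sm ^ i * S k)) = 0" 
          using less by (intro sum.neutral) auto
        then have "f (sm ^ Suc j * S k) = - om n (- k) * f (sm ^ Suc j * S k)"
          using rec[of j k] less[of j] Suc by simp
        then have "(1 + om n (- k)) * f (sm ^ Suc j * S k) = 0" by algebra
        then show ?thesis using False Suc by (simp add: add_eq_0_iff)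
      qed
    next
      case True
      have "{..Suc m} = insert (Suc m) (insert m {..<m})" by auto
      then have "(\<Sum>i\<le>Suc m. of_nat (Suc m choose i) * f (sm ^ i * S k)) = 
          f (sm ^ Suc m * S k) + of_nat (Suc m) * f (sm ^ m * S k) + (\<Sum>i<m. of_nat (Suc m choose i) * f (sm ^ i * S k))"
        by simp
      also have "(\<Sum>i<m. of_nat (Suc m choose i) * f (sm ^ i * S k)) = 0"
        using less by (intro sum.neutral) auto
      finally have "of_nat (m + 2) * f (sm ^ m * S k) = 0"
        using rec[of m k] True by (simp add: algebra_simps)
      then show ?thesis by (metis add_2_eq_Suc' mult_eq_0_iff of_nat_eq_0_iff nat.simps(3))
    qed
  qed
  have Rz: "f (R k * sm ^ m) = 0" for m k
  proof (cases "even m")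
    case True
    then obtain i where "m = 2 * i" by blast
    then show ?thesis using refl0[OF refl_part_Cc_pow, of i k] f_conj_R[OF adm, of "Cc ^ i" k]
      by (simp add: sm_pow_even AA_intros)
  next
    case False
    then obtain i where m: "m = Suc (2 * i)" by (auto elim!: oddE)
    have "f (R k * rho * Cc ^ i) = psum (\<lambda>l. c l * f (S (k - l) * sm ^ (2 * i)))"
      unfolding R_rho sm_pow_even by (simp add: psum_right lin_psum[OF fl] fs mult.assoc)
    also have "\<dots> = 0" using Fz by (simp add: S_sm_pow psum_def)
    finally show ?thesis unfolding m sm_pow_odd 
      using f_R_sg_Cc(1)[OF adm, of k i] by (simp add: right_diff_distrib fs mult.assoc)
  qed
  have "lin (\<lambda>x. 0)" by (simp add: lin_def)
  from lin_span_eq[OF fl this AA_sm_span[OF x]] show ?thesis using Fz Rz by blast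
qed

text \<open>
  The words of odd and of even length span the two components of the grading.
\<close>

definition "ODD = V.span {x. \<exists>l w. odd l \<and> (l, w, x) \<in> hom}"
definition "EVEN = V.span {x. \<exists>l w. even l \<and> (l, w, x) \<in> hom}"

lemma EVEN_letter: 
  assumes "a \<in> {z, zb, d, db}" 
  shows "x \<in> EVEN \<Longrightarrow> a * x \<in> ODD" "x \<in> ODD \<Longrightarrow> a * x \<in> EVEN"
proof -
  have 1: "\<exists>w'. (Suc l, w', a * x) \<in> hom" if "(l, w, x) \<in> hom" for l w x
    using assms hom.intros(2-5)[OF that] by blast
  show "x \<in> EVEN \<Longrightarrow> a * x \<in> ODD" unfolding ODD_def EVEN_def
    by (rule span_linear_image[where f = "\<lambda>x. a * x"], assumption)
       (use 1 in \<open>auto simp: distrib_left cst_left intro!: V.span_base, metis even_Suc\<close>)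
  show "x \<in> ODD \<Longrightarrow> a * x \<in> EVEN" unfolding ODD_def EVEN_def
    by (rule span_linear_image[where f = "\<lambda>x. a * x"], assumption)
       (use 1 in \<open>auto simp: distrib_left cst_left intro!: V.span_base, metis even_Suc\<close>)
qed

lemma EVEN_AA: "x \<in> AA \<Longrightarrow> x \<in> EVEN"
proof -
  have G: "g \<in> EVEN" if "g \<in> G" for g unfolding EVEN_def
    by (rule V.span_base) (use hom.intros(1)[OF that] in \<open>auto intro!: exI[of _ 0]\<close>)
  have sub: "V.subspace EVEN" unfolding EVEN_def by (rule V.subspace_span)
  have sg: "sg * x \<in> EVEN" if "x \<in> EVEN" for x
    unfolding sg_def left_diff_distrib mult.assoc
    by (intro V.subspace_diff[OF sub] EVEN_letter(2) EVEN_letter(1) that) auto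
  have "sg ^ m * g \<in> EVEN" if "g \<in> G" for m g
    by (induction m) (use G that sg in \<open>auto simp: mult.assoc\<close>)
  then have "AA \<subseteq> EVEN" unfolding AA_def by (intro V.span_minimal sub) auto
  then show "x \<in> AA \<Longrightarrow> x \<in> EVEN" by blast
qed

text \<open>
  Supertraces vanish on commutators with the even elements \<open>E\<close> and \<open>F\<close>, hence on \<open>PP\<close>; the
  projection of \<open>d (zb x) + (zb x) d\<close> to \<open>AA\<close> then gives the recursion.
\<close>

theorem supertrace_admissible:
  assumes h: "lin h"
    and hG: "\<And>x g. x \<in> alg \<Longrightarrow> g \<in> G \<Longrightarrow> h (g * x) = h (x * g)"
    and ha: "\<And>l w x a. (l, w, x) \<in> hom \<Longrightarrow> odd l \<Longrightarrow> a \<in> {z, zb, d, db} \<Longrightarrow> h (a * x) = - h (x * a)"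
    and he: "\<And>x a. x \<in> alg \<Longrightarrow> a \<in> {E, F, sg} \<Longrightarrow> h (a * x) = h (x * a)"
  shows "admissible h" "x \<in> PP \<Longrightarrow> h x = 0"
proof -
  note hs = lin_add[OF h] lin_cst[OF h] lin_minus[OF h] lin_diff[OF h] lin_0[OF h]
  show "h x = 0" if "x \<in> PP"
  proof -
    obtain y y' where "y \<in> alg" "y' \<in> alg" "x = dm y + dp y'" using PP_N \<open>x \<in> PP\<close> by blast
    then show ?thesis using he[of y F] he[of y' E] by (simp add: hs dm_def dp_def)
  qed
  have odd: "h (a * x) = - h (x * a)" if "x \<in> ODD" "a \<in> {z, zb, d, db}" for x a
    using lin_span_eq[of "\<lambda>x. h (a * x)" "\<lambda>x. - h (x * a)" x "{x. \<exists>l w. odd l \<and> (l, w, x) \<in> hom}"] 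
      that ha unfolding ODD_def by (auto simp: lin_def distrib_left distrib_right hs cst_left[of a] mult.assoc)
  have e1: "z * db - d * zb = sm - 1" and e2: "zb * d - db * z = - (sp + 1)" 
    and e3: "zb * db - db * zb = - gB"
    by (simp_all add: sm_def sp_def sg_def letter_rw)
  have S: "h (S k * x * S (- k)) = h x" if "x \<in> AA" for k x
    using hG[of "x * S (- k)" "S k"] that 
    by (simp add: mult.assoc S_S AA_alg AA_intros) (simp add: G_def)
  have R: "h (R k * x * R k) = h x" if "x \<in> AA" for k x
    using hG[of "x * R k" "R k"] that 
    by (simp add: mult.assoc R_R AA_alg AA_intros) (simp add: G_def)
  have sg: "h (sg * x) = h (x * sg)" if "x \<in> AA" for x using he[OF AA_alg[OF that], of sg] by simp
  have T: "h (d * zb * x - z * db * x) = - h (zb * x * d - db * x * z)" if "x \<in> AA" for x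
  proof -
    have 1: "zb * x \<in> ODD" "db * x \<in> ODD" using EVEN_letter(1)[of _ x] EVEN_AA[OF that] by auto
    show ?thesis using odd[OF 1(1), of d] odd[OF 1(2), of z] by (simp add: hs mult.assoc)
  qed
  have E1: "h ((sm - 1) * sm ^ j * S k) = - om n (- k) * h ((sp + 1) ^ Suc j * S k)" for j k
  proof -
    define x where "x = sm ^ j * S k"
    define y where "y = cst (om n (- k)) * ((sp + 1) ^ j * S k)"
    have AA: "x \<in> AA" "y \<in> AA" unfolding x_def y_def by (auto intro!: AA_intros)
    have xz: "x * z = z * y"
    proof -
      have "x * z = cst (om n (- k)) * (sm ^ j * z * S k)"
        by (simp add: x_def mult.assoc S_z cst_left[of "sm ^ j"])
      then show ?thesis using Q_z[OF Q_pow, of j] by (simp add: y_def mult.assoc cst_l)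
    qed
    have xd: "x * d = d * y" by (rule S_cst_z[OF xz AA])
    have "d * zb * x - z * db * x = - ((z * db - d * zb) * x)" by (simp add: left_diff_distrib)
    moreover have "zb * x * d - db * x * z = (zb * d - db * z) * y"
      by (simp add: left_diff_distrib mult.assoc xz xd del: mult_cancel_left)
    ultimately have "- h ((sm - 1) * x) = h ((sp + 1) * y)"
      using T[OF AA(1)] by (simp only: e1 e2 hs mult_minus_left minus_minus)
    then have "h ((sm - 1) * x) = - h ((sp + 1) * y)" by (metis minus_minus)
    then show ?thesis by (simp only: x_def y_def cst_left[of "sp + 1"] hs power_Suc mult.assoc mult_minus_left)
  qed
  have Gr: "h (R k) = - psum (\<lambda>l. c l * (1 + om n (k - l)) * h (S (l - k)))" for k
  proof -
    define y where "y = - (cst (om n k) * R k)"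
    have AA: "R k \<in> AA" "y \<in> AA" unfolding y_def by (auto intro!: AA_intros)
    have xz: "R k * z = zb * y" by (simp add: y_def R_z cst_l)
    have xd: "R k * d = db * y" by (rule R_cst_z[OF xz AA])
    have "d * zb * R k - z * db * R k = - ((z * db - d * zb) * R k)" by (simp add: left_diff_distrib)
    moreover have "zb * R k * d - db * R k * z = (zb * db - db * zb) * y"
      by (simp add: left_diff_distrib mult.assoc xz xd del: mult_cancel_left)
    ultimately have 1: "- h ((sm - 1) * R k) = h (gB * y)"
      using T[OF AA(1)] by (simp only: e1 e3 hs mult_minus_left minus_minus)
    have "h (sg * R k) = 0" using sg[OF AA(1)] by (simp add: R_sg hs)
    then have 2: "h ((sm - 1) * R k) = - h (rho * R k) - h (R k)"
      by (simp add: sm_def left_diff_distrib hs)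
    have 3: "h (gB * y) = - om n k * h (gB * R k)" by (simp add: y_def hs cst_left[of gB])
    have "h (R k) = - (h (rho * R k) + om n k * h (gB * R k))" using 1 2 3 by (simp add: algebra_simps)
    also have "h (rho * R k) + om n k * h (gB * R k) = psum (\<lambda>l. c l * h (S (l - k)) + om n k * (c l * om n (- l) * h (S (l - k))))"
      unfolding rho_R gB_R lin_psum[OF h] hs psum_scale psum_add ..
    also have "\<dots> = psum (\<lambda>l. c l * (1 + om n (k - l)) * h (S (l - k)))"
      by (rule psum_cong) (use om_add[of n k "- l" for l] in \<open>simp add: algebra_simps\<close>)
    finally show ?thesis .
  qed
  show "admissible h" unfolding admissible_def using h S R sg E1 Gr by blast
qed

end

context dunkl_algebra
begin

section \<open>Existence of admissible functionals\<close>

lemma shift_two: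
  fixes f :: "int \<Rightarrow> 'b"
  assumes "\<And>l. f (l + 2) = f l"
  shows "f (l + 2 * k) = f l"
proof -
  have 1: "f (l + 2 * int k) = f l" for l k
  proof (induction k)
    case (Suc k)
    then show ?case using assms[of "l + 2 * int k"] by (simp add: algebra_simps)
  qed simp
  show ?thesis
  proof (cases "k \<ge> 0")
    case True
    then show ?thesis using 1[of l "nat k"] by simp
  next
    case False
    then show ?thesis using 1[of "l + 2 * k" "nat (- k)"] by simp
  qed
qed

text \<open>
  The prescribed values: \<open>eta v i k\<close> is that of \<open>Cc ^ i R k\<close> and \<open>FF v k m\<close> that of \<open>sm ^ m S k\<close>, where \<open>v\<close> gives
  the initial values at the rotations. The value at \<open>R k\<close> is the one forced by admissibility, and
  \<open>Cc = sg\<^sup>2 + rho\<^sup>2\<close> together with the vanishing of \<open>f (R k sg x)\<close> forces the recursion for \<open>eta\<close>.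
  The term \<open>psi\<close> is the difference between the values at \<open>sm ^ m S k\<close> and \<open>sp ^ m S k\<close>, up to sign.
\<close>

primrec eta :: "(int \<Rightarrow> complex) \<Rightarrow> nat \<Rightarrow> int \<Rightarrow> complex" where
  "eta v 0 = (\<lambda>k. - psum (\<lambda>l. c l * (1 + om n (k - l)) * v (l - k)))"
| "eta v (Suc i) = (\<lambda>k. psum (\<lambda>l. psum (\<lambda>l'. c l * c l' * eta v i (k + l' - l))))"

definition "psi v k m = (if odd m then 2 * psum (\<lambda>l. c l * eta v (m div 2) (l - k)) else 0)"

definition "Psi v k = Abs_fps (\<lambda>j. if j = 0 then 0 else psi v k (j - 1) / fact j)"

definition "FF v k m = fact m * fps_nth (fps_deriv (Gsol (om n (- k)) ((1 + om n (- k))\<^sup>2 * v k) (Psi v k))) m"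

lemma Psi_0 [simp]: "fps_nth (Psi v k) 0 = 0" and Psi_1: "fps_nth (Psi v k) 1 = 0"
  by (simp_all add: Psi_def psi_def)

lemma Psi_neg: "fps_neg_arg (Psi v k) = Psi v k"
proof (rule fps_ext)
  fix j
  show "fps_nth (fps_neg_arg (Psi v k)) j = fps_nth (Psi v k) j"
    by (cases "even j") (auto simp: Psi_def psi_def elim: oddE)
qed

lemma rho_rho_S: "rho * (rho * S k) = psum (\<lambda>l. psum (\<lambda>l'. cst (c l * c l') * S (k + l' - l)))"
proof -
  have 1: "l' - (l - k) = k + l' - l" for l l' :: int by simp
  show ?thesis unfolding rho_S psum_left cst_left[of rho] rho_R cst_cst 1 ..
qed

lemma FF_ode: "FF v k (Suc j) - FF v k j =
  - om n (- k) * (\<Sum>i\<le>Suc j. of_nat (Suc j choose i) * (FF v k i + psi v k i))"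
proof -
  let ?f = "fps_deriv (Gsol (om n (- k)) ((1 + om n (- k))\<^sup>2 * v k) (Psi v k))"
  have "fps_deriv ?f - ?f + fps_const (om n (- k)) * fps_deriv (fps_exp 1 * (?f + fps_deriv (Psi v k))) = 0"
    by (rule Gsol_ode) auto
  from arg_cong[OF this, of "\<lambda>g. fact j * fps_nth g j"]
  have "fact j * (of_nat (Suc j) * fps_nth ?f (Suc j)) - fact j * fps_nth ?f j + 
     om n (- k) * (fact j * (of_nat (Suc j) * fps_nth (fps_exp 1 * (?f + fps_deriv (Psi v k))) (Suc j))) = 0"
    by (simp only: fps_sub_nth fps_add_nth fps_mult_left_const_nth fps_deriv_nth fps_zero_nth 
        distrib_left right_diff_distrib mult_zero_right Suc_eq_plus1[symmetric] mult.left_commute)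
  moreover have "fact j * (of_nat (Suc j) * fps_nth (fps_exp 1 * (?f + fps_deriv (Psi v k))) (Suc j)) = 
     (\<Sum>i\<le>Suc j. of_nat (Suc j choose i) * (FF v k i + psi v k i))"
  proof -
    have 1: "fact i * fps_nth (?f + fps_deriv (Psi v k)) i = FF v k i + psi v k i" for i
    proof -
      have "(fact i :: complex) * (of_nat (Suc i) * (psi v k i / fact (Suc i))) = psi v k i"
        by (simp add: field_simps del: of_nat_Suc)
      then show ?thesis by (simp add: FF_def Psi_def distrib_left del: of_nat_Suc fact_Suc)
    qed
    have "fact j * (of_nat (Suc j) * fps_nth (fps_exp 1 * (?f + fps_deriv (Psi v k))) (Suc j)) = 
        fact (Suc j) * fps_nth (fps_exp 1 * (?f + fps_deriv (Psi v k))) (Suc j)" by (simp add: algebra_simps)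
    also have "\<dots> = (\<Sum>i\<le>Suc j. of_nat (Suc j choose i) * (FF v k i + psi v k i))"
      unfolding fps_exp_mult_nth 1 ..
    finally show ?thesis .
  qed
  moreover have "fact j * (of_nat (Suc j) * fps_nth ?f (Suc j)) = FF v k (Suc j)"
    by (simp only: FF_def fact_Suc of_nat_mult) (simp add: algebra_simps)
  moreover have "fact j * fps_nth ?f j = FF v k j" by (simp only: FF_def)
  ultimately have "FF v k (Suc j) - FF v k j + om n (- k) * (\<Sum>i\<le>Suc j. of_nat (Suc j choose i) * (FF v k i + psi v k i)) = 0"
    by (simp only:)
  then show ?thesis by (simp only: eq_neg_iff_add_eq_0 mult_minus_left)
qed

lemma FF_0: "om n (- k) \<noteq> - 1 \<Longrightarrow> FF v k 0 = v k"
  using Gsol_initial[of "om n (- k)" "Psi v k" "v k"] Psi_1 by (simp add: FF_def)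

context
  fixes v :: "int \<Rightarrow> complex" assumes v_per: "\<And>k. v (k + int n) = v k" and v_neg: "\<And>k. v (- k) = v k"
begin

lemma eta_shift: "eta v i (k + 2) = eta v i k"
proof (induction i arbitrary: k)
  case 0
  have "psum (\<lambda>l. (\<lambda>l. c l * (1 + om n (k + 2 - l)) * v (l - (k + 2))) (l + 2)) = 
      psum (\<lambda>l. c l * (1 + om n (k + 2 - l)) * v (l - (k + 2)))"
    by (rule psum_shift) 
       (use om_n'[of "k + 2 - l" for l] v_per[of "l - (k + 2)" for l] in \<open>simp add: per algebra_simps\<close>)
  then show ?case by (simp add: c_shift algebra_simps)
next
  case (Suc i)
  have "k + 2 + l' - l = k + l' - l + 2" for l l' by simp
  then show ?case by (simp only: eta.simps Suc)
qed

lemma eta_even: "eta v i (k + 2 * j) = eta v i k"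
  by (rule shift_two[of "eta v i", OF eta_shift])

lemma eta_period: "eta v i (k + int n) = eta v i k"
proof (induction i arbitrary: k)
  case 0
  have "om n (k + int n - l) = om n (k - l)" "v (l - (k + int n)) = v (l - k)" for l
    using om_n[of "k - l"] v_per[of "l - (k + int n)"] by (simp_all add: algebra_simps)
  then show ?case by simp
next
  case (Suc i)
  have "k + int n + l' - l = k + l' - l + int n" for l l' by simp
  then show ?case by (simp only: eta.simps Suc)
qed

lemma psi_period: "psi v (k + int n) m = psi v k m"
proof -
  have "eta v i (l - (k + int n)) = eta v i (l - k)" for i l
    using eta_period[of i "l - (k + int n)"] by simp
  then show ?thesis by (simp add: psi_def)
qed

lemma psi_neg: "psi v (- k) m = psi v k m"
proof -
  have "eta v i (l - - k) = eta v i (l - k)" for i l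
    using eta_even[of i "l - k" k] by (simp add: algebra_simps)
  then show ?thesis by (simp add: psi_def)
qed

lemma FF_period: "FF v (k + int n) m = FF v k m"
proof -
  have "om n (- (k + int n)) = om n (- k)" using om_n[of "- (k + int n)"] by simp
  moreover have "Psi v (k + int n) = Psi v k" unfolding Psi_def psi_period ..
  ultimately show ?thesis by (simp add: FF_def v_per)
qed

lemma FF_neg: "FF v k m - (- 1) ^ m * FF v (- k) m = - psi v k m"
proof -
  let ?G = "\<lambda>k. Gsol (om n (- k)) ((1 + om n (- k))\<^sup>2 * v k) (Psi v k)"
  have P: "Psi v (- k) = Psi v k" unfolding Psi_def psi_neg ..
  have i: "inverse (om n (- k)) = om n k" by (metis om_minus_eq minus_minus)
  have "om n (- k) * (1 + om n k) = 1 + om n (- k)" by (simp add: distrib_left)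
  then have b: "(1 + om n (- k))\<^sup>2 * v k / (om n (- k))\<^sup>2 = (1 + om n k)\<^sup>2 * v (- k)"
    by (metis (no_types, opaque_lifting) v_neg power_mult_distrib mult.assoc nonzero_mult_div_cancel_left om_nonzero power_not_zero)
  have "?G k + fps_neg_arg (Gsol (inverse (om n (- k))) ((1 + om n (- k))\<^sup>2 * v k / (om n (- k))\<^sup>2) (Psi v k)) = 
     fps_const ((1 + om n (- k))\<^sup>2 * v k / om n (- k)) - Psi v k"
    by (rule Gsol_symmetric) (auto simp: Psi_neg)
  then have "?G k + fps_neg_arg (?G (- k)) = fps_const ((1 + om n (- k))\<^sup>2 * v k / om n (- k)) - Psi v k"
    unfolding i b by (simp add: P)
  from arg_cong[OF this, of "\<lambda>g. fact (Suc m) * fps_nth g (Suc m)"]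
  have "fact (Suc m) * fps_nth (?G k) (Suc m) - (- 1) ^ m * (fact (Suc m) * fps_nth (?G (- k)) (Suc m)) = - psi v k m"
    by (simp add: Psi_def algebra_simps del: fact_Suc)
  moreover have "FF v k m = fact (Suc m) * fps_nth (?G k) (Suc m)" for k
    by (simp add: FF_def algebra_simps)
  ultimately show ?thesis by (simp only:)
qed

end

end

text \<open>
  Without independence, values could not be prescribed on the invariants: a quotient of the algebra by an
  ideal satisfies the same relations, but may have fewer supertraces.
\<close>

locale dunkl_algebra_indep = dunkl_algebra +
  assumes indep: "(\<Sum>m<M. \<Sum>k\<in>{0..<int n}. cst (a m k) * (sg ^ (m mod 2) * Cc ^ (m div 2) * S k)
      + cst (b m k) * (sg ^ (m mod 2) * Cc ^ (m div 2) * R k)) = 0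
    \<Longrightarrow> m < M \<Longrightarrow> k \<in> {0..<int n} \<Longrightarrow> a m k = 0 \<and> b m k = 0"
begin

definition "basis = (\<lambda>(m, k, e). sg ^ (m mod 2) * Cc ^ (m div 2) * (if e then S k else R k))"

lemma basis_indep:
  assumes J: "finite J" "J \<subseteq> UNIV \<times> {0..<int n} \<times> UNIV" and s: "(\<Sum>i\<in>J. cst (u i) * basis i) = 0" and i: "i \<in> J"
  shows "u i = 0"
proof -
  obtain M where M: "\<And>i. i \<in> J \<Longrightarrow> fst i < M"
    using finite_nat_set_iff_bounded[of "fst ` J"] J(1) by auto
  define U where "U i = (if i \<in> J then u i else 0)" for i
  have "0 = (\<Sum>i\<in>J. cst (U i) * basis i)" unfolding s[symmetric] by (rule sum.cong) (auto simp: U_def)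
  also have "\<dots> = (\<Sum>i\<in>{..<M} \<times> {0..<int n} \<times> UNIV. cst (U i) * basis i)"
    by (rule sum.mono_neutral_left) (use J M in \<open>auto simp: U_def\<close>)
  also have "\<dots> = (\<Sum>m<M. \<Sum>k\<in>{0..<int n}. \<Sum>e\<in>UNIV. cst (U (m, k, e)) * basis (m, k, e))"
    by (simp add: sum.cartesian_product)
  also have "\<dots> = (\<Sum>m<M. \<Sum>k\<in>{0..<int n}. cst (U (m, k, True)) * (sg ^ (m mod 2) * Cc ^ (m div 2) * S k)
      + cst (U (m, k, False)) * (sg ^ (m mod 2) * Cc ^ (m div 2) * R k))"
    by (simp add: UNIV_bool basis_def add.commute)
  finally have *: "m < M \<Longrightarrow> k \<in> {0..<int n} \<Longrightarrow> U (m, k, True) = 0 \<and> U (m, k, False) = 0" for m k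
    using indep[where M = M and a = "\<lambda>m k. U (m, k, True)" and b = "\<lambda>m k. U (m, k, False)", of m k] by simp
  obtain m k e where i': "i = (m, k, e)" by (cases i)
  then have "m < M" "k \<in> {0..<int n}" using i M J(2) by force+
  then have "U i = 0" using * i' by (cases e) auto
  then show ?thesis using i by (simp add: U_def)
qed

lemma exists_lin: "\<exists>f. lin f \<and> (\<forall>i\<in>UNIV \<times> {0..<int n} \<times> UNIV. f (basis i) = w i)"
proof -
  let ?I = "UNIV \<times> {0..<int n} \<times> UNIV :: (nat \<times> int \<times> bool) set"
  have inj: "inj_on basis ?I"
  proof (rule inj_onI, rule ccontr)
    fix i j assume ij: "i \<in> ?I" "j \<in> ?I" "basis i = basis j" "i \<noteq> j"
    have "(\<Sum>x\<in>{i, j}. cst (if x = i then 1 else - 1) * basis x) = 0"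
      using ij by (simp add: cst_minus)
    from basis_indep[OF _ _ this, of i] ij show False by simp
  qed
  have "V.independent (basis ` ?I)"
  proof
    assume "V.dependent (basis ` ?I)"
    then obtain X u x where X: "finite X" "X \<subseteq> basis ` ?I" "x \<in> X" "u x \<noteq> 0" "(\<Sum>v\<in>X. cst (u v) * v) = 0"
      unfolding V.dependent_explicit by auto
    obtain J where J: "J \<subseteq> ?I" "X = basis ` J" using X(2) by (auto simp: subset_image_iff)
    have injJ: "inj_on basis J" using inj J(1) inj_on_subset by blast
    have "(\<Sum>i\<in>J. cst (u (basis i)) * basis i) = 0"
      using X(5) unfolding J(2) sum.reindex[OF injJ] by simp
    moreover have "finite J" using X(1) J(2) injJ finite_imageD by blast
    moreover obtain i where "i \<in> J" "x = basis i" using X(3) J(2) by blast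
    ultimately show False using basis_indep[of J "\<lambda>i. u (basis i)" i] J(1) X(4) by simp
  qed
  then obtain f where f: "lin f" "\<forall>b\<in>basis ` ?I. f b = w (the_inv_into ?I basis b)"
    using lin_extend[of "basis ` ?I" "\<lambda>b. w (the_inv_into ?I basis b)"] by blast
  have "\<forall>i\<in>?I. f (basis i) = w i" using f(2) the_inv_into_f_f[OF inj] by simp
  then show ?thesis using f(1) by blast
qed

lemma AA_basis_span:
  assumes "x \<in> AA"
  shows "x \<in> V.span {x. \<exists>i k. x \<in> {Cc ^ i * S k, sg * Cc ^ i * S k, Cc ^ i * R k, sg * Cc ^ i * R k}}" (is "x \<in> V.span ?X")
proof -
  have in1: "Cc ^ i * S k \<in> V.span ?X" "sg * Cc ^ i * S k \<in> V.span ?X" 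
    "Cc ^ i * R k \<in> V.span ?X" "sg * Cc ^ i * R k \<in> V.span ?X" for i k
    by (rule V.span_base, blast)+
  have sgsg: "sg * (sg * (Cc ^ i * g)) = Cc ^ Suc i * g - Cc ^ i * (rho * (rho * g))" for i g
  proof -
    have "rho * (rho * Cc ^ i) = Cc ^ i * (rho * rho)"
      using comm_pow[of "rho * rho" Cc i] by (simp add: mult.assoc rho_Cc rho_Cc[THEN rw_assoc])
    from arg_cong[OF this, of "\<lambda>x. x * g"] have "rho * (rho * (Cc ^ i * g)) = Cc ^ i * (rho * (rho * g))"
      by (simp add: mult.assoc)
    moreover have "sg * sg = Cc - rho * rho" by (simp add: Cc_def)
    from rw_assoc[OF this, of "Cc ^ i * g"] have "sg * (sg * (Cc ^ i * g)) = Cc ^ Suc i * g - rho * (rho * (Cc ^ i * g))"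
      by (simp add: left_diff_distrib mult.assoc)
    ultimately show ?thesis by simp
  qed
  have sgX: "sg * x \<in> V.span ?X" if "x \<in> V.span ?X" for x
    using that
  proof (rule span_linear_image[where f = "\<lambda>x. sg * x"])
    fix x assume "x \<in> ?X"
    then obtain i k where "x \<in> {Cc ^ i * S k, sg * Cc ^ i * S k, Cc ^ i * R k, sg * Cc ^ i * R k}" by blast
    then consider "x = Cc ^ i * S k" | "x = sg * Cc ^ i * S k" | "x = Cc ^ i * R k" | "x = sg * Cc ^ i * R k" by blast
    then show "sg * x \<in> V.span ?X"
    proof cases
      case 1
      then show ?thesis using in1(2)[of i k] by (simp add: mult.assoc)
    next
      case 3
      then show ?thesis using in1(4)[of i k] by (simp add: mult.assoc)
    next
      case 2
      have "sg * x = Cc ^ Suc i * S k - psum (\<lambda>l. psum (\<lambda>l'. cst (c l * c l') * (Cc ^ i * S (k + l' - l))))"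
        unfolding 2 mult.assoc sgsg rho_rho_S psum_left cst_left[of "Cc ^ i"] ..
      then show ?thesis unfolding psum_def
        by (simp only:) (intro V.span_diff V.span_sum V.span_scale in1)
    next
      case 4
      have "sg * x = Cc ^ Suc i * R k - psum (\<lambda>l. psum (\<lambda>l'. cst (c l * c l') * (Cc ^ i * R (k + l' - l))))"
        unfolding 4 mult.assoc sgsg rho_rho_R psum_left cst_left[of "Cc ^ i"] ..
      then show ?thesis unfolding psum_def
        by (simp only:) (intro V.span_diff V.span_sum V.span_scale in1)
    qed
  qed (auto simp: distrib_left cst_left[of sg])
  have "sg ^ m * g \<in> V.span ?X" if "g \<in> G" for m g
  proof (induction m)
    case 0
    then show ?case using that in1(1,3)[of 0] by (auto simp: G_def)
  next
    case (Suc m)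
    then show ?case using sgX by (simp add: mult.assoc)
  qed
  then have "AA \<subseteq> V.span ?X" unfolding AA_def by (intro V.span_minimal V.subspace_span) auto
  then show ?thesis using assms by blast
qed

text \<open>
  The values prescribed by \<open>eta\<close> and \<open>FF\<close> define a functional since the invariants \<open>sg ^ i Cc ^ j g\<close> with
  \<open>i < 2\<close> are independent. On \<open>sg Cc ^ i S k\<close> the value has to be odd in \<open>k\<close>, since \<open>R 0\<close> anticommutes
  with \<open>sg\<close>; it is the odd part of \<open>FF\<close>, and \<open>FF_neg\<close> shows that the even part is accounted for by
  \<open>rho\<close>. The power series identity turns into the recursion.
\<close>

theorem admissible_exists:
  assumes v_per: "\<And>k. v (k + int n) = v k" and v_neg: "\<And>k. v (- k) = v k"
  shows "\<exists>f. admissible f \<and> (\<forall>k. om n k \<noteq> - 1 \<longrightarrow> f (S k) = v k)"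
proof -
  note eta_even = eta_even[of v, OF v_per v_neg] and eta_period = eta_period[of v, OF v_per v_neg]
    and psi_period = psi_period[of v, OF v_per v_neg] and FF_period = FF_period[of v, OF v_per v_neg]
    and FF_neg = FF_neg[of v, OF v_per v_neg] and psi_neg = psi_neg[of v, OF v_per v_neg]
  define w where "w = (\<lambda>(m, k, e). if e then FF v k m + (if odd m then psi v k m / 2 else 0) 
      else if even m then eta v (m div 2) k else 0)"
  obtain f where f: "lin f" "\<forall>i\<in>UNIV \<times> {0..<int n} \<times> UNIV. f (basis i) = w i"
    using exists_lin by blast
  note fs = lin_add[OF f(1)] lin_cst[OF f(1)] lin_minus[OF f(1)] lin_diff[OF f(1)] lin_0[OF f(1)]
  have fw: "f (basis (m, k, e)) = w (m, k, e)" for m k e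
  proof -
    have b: "basis (m, k mod int n, e) = basis (m, k, e)"
      using mod_periodic[of S n k, OF S_period] mod_periodic[of R n k, OF R_period] by (simp add: basis_def)
    have "w (m, k mod int n, e) = w (m, k, e)"
      using mod_periodic[of "\<lambda>k. FF v k m" n k, OF FF_period] mod_periodic[of "\<lambda>k. psi v k m" n k, OF psi_period]
        mod_periodic[of "eta v (m div 2)" n k, OF eta_period] by (simp add: w_def)
    moreover have "f (basis (m, k mod int n, e)) = w (m, k mod int n, e)"
      by (rule bspec[OF f(2)]) (use n_pos in auto)
    ultimately show ?thesis unfolding b by simp
  qed
  have f1: "f (Cc ^ i * S k) = FF v k (2 * i)" for i k
    using fw[of "2 * i" k True] by (simp add: basis_def w_def)
  have f2: "f (sg * Cc ^ i * S k) = FF v k (Suc (2 * i)) + psi v k (Suc (2 * i)) / 2" for i k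
    using fw[of "Suc (2 * i)" k True] by (simp add: basis_def w_def)
  have f3: "f (Cc ^ i * R k) = eta v i k" for i k
    using fw[of "2 * i" k False] by (simp add: basis_def w_def)
  have f4: "f (sg * Cc ^ i * R k) = 0" for i k
    using fw[of "Suc (2 * i)" k False] by (simp add: basis_def w_def)
  have GC: "S j * Cc ^ i = Cc ^ i * S j" "R j * Cc ^ i = Cc ^ i * R j" for i j
    using comm_pow G_Cc by (simp_all add: G_def)
  have eqI: "f' x = f'' x" if "lin f'" "lin f''" "x \<in> AA" and
    "\<And>i k. f' (Cc ^ i * S k) = f'' (Cc ^ i * S k)" "\<And>i k. f' (sg * Cc ^ i * S k) = f'' (sg * Cc ^ i * S k)"
    "\<And>i k. f' (Cc ^ i * R k) = f'' (Cc ^ i * R k)" "\<And>i k. f' (sg * Cc ^ i * R k) = f'' (sg * Cc ^ i * R k)" for f' f'' x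
    by (rule lin_span_eq[OF that(1,2) AA_basis_span[OF that(3)]]) (use that(4-7) in blast)
  have linc: "lin (\<lambda>x. f (a * x * b))" for a b
    by (simp add: lin_def distrib_left distrib_right fs cst_left[of a] mult.assoc)
  have W1: "f (S j * x * S (- j)) = f x" if "x \<in> AA" for x j
  proof (rule eqI[OF linc f(1) that])
    fix i k
    have 1: "S j * (y * g) * S (- j) = y * (S j * g * S (- j))" if "S j * y = y * S j" for y g
      by (simp add: mult.assoc rw_assoc[OF that])
    have 2: "S j * Cc ^ i = Cc ^ i * S j" "S j * (sg * Cc ^ i) = sg * Cc ^ i * S j"
      by (simp_all add: GC S_sg mult.assoc S_sg[THEN rw_assoc])
    have 3: "S j * S k * S (- j) = S k" "S j * R k * S (- j) = R (k + 2 * j)"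
      by (simp_all add: S_S S_R R_S algebra_simps)
    show "f (S j * (Cc ^ i * S k) * S (- j)) = f (Cc ^ i * S k)" 
      "f (S j * (sg * Cc ^ i * S k) * S (- j)) = f (sg * Cc ^ i * S k)"
      "f (S j * (Cc ^ i * R k) * S (- j)) = f (Cc ^ i * R k)"
      "f (S j * (sg * Cc ^ i * R k) * S (- j)) = f (sg * Cc ^ i * R k)"
      unfolding 1[OF 2(1)] 1[OF 2(2)] 3 f3 f4 eta_even by simp_all
  qed
  have odd_sym: "FF v (- k) (Suc (2 * i)) + psi v (- k) (Suc (2 * i)) / 2 = 
      - (FF v k (Suc (2 * i)) + psi v k (Suc (2 * i)) / 2)" for i k
  proof -
    have "FF v k (Suc (2 * i)) + FF v (- k) (Suc (2 * i)) = - psi v k (Suc (2 * i))"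
      using FF_neg[of k "Suc (2 * i)"] by simp
    then show ?thesis unfolding psi_neg by (simp add: field_simps) algebra
  qed
  have even_sym: "FF v (- k) (2 * i) = FF v k (2 * i)" for i k
    using FF_neg[of k "2 * i"] by (simp add: psi_def)
  have W2: "f (R j * x * R j) = f x" if "x \<in> AA" for x j
  proof (rule eqI[OF linc f(1) that])
    fix i k
    have 1: "R j * (y * g) * R j = y * (R j * g * R j)" if "R j * y = y * R j" for y g
      by (simp add: mult.assoc rw_assoc[OF that])
    have m1: "R j * (y * g) * R j = - (y * (R j * g * R j))" if "R j * y = - (y * R j)" for y g
      by (simp add: mult.assoc rw_assoc[OF that])
    have 2: "R j * Cc ^ i = Cc ^ i * R j" "R j * (sg * Cc ^ i) = - (sg * Cc ^ i * R j)"
      by (simp_all add: GC R_sg mult.assoc R_sg[THEN rw_assoc])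
    have 3: "R j * S k * R j = S (- k)" "R j * R k * R j = R (k + 2 * (j - k))"
      by (simp_all add: R_S R_R S_R algebra_simps)
    show "f (R j * (Cc ^ i * S k) * R j) = f (Cc ^ i * S k)" 
      "f (R j * (sg * Cc ^ i * S k) * R j) = f (sg * Cc ^ i * S k)"
      "f (R j * (Cc ^ i * R k) * R j) = f (Cc ^ i * R k)"
      "f (R j * (sg * Cc ^ i * R k) * R j) = f (sg * Cc ^ i * R k)"
      unfolding 1[OF 2(1)] m1[OF 2(2)] 3 fs f1 f2 f3 f4 eta_even even_sym odd_sym by simp_all
  qed
  have rho_Cc_pow: "rho * Cc ^ i = Cc ^ i * rho" for i by (rule comm_pow[OF rho_Cc])
  have sgsg: "f (sg * (sg * (Cc ^ i * R k))) = 0" for i k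
  proof -
    have "sg * sg = Cc - rho * rho" by (simp add: Cc_def)
    from rw_assoc[OF this, of "Cc ^ i * R k"] have "sg * (sg * (Cc ^ i * R k)) = Cc ^ Suc i * R k - rho * (rho * (Cc ^ i * R k))"
      by (simp add: left_diff_distrib mult.assoc)
    also have "rho * (rho * (Cc ^ i * R k)) = Cc ^ i * (rho * (rho * R k))"
      by (simp add: mult.assoc rho_Cc_pow[THEN rw_assoc])
    also have "\<dots> = psum (\<lambda>l. psum (\<lambda>l'. cst (c l * c l') * (Cc ^ i * R (k + l' - l))))"
      unfolding rho_rho_R psum_left cst_left[of "Cc ^ i"] ..
    finally show ?thesis by (simp only: fs lin_psum[OF f(1)] f3) simp
  qed
  have Tr: "f (sg * x) = f (x * sg)" if "x \<in> AA" for x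
  proof -
    have CS: "Cc ^ i * (sg * y) = sg * (Cc ^ i * y)" for i y
      using comm_pow[OF sg_Cc, of i] by (simp flip: mult.assoc)
    have "f (sg * x * 1) = f (1 * x * sg)"
      by (rule eqI[OF linc linc that])
        (simp_all add: mult.assoc S_sg R_sg CS fs f4[unfolded mult.assoc] sgsg)
    then show ?thesis by simp
  qed
  have rhoS: "f (rho * Cc ^ i * S k) = psi v k (Suc (2 * i)) / 2" for i k
  proof -
    have "rho * Cc ^ i * S k = Cc ^ i * (rho * S k)" by (simp add: rho_Cc_pow mult.assoc)
    also have "\<dots> = psum (\<lambda>l. cst (c l) * (Cc ^ i * R (l - k)))" unfolding rho_S psum_left cst_left[of "Cc ^ i"] ..
    finally have e: "rho * Cc ^ i * S k = psum (\<lambda>l. cst (c l) * (Cc ^ i * R (l - k)))" .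
    show ?thesis unfolding e lin_psum[OF f(1)] fs f3 by (simp add: psi_def)
  qed
  have fsm: "f (sm ^ m * S k) = FF v k m" and fsp: "f (sp ^ m * S k) = FF v k m + psi v k m" for m k
  proof -
    have "f (sm ^ m * S k) = FF v k m \<and> f (sp ^ m * S k) = FF v k m + psi v k m"
    proof (cases "even m")
      case True
      then obtain i where "m = 2 * i" by blast
      then show ?thesis by (simp add: sm_pow_even sp_pow_even f1 psi_def)
    next
      case False
      then obtain i where m: "m = Suc (2 * i)" by (auto elim!: oddE)
      show ?thesis unfolding m sm_pow_odd sp_pow_odd left_diff_distrib distrib_right fs f2 rhoS by simp
    qed
    then show "f (sm ^ m * S k) = FF v k m" "f (sp ^ m * S k) = FF v k m + psi v k m" by auto
  qed
  have E1: "f ((sm - 1) * sm ^ j * S k) = - om n (- k) * f ((sp + 1) ^ Suc j * S k)" for j k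
  proof -
    have "f ((sp + 1) ^ Suc j * S k) = (\<Sum>i\<le>Suc j. of_nat (Suc j choose i) * f (sp ^ i * S k))"
      unfolding sp_binomial sum_distrib_right lin_sum[OF f(1)] mult.assoc
      by (simp only: cst_of_nat[symmetric] fs)
    then show ?thesis using FF_ode[of v k j] fsm[of "Suc j" k] 
      by (simp add: left_diff_distrib fs fsm fsp mult.assoc)
  qed
  have S0: "f (S k) = v k" if "om n k \<noteq> - 1" for k
  proof -
    have "om n (- k) \<noteq> - 1" using that om_minus_eq[of n "- k"] by auto
    then show ?thesis using fsm[of 0 k] FF_0 by simp
  qed
  have Gr: "f (R k) = - psum (\<lambda>l. c l * (1 + om n (k - l)) * f (S (l - k)))" for k
  proof -
    have 1: "(1 + om n (k - l)) * f (S (l - k)) = (1 + om n (k - l)) * v (l - k)" for l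
    proof (cases "om n (l - k) = - 1")
      case True
      then have "om n (k - l) = - 1" using om_minus_eq[of n "l - k"] by simp
      then show ?thesis by simp
    qed (use S0 in simp)
    have "f (R k) = eta v 0 k" using f3[of 0 k] by simp
    then show ?thesis unfolding mult.assoc 1 by (simp add: mult.assoc)
  qed
  have "admissible f" unfolding admissible_def using f(1) W1 W2 Tr E1 Gr by blast
  then show ?thesis using S0 by blast
qed

end

section \<open>Smooth functions of polynomial growth\<close>

lemma pd_eq: "(f has_derivative f') (at z) \<Longrightarrow> pd u f z = f' u"
  unfolding pd_def using frechet_derivative_at by metis

lemma has_derivative_pd:
  assumes "f differentiable (at z)"
  shows "(f has_derivative (\<lambda>u. Re u *\<^sub>R pd 1 f z + Im u *\<^sub>R pd \<i> f z)) (at z)"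
proof -
  let ?f' = "frechet_derivative f (at z)"
  have 1: "(f has_derivative ?f') (at z)" using assms frechet_derivative_works by blast
  interpret linear ?f' using 1 has_derivative_linear by blast
  have "?f' u = Re u *\<^sub>R pd 1 f z + Im u *\<^sub>R pd \<i> f z" for u
  proof -
    have "u = Re u *\<^sub>R 1 + Im u *\<^sub>R \<i>" by (simp add: complex_eq_iff)
    then have "?f' u = ?f' (Re u *\<^sub>R 1 + Im u *\<^sub>R \<i>)" by simp
    then show ?thesis by (simp add: add scale pd_def)
  qed
  then show ?thesis using 1 by presburger
qed

text \<open>
  Closure properties of the function space are shown by exhibiting a set that contains the function and
  is stable under the two partial derivatives.
\<close>

lemma CC_coinduct:
  assumes "f \<in> X"
    and "\<And>f z. f \<in> X \<Longrightarrow> f differentiable (at z)" "\<And>f. f \<in> X \<Longrightarrow> poly_growth f"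
    and "\<And>f. f \<in> X \<Longrightarrow> pd 1 f \<in> X" "\<And>f. f \<in> X \<Longrightarrow> pd \<i> f \<in> X"
  shows "f \<in> CC"
proof -
  have "foldr pd us f \<in> X" if "set us \<subseteq> {1, \<i>}" for us
    using that by (induction us) (use assms in auto)
  then show ?thesis using assms(2,3) unfolding CC_def by blast
qed

lemma CC_differentiable: "f \<in> CC \<Longrightarrow> f differentiable (at z)"
  and CC_growth: "f \<in> CC \<Longrightarrow> poly_growth f"
  unfolding CC_def by (auto dest: spec[of _ "[]"])

lemma CC_pd: "f \<in> CC \<Longrightarrow> u \<in> {1, \<i>} \<Longrightarrow> pd u f \<in> CC"
proof -
  assume f: "f \<in> CC" and u: "u \<in> {1, \<i>}"
  have "foldr pd us (pd u f) = foldr pd (us @ [u]) f" for us by simp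
  then show ?thesis using f u unfolding CC_def by (auto simp del: foldr_append)
qed

lemma CC_pd1 [simp]: "f \<in> CC \<Longrightarrow> pd 1 f \<in> CC" and CC_pdi [simp]: "f \<in> CC \<Longrightarrow> pd \<i> f \<in> CC"
  using CC_pd by auto

lemma CC_deriv: "f \<in> CC \<Longrightarrow> (f has_derivative (\<lambda>u. Re u *\<^sub>R pd 1 f z + Im u *\<^sub>R pd \<i> f z)) (at z)"
  by (rule has_derivative_pd[OF CC_differentiable])

lemma CC_continuous: "f \<in> CC \<Longrightarrow> continuous_on A f"
  using CC_differentiable differentiable_imp_continuous_within 
  by (metis continuous_at_imp_continuous_on)

lemma poly_growthE:
  assumes "poly_growth f"
  obtains K N where "K \<ge> 0" "\<And>z. norm (f z) \<le> K * (1 + norm z) ^ N"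
proof -
  obtain K N where 1: "norm (f z) \<le> K * (1 + norm z) ^ N" for z 
    using assms unfolding poly_growth_def by blast
  from 1[of 0] have "norm (f 0) \<le> K" by simp
  then have "K \<ge> 0" using norm_ge_zero order_trans by blast
  then show ?thesis using 1 that by blast
qed

lemma one_norm_pow_mono: "N \<le> M \<Longrightarrow> (1 + norm z) ^ N \<le> (1 + norm z) ^ M" for z :: complex
  by (rule power_increasing) auto

lemma poly_growth_add: "poly_growth f \<Longrightarrow> poly_growth g \<Longrightarrow> poly_growth (\<lambda>z. f z + g z)"
proof -
  assume "poly_growth f" "poly_growth g"
  then obtain K N L M where *: "K \<ge> 0" "\<And>z. norm (f z) \<le> K * (1 + norm z) ^ N" "L \<ge> 0" "\<And>z. norm (g z) \<le> L * (1 + norm z) ^ M"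
    by (metis poly_growthE)
  have "norm (f z + g z) \<le> (K + L) * (1 + norm z) ^ (max N M)" for z
  proof -
    have "norm (f z) \<le> K * (1 + norm z) ^ (max N M)" "norm (g z) \<le> L * (1 + norm z) ^ (max N M)"
      using * one_norm_pow_mono[of N "max N M" z] one_norm_pow_mono[of M "max N M" z]
      by (meson max.cobounded1 max.cobounded2 mult_left_mono order_trans)+
    then show ?thesis using norm_triangle_ineq[of "f z" "g z"] by (simp add: distrib_right)
  qed
  then show ?thesis unfolding poly_growth_def by blast
qed

lemma poly_growth_mult: "poly_growth f \<Longrightarrow> poly_growth g \<Longrightarrow> poly_growth (\<lambda>z. f z * g z)"
proof -
  assume "poly_growth f" "poly_growth g"
  then obtain K N L M where *: "K \<ge> 0" "\<And>z. norm (f z) \<le> K * (1 + norm z) ^ N" "L \<ge> 0" "\<And>z. norm (g z) \<le> L * (1 + norm z) ^ M"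
    by (metis poly_growthE)
  have "norm (f z * g z) \<le> (K * L) * (1 + norm z) ^ (N + M)" for z
  proof -
    have "norm (f z) * norm (g z) \<le> (K * (1 + norm z) ^ N) * (L * (1 + norm z) ^ M)"
      using * by (intro mult_mono) auto
    then show ?thesis by (simp add: norm_mult power_add algebra_simps)
  qed
  then show ?thesis unfolding poly_growth_def by blast
qed

lemma poly_growth_linear: "bounded_linear m \<Longrightarrow> poly_growth (\<lambda>z. p + m z)"
proof -
  assume "bounded_linear m"
  then obtain K where K: "K \<ge> 0" "\<And>z. norm (m z) \<le> norm z * K"
    using bounded_linear.nonneg_bounded by blast
  have "norm (p + m z) \<le> (norm p + K) * (1 + norm z) ^ 1" for z
    using norm_triangle_ineq[of p "m z"] K by (simp add: algebra_simps) 
      (smt (verit) mult_nonneg_nonneg norm_ge_zero)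
  then show ?thesis unfolding poly_growth_def by blast
qed

lemma poly_growth_compose: 
  assumes "poly_growth f" "poly_growth m" 
  shows "poly_growth (\<lambda>z. f (m z))"
proof -
  obtain K N L M where *: "K \<ge> 0" "\<And>z. norm (f z) \<le> K * (1 + norm z) ^ N" "L \<ge> 0" "\<And>z. norm (m z) \<le> L * (1 + norm z) ^ M"
    using assms by (metis poly_growthE)
  have "norm (f (m z)) \<le> (K * (1 + L) ^ N) * (1 + norm z) ^ (M * N)" for z
  proof -
    have "1 + norm (m z) \<le> (1 + L) * (1 + norm z) ^ M"
    proof -
      have "1 \<le> (1 + norm z) ^ M" by (rule one_le_power) simp
      then show ?thesis using *(4)[of z] unfolding distrib_right mult_1_left by linarith
    qed
    then have "(1 + norm (m z)) ^ N \<le> ((1 + L) * (1 + norm z) ^ M) ^ N" by (rule power_mono) simp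
    then have "K * (1 + norm (m z)) ^ N \<le> K * ((1 + L) * (1 + norm z) ^ M) ^ N" using *(1) by (rule mult_left_mono)
    then show ?thesis using *(2)[of "m z"] by (simp add: power_mult_distrib power_mult mult.assoc)
  qed
  then show ?thesis unfolding poly_growth_def by blast
qed

lemma CC_lincomb:
  assumes "f \<in> CC" "g \<in> CC"
  shows "(\<lambda>z. a * f z + b * g z) \<in> CC"
proof (rule CC_coinduct[of _ "{h. \<exists>f\<in>CC. \<exists>g\<in>CC. h = (\<lambda>z. a * f z + b * g z)}"])
  have eq: "pd u (\<lambda>z. a * f z + b * g z) = (\<lambda>z. a * pd u f z + b * pd u g z)" if "f \<in> CC" "g \<in> CC" for f g u
  proof
    fix z
    have "((\<lambda>z. a * f z + b * g z) has_derivative (\<lambda>u. a * frechet_derivative f (at z) u + b * frechet_derivative g (at z) u)) (at z)"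
      using CC_differentiable[OF that(1)] CC_differentiable[OF that(2)] frechet_derivative_works
      by (auto intro!: derivative_eq_intros)
    from pd_eq[OF this] show "pd u (\<lambda>z. a * f z + b * g z) z = a * pd u f z + b * pd u g z" by (simp add: pd_def)
  qed
  show "pd 1 h \<in> {h. \<exists>f\<in>CC. \<exists>g\<in>CC. h = (\<lambda>z. a * f z + b * g z)}" 
    if "h \<in> {h. \<exists>f\<in>CC. \<exists>g\<in>CC. h = (\<lambda>z. a * f z + b * g z)}" for h
    using that eq CC_pd1 by blast
  show "pd \<i> h \<in> {h. \<exists>f\<in>CC. \<exists>g\<in>CC. h = (\<lambda>z. a * f z + b * g z)}" 
    if "h \<in> {h. \<exists>f\<in>CC. \<exists>g\<in>CC. h = (\<lambda>z. a * f z + b * g z)}" for h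
    using that eq CC_pdi by blast
  show "poly_growth h" if "h \<in> {h. \<exists>f\<in>CC. \<exists>g\<in>CC. h = (\<lambda>z. a * f z + b * g z)}" for h
  proof -
    have "poly_growth (\<lambda>z. a * f z)" if "f \<in> CC" for f a
      using poly_growth_mult[OF _ CC_growth[OF that], of "\<lambda>_. a"] poly_growth_linear[OF bounded_linear_zero, of a] by simp
    then show ?thesis using that poly_growth_add by blast
  qed
  show "h differentiable at z" if "h \<in> {h. \<exists>f\<in>CC. \<exists>g\<in>CC. h = (\<lambda>z. a * f z + b * g z)}" for h z
    using that CC_differentiable by (auto intro!: differentiable_add differentiable_mult)
qed (use assms in blast)

lemma CC_add: "f \<in> CC \<Longrightarrow> g \<in> CC \<Longrightarrow> (\<lambda>z. f z + g z) \<in> CC"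
  using CC_lincomb[of f g 1 1] by simp
lemma CC_diff: "f \<in> CC \<Longrightarrow> g \<in> CC \<Longrightarrow> (\<lambda>z. f z - g z) \<in> CC"
  using CC_lincomb[of f g 1 "- 1"] by simp
lemma CC_scale: "f \<in> CC \<Longrightarrow> (\<lambda>z. a * f z) \<in> CC"
  using CC_lincomb[of f f a 0] by simp

lemma CC_const: "(\<lambda>z. a) \<in> CC"
proof (rule CC_coinduct[of _ "range (\<lambda>a z. a)"])
  have pd: "pd u (\<lambda>z. a) = (\<lambda>z. 0)" for u a
    using pd_eq[OF has_derivative_const] by (intro ext)
  show "pd 1 f \<in> range (\<lambda>a z. a)" "pd \<i> f \<in> range (\<lambda>a z. a)" if "f \<in> range (\<lambda>a z. a)" for f
    using that pd by auto
  show "poly_growth f" if "f \<in> range (\<lambda>a z. a)" for f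
    using that poly_growth_linear[OF bounded_linear_zero] by auto
qed auto

lemma CC_sum: "(\<And>i. i \<in> I \<Longrightarrow> f i \<in> CC) \<Longrightarrow> (\<lambda>z. \<Sum>i\<in>I. f i z) \<in> CC"
  by (induction I rule: infinite_finite_induct) (auto intro: CC_const CC_add)

lemma pd_mult_linear:
  assumes "bounded_linear m" "f \<in> CC"
  shows "pd u (\<lambda>z. m z * f z) z = m u * f z + m z * pd u f z"
proof -
  interpret bounded_linear m by fact
  have "((\<lambda>z. m z * f z) has_derivative (\<lambda>u. m z * frechet_derivative f (at z) u + m u * f z)) (at z)"
    using CC_differentiable[OF assms(2)] frechet_derivative_works
    by (intro has_derivative_mult bounded_linear_imp_has_derivative assms(1)) blast
  from pd_eq[OF this] show ?thesis by (simp add: pd_def)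
qed

lemma bounded_linear_has_derivative: "bounded_linear m \<Longrightarrow> (m has_derivative m) F"
  by (rule bounded_linear_imp_has_derivative)

lemma pd_add: "f \<in> CC \<Longrightarrow> g \<in> CC \<Longrightarrow> pd u (\<lambda>z. f z + g z) z = pd u f z + pd u g z"
  and pd_diff: "f \<in> CC \<Longrightarrow> g \<in> CC \<Longrightarrow> pd u (\<lambda>z. f z - g z) z = pd u f z - pd u g z"
  and pd_scale: "f \<in> CC \<Longrightarrow> pd u (\<lambda>z. a * f z) z = a * pd u f z"
proof -
  show "f \<in> CC \<Longrightarrow> pd u (\<lambda>z. a * f z) z = a * pd u f z"
    using pd_eq[OF has_derivative_mult_right[OF frechet_derivative_works[THEN iffD1, OF CC_differentiable]]]
    by (simp add: pd_def)
  show "f \<in> CC \<Longrightarrow> g \<in> CC \<Longrightarrow> pd u (\<lambda>z. f z + g z) z = pd u f z + pd u g z"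
    using pd_eq[OF has_derivative_add[OF frechet_derivative_works[THEN iffD1, OF CC_differentiable] frechet_derivative_works[THEN iffD1, OF CC_differentiable]]]
    by (simp add: pd_def)
  show "f \<in> CC \<Longrightarrow> g \<in> CC \<Longrightarrow> pd u (\<lambda>z. f z - g z) z = pd u f z - pd u g z"
    using pd_eq[OF has_derivative_diff[OF frechet_derivative_works[THEN iffD1, OF CC_differentiable] frechet_derivative_works[THEN iffD1, OF CC_differentiable]]]
    by (simp add: pd_def)
qed

lemma CC_mult_linear:
  assumes m: "bounded_linear m" and "f \<in> CC"
  shows "(\<lambda>z. m z * f z) \<in> CC"
proof (rule CC_coinduct[of _ "{h. \<exists>f\<in>CC. \<exists>g\<in>CC. h = (\<lambda>z. m z * f z + g z)}"])
  let ?X = "{h. \<exists>f\<in>CC. \<exists>g\<in>CC. h = (\<lambda>z. m z * f z + g z)}"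
  have diff: "(\<lambda>z. m z * f z) differentiable at z" if "f \<in> CC" for f z
    using bounded_linear_imp_differentiable[OF m] CC_differentiable[OF that] by (intro differentiable_mult) auto
  have eq: "pd u (\<lambda>z. m z * f z + g z) = (\<lambda>z. m z * pd u f z + (m u * f z + pd u g z))" if "f \<in> CC" "g \<in> CC" for f g u
  proof
    fix z
    have "pd u (\<lambda>z. m z * f z + g z) z = pd u (\<lambda>z. m z * f z) z + pd u g z"
      using pd_eq[OF has_derivative_add[OF frechet_derivative_works[THEN iffD1, OF diff[OF that(1)]] frechet_derivative_works[THEN iffD1, OF CC_differentiable[OF that(2)]]]]
      by (simp add: pd_def)
    then show "pd u (\<lambda>z. m z * f z + g z) z = m z * pd u f z + (m u * f z + pd u g z)"
      using pd_mult_linear[OF m that(1)] by simp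
  qed
  have "pd u h \<in> ?X" if "h \<in> ?X" "u \<in> {1, \<i>}" for h u
  proof -
    obtain f g where fg: "f \<in> CC" "g \<in> CC" "h = (\<lambda>z. m z * f z + g z)" using \<open>h \<in> ?X\<close> by blast
    have "pd u f \<in> CC" "(\<lambda>z. m u * f z + pd u g z) \<in> CC" using fg that(2) by (auto intro!: CC_add CC_scale CC_pd)
    then show ?thesis unfolding fg(3) eq[OF fg(1,2)]
      by (intro CollectI bexI[of _ "pd u f"] bexI[of _ "\<lambda>z. m u * f z + pd u g z"] refl)
  qed
  then show "pd 1 h \<in> ?X" "pd \<i> h \<in> ?X" if "h \<in> ?X" for h using that by auto
  show "poly_growth h" if "h \<in> ?X" for h
    using that poly_growth_add poly_growth_mult poly_growth_linear[OF m, of 0] CC_growth by fastforce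
  show "h differentiable at z" if "h \<in> ?X" for h z
    using that diff CC_differentiable by (auto intro!: differentiable_add)
  show "(\<lambda>z. m z * f z) \<in> ?X"
    by (intro CollectI bexI[of _ f] bexI[of _ "\<lambda>z. 0"] assms(2) CC_const) simp
qed

lemma bounded_linear_refl: "bounded_linear (reflection v)"
proof -
  have "bounded_linear (\<lambda>z. - (v\<^sup>2) * cnj z)"
    by (rule bounded_linear_compose[OF bounded_linear_mult_right bounded_linear_cnj])
  then show ?thesis unfolding reflection_def .
qed

lemma pd_compose:
  assumes m: "bounded_linear m" and "f \<in> CC"
  shows "pd u (\<lambda>z. f (p + m z)) z = Re (m u) *\<^sub>R pd 1 f (p + m z) + Im (m u) *\<^sub>R pd \<i> f (p + m z)"
    "(\<lambda>z. f (p + m z)) differentiable (at z)"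
proof -
  interpret bounded_linear m by fact
  have "((\<lambda>z. p + m z) has_derivative m) (at z)"
    using has_derivative_add[OF has_derivative_const bounded_linear_has_derivative[OF m]] by simp
  from has_derivative_compose[OF this CC_deriv[OF assms(2)]]
  have "((\<lambda>z. f (p + m z)) has_derivative (\<lambda>u. Re (m u) *\<^sub>R pd 1 f (p + m z) + Im (m u) *\<^sub>R pd \<i> f (p + m z))) (at z)" .
  then show "pd u (\<lambda>z. f (p + m z)) z = Re (m u) *\<^sub>R pd 1 f (p + m z) + Im (m u) *\<^sub>R pd \<i> f (p + m z)"
    "(\<lambda>z. f (p + m z)) differentiable (at z)"
    using pd_eq differentiableI by blast+
qed

lemma CC_compose:
  assumes m: "bounded_linear m" and "f \<in> CC"
  shows "(\<lambda>z. f (p + m z)) \<in> CC"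
proof (rule CC_coinduct[of _ "{h. \<exists>f\<in>CC. h = (\<lambda>z. f (p + m z))}"])
  let ?X = "{h. \<exists>f\<in>CC. h = (\<lambda>z. f (p + m z))}"
  have "pd u h \<in> ?X" if "h \<in> ?X" for h u
  proof -
    obtain f where f: "f \<in> CC" "h = (\<lambda>z. f (p + m z))" using \<open>h \<in> ?X\<close> by blast
    let ?g = "\<lambda>z. of_real (Re (m u)) * pd 1 f z + of_real (Im (m u)) * pd \<i> f z"
    have "?g \<in> CC" by (intro CC_lincomb CC_pd1 CC_pdi f)
    moreover have "pd u h = (\<lambda>z. ?g (p + m z))" unfolding f(2) using pd_compose(1)[OF m f(1)] 
      by (intro ext) (simp add: scaleR_conv_of_real)
    ultimately show ?thesis by (intro CollectI bexI[of _ ?g])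
  qed
  then show "pd 1 h \<in> ?X" "pd \<i> h \<in> ?X" if "h \<in> ?X" for h using that by auto
  show "poly_growth h" if "h \<in> ?X" for h
    using that poly_growth_compose[OF CC_growth poly_growth_linear[OF m]] by auto
  show "h differentiable at z" if "h \<in> ?X" for h z
    using that pd_compose(2)[OF m] by auto
qed (use assms in blast)

lemma CC_compose_linear: "bounded_linear m \<Longrightarrow> f \<in> CC \<Longrightarrow> (\<lambda>z. f (m z)) \<in> CC"
  using CC_compose[of m f 0] by simp

section \<open>Averages along segments\<close>

text \<open>
  The point that divides the segment from \<open>p + m z\<close> to \<open>z\<close>. In the applications \<open>p + m z\<close> is either the mirror
  image of \<open>z\<close> or a fixed point.
\<close>

definition seg :: "complex \<Rightarrow> (complex \<Rightarrow> complex) \<Rightarrow> real \<Rightarrow> complex \<Rightarrow> complex" where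
  "seg p m t z = (1 - t) *\<^sub>R (p + m z) + t *\<^sub>R z"

definition segl :: "(complex \<Rightarrow> complex) \<Rightarrow> real \<Rightarrow> complex \<Rightarrow> complex" where
  "segl m t u = (1 - t) *\<^sub>R m u + t *\<^sub>R u"

text \<open>
  The integrands that arise from \<open>f (seg p m t z)\<close> by differentiation with respect to \<open>z\<close>: the chain rule
  produces factors that depend continuously on \<open>t\<close> only.
\<close>

inductive_set segfun :: "complex \<Rightarrow> (complex \<Rightarrow> complex) \<Rightarrow> (real \<Rightarrow> complex \<Rightarrow> complex) set" for p m where
  base: "continuous_on UNIV q \<Longrightarrow> f \<in> CC \<Longrightarrow> (\<lambda>t z. q t *\<^sub>R f (seg p m t z)) \<in> segfun p m"
| add: "\<phi> \<in> segfun p m \<Longrightarrow> \<psi> \<in> segfun p m \<Longrightarrow> (\<lambda>t z. \<phi> t z + \<psi> t z) \<in> segfun p m"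

lemma segl_bounded_linear: "bounded_linear m \<Longrightarrow> bounded_linear (segl m t)"
  unfolding segl_def
  by (intro bounded_linear_add bounded_linear_const_scaleR bounded_linear_ident)

lemma seg_eq: "seg p m t z = (1 - t) *\<^sub>R p + segl m t z"
  by (simp add: seg_def segl_def algebra_simps)

lemma segfun_continuous:
  assumes "\<phi> \<in> segfun p m" "bounded_linear m"
  shows "continuous_on A (\<lambda>(z, t). \<phi> t z)"
  using assms(1)
proof (induction rule: segfun.induct)
  case (base q f)
  have "continuous_on A (\<lambda>x. m (fst x))"
    by (intro bounded_linear.continuous_on[OF assms(2)] continuous_intros)
  then have "continuous_on A (\<lambda>x. seg p m (snd x) (fst x))"
    unfolding seg_def by (intro continuous_intros)
  then have "continuous_on A (\<lambda>x. f (seg p m (snd x) (fst x)))"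
    by (rule continuous_on_compose2[OF CC_continuous[OF base(2), of UNIV]]) auto
  moreover have "continuous_on A (\<lambda>x. q (snd x))"
    by (rule continuous_on_compose2[OF base(1)]) (auto intro: continuous_intros)
  ultimately show ?case unfolding split_beta by (intro continuous_intros)
next
  case (add \<phi> \<psi>)
  then show ?case unfolding split_beta by (intro continuous_intros)
qed

lemma segfun_derivative:
  assumes "\<phi> \<in> segfun p m" "bounded_linear m"
  shows "\<exists>\<phi>1\<in>segfun p m. \<exists>\<phi>2\<in>segfun p m. \<forall>t z. (\<phi> t has_derivative (\<lambda>u. Re u *\<^sub>R \<phi>1 t z + Im u *\<^sub>R \<phi>2 t z)) (at z)"
  using assms(1)
proof (induction rule: segfun.induct)
  case (base q f)
  define D where "D u = (\<lambda>t z. (q t * Re (segl m t u)) *\<^sub>R pd 1 f (seg p m t z) + (q t * Im (segl m t u)) *\<^sub>R pd \<i> f (seg p m t z))" for u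
  have cont: "continuous_on UNIV (\<lambda>t. q t * Re (segl m t u))" "continuous_on UNIV (\<lambda>t. q t * Im (segl m t u))" for u
    unfolding segl_def by (intro continuous_intros base(1))+
  have D: "D u \<in> segfun p m" for u
    unfolding D_def by (intro segfun.intros cont CC_pd1 CC_pdi base(2))
  have "((\<lambda>z. q t *\<^sub>R f (seg p m t z)) has_derivative (\<lambda>u. Re u *\<^sub>R D 1 t z + Im u *\<^sub>R D \<i> t z)) (at z)" for t z
  proof -
    interpret L: bounded_linear "segl m t" by (rule segl_bounded_linear[OF assms(2)])
    have "((\<lambda>z. (1 - t) *\<^sub>R p + segl m t z) has_derivative segl m t) (at z)"
      using has_derivative_add[OF has_derivative_const bounded_linear_has_derivative[OF L.bounded_linear_axioms]] by simp
    then have "((\<lambda>z. seg p m t z) has_derivative segl m t) (at z)" by (simp add: seg_eq)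
    from has_derivative_scaleR_right[OF has_derivative_compose[OF this CC_deriv[OF base(2)]], of "q t"]
    have hd: "((\<lambda>z. q t *\<^sub>R f (seg p m t z)) has_derivative (\<lambda>u. q t *\<^sub>R (Re (segl m t u) *\<^sub>R pd 1 f (seg p m t z) + Im (segl m t u) *\<^sub>R pd \<i> f (seg p m t z)))) (at z)" .
    have e: "segl m t u = Re u *\<^sub>R segl m t 1 + Im u *\<^sub>R segl m t \<i>" for u
    proof -
      have "u = Re u *\<^sub>R 1 + Im u *\<^sub>R \<i>" by (simp add: complex_eq_iff)
      from arg_cong[OF this, of "segl m t"] show ?thesis by (simp only: L.add L.scaleR)
    qed
    have ReIm: "Re (segl m t u) = Re u * Re (segl m t 1) + Im u * Re (segl m t \<i>)" 
      "Im (segl m t u) = Re u * Im (segl m t 1) + Im u * Im (segl m t \<i>)" for u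
      by (subst e, simp)+
    have eqn: "(\<lambda>u. q t *\<^sub>R (Re (segl m t u) *\<^sub>R pd 1 f (seg p m t z) + Im (segl m t u) *\<^sub>R pd \<i> f (seg p m t z))) =
       (\<lambda>u. Re u *\<^sub>R D 1 t z + Im u *\<^sub>R D \<i> t z)"
    proof
      fix u
      have "q t *\<^sub>R ((Re u * a + Im u * b) *\<^sub>R x + (Re u * a' + Im u * b') *\<^sub>R y) =
          Re u *\<^sub>R ((q t * a) *\<^sub>R x + (q t * a') *\<^sub>R y) + Im u *\<^sub>R ((q t * b) *\<^sub>R x + (q t * b') *\<^sub>R y)" 
        for a b a' b' :: real and x y :: complex
        by (simp add: algebra_simps)
      then show "q t *\<^sub>R (Re (segl m t u) *\<^sub>R pd 1 f (seg p m t z) + Im (segl m t u) *\<^sub>R pd \<i> f (seg p m t z)) =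
          Re u *\<^sub>R D 1 t z + Im u *\<^sub>R D \<i> t z"
        unfolding D_def ReIm[of u] .
    qed
    show ?thesis using hd unfolding eqn .
  qed
  then show ?case using D by blast
next
  case (add \<phi> \<psi>)
  then obtain \<phi>1 \<phi>2 \<psi>1 \<psi>2 where *: "\<phi>1 \<in> segfun p m" "\<phi>2 \<in> segfun p m" "\<psi>1 \<in> segfun p m" "\<psi>2 \<in> segfun p m"
    and d: "\<And>t z. (\<phi> t has_derivative (\<lambda>u. Re u *\<^sub>R \<phi>1 t z + Im u *\<^sub>R \<phi>2 t z)) (at z)"
     "\<And>t z. (\<psi> t has_derivative (\<lambda>u. Re u *\<^sub>R \<psi>1 t z + Im u *\<^sub>R \<psi>2 t z)) (at z)" by blast
  have "((\<lambda>z. \<phi> t z + \<psi> t z) has_derivative (\<lambda>u. Re u *\<^sub>R (\<phi>1 t z + \<psi>1 t z) + Im u *\<^sub>R (\<phi>2 t z + \<psi>2 t z))) (at z)" for t z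
    using has_derivative_add[OF d(1)[of t z] d(2)[of t z]]
    by (rule has_derivative_eq_rhs) (rule ext, simp add: scaleR_add_right)
  then show ?case
    by (intro bexI[OF bexI[OF _ segfun.add[OF *(2,4)]] segfun.add[OF *(1,3)]] allI)
qed

lemma segfun_growth:
  assumes "\<phi> \<in> segfun p m" "bounded_linear m"
  shows "\<exists>K N. \<forall>t\<in>{0..1}. \<forall>z. norm (\<phi> t z) \<le> K * (1 + norm z) ^ N"
  using assms(1)
proof (induction rule: segfun.induct)
  case (base q f)
  have "bounded (q ` {0..1})"
    by (intro compact_imp_bounded compact_continuous_image continuous_on_subset[OF base(1)]) auto
  then obtain Q where "\<forall>y\<in>q ` {0..1}. norm y \<le> Q" unfolding bounded_iff by blast
  then have Q: "\<And>t. t \<in> {0..1} \<Longrightarrow> norm (q t) \<le> Q" by blast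
  have "norm (q 0) \<le> Q" by (rule Q) simp
  then have Q0: "Q \<ge> 0" using norm_ge_zero order_trans by blast
  obtain K N where K: "K \<ge> 0" "\<And>z. norm (f z) \<le> K * (1 + norm z) ^ N" using poly_growthE[OF CC_growth[OF base(2)]] by blast
  obtain L M where L: "L \<ge> 0" "\<And>z. norm (p + m z) \<le> L * (1 + norm z) ^ M" using poly_growthE[OF poly_growth_linear[OF assms(2)]] by blast
  have "norm (q t *\<^sub>R f (seg p m t z)) \<le> (Q * (K * (L + 2) ^ N)) * (1 + norm z) ^ (Suc M * N)" if t: "t \<in> {0..1}" for t z
  proof -
    let ?r = "1 + norm z"
    have r: "?r ^ M \<le> ?r ^ Suc M" "1 \<le> ?r ^ Suc M" "norm z \<le> ?r ^ Suc M"
      using one_norm_pow_mono[of M "Suc M" z] one_norm_pow_mono[of 0 "Suc M" z] one_norm_pow_mono[of 1 "Suc M" z] by auto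
    have "norm (seg p m t z) \<le> (1 - t) * norm (p + m z) + t * norm z"
      unfolding seg_def using t by (intro order_trans[OF norm_triangle_ineq]) simp
    also have "\<dots> \<le> 1 * norm (p + m z) + 1 * norm z" using t by (intro add_mono mult_right_mono) auto
    also have "\<dots> \<le> L * ?r ^ Suc M + ?r ^ Suc M" 
      using L(2)[of z] r mult_left_mono[OF r(1) L(1)] by linarith
    finally have "1 + norm (seg p m t z) \<le> (L + 2) * ?r ^ Suc M" using r(2) unfolding distrib_right by linarith
    then have "(1 + norm (seg p m t z)) ^ N \<le> ((L + 2) * ?r ^ Suc M) ^ N" by (intro power_mono) auto
    then have "norm (f (seg p m t z)) \<le> K * ((L + 2) * ?r ^ Suc M) ^ N"
      using K(2)[of "seg p m t z"] mult_left_mono[OF _ K(1)] order_trans by blast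
    then have "norm (q t) * norm (f (seg p m t z)) \<le> Q * (K * ((L + 2) * ?r ^ Suc M) ^ N)"
      using Q[OF t] Q0 by (intro mult_mono) auto
    also have "Q * (K * ((L + 2) * ?r ^ Suc M) ^ N) = (Q * (K * (L + 2) ^ N)) * ?r ^ (Suc M * N)"
      by (simp only: power_mult_distrib power_mult mult.assoc)
    finally show ?thesis by (simp only: norm_scaleR real_norm_def)
  qed
  then show ?case by blast
next
  case (add \<phi> \<psi>)
  then obtain K N L M where *: "\<And>t z. t \<in> {0..1} \<Longrightarrow> norm (\<phi> t z) \<le> K * (1 + norm z) ^ N" "\<And>t z. t \<in> {0..1} \<Longrightarrow> norm (\<psi> t z) \<le> L * (1 + norm z) ^ M" by blast
  have "norm (\<phi> 0 0) \<le> K" "norm (\<psi> 0 0) \<le> L" using *(1)[of 0 0] *(2)[of 0 0] by simp_all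
  then have KL: "K \<ge> 0" "L \<ge> 0" using norm_ge_zero order_trans by blast+
  have "norm (\<phi> t z + \<psi> t z) \<le> (K + L) * (1 + norm z) ^ (max N M)" if t: "t \<in> {0..1}" for t z
  proof -
    have "norm (\<phi> t z) \<le> K * (1 + norm z) ^ (max N M)" "norm (\<psi> t z) \<le> L * (1 + norm z) ^ (max N M)"
      using *[OF t] KL one_norm_pow_mono[of N "max N M" z] one_norm_pow_mono[of M "max N M" z]
      by (meson max.cobounded1 max.cobounded2 mult_left_mono order_trans)+
    then show ?thesis using norm_triangle_ineq[of "\<phi> t z" "\<psi> t z"] by (simp add: distrib_right)
  qed
  then show ?case by blast
qed

lemma segfun_continuous_t:
  assumes "\<phi> \<in> segfun p m" "bounded_linear m"
  shows "continuous_on {0..1} (\<lambda>t. \<phi> t z)"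
proof -
  have "continuous_on {0..1} (\<lambda>t :: real. (z, t))"
    by (rule continuous_on_Pair[OF continuous_on_const continuous_on_id])
  from continuous_on_compose[OF this segfun_continuous[OF assms]] show ?thesis by (simp add: o_def)
qed

definition blin :: "complex \<Rightarrow> complex \<Rightarrow> complex \<Rightarrow>\<^sub>L complex" where
  "blin a b = ((blinfun_scaleR_left a :: real \<Rightarrow>\<^sub>L complex) o\<^sub>L (Blinfun Re :: complex \<Rightarrow>\<^sub>L real))
    + ((blinfun_scaleR_left b :: real \<Rightarrow>\<^sub>L complex) o\<^sub>L (Blinfun Im :: complex \<Rightarrow>\<^sub>L real))"

lemma blin_apply: "blinfun_apply (blin a b) u = Re u *\<^sub>R a + Im u *\<^sub>R b"
  by (simp add: blin_def plus_blinfun.rep_eq bounded_linear_Blinfun_apply bounded_linear_Re bounded_linear_Im)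

lemma segfun_integral_derivative:
  assumes "\<phi> \<in> segfun p m" "\<phi>1 \<in> segfun p m" "\<phi>2 \<in> segfun p m" and m: "bounded_linear m"
    and d: "\<And>t z. (\<phi> t has_derivative (\<lambda>u. Re u *\<^sub>R \<phi>1 t z + Im u *\<^sub>R \<phi>2 t z)) (at z)"
  shows "((\<lambda>z. integral {0..1} (\<lambda>t. \<phi> t z)) has_derivative 
    (\<lambda>u. Re u *\<^sub>R integral {0..1} (\<lambda>t. \<phi>1 t z) + Im u *\<^sub>R integral {0..1} (\<lambda>t. \<phi>2 t z))) (at z)"
proof -
  have ct: "continuous_on {0..1} (\<lambda>t. \<xi> t z)" if "\<xi> \<in> segfun p m" for \<xi> z
    by (rule segfun_continuous_t[OF that m])
  have int: "(\<lambda>t. \<xi> t z) integrable_on {0..1}" if "\<xi> \<in> segfun p m" for \<xi> z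
    by (rule integrable_continuous_real[OF ct[OF that]])
  have cb: "continuous_on A (\<lambda>(z, t). blin (\<phi>1 t z) (\<phi>2 t z))" for A
    unfolding blin_def split_beta
    using segfun_continuous[OF assms(2) m, of A] segfun_continuous[OF assms(3) m, of A] unfolding split_beta
    by (intro continuous_intros bounded_bilinear.continuous_on[OF bounded_bilinear_blinfun_compose])
  have "((\<lambda>z. integral (cbox 0 1) (\<lambda>t. \<phi> t z)) has_derivative 
      blinfun_apply (integral (cbox 0 1) (\<lambda>t. blin (\<phi>1 t z) (\<phi>2 t z)))) (at z within UNIV)"
  proof (rule leibniz_rule[where fx = "\<lambda>z t. blin (\<phi>1 t z) (\<phi>2 t z)"])
    show "((\<lambda>z. \<phi> t z) has_derivative blinfun_apply (blin (\<phi>1 t z) (\<phi>2 t z))) (at z within UNIV)" for z t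
      using d[of t z] by (simp add: blin_apply[abs_def])
    show "(\<lambda>t. \<phi> t z) integrable_on cbox 0 1" for z using int[OF assms(1)] by simp
  qed (use cb in auto)
  then have "((\<lambda>z. integral {0..1} (\<lambda>t. \<phi> t z)) has_derivative
      blinfun_apply (integral {0..1} (\<lambda>t. blin (\<phi>1 t z) (\<phi>2 t z)))) (at z)"
    by (simp only: cbox_interval)
  moreover have "blinfun_apply (integral {0..1} (\<lambda>t. blin (\<phi>1 t z) (\<phi>2 t z))) = 
      (\<lambda>u. Re u *\<^sub>R integral {0..1} (\<lambda>t. \<phi>1 t z) + Im u *\<^sub>R integral {0..1} (\<lambda>t. \<phi>2 t z))"
  proof
    fix u
    have "continuous_on {0..1} (\<lambda>t :: real. (z, t))"
      by (rule continuous_on_Pair[OF continuous_on_const continuous_on_id])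
    from continuous_on_compose[OF this cb] have "continuous_on {0..1} (\<lambda>t. blin (\<phi>1 t z) (\<phi>2 t z))"
      by (simp add: o_def)
    then have "(\<lambda>t. blin (\<phi>1 t z) (\<phi>2 t z)) integrable_on {0..1}" by (rule integrable_continuous_real)
    then have "blinfun_apply (integral {0..1} (\<lambda>t. blin (\<phi>1 t z) (\<phi>2 t z))) u = 
        integral {0..1} (\<lambda>t. Re u *\<^sub>R \<phi>1 t z + Im u *\<^sub>R \<phi>2 t z)"
      by (simp add: blinfun_apply_integral blin_apply)
    also have "\<dots> = Re u *\<^sub>R integral {0..1} (\<lambda>t. \<phi>1 t z) + Im u *\<^sub>R integral {0..1} (\<lambda>t. \<phi>2 t z)"
      by (subst integral_add) (intro integrable_cmul int assms, intro integrable_cmul int assms, simp)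
    finally show "blinfun_apply (integral {0..1} (\<lambda>t. blin (\<phi>1 t z) (\<phi>2 t z))) u = 
      Re u *\<^sub>R integral {0..1} (\<lambda>t. \<phi>1 t z) + Im u *\<^sub>R integral {0..1} (\<lambda>t. \<phi>2 t z)" .
  qed
  ultimately show ?thesis by (simp only:)
qed

lemma CC_segfun:
  assumes "\<phi> \<in> segfun p m" and m: "bounded_linear m"
  shows "(\<lambda>z. integral {0..1} (\<lambda>t. \<phi> t z)) \<in> CC"
proof (rule CC_coinduct[of _ "(\<lambda>\<phi> z. integral {0..1} (\<lambda>t. \<phi> t z)) ` segfun p m"])
  let ?X = "(\<lambda>\<phi> z. integral {0..1} (\<lambda>t. \<phi> t z)) ` segfun p m"
  have *: "\<exists>g1\<in>?X. \<exists>g2\<in>?X. \<forall>z. (h has_derivative (\<lambda>u. Re u *\<^sub>R g1 z + Im u *\<^sub>R g2 z)) (at z)" if "h \<in> ?X" for h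
  proof -
    obtain \<phi> where \<phi>: "\<phi> \<in> segfun p m" "h = (\<lambda>z. integral {0..1} (\<lambda>t. \<phi> t z))" using \<open>h \<in> ?X\<close> by blast
    obtain \<phi>1 \<phi>2 where 1: "\<phi>1 \<in> segfun p m" "\<phi>2 \<in> segfun p m" 
      "\<And>t z. (\<phi> t has_derivative (\<lambda>u. Re u *\<^sub>R \<phi>1 t z + Im u *\<^sub>R \<phi>2 t z)) (at z)" using segfun_derivative[OF \<phi>(1) m] by blast
    show ?thesis unfolding \<phi>(2)
      by (rule bexI[of _ "\<lambda>z. integral {0..1} (\<lambda>t. \<phi>1 t z)"], rule bexI[of _ "\<lambda>z. integral {0..1} (\<lambda>t. \<phi>2 t z)"],
          rule allI, rule segfun_integral_derivative[OF \<phi>(1) 1(1,2) m 1(3)]) (use 1 in auto)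
  qed
  show "h differentiable at z" if "h \<in> ?X" for h z using *[OF that] differentiableI by blast
  have pd: "pd 1 h \<in> ?X \<and> pd \<i> h \<in> ?X" if h: "h \<in> ?X" for h
  proof -
    obtain g1 g2 where g: "g1 \<in> ?X" "g2 \<in> ?X" "\<And>z. (h has_derivative (\<lambda>u. Re u *\<^sub>R g1 z + Im u *\<^sub>R g2 z)) (at z)"
      using *[OF h] by blast
    have "pd 1 h = g1" "pd \<i> h = g2" using pd_eq[OF g(3)] by (auto intro!: ext)
    then show ?thesis using g by simp
  qed
  show "pd 1 h \<in> ?X" "pd \<i> h \<in> ?X" if "h \<in> ?X" for h using pd[OF that] by auto
  show "poly_growth h" if "h \<in> ?X" for h
  proof -
    obtain \<phi> where \<phi>: "\<phi> \<in> segfun p m" "h = (\<lambda>z. integral {0..1} (\<lambda>t. \<phi> t z))" using \<open>h \<in> ?X\<close> by blast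
    obtain K N where K: "\<And>t z. t \<in> {0..1} \<Longrightarrow> norm (\<phi> t z) \<le> K * (1 + norm z) ^ N" using segfun_growth[OF \<phi>(1) m] by blast
    have "norm (h z) \<le> K * (1 + norm z) ^ N" for z
    proof -
      have "continuous_on {0..1} (\<lambda>t. \<phi> t z)"
        by (rule segfun_continuous_t[OF \<phi>(1) m])
      then have "(\<lambda>t. \<phi> t z) integrable_on {0..1}" by (rule integrable_continuous_real)
      from integral_norm_bound_integral[OF this, of "\<lambda>t. K * (1 + norm z) ^ N"] K
      show ?thesis unfolding \<phi>(2) by (simp add: integrable_const_ivl)
    qed
    then show ?thesis unfolding poly_growth_def by blast
  qed
qed (use assms in blast)

text \<open>
  The fundamental theorem of calculus along the segment from \<open>p + m z\<close> to \<open>z\<close>. For a reflection it shows that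
  the difference quotients of the Dunkl operators are smooth, and for a constant it is the usual
  Hadamard lemma.
\<close>

lemma hadamard:
  assumes f: "f \<in> CC" and m: "bounded_linear m"
  shows "\<exists>f1\<in>CC. \<exists>f2\<in>CC. \<forall>z. f z - f (p + m z) = Re (z - (p + m z)) *\<^sub>R f1 z + Im (z - (p + m z)) *\<^sub>R f2 z"
proof -
  let ?I = "\<lambda>g z. integral {0..1} (\<lambda>t. 1 *\<^sub>R g (seg p m t z))"
  have I: "?I g \<in> CC" if "g \<in> CC" for g
    by (rule CC_segfun[OF segfun.base[OF continuous_on_const that] m])
  have "f z - f (p + m z) = Re (z - (p + m z)) *\<^sub>R ?I (pd 1 f) z + Im (z - (p + m z)) *\<^sub>R ?I (pd \<i> f) z" for z
  proof -
    define w where "w = z - (p + m z)"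
    have seg: "seg p m t z = (p + m z) + t *\<^sub>R w" for t by (simp add: seg_def w_def algebra_simps)
    have "((\<lambda>t. f (seg p m t z)) has_vector_derivative Re w *\<^sub>R pd 1 f (seg p m t z) + Im w *\<^sub>R pd \<i> f (seg p m t z)) (at t within {0..1})" for t
    proof -
      have "((\<lambda>t. seg p m t z) has_derivative (\<lambda>s. s *\<^sub>R w)) (at t within {0..1})"
        unfolding seg by (auto intro!: derivative_eq_intros)
      from has_derivative_compose[OF this CC_deriv[OF f]]
      show ?thesis unfolding has_vector_derivative_def by (simp add: algebra_simps)
    qed
    then have "((\<lambda>t. Re w *\<^sub>R pd 1 f (seg p m t z) + Im w *\<^sub>R pd \<i> f (seg p m t z)) has_integral f (seg p m 1 z) - f (seg p m 0 z)) {0..1}"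
      by (intro fundamental_theorem_of_calculus) auto
    moreover have "seg p m 1 z = z" "seg p m 0 z = p + m z" by (simp_all add: seg_def)
    ultimately have "f z - f (p + m z) = integral {0..1} (\<lambda>t. Re w *\<^sub>R pd 1 f (seg p m t z) + Im w *\<^sub>R pd \<i> f (seg p m t z))"
      by (simp add: integral_unique)
    moreover have int: "(\<lambda>t. g (seg p m t z)) integrable_on {0..1}" if "g \<in> CC" for g
      by (rule integrable_continuous_real, rule continuous_on_compose2[OF CC_continuous[OF that, of UNIV]])
         (auto simp: seg intro!: continuous_intros)
    ultimately show ?thesis using int[OF CC_pd1[OF f]] int[OF CC_pdi[OF f]]
      by (simp add: integral_add integrable_cmul w_def[symmetric])
  qed
  then show ?thesis
    by (intro bexI[OF _ I[OF CC_pd1[OF f]]] bexI[OF _ I[OF CC_pdi[OF f]]] allI)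
qed

section \<open>Difference quotients of reflections\<close>

definition den :: "complex \<Rightarrow> complex \<Rightarrow> complex" where
  "den v w = w * cnj v + cnj w * v"

lemma den_real: "den v w = of_real (2 * Re (w * cnj v))"
proof -
  have "cnj w * v = cnj (w * cnj v)" by simp
  then show ?thesis unfolding den_def using complex_add_cnj[of "w * cnj v"] by simp
qed

lemma bounded_linear_den: "bounded_linear (den v)"
  unfolding den_def by (intro bounded_linear_add bounded_linear_mult_left
    bounded_linear_compose[OF bounded_linear_mult_left bounded_linear_cnj])

lemma norm_one_cnj: "norm v = 1 \<Longrightarrow> v * cnj v = 1"
  using complex_norm_square[of v] by simp

lemma sub_reflection: "norm v = 1 \<Longrightarrow> z - reflection v z = v * den v z"
proof -
  assume "norm v = 1"
  then have "v * cnj v = 1" by (rule norm_one_cnj)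
  moreover have "v * den v z = (v * cnj v) * z + v\<^sup>2 * cnj z"
    by (simp add: den_def power2_eq_square algebra_simps)
  ultimately show ?thesis by (simp add: reflection_def)
qed

text \<open>
  The mirror has a dense complement, so a continuous quotient is unique and coincides with the extension
  by limits. Identities between difference quotients are proved by multiplying with \<open>den v\<close>.
\<close>

lemma refl_quot_unique:
  assumes v: "norm v = 1" and g: "continuous_on UNIV g" and eq: "\<And>z. g z * den v z = f z - f (reflection v z)"
  shows "refl_quot v f = g"
proof
  fix z
  let ?q = "\<lambda>w. (f w - f (reflection v w)) / den v w"
  let ?A = "{w. den v w \<noteq> 0}"
  have q: "?q w = g w" if "den v w \<noteq> 0" for w
    using eq[of w] that by (simp add: field_simps)
  have def: "refl_quot v f z = (if den v z \<noteq> 0 then ?q z else Lim (at z within ?A) ?q)"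
    by (simp add: refl_quot_def den_def Let_def)
  show "refl_quot v f z = g z"
  proof (cases "den v z = 0")
    case False
    then show ?thesis using q def by simp
  next
    case True
    have "z islimpt ?A" unfolding islimpt_approachable
    proof (intro allI impI)
      fix e :: real assume e: "e > 0"
      let ?w = "z + of_real (e / 2) * v"
      have "den v ?w = den v z + of_real e * (v * cnj v)" by (simp add: den_def algebra_simps)
      then have "den v ?w \<noteq> 0" using True norm_one_cnj[OF v] e by simp
      moreover have "dist ?w z = e / 2" using v e by (simp add: dist_norm norm_mult)
      ultimately show "\<exists>x'\<in>?A. x' \<noteq> z \<and> dist x' z < e" using e by (intro bexI[of _ ?w]) auto
    qed
    then have nt: "\<not> trivial_limit (at z within ?A)" using trivial_limit_within by blast
    have "(g \<longlongrightarrow> g z) (at z within ?A)"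
      using g continuous_on_eq_continuous_within[of UNIV g] continuous_within tendsto_within_subset by blast
    moreover have "eventually (\<lambda>w. g w = ?q w) (at z within ?A)"
      unfolding eventually_at using q by (intro exI[of _ 1]) auto
    ultimately have "(?q \<longlongrightarrow> g z) (at z within ?A)" by (rule Lim_transform_eventually)
    then have "Lim (at z within ?A) ?q = g z" using nt by (rule tendsto_Lim[rotated])
    then show ?thesis using def True by simp
  qed
qed

lemma refl_quot_exists:
  assumes v: "norm v = 1" and f: "f \<in> CC"
  shows "\<exists>g\<in>CC. \<forall>z. g z * den v z = f z - f (reflection v z)"
proof -
  obtain f1 f2 where 1: "f1 \<in> CC" "f2 \<in> CC" and
    h: "\<And>z. f z - f (0 + reflection v z) = Re (z - (0 + reflection v z)) *\<^sub>R f1 z + Im (z - (0 + reflection v z)) *\<^sub>R f2 z"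
    using hadamard[OF f bounded_linear_refl[of v], of 0] by blast
  let ?g = "\<lambda>z. of_real (Re v) * f1 z + of_real (Im v) * f2 z"
  have "?g z * den v z = f z - f (reflection v z)" for z
  proof -
    have "Re (v * den v z) = Re v * (2 * Re (z * cnj v))" "Im (v * den v z) = Im v * (2 * Re (z * cnj v))"
      unfolding den_real by simp_all
    then show ?thesis using h[of z] unfolding add_0_left sub_reflection[OF v] 
      by (simp only: scaleR_conv_of_real of_real_mult den_real) (simp add: algebra_simps)
  qed
  then show ?thesis by (intro bexI[of _ ?g] allI CC_lincomb 1)
qed

lemma refl_quot_CC: "norm v = 1 \<Longrightarrow> f \<in> CC \<Longrightarrow> refl_quot v f \<in> CC"
  and refl_quot_den: "norm v = 1 \<Longrightarrow> f \<in> CC \<Longrightarrow> refl_quot v f z * den v z = f z - f (reflection v z)"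
proof -
  assume v: "norm v = 1" and f: "f \<in> CC"
  obtain g where g: "g \<in> CC" "\<And>z. g z * den v z = f z - f (reflection v z)"
    using refl_quot_exists[OF v f] by blast
  have "refl_quot v f = g" by (rule refl_quot_unique[OF v CC_continuous[OF g(1)] g(2)])
  then show "refl_quot v f \<in> CC" "refl_quot v f z * den v z = f z - f (reflection v z)" using g by auto
qed

lemma refl_quot_lincomb:
  assumes v: "norm v = 1" and f: "f \<in> CC" "g \<in> CC"
  shows "refl_quot v (\<lambda>z. a * f z + b * g z) = (\<lambda>z. a * refl_quot v f z + b * refl_quot v g z)"
proof (rule refl_quot_unique[OF v])
  show "continuous_on UNIV (\<lambda>z. a * refl_quot v f z + b * refl_quot v g z)"
    using refl_quot_CC[OF v] f by (intro CC_continuous CC_lincomb)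
  show "(a * refl_quot v f z + b * refl_quot v g z) * den v z =
      a * f z + b * g z - (a * f (reflection v z) + b * g (reflection v z))" for z
    using refl_quot_den[OF v f(1), of z] refl_quot_den[OF v f(2), of z]
    by (simp add: distrib_right mult.assoc right_diff_distrib)
qed

lemma refl_quot_const: "norm v = 1 \<Longrightarrow> refl_quot v (\<lambda>z. a) = (\<lambda>z. 0)"
  by (rule refl_quot_unique) auto

lemma refl_quot_z:
  assumes v: "norm v = 1" and f: "f \<in> CC"
  shows "refl_quot v (\<lambda>z. z * f z) = (\<lambda>z. z * refl_quot v f z + v * f (reflection v z))"
proof (rule refl_quot_unique[OF v])
  show "continuous_on UNIV (\<lambda>z. z * refl_quot v f z + v * f (reflection v z))"
    by (intro CC_continuous CC_add CC_scale CC_mult_linear[OF bounded_linear_ident] refl_quot_CC[OF v f]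
        CC_compose_linear[OF bounded_linear_refl f])
  show "(z * refl_quot v f z + v * f (reflection v z)) * den v z = z * f z - reflection v z * f (reflection v z)" for z
  proof -
    have "(z * refl_quot v f z + v * f (reflection v z)) * den v z = 
       z * (refl_quot v f z * den v z) + (v * den v z) * f (reflection v z)" by (simp add: algebra_simps)
    then show ?thesis unfolding refl_quot_den[OF v f] sub_reflection[OF v, symmetric] by (simp add: algebra_simps)
  qed
qed

lemma refl_quot_cnj:
  assumes v: "norm v = 1" and f: "f \<in> CC"
  shows "refl_quot v (\<lambda>z. cnj z * f z) = (\<lambda>z. cnj z * refl_quot v f z + cnj v * f (reflection v z))"
proof (rule refl_quot_unique[OF v])
  show "continuous_on UNIV (\<lambda>z. cnj z * refl_quot v f z + cnj v * f (reflection v z))"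
    by (intro CC_continuous CC_add CC_scale CC_mult_linear[OF bounded_linear_cnj] refl_quot_CC[OF v f]
        CC_compose_linear[OF bounded_linear_refl f])
  have cd: "cnj (den v z) = den v z" for z by (simp add: den_def algebra_simps)
  show "(cnj z * refl_quot v f z + cnj v * f (reflection v z)) * den v z = cnj z * f z - cnj (reflection v z) * f (reflection v z)" for z
  proof -
    have "cnj z - cnj (reflection v z) = cnj v * den v z"
      using arg_cong[OF sub_reflection[OF v, of z], of cnj] cd by simp
    moreover have "(cnj z * refl_quot v f z + cnj v * f (reflection v z)) * den v z = 
       cnj z * (refl_quot v f z * den v z) + (cnj v * den v z) * f (reflection v z)" by (simp add: algebra_simps)
    ultimately show ?thesis unfolding refl_quot_den[OF v f] by (simp add: algebra_simps)
  qed
qed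

lemma refl_quot_neg:
  assumes v: "norm v = 1" and f: "f \<in> CC"
  shows "refl_quot (- v) f = (\<lambda>z. - refl_quot v f z)"
proof (rule refl_quot_unique)
  show "continuous_on UNIV (\<lambda>z. - refl_quot v f z)"
    using CC_continuous[OF CC_scale[OF refl_quot_CC[OF v f], of "- 1"]] by simp
  show "- refl_quot v f z * den (- v) z = f z - f (reflection (- v) z)" for z
    using refl_quot_den[OF v f, of z] by (simp add: den_def reflection_def algebra_simps)
qed (use v in simp)

lemma norm_reflection: "norm w = 1 \<Longrightarrow> norm (reflection w z) = norm z"
  by (simp add: reflection_def norm_mult norm_power)

lemma refl_quot_compose:
  assumes v: "norm v = 1" and w: "norm w = 1" and f: "f \<in> CC"
  shows "refl_quot v (\<lambda>z. f (reflection w z)) = (\<lambda>z. refl_quot (reflection w v) f (reflection w z))"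
proof (rule refl_quot_unique[OF v])
  let ?v = "reflection w v"
  have v': "norm ?v = 1" using norm_reflection[OF w] v by simp
  show "continuous_on UNIV (\<lambda>z. refl_quot ?v f (reflection w z))"
    by (intro CC_continuous CC_compose_linear[OF bounded_linear_refl] refl_quot_CC[OF v' f])
  fix z
  have ww: "w * cnj w = 1" by (rule norm_one_cnj[OF w])
  have "den ?v (reflection w z) = (w * cnj w)\<^sup>2 * den v z"
    by (simp add: den_def reflection_def power2_eq_square algebra_simps)
  then have 1: "den ?v (reflection w z) = den v z" using ww by simp
  have "reflection ?v (reflection w z) = (w * cnj w)\<^sup>2 * reflection w (reflection v z)"
    by (simp add: reflection_def power2_eq_square algebra_simps)
  then have 2: "reflection ?v (reflection w z) = reflection w (reflection v z)" using ww by simp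
  show "refl_quot ?v f (reflection w z) * den v z = f (reflection w z) - f (reflection w (reflection v z))"
    using refl_quot_den[OF v' f, of "reflection w z"] unfolding 1 2 .
qed

section \<open>The Dunkl operators as sums over the mirrors\<close>

definition rv :: "nat \<Rightarrow> int \<Rightarrow> complex" where
  "rv n k = cis (pi * of_int k / real n)"

lemma norm_rv [simp]: "norm (rv n k) = 1" by (simp add: rv_def)

lemma root_vec_rv: "root_vec n k = rv n (int k)" by (simp add: root_vec_def rv_def)

lemma rv_add: "rv n (k + l) = rv n k * rv n l"
  by (simp add: rv_def cis_mult distrib_left add_divide_distrib)

lemma rv_square: "(rv n k)\<^sup>2 = om n k"
  by (simp add: rv_def om_def power2_eq_square cis_mult mult.assoc)

lemma cnj_rv: "cnj (rv n k) = rv n (- k)"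
  by (simp add: rv_def cis_cnj)

lemma cnj_om: "cnj (om n k) = om n (- k)"
  by (simp add: om_def cis_cnj)

lemma rv_n: "n > 0 \<Longrightarrow> rv n (int n) = - 1"
  by (simp add: rv_def)

lemma rv_period: "n > 0 \<Longrightarrow> rv n (k + int n) = - rv n k"
  by (simp add: rv_add rv_n)

definition refl_map :: "nat \<Rightarrow> int \<Rightarrow> complex \<Rightarrow> complex" where
  "refl_map n k = reflection (rv n k)"

lemma refl_map_eq: "refl_map n k z = - om n k * cnj z"
  by (simp add: refl_map_def reflection_def rv_square)

lemma refl_map_rv: "refl_map n k (rv n l) = - rv n (2 * k - l)"
proof -
  have "om n k * rv n (- l) = rv n (2 * k - l)"
    using rv_add[of n k k] rv_add[of n "k + k" "- l"] rv_square[of n k] by (simp add: power2_eq_square)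
  then show ?thesis by (simp add: refl_map_eq cnj_rv)
qed

definition cc :: "complex \<Rightarrow> complex \<Rightarrow> int \<Rightarrow> complex" where
  "cc \<nu>0 \<nu>1 l = (if even l then \<nu>0 else \<nu>1)"

text \<open>
  Half of the Dunkl operators. The definition of the latter runs over all \<open>2 n\<close> roots; opposite roots give
  equal terms, which are combined here to one term for each mirror.
\<close>

definition dd :: "nat \<Rightarrow> complex \<Rightarrow> complex \<Rightarrow> (complex \<Rightarrow> complex) \<Rightarrow> complex \<Rightarrow> complex" where
  "dd n \<nu>0 \<nu>1 f z = d_zbar f z + (\<Sum>l\<in>{0..<int n}. cc \<nu>0 \<nu>1 l * rv n l * refl_quot (rv n l) f z)"

definition ddb :: "nat \<Rightarrow> complex \<Rightarrow> complex \<Rightarrow> (complex \<Rightarrow> complex) \<Rightarrow> complex \<Rightarrow> complex" where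
  "ddb n \<nu>0 \<nu>1 f z = d_z f z + (\<Sum>l\<in>{0..<int n}. cc \<nu>0 \<nu>1 l * cnj (rv n l) * refl_quot (rv n l) f z)"

lemma sum_both_parities:
  fixes C :: "int \<Rightarrow> complex"
  assumes "\<And>l. C (l + int n) = C l"
  shows "(\<Sum>k<n. C (int (2 * k))) + (\<Sum>k<n. C (int (2 * k + 1))) = 2 * (\<Sum>l\<in>{0..<int n}. C l)"
proof -
  have 1: "(\<Sum>k<m. C (int (2 * k))) + (\<Sum>k<m. C (int (2 * k + 1))) = (\<Sum>j<2 * m. C (int j))" for m
  proof (induction m)
    case (Suc m)
    have "2 * Suc m = Suc (Suc (2 * m))" by simp
    then have "(\<Sum>j<2 * Suc m. C (int j)) = (\<Sum>j<2 * m. C (int j)) + C (int (2 * m)) + C (int (2 * m + 1))"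
      by (simp only: sum.lessThan_Suc Suc_eq_plus1[symmetric])
    then show ?case unfolding Suc[symmetric] by (simp only: sum.lessThan_Suc ac_simps)
  qed simp
  have 2: "(\<Sum>j<n + m. C (int j)) = (\<Sum>j<n. C (int j)) + (\<Sum>j<m. C (int j))" for m
  proof (induction m)
    case (Suc m)
    have "C (int (n + m)) = C (int m)" using assms[of "int m"] by (simp add: add.commute)
    then show ?case by (simp only: add_Suc_right sum.lessThan_Suc Suc add.assoc)
  qed simp
  have 3: "(\<Sum>j<m. C (int j)) = (\<Sum>l\<in>{0..<int m}. C l)" for m
    by (rule sum.reindex_bij_witness[where i = nat and j = int]) auto
  have "(\<Sum>j<2 * n. C (int j)) = (\<Sum>l\<in>{0..<int n}. C l) + (\<Sum>l\<in>{0..<int n}. C l)"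
    unfolding mult_2[of n] 2[of n] 3[of n] ..
  then show ?thesis unfolding 1 by (simp only: mult_2)
qed

lemma cc_period: "(odd n \<Longrightarrow> \<nu>0 = \<nu>1) \<Longrightarrow> cc \<nu>0 \<nu>1 (l + int n) = cc \<nu>0 \<nu>1 l"
  by (cases "even n") (auto simp: cc_def)

lemma dunkl_dd:
  assumes n: "n > 0" and \<nu>: "odd n \<Longrightarrow> \<nu>0 = \<nu>1" and f: "f \<in> CC"
  shows "dunkl_z n \<nu>0 \<nu>1 f z = 2 * dd n \<nu>0 \<nu>1 f z" "dunkl_zbar n \<nu>0 \<nu>1 f z = 2 * ddb n \<nu>0 \<nu>1 f z"
proof -
  have 1: "cc \<nu>0 \<nu>1 (int (2 * k)) = \<nu>0" "cc \<nu>0 \<nu>1 (int (2 * k + 1)) = \<nu>1" for k by (auto simp: cc_def)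
  note p = cc_period[OF \<nu>] rv_period[OF n] refl_quot_neg[OF norm_rv f]
  have "dunkl_z n \<nu>0 \<nu>1 f z = 2 * d_zbar f z + 
     ((\<Sum>k<n. (\<lambda>l. cc \<nu>0 \<nu>1 l * rv n l * refl_quot (rv n l) f z) (int (2 * k))) + 
      (\<Sum>k<n. (\<lambda>l. cc \<nu>0 \<nu>1 l * rv n l * refl_quot (rv n l) f z) (int (2 * k + 1))))"
    unfolding dunkl_z_def root_vec_rv 1 by (simp add: sum_distrib_left mult.assoc add.assoc)
  also have "\<dots> = 2 * dd n \<nu>0 \<nu>1 f z"
    by (subst sum_both_parities) (simp_all add: p dd_def distrib_left)
  finally show "dunkl_z n \<nu>0 \<nu>1 f z = 2 * dd n \<nu>0 \<nu>1 f z" .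
  have "dunkl_zbar n \<nu>0 \<nu>1 f z = 2 * d_z f z + 
     ((\<Sum>k<n. (\<lambda>l. cc \<nu>0 \<nu>1 l * cnj (rv n l) * refl_quot (rv n l) f z) (int (2 * k))) + 
      (\<Sum>k<n. (\<lambda>l. cc \<nu>0 \<nu>1 l * cnj (rv n l) * refl_quot (rv n l) f z) (int (2 * k + 1))))"
    unfolding dunkl_zbar_def root_vec_rv 1 by (simp add: sum_distrib_left mult.assoc add.assoc)
  also have "\<dots> = 2 * ddb n \<nu>0 \<nu>1 f z"
    by (subst sum_both_parities) (simp_all add: p ddb_def distrib_left)
  finally show "dunkl_zbar n \<nu>0 \<nu>1 f z = 2 * ddb n \<nu>0 \<nu>1 f z" .
qed

lemma CC_d_zbar: "f \<in> CC \<Longrightarrow> d_zbar f \<in> CC" and CC_d_z: "f \<in> CC \<Longrightarrow> d_z f \<in> CC"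
proof -
  assume "f \<in> CC"
  then have "(\<lambda>z. (1 / 2) * pd 1 f z + (\<i> / 2) * pd \<i> f z) \<in> CC" "(\<lambda>z. (1 / 2) * pd 1 f z + (- \<i> / 2) * pd \<i> f z) \<in> CC"
    by (intro CC_lincomb; simp)+
  moreover have "d_zbar f = (\<lambda>z. (1 / 2) * pd 1 f z + (\<i> / 2) * pd \<i> f z)" 
    "d_z f = (\<lambda>z. (1 / 2) * pd 1 f z + (- \<i> / 2) * pd \<i> f z)"
    by (auto simp: d_zbar_def d_z_def field_simps)
  ultimately show "d_zbar f \<in> CC" "d_z f \<in> CC" by simp_all
qed

lemma CC_dd: "f \<in> CC \<Longrightarrow> dd n \<nu>0 \<nu>1 f \<in> CC" and CC_ddb: "f \<in> CC \<Longrightarrow> ddb n \<nu>0 \<nu>1 f \<in> CC"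
  unfolding dd_def[abs_def] ddb_def[abs_def]
  by (intro CC_add CC_sum CC_scale CC_d_zbar CC_d_z refl_quot_CC norm_rv; assumption)+

lemma pd_lincomb:
  assumes "f \<in> CC" "g \<in> CC"
  shows "pd u (\<lambda>z. a * f z + b * g z) z = a * pd u f z + b * pd u g z"
  by (simp add: pd_add CC_scale assms pd_scale)

lemma dd_lincomb:
  assumes "f \<in> CC" "g \<in> CC"
  shows "dd n \<nu>0 \<nu>1 (\<lambda>z. a * f z + b * g z) = (\<lambda>z. a * dd n \<nu>0 \<nu>1 f z + b * dd n \<nu>0 \<nu>1 g z)"
    "ddb n \<nu>0 \<nu>1 (\<lambda>z. a * f z + b * g z) = (\<lambda>z. a * ddb n \<nu>0 \<nu>1 f z + b * ddb n \<nu>0 \<nu>1 g z)"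
  unfolding dd_def ddb_def refl_quot_lincomb[OF norm_rv assms] d_zbar_def d_z_def pd_lincomb[OF assms]
  by (auto simp: sum_distrib_left sum.distrib field_simps)

lemma d_mult:
  assumes "f \<in> CC"
  shows "d_zbar (\<lambda>z. z * f z) z = z * d_zbar f z" "d_zbar (\<lambda>z. cnj z * f z) z = f z + cnj z * d_zbar f z"
  unfolding d_zbar_def pd_mult_linear[OF bounded_linear_ident assms] pd_mult_linear[OF bounded_linear_cnj assms]
  by (simp_all add: field_simps)

lemma dd_z:
  assumes "f \<in> CC"
  shows "dd n \<nu>0 \<nu>1 (\<lambda>z. z * f z) z = z * dd n \<nu>0 \<nu>1 f z + (\<Sum>l\<in>{0..<int n}. (cc \<nu>0 \<nu>1 l * om n l) * f (refl_map n l z))"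
  unfolding dd_def d_mult[OF assms] refl_quot_z[OF norm_rv assms] rv_square[symmetric] refl_map_def
  by (simp add: distrib_left sum_distrib_left sum.distrib power2_eq_square mult_ac)

lemma dd_cnj:
  assumes "f \<in> CC"
  shows "dd n \<nu>0 \<nu>1 (\<lambda>z. cnj z * f z) z = cnj z * dd n \<nu>0 \<nu>1 f z + f z + (\<Sum>l\<in>{0..<int n}. cc \<nu>0 \<nu>1 l * f (refl_map n l z))"
proof -
  have 1: "cc \<nu>0 \<nu>1 l * rv n l * (cnj z * refl_quot (rv n l) f z + cnj (rv n l) * f (refl_map n l z)) = 
     cnj z * (cc \<nu>0 \<nu>1 l * rv n l * refl_quot (rv n l) f z) + cc \<nu>0 \<nu>1 l * f (refl_map n l z)" for l
  proof -
    have "cc \<nu>0 \<nu>1 l * rv n l * (cnj z * refl_quot (rv n l) f z + cnj (rv n l) * f (refl_map n l z)) = 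
      cnj z * (cc \<nu>0 \<nu>1 l * rv n l * refl_quot (rv n l) f z) + (rv n l * cnj (rv n l)) * (cc \<nu>0 \<nu>1 l * f (refl_map n l z))"
      by (simp add: algebra_simps)
    then show ?thesis unfolding norm_one_cnj[OF norm_rv] by simp
  qed
  show ?thesis unfolding dd_def d_mult[OF assms] refl_quot_cnj[OF norm_rv assms] refl_map_def[symmetric] 1
    by (simp add: distrib_left sum_distrib_left sum.distrib)
qed

lemma d_z_compose_refl:
  assumes "f \<in> CC"
  shows "d_zbar f (refl_map n k z) = - om n k * d_z (\<lambda>z. f (refl_map n k z)) z"
proof -
  have m: "bounded_linear (refl_map n k)" unfolding refl_map_def by (rule bounded_linear_refl)
  define a b where "a = Re (om n k)" and "b = Im (om n k)"
  have ab: "om n k = Complex a b" by (simp add: a_def b_def)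
  have nn: "a * a + b * b = 1"
    using norm_cis[of "2 * pi * of_int k / real n"] unfolding om_def[symmetric] ab complex_norm power2_eq_square by simp
  have p: "pd u (\<lambda>z. f (refl_map n k z)) z = 
      Re (refl_map n k u) *\<^sub>R pd 1 f (refl_map n k z) + Im (refl_map n k u) *\<^sub>R pd \<i> f (refl_map n k z)" for u
    using pd_compose(1)[OF m assms, of u 0 z] by simp
  have r: "Re (refl_map n k 1) = - a" "Im (refl_map n k 1) = - b" "Re (refl_map n k \<i>) = - b" "Im (refl_map n k \<i>) = a"
    by (simp_all add: refl_map_eq ab)
  define x y where "x = pd 1 f (refl_map n k z)" and "y = pd \<i> f (refl_map n k z)"
  have "- om n k * d_z (\<lambda>z. f (refl_map n k z)) z = 
      - (of_real a + \<i> * of_real b) * ((- of_real a * x - of_real b * y) - \<i> * (- of_real b * x + of_real a * y)) / 2"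
    unfolding d_z_def p r x_def[symmetric] y_def[symmetric] scaleR_conv_of_real ab Complex_eq
    by simp
  also have "\<dots> = (of_real (a * a + b * b)) * (x + \<i> * y) / 2"
    by (simp add: algebra_simps)
  also have "\<dots> = d_zbar f (refl_map n k z)" unfolding nn by (simp add: d_zbar_def x_def y_def)
  finally show ?thesis by simp
qed

text \<open>
  The reflection permutes the mirrors and preserves the coupling constants.
\<close>

lemma dd_refl:
  assumes n: "n > 0" and \<nu>: "odd n \<Longrightarrow> \<nu>0 = \<nu>1" and f: "f \<in> CC"
  shows "dd n \<nu>0 \<nu>1 f (refl_map n k z) = - om n k * ddb n \<nu>0 \<nu>1 (\<lambda>z. f (refl_map n k z)) z"
proof -
  let ?C = "\<lambda>l. cc \<nu>0 \<nu>1 l * rv n l * refl_quot (rv n l) f (refl_map n k z)"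
  note p = cc_period[OF \<nu>] rv_period[OF n] refl_quot_neg[OF norm_rv f]
  have c: "cc \<nu>0 \<nu>1 (2 * k - l) = cc \<nu>0 \<nu>1 l" for l by (simp add: cc_def)
  have "- om n k * (cc \<nu>0 \<nu>1 l * cnj (rv n l) * refl_quot (rv n l) (\<lambda>z. f (refl_map n k z)) z) = ?C (2 * k - l)" for l
  proof -
    have "refl_quot (rv n l) (\<lambda>z. f (refl_map n k z)) z = refl_quot (- rv n (2 * k - l)) f (refl_map n k z)"
      using refl_quot_compose[OF norm_rv norm_rv f, of n l n k] unfolding refl_map_def[symmetric] refl_map_rv by (rule fun_cong)
    also have "\<dots> = - refl_quot (rv n (2 * k - l)) f (refl_map n k z)"
      using refl_quot_neg[OF norm_rv f] by simp
    finally have 1: "refl_quot (rv n l) (\<lambda>z. f (refl_map n k z)) z = - refl_quot (rv n (2 * k - l)) f (refl_map n k z)" .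
    have 2: "om n k * cnj (rv n l) = rv n (2 * k - l)" using refl_map_rv[of n k l] by (simp add: refl_map_eq)
    show ?thesis unfolding 1 2[symmetric] c by (simp add: mult_ac)
  qed
  then have "- om n k * (\<Sum>l\<in>{0..<int n}. cc \<nu>0 \<nu>1 l * cnj (rv n l) * refl_quot (rv n l) (\<lambda>z. f (refl_map n k z)) z) =
      (\<Sum>l\<in>{0..<int n}. ?C (2 * k - l))"
    unfolding sum_distrib_left by (intro sum.cong refl)
  also have "\<dots> = (\<Sum>l\<in>{0..<int n}. ?C l)"
    by (rule sum_periodic_reflect[OF n]) (simp add: p)
  finally show ?thesis unfolding dd_def ddb_def d_z_compose_refl[OF f] by (simp add: distrib_left)
qed

lemma dd_const: "dd n \<nu>0 \<nu>1 (\<lambda>z. a) = (\<lambda>z. 0)" "ddb n \<nu>0 \<nu>1 (\<lambda>z. a) = (\<lambda>z. 0)"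
  unfolding dd_def ddb_def refl_quot_const[OF norm_rv] d_zbar_def d_z_def
  by (auto simp: pd_eq[OF has_derivative_const])

section \<open>The ring of linear operators on test functions\<close>

text \<open>
  A ring structure requires linearity for one of the distributive laws, so the ring consists of the linear
  operators that preserve the function space, extended by 0 to all functions.
\<close>

definition lop_ok :: "oper \<Rightarrow> bool" where
  "lop_ok T \<longleftrightarrow> (\<forall>f\<in>CC. T f \<in> CC) \<and>
    (\<forall>f\<in>CC. \<forall>g\<in>CC. \<forall>a b. T (\<lambda>z. a * f z + b * g z) = (\<lambda>z. a * T f z + b * T g z))"

typedef lop = "{T :: oper. lop_ok T \<and> (\<forall>f. f \<notin> CC \<longrightarrow> T f = 0)}"
  by (rule exI[of _ "\<lambda>f z. 0"]) (auto simp: lop_ok_def CC_const)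

definition mk :: "oper \<Rightarrow> lop" where
  "mk T = Abs_lop (on_CC T)"

definition ap :: "lop \<Rightarrow> oper" where
  "ap = Rep_lop"

lemma ap_mk: "lop_ok T \<Longrightarrow> ap (mk T) = on_CC T"
  unfolding ap_def mk_def
proof (rule Abs_lop_inverse)
  assume T: "lop_ok T"
  have "lop_ok (on_CC T)" unfolding lop_ok_def
  proof (intro conjI ballI allI)
    fix f g a b assume fg: "f \<in> CC" "g \<in> CC"
    then have "(\<lambda>z. a * f z + b * g z) \<in> CC" by (rule CC_lincomb)
    then show "on_CC T (\<lambda>z. a * f z + b * g z) = (\<lambda>z. a * on_CC T f z + b * on_CC T g z)"
      using T fg by (simp add: on_CC_def lop_ok_def)
  qed (use T in \<open>auto simp: on_CC_def lop_ok_def\<close>)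
  then show "on_CC T \<in> {T. lop_ok T \<and> (\<forall>f. f \<notin> CC \<longrightarrow> T f = 0)}" by (simp add: on_CC_def)
qed

lemma ap_mk_apply: "lop_ok T \<Longrightarrow> f \<in> CC \<Longrightarrow> ap (mk T) f = T f"
  by (simp add: ap_mk on_CC_def)

lemma ap_ok: "lop_ok (ap x)" and ap_outside: "f \<notin> CC \<Longrightarrow> ap x f = 0"
  using Rep_lop[of x] by (auto simp: ap_def)

lemma ap_CC: "f \<in> CC \<Longrightarrow> ap x f \<in> CC"
  and ap_lincomb: "f \<in> CC \<Longrightarrow> g \<in> CC \<Longrightarrow> ap x (\<lambda>z. a * f z + b * g z) = (\<lambda>z. a * ap x f z + b * ap x g z)"
  using ap_ok[of x] by (auto simp: lop_ok_def)

lemma ap_inject: "ap x = ap y \<Longrightarrow> x = y"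
  by (simp add: ap_def Rep_lop_inject)

lemma lop_eqI: "(\<And>f z. f \<in> CC \<Longrightarrow> ap x f z = ap y f z) \<Longrightarrow> x = y"
  by (rule ap_inject, rule ext) (metis ap_outside ext)

lemma ap_add: "f \<in> CC \<Longrightarrow> g \<in> CC \<Longrightarrow> ap x (\<lambda>z. f z + g z) = (\<lambda>z. ap x f z + ap x g z)"
  and ap_diff: "f \<in> CC \<Longrightarrow> g \<in> CC \<Longrightarrow> ap x (\<lambda>z. f z - g z) = (\<lambda>z. ap x f z - ap x g z)"
  and ap_scale: "f \<in> CC \<Longrightarrow> ap x (\<lambda>z. a * f z) = (\<lambda>z. a * ap x f z)"
  using ap_lincomb[of f g x 1 1] ap_lincomb[of f g x 1 "- 1"] ap_lincomb[of f f x a 0] by simp_all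

instantiation lop :: ring_1
begin

definition "0 = mk (\<lambda>f z. 0)"
definition "1 = mk (\<lambda>f. f)"
definition "x + y = mk (\<lambda>f z. ap x f z + ap y f z)"
definition "x - y = mk (\<lambda>f z. ap x f z - ap y f z)"
definition "- x = mk (\<lambda>f z. - ap x f z)"
definition "x * y = mk (\<lambda>f. ap x (ap y f))"

lemma lop_ok_ops: 
  "lop_ok (\<lambda>f z. 0)" "lop_ok (\<lambda>f. f)" "lop_ok (\<lambda>f z. ap x f z + ap y f z)"
  "lop_ok (\<lambda>f z. ap x f z - ap y f z)" "lop_ok (\<lambda>f z. - ap x f z)" "lop_ok (\<lambda>f. ap x (ap y f))"
  using CC_scale[of "ap x f" "- 1" for f]
  by (auto simp: lop_ok_def CC_const CC_lincomb CC_add CC_diff ap_CC ap_lincomb algebra_simps)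

lemma ap_ring:
  assumes "f \<in> CC"
  shows "ap 0 f z = 0" "ap 1 f = f" "ap (x + y) f z = ap x f z + ap y f z"
    "ap (x - y) f z = ap x f z - ap y f z" "ap (- x) f z = - ap x f z" "ap (x * y) f = ap x (ap y f)"
  unfolding zero_lop_def one_lop_def plus_lop_def minus_lop_def uminus_lop_def times_lop_def
  by (simp_all add: ap_mk_apply[OF lop_ok_ops(1)] ap_mk_apply[OF lop_ok_ops(2)] ap_mk_apply[OF lop_ok_ops(3)]
     ap_mk_apply[OF lop_ok_ops(4)] ap_mk_apply[OF lop_ok_ops(5)] ap_mk_apply[OF lop_ok_ops(6)] assms)

instance
proof
  fix x y w :: lop
  show "x * y * w = x * (y * w)" by (rule lop_eqI) (simp add: ap_ring ap_CC)
  show "1 * x = x" "x * 1 = x" by (rule lop_eqI, simp add: ap_ring ap_CC)+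
  show "x + y + w = x + (y + w)" "x + y = y + x" "0 + x = x" "- x + x = 0" "x - y = x + - y"
    by (rule lop_eqI, simp add: ap_ring)+
  show "(x + y) * w = x * w + y * w" by (rule lop_eqI) (simp add: ap_ring ap_CC)
  show "x * (y + w) = x * y + x * w"
  proof (rule lop_eqI)
    fix f z assume f: "f \<in> CC"
    have "ap (y + w) f = (\<lambda>z. ap y f z + ap w f z)" using f by (simp add: ap_ring fun_eq_iff)
    then show "ap (x * (y + w)) f z = ap (x * y + x * w) f z" using f by (simp add: ap_ring ap_CC ap_add)
  qed
  show "(0 :: lop) \<noteq> 1"
  proof
    assume "(0 :: lop) = 1"
    then have "ap 0 (\<lambda>z. 1) 0 = ap 1 (\<lambda>z. 1) 0" by simp
    then show False by (simp add: ap_ring CC_const)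
  qed
qed

end

lemma ap_sum: "f \<in> CC \<Longrightarrow> ap (\<Sum>i\<in>I. x i) f z = (\<Sum>i\<in>I. ap (x i) f z)"
  by (induction I rule: infinite_finite_induct) (auto simp: ap_ring)

definition "Lc a = mk (\<lambda>f z. a * f z)"
definition "Lz = mk (\<lambda>f z. z * f z)"
definition "Lzb = mk (\<lambda>f z. cnj z * f z)"
definition "Ld n \<nu>0 \<nu>1 = mk (dd n \<nu>0 \<nu>1)"
definition "Ldb n \<nu>0 \<nu>1 = mk (ddb n \<nu>0 \<nu>1)"
definition "LS n k = mk (\<lambda>f z. f (om n (- k) * z))"
definition "LR n k = mk (\<lambda>f z. f (refl_map n k z))"

lemma lop_ok_gens:
  "lop_ok (\<lambda>f z. a * f z)" "lop_ok (\<lambda>f z. z * f z)" "lop_ok (\<lambda>f z. cnj z * f z)"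
  "lop_ok (dd n \<nu>0 \<nu>1)" "lop_ok (ddb n \<nu>0 \<nu>1)" "lop_ok (\<lambda>f z. f (om n (- k) * z))" "lop_ok (\<lambda>f z. f (refl_map n k z))"
proof -
  have I: "lop_ok T" if "\<And>f. f \<in> CC \<Longrightarrow> T f \<in> CC"
    "\<And>f g a b. f \<in> CC \<Longrightarrow> g \<in> CC \<Longrightarrow> T (\<lambda>z. a * f z + b * g z) = (\<lambda>z. a * T f z + b * T g z)" for T
    using that unfolding lop_ok_def by blast
  show "lop_ok (\<lambda>f z. a * f z)" by (rule I, erule CC_scale) (simp add: algebra_simps)
  show "lop_ok (\<lambda>f z. z * f z)" 
    by (rule I, erule CC_mult_linear[OF bounded_linear_ident]) (simp add: algebra_simps)
  show "lop_ok (\<lambda>f z. cnj z * f z)" 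
    by (rule I, erule CC_mult_linear[OF bounded_linear_cnj]) (simp add: algebra_simps)
  show "lop_ok (dd n \<nu>0 \<nu>1)" by (rule I, erule CC_dd, rule dd_lincomb)
  show "lop_ok (ddb n \<nu>0 \<nu>1)" by (rule I, erule CC_ddb, rule dd_lincomb)
  show "lop_ok (\<lambda>f z. f (om n (- k) * z))" 
    by (rule I, erule CC_compose_linear[OF bounded_linear_mult_right]) simp
  show "lop_ok (\<lambda>f z. f (refl_map n k z))"
    by (rule I, erule CC_compose_linear[OF bounded_linear_refl[of "rv n k"], folded refl_map_def]) simp
qed

lemma ap_gens:
  assumes "f \<in> CC"
  shows "ap (Lc a) f = (\<lambda>z. a * f z)" "ap Lz f = (\<lambda>z. z * f z)" "ap Lzb f = (\<lambda>z. cnj z * f z)"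
    "ap (Ld n \<nu>0 \<nu>1) f = dd n \<nu>0 \<nu>1 f" "ap (Ldb n \<nu>0 \<nu>1) f = ddb n \<nu>0 \<nu>1 f"
    "ap (LS n k) f = (\<lambda>z. f (om n (- k) * z))" "ap (LR n k) f = (\<lambda>z. f (refl_map n k z))"
  unfolding Lc_def Lz_def Lzb_def Ld_def Ldb_def LS_def LR_def
  by (rule ap_mk_apply[OF lop_ok_gens(1) assms] ap_mk_apply[OF lop_ok_gens(2) assms] ap_mk_apply[OF lop_ok_gens(3) assms]
    ap_mk_apply[OF lop_ok_gens(4) assms] ap_mk_apply[OF lop_ok_gens(5) assms] ap_mk_apply[OF lop_ok_gens(6) assms]
    ap_mk_apply[OF lop_ok_gens(7) assms])+

lemma CC_gens:
  assumes "f \<in> CC"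
  shows "(\<lambda>z. a * f z) \<in> CC" "(\<lambda>z. z * f z) \<in> CC" "(\<lambda>z. cnj z * f z) \<in> CC"
    "dd n \<nu>0 \<nu>1 f \<in> CC" "ddb n \<nu>0 \<nu>1 f \<in> CC" "(\<lambda>z. f (om n (- k) * z)) \<in> CC" "(\<lambda>z. f (refl_map n k z)) \<in> CC"
proof -
  have *: "T f \<in> CC" if "lop_ok T" for T using that assms unfolding lop_ok_def by blast
  show "(\<lambda>z. a * f z) \<in> CC" "(\<lambda>z. z * f z) \<in> CC" "(\<lambda>z. cnj z * f z) \<in> CC"
    "dd n \<nu>0 \<nu>1 f \<in> CC" "ddb n \<nu>0 \<nu>1 f \<in> CC" "(\<lambda>z. f (om n (- k) * z)) \<in> CC" "(\<lambda>z. f (refl_map n k z)) \<in> CC"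
    by (rule *[OF lop_ok_gens(1)], rule *[OF lop_ok_gens(2)], rule *[OF lop_ok_gens(3)], rule *[OF lop_ok_gens(4)],
        rule *[OF lop_ok_gens(5)], rule *[OF lop_ok_gens(6)], rule *[OF lop_ok_gens(7)])
qed

lemmas ap_simps = ap_ring ap_gens ap_sum CC_gens ap_CC

lemma om_diff: "om n (k - l) = om n k * om n (- l)"
  using om_add[of n k "- l"] by simp

lemma Lc_algebra: "Lc (a + b) = Lc a + Lc b" "Lc (a * b) = Lc a * Lc b" "Lc 1 = 1" "x * Lc a = Lc a * x"
  by (rule lop_eqI; simp only: ap_simps ap_scale; simp add: algebra_simps)+

lemma group_algebra: 
  "LS n 0 = 1" "LS n k * LS n l = LS n (k + l)" "LS n k * LR n l = LR n (k + l)"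
  "LR n k * LS n l = LR n (k - l)" "LR n k * LR n l = LS n (k - l)"
  by (rule lop_eqI; simp only: ap_simps; simp add: refl_map_eq cnj_om om_add om_diff mult_ac)+

lemma group_z:
  "LS n k * Lz = Lc (om n (- k)) * (Lz * LS n k)" "LS n k * Lzb = Lc (om n k) * (Lzb * LS n k)"
  "LR n k * Lz = - (Lc (om n k) * (Lzb * LR n k))" "LR n k * Lzb = - (Lc (om n (- k)) * (Lz * LR n k))"
  by (rule lop_eqI; simp only: ap_simps; simp add: refl_map_eq cnj_om mult_ac)+

lemma Lz_Lzb: "Lzb * Lz = Lz * Lzb"
  by (rule lop_eqI; simp only: ap_simps; simp add: mult_ac)

context
  fixes n :: nat and \<nu>0 \<nu>1 :: complex
  assumes n2: "n \<ge> 2" and \<nu>: "odd n \<Longrightarrow> \<nu>0 = \<nu>1"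
begin

lemma npos: "n > 0" using n2 by simp

lemma LR_Ld: "LR n k * Ld n \<nu>0 \<nu>1 = - (Lc (om n k) * (Ldb n \<nu>0 \<nu>1 * LR n k))"
proof (rule lop_eqI)
  fix f z assume f: "f \<in> CC"
  show "ap (LR n k * Ld n \<nu>0 \<nu>1) f z = ap (- (Lc (om n k) * (Ldb n \<nu>0 \<nu>1 * LR n k))) f z"
    using dd_refl[OF npos \<nu> f, of k z] by (simp add: ap_simps f)
qed

lemma LR_LR: "LR n k * LR n k = 1"
  by (simp add: group_algebra)

lemma LR_Ldb: "LR n k * Ldb n \<nu>0 \<nu>1 = - (Lc (om n (- k)) * (Ld n \<nu>0 \<nu>1 * LR n k))"
proof -
  have "LR n k * (LR n k * Ld n \<nu>0 \<nu>1) * LR n k = - (LR n k * (Lc (om n k) * (Ldb n \<nu>0 \<nu>1 * LR n k)) * LR n k)"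
    unfolding LR_Ld by simp
  moreover have "LR n k * (LR n k * Ld n \<nu>0 \<nu>1) * LR n k = Ld n \<nu>0 \<nu>1 * LR n k"
  proof -
    have "LR n k * (LR n k * Ld n \<nu>0 \<nu>1) * LR n k = (LR n k * LR n k) * Ld n \<nu>0 \<nu>1 * LR n k"
      by (simp only: mult.assoc)
    then show ?thesis by (simp only: LR_LR mult_1_left)
  qed
  moreover have "LR n k * (Lc (om n k) * (Ldb n \<nu>0 \<nu>1 * LR n k)) * LR n k = Lc (om n k) * (LR n k * Ldb n \<nu>0 \<nu>1)"
  proof -
    have "LR n k * (Lc (om n k) * (Ldb n \<nu>0 \<nu>1 * LR n k)) * LR n k = (LR n k * Lc (om n k)) * (Ldb n \<nu>0 \<nu>1 * (LR n k * LR n k))"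
      by (simp only: mult.assoc)
    then show ?thesis unfolding LR_LR Lc_algebra(4)[of "LR n k"] by (simp add: mult.assoc)
  qed
  ultimately have 1: "Ld n \<nu>0 \<nu>1 * LR n k = - (Lc (om n k) * (LR n k * Ldb n \<nu>0 \<nu>1))" by simp
  have "Lc (om n (- k)) * (Ld n \<nu>0 \<nu>1 * LR n k) = - ((Lc (om n (- k)) * Lc (om n k)) * (LR n k * Ldb n \<nu>0 \<nu>1))"
    unfolding 1 by (simp add: mult.assoc)
  also have "Lc (om n (- k)) * Lc (om n k) = 1" by (simp flip: Lc_algebra(2) add: Lc_algebra(3))
  finally show ?thesis by simp
qed

lemma LS_eq: "LS n k = LR n k * LR n 0" by (simp add: group_algebra)

lemma LS_Ld: "LS n k * Ld n \<nu>0 \<nu>1 = Lc (om n (- k)) * (Ld n \<nu>0 \<nu>1 * LS n k)"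
  and LS_Ldb: "LS n k * Ldb n \<nu>0 \<nu>1 = Lc (om n k) * (Ldb n \<nu>0 \<nu>1 * LS n k)"
proof -
  have "LS n k * Ld n \<nu>0 \<nu>1 = LR n k * (LR n 0 * Ld n \<nu>0 \<nu>1)" by (simp add: LS_eq mult.assoc)
  also have "\<dots> = - (LR n k * Ldb n \<nu>0 \<nu>1 * LR n 0)" unfolding LR_Ld by (simp add: Lc_algebra(3) mult.assoc)
  also have "\<dots> = Lc (om n (- k)) * (Ld n \<nu>0 \<nu>1 * LS n k)" unfolding LR_Ldb LS_eq by (simp add: mult.assoc)
  finally show "LS n k * Ld n \<nu>0 \<nu>1 = Lc (om n (- k)) * (Ld n \<nu>0 \<nu>1 * LS n k)" .
  have "LS n k * Ldb n \<nu>0 \<nu>1 = LR n k * (LR n 0 * Ldb n \<nu>0 \<nu>1)" by (simp add: LS_eq mult.assoc)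
  also have "\<dots> = - (LR n k * Ld n \<nu>0 \<nu>1 * LR n 0)" unfolding LR_Ldb by (simp add: Lc_algebra(3) mult.assoc)
  also have "\<dots> = Lc (om n k) * (Ldb n \<nu>0 \<nu>1 * LS n k)" unfolding LR_Ld LS_eq by (simp add: mult.assoc)
  finally show "LS n k * Ldb n \<nu>0 \<nu>1 = Lc (om n k) * (Ldb n \<nu>0 \<nu>1 * LS n k)" .
qed

lemma Ld_z: "Ld n \<nu>0 \<nu>1 * Lz = Lz * Ld n \<nu>0 \<nu>1 + (\<Sum>l\<in>{0..<int n}. Lc (cc \<nu>0 \<nu>1 l * om n l) * LR n l)"
  and Ld_zb: "Ld n \<nu>0 \<nu>1 * Lzb = Lzb * Ld n \<nu>0 \<nu>1 + 1 + (\<Sum>l\<in>{0..<int n}. Lc (cc \<nu>0 \<nu>1 l) * LR n l)"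
  by (rule lop_eqI; simp only: ap_simps dd_z dd_cnj)+

lemma cc_minus: "cc \<nu>0 \<nu>1 (- l) = cc \<nu>0 \<nu>1 l" and cc_shift: "cc \<nu>0 \<nu>1 (l + 2) = cc \<nu>0 \<nu>1 l"
  by (simp_all add: cc_def)

lemma L_period: "LS n (k + int n) = LS n k" "LR n (k + int n) = LR n k"
proof -
  have "om n (- (k + int n)) = om n (- k)" using om_period[OF npos, of "- (k + int n)"] by simp
  then show "LS n (k + int n) = LS n k" by (simp add: LS_def)
  have "refl_map n (k + int n) = refl_map n k" by (rule ext) (simp add: refl_map_eq om_period[OF npos])
  then show "LR n (k + int n) = LR n k" by (simp add: LR_def)
qed

text \<open>
  Conjugation with \<open>R 0\<close> exchanges \<open>z\<close> with \<open>- zb\<close> and \<open>d\<close> with \<open>- db\<close>, and so halves the number of relations to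
  be verified.
\<close>

lemma conj_L: "Ldb n \<nu>0 \<nu>1 = - (LR n 0 * Ld n \<nu>0 \<nu>1 * LR n 0)" "Lz = - (LR n 0 * Lzb * LR n 0)" 
  "Lzb = - (LR n 0 * Lz * LR n 0)"
  by (simp_all add: LR_Ld group_z Lc_algebra(3) mult.assoc LR_LR)

lemma conj_prod: "- (LR n 0 * x * LR n 0) * - (LR n 0 * y * LR n 0) = LR n 0 * (x * y) * LR n 0"
proof -
  have "- (LR n 0 * x * LR n 0) * - (LR n 0 * y * LR n 0) = LR n 0 * x * (LR n 0 * LR n 0) * y * LR n 0"
    by (simp add: mult.assoc)
  then show ?thesis by (simp add: LR_LR mult.assoc)
qed

lemma conj_sum: "LR n 0 * (\<Sum>l\<in>{0..<int n}. Lc (a l) * LR n l) * LR n 0 = (\<Sum>l\<in>{0..<int n}. Lc (a l) * LR n (- l))"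
  unfolding sum_distrib_left sum_distrib_right
proof (rule sum.cong[OF refl])
  fix l
  have "LR n 0 * (Lc (a l) * LR n l) * LR n 0 = Lc (a l) * (LR n 0 * LR n l * LR n 0)"
    by (metis Lc_algebra(4) mult.assoc)
  also have "LR n 0 * LR n l * LR n 0 = LR n (- l)" by (simp add: group_algebra)
  finally show "LR n 0 * (Lc (a l) * LR n l) * LR n 0 = Lc (a l) * LR n (- l)" .
qed

lemma Ldb_z: "Ldb n \<nu>0 \<nu>1 * Lz = Lz * Ldb n \<nu>0 \<nu>1 + 1 + (\<Sum>l\<in>{0..<int n}. Lc (cc \<nu>0 \<nu>1 l) * LR n l)"
proof -
  let ?g = "\<lambda>l. Lc (cc \<nu>0 \<nu>1 l) * LR n l"
  have "Ldb n \<nu>0 \<nu>1 * Lz = LR n 0 * (Ld n \<nu>0 \<nu>1 * Lzb) * LR n 0"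
    by (subst conj_L(1), subst conj_L(2)) (rule conj_prod)
  also have "\<dots> = LR n 0 * (Lzb * Ld n \<nu>0 \<nu>1) * LR n 0 + LR n 0 * LR n 0 + LR n 0 * (\<Sum>l\<in>{0..<int n}. ?g l) * LR n 0"
    unfolding Ld_zb by (simp add: distrib_left distrib_right)
  also have "LR n 0 * (Lzb * Ld n \<nu>0 \<nu>1) * LR n 0 = Lz * Ldb n \<nu>0 \<nu>1"
    by (subst conj_L(1), subst conj_L(2)) (rule conj_prod[symmetric])
  also have "LR n 0 * (\<Sum>l\<in>{0..<int n}. ?g l) * LR n 0 = (\<Sum>l\<in>{0..<int n}. ?g (0 - l))"
    unfolding conj_sum by (simp add: cc_minus)
  also have "\<dots> = (\<Sum>l\<in>{0..<int n}. ?g l)"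
    by (rule sum_periodic_reflect[OF npos]) (simp add: L_period cc_period[OF \<nu>])
  finally show ?thesis by (simp add: LR_LR)
qed

lemma Ldb_zb: "Ldb n \<nu>0 \<nu>1 * Lzb = Lzb * Ldb n \<nu>0 \<nu>1 + (\<Sum>l\<in>{0..<int n}. Lc (cc \<nu>0 \<nu>1 l * om n (- l)) * LR n l)"
proof -
  let ?g = "\<lambda>l. Lc (cc \<nu>0 \<nu>1 l * om n (- l)) * LR n l"
  have omp: "om n (- l - int n) = om n (- l)" for l using om_period[OF npos, of "- l - int n"] by simp
  have "Ldb n \<nu>0 \<nu>1 * Lzb = LR n 0 * (Ld n \<nu>0 \<nu>1 * Lz) * LR n 0"
    by (subst conj_L(1), subst conj_L(3)) (rule conj_prod)
  also have "\<dots> = LR n 0 * (Lz * Ld n \<nu>0 \<nu>1) * LR n 0 + LR n 0 * (\<Sum>l\<in>{0..<int n}. Lc (cc \<nu>0 \<nu>1 l * om n l) * LR n l) * LR n 0"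
    unfolding Ld_z by (simp add: distrib_left distrib_right)
  also have "LR n 0 * (Lz * Ld n \<nu>0 \<nu>1) * LR n 0 = Lzb * Ldb n \<nu>0 \<nu>1"
    by (subst conj_L(1), subst conj_L(3)) (rule conj_prod[symmetric])
  also have "LR n 0 * (\<Sum>l\<in>{0..<int n}. Lc (cc \<nu>0 \<nu>1 l * om n l) * LR n l) * LR n 0 = (\<Sum>l\<in>{0..<int n}. ?g (0 - l))"
    unfolding conj_sum by (simp add: cc_minus)
  also have "\<dots> = (\<Sum>l\<in>{0..<int n}. ?g l)"
    by (rule sum_periodic_reflect[OF npos]) (simp add: L_period cc_period[OF \<nu>] omp)
  finally show ?thesis .
qed

end

section \<open>Commutativity of the Dunkl operators\<close>

text \<open>
  By the Hadamard lemma \<open>f = f w + (z - w) g1 + (cnj z - cnj w) g2\<close>. An operator that commutes with both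
  coordinates and kills constants maps this to a function that vanishes at \<open>w\<close>.
\<close>

lemma ap_commuting_zero:
  assumes z: "x * Lz = Lz * x" and zb: "x * Lzb = Lzb * x" and 1: "ap x (\<lambda>z. 1) = (\<lambda>z. 0)"
  shows "x = 0"
proof (rule lop_eqI)
  fix f w assume f: "f \<in> CC"
  have "bounded_linear (\<lambda>_ :: complex. 0 :: complex)" by (rule bounded_linear_zero)
  then obtain f1 f2 where f12: "f1 \<in> CC" "f2 \<in> CC" and
    h: "\<And>z. f z - f (w + 0) = Re (z - (w + 0)) *\<^sub>R f1 z + Im (z - (w + 0)) *\<^sub>R f2 z"
    using hadamard[OF f, of "\<lambda>_. 0" w] by blast
  define g1 where "g1 z = (1 / 2) * f1 z + (- \<i> / 2) * f2 z" for z
  define g2 where "g2 z = (1 / 2) * f1 z + (\<i> / 2) * f2 z" for z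
  have g: "g1 \<in> CC" "g2 \<in> CC" unfolding g1_def[abs_def] g2_def[abs_def] by (intro CC_lincomb f12)+
  have ReIm: "of_real (Re u) = (u + cnj u) / 2" "of_real (Im u) = - \<i> * (u - cnj u) / 2" for u
    by (simp_all add: complex_eq_iff)
  have "f z - f w = (z - w) * g1 z + (cnj z - cnj w) * g2 z" for z
    using h[of z] unfolding scaleR_conv_of_real ReIm g1_def g2_def by (simp add: field_simps)
  then have fz: "f z = f w * 1 + ((z * g1 z - w * g1 z) + (cnj z * g2 z - cnj w * g2 z))" for z
    by (simp add: algebra_simps)
  have eq: "f = (\<lambda>z. f w * 1 + ((z * g1 z - w * g1 z) + (cnj z * g2 z - cnj w * g2 z)))"
    by (rule ext) (rule fz)
  have xz: "ap x (\<lambda>z. z * g z) = (\<lambda>z. z * ap x g z)" "ap x (\<lambda>z. cnj z * g z) = (\<lambda>z. cnj z * ap x g z)" if "g \<in> CC" for g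
    using arg_cong[OF z, of "\<lambda>y. ap y g"] arg_cong[OF zb, of "\<lambda>y. ap y g"] that by (simp_all add: ap_simps)
  have "ap x f = (\<lambda>z. f w * 0 + ((z * ap x g1 z - w * ap x g1 z) + (cnj z * ap x g2 z - cnj w * ap x g2 z)))"
    by (subst eq) (simp only: ap_add ap_diff ap_scale xz 1 CC_add CC_diff CC_scale CC_const CC_gens g)
  then show "ap x f w = ap 0 f w" using f by (simp add: ap_ring)
qed

lemma dunkl_relations_lop:
  assumes "n \<ge> 2" "odd n \<Longrightarrow> \<nu>0 = \<nu>1"
  shows "dunkl_relations Lc Lz Lzb (Ld n \<nu>0 \<nu>1) (Ldb n \<nu>0 \<nu>1) (LS n) (LR n) n (cc \<nu>0 \<nu>1)"
  by unfold_locales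
    (rule assms(1) Lc_algebra(1-4) cc_shift[OF assms] cc_period[OF assms(2)] cc_minus[OF assms] group_algebra L_period[OF assms]
      group_z LS_Ld[OF assms] LS_Ldb[OF assms] LR_Ld[OF assms] LR_Ldb[OF assms] Lz_Lzb Ld_z[OF assms] Ld_zb[OF assms]
      Ldb_z[OF assms] Ldb_zb[OF assms]; assumption?)+

lemma dunkl_algebra_lop:
  assumes "n \<ge> 2" "odd n \<Longrightarrow> \<nu>0 = \<nu>1"
  shows "dunkl_algebra Lc Lz Lzb (Ld n \<nu>0 \<nu>1) (Ldb n \<nu>0 \<nu>1) (LS n) (LR n) n (cc \<nu>0 \<nu>1)"
proof -
  interpret dunkl_relations Lc Lz Lzb "Ld n \<nu>0 \<nu>1" "Ldb n \<nu>0 \<nu>1" "LS n" "LR n" n "cc \<nu>0 \<nu>1"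
    by (rule dunkl_relations_lop[OF assms])
  have "ap (Ldb n \<nu>0 \<nu>1 * Ld n \<nu>0 \<nu>1 - Ld n \<nu>0 \<nu>1 * Ldb n \<nu>0 \<nu>1) (\<lambda>z. 1) = (\<lambda>z. 0)"
    by (rule ext) (simp add: ap_simps CC_const dd_const)
  from ap_commuting_zero[OF commutator_z commutator_zb this] 
  show ?thesis by unfold_locales simp
qed

section \<open>Orders of vanishing on an orbit\<close>

text \<open>
  All partial derivatives of order less than \<open>m\<close> vanish on \<open>Y\<close>. The recursive form avoids multi-indices.
\<close>

primrec flat :: "complex set \<Rightarrow> nat \<Rightarrow> (complex \<Rightarrow> complex) \<Rightarrow> bool" where
  "flat Y 0 f = True"
| "flat Y (Suc m) f = ((\<forall>y\<in>Y. f y = 0) \<and> flat Y m (pd 1 f) \<and> flat Y m (pd \<i> f))"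

lemma flat_Suc: "flat Y (Suc m) f \<Longrightarrow> flat Y m f"
proof (induction m arbitrary: f)
  case (Suc m)
  have "\<forall>y\<in>Y. f y = 0" "flat Y (Suc m) (pd 1 f)" "flat Y (Suc m) (pd \<i> f)"
    using Suc.prems unfolding flat.simps(2)[of Y "Suc m"] by blast+
  then show ?case unfolding flat.simps(2)[of Y m f] using Suc.IH by blast
qed simp

lemma flat_mono: "k \<le> m \<Longrightarrow> flat Y m f \<Longrightarrow> flat Y k f"
proof (induction m)
  case (Suc m)
  then show ?case using flat_Suc[of Y m f] by (cases "k = Suc m") auto
qed (simp only: le_zero_eq)

lemma flat_zero: "flat Y m f \<Longrightarrow> m > 0 \<Longrightarrow> y \<in> Y \<Longrightarrow> f y = 0"
  by (cases m) auto

lemma flat_pd: "flat Y (Suc m) f \<Longrightarrow> u \<in> {1, \<i>} \<Longrightarrow> flat Y m (pd u f)"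
  by auto

lemma flat_lincomb:
  "f \<in> CC \<Longrightarrow> g \<in> CC \<Longrightarrow> flat Y m f \<Longrightarrow> flat Y m g \<Longrightarrow> flat Y m (\<lambda>z. a * f z + b * g z)"
proof (induction m arbitrary: f g)
  case (Suc m)
  have "pd u (\<lambda>z. a * f z + b * g z) = (\<lambda>z. a * pd u f z + b * pd u g z)" for u
    by (rule ext) (rule pd_lincomb[OF Suc.prems(1,2)])
  moreover have "flat Y m (\<lambda>z. a * pd u f z + b * pd u g z)" if "u \<in> {1, \<i>}" for u
    using that Suc.prems by (intro Suc.IH CC_pd flat_pd)
  ultimately show ?case using Suc.prems(3,4) by simp
qed simp

lemma flat_add: "f \<in> CC \<Longrightarrow> g \<in> CC \<Longrightarrow> flat Y m f \<Longrightarrow> flat Y m g \<Longrightarrow> flat Y m (\<lambda>z. f z + g z)"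
  and flat_diff: "f \<in> CC \<Longrightarrow> g \<in> CC \<Longrightarrow> flat Y m f \<Longrightarrow> flat Y m g \<Longrightarrow> flat Y m (\<lambda>z. f z - g z)"
  and flat_scale: "f \<in> CC \<Longrightarrow> flat Y m f \<Longrightarrow> flat Y m (\<lambda>z. a * f z)"
  using flat_lincomb[of f g Y m 1 1] flat_lincomb[of f g Y m 1 "- 1"] flat_lincomb[of f f Y m a 0] by simp_all

lemma flat_const0: "flat Y m (\<lambda>z. 0)"
proof (induction m)
  case (Suc m)
  have "pd u (\<lambda>z. 0) = (\<lambda>z. 0)" for u by (rule ext) (rule pd_eq[OF has_derivative_const])
  then show ?case using Suc by simp
qed simp

lemma flat_sum: "(\<And>i. i \<in> I \<Longrightarrow> f i \<in> CC) \<Longrightarrow> (\<And>i. i \<in> I \<Longrightarrow> flat Y m (f i)) \<Longrightarrow> flat Y m (\<lambda>z. \<Sum>i\<in>I. f i z)"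
proof (induction I rule: infinite_finite_induct)
  case (insert i I)
  have "flat Y m (\<lambda>z. f i z + (\<Sum>i\<in>I. f i z))"
    by (rule flat_add) (use insert in \<open>simp_all add: CC_sum\<close>)
  then show ?case using insert by simp
qed (simp_all add: flat_const0)

lemma pd_mult_linear_fun:
  "bounded_linear l \<Longrightarrow> f \<in> CC \<Longrightarrow> pd u (\<lambda>z. l z * f z) = (\<lambda>z. l u * f z + l z * pd u f z)"
  by (rule ext) (rule pd_mult_linear)

lemma flat_mult_linear:
  assumes l: "bounded_linear l"
  shows "f \<in> CC \<Longrightarrow> flat Y m f \<Longrightarrow> flat Y m (\<lambda>z. l z * f z)"
proof (induction m arbitrary: f)
  case (Suc m)
  have "flat Y m (pd u (\<lambda>z. l z * f z))" if "u \<in> {1, \<i>}" for u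
    unfolding pd_mult_linear_fun[OF l Suc.prems(1)]
    using Suc.prems that flat_pd[OF Suc.prems(2) that] flat_Suc[OF Suc.prems(2)]
    by (intro flat_add flat_scale Suc.IH CC_scale CC_mult_linear[OF l] CC_pd)
  then show ?case using Suc.prems(2) by simp
qed simp

lemma flat_compose:
  assumes m: "bounded_linear m" and Y: "\<And>y. y \<in> Y \<Longrightarrow> m y \<in> Y"
  shows "f \<in> CC \<Longrightarrow> flat Y k f \<Longrightarrow> flat Y k (\<lambda>z. f (m z))"
proof (induction k arbitrary: f)
  case (Suc k)
  have "flat Y k (pd u (\<lambda>z. f (m z)))" for u
  proof -
    have "pd u (\<lambda>z. f (m z)) = (\<lambda>z. of_real (Re (m u)) * pd 1 f (m z) + of_real (Im (m u)) * pd \<i> f (m z))"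
      using pd_compose(1)[OF m Suc.prems(1), of u 0] by (intro ext) (simp add: scaleR_conv_of_real)
    then show ?thesis using Suc 
      by (simp only:) (intro flat_lincomb CC_compose_linear[OF m] Suc.IH CC_pd1 CC_pdi, auto)
  qed
  then show ?case using Suc.prems(2) Y by simp
qed simp

lemma flat_divide:
  assumes l: "bounded_linear l" and Y: "\<And>y. y \<in> Y \<Longrightarrow> l y \<noteq> 0"
  shows "q \<in> CC \<Longrightarrow> flat Y m (\<lambda>z. l z * q z) \<Longrightarrow> flat Y m q"
proof (induction m arbitrary: q)
  case (Suc m)
  have q: "flat Y m q" by (rule Suc.IH[OF Suc.prems(1) flat_Suc[OF Suc.prems(2)]])
  have "flat Y m (pd u q)" if u: "u \<in> {1, \<i>}" for u
  proof (rule Suc.IH[OF CC_pd[OF Suc.prems(1) u]])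
    have "flat Y m (\<lambda>z. l u * q z + l z * pd u q z)"
      using flat_pd[OF Suc.prems(2) u] unfolding pd_mult_linear_fun[OF l Suc.prems(1)] .
    then have "flat Y m (\<lambda>z. (l u * q z + l z * pd u q z) - l u * q z)"
      by (intro flat_diff flat_scale CC_add CC_scale CC_mult_linear[OF l] CC_pd u Suc.prems(1) q)
    then show "flat Y m (\<lambda>z. l z * pd u q z)" by simp
  qed
  moreover have "q y = 0" if "y \<in> Y" for y using flat_zero[OF Suc.prems(2) _ that] Y[OF that] by simp
  ultimately show ?case by simp
qed simp

lemma flat_d: 
  assumes "f \<in> CC" "flat Y (Suc m) f"
  shows "flat Y m (d_z f)" "flat Y m (d_zbar f)"
proof -
  have "d_zbar f = (\<lambda>z. (1 / 2) * pd 1 f z + (\<i> / 2) * pd \<i> f z)" 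
    "d_z f = (\<lambda>z. (1 / 2) * pd 1 f z + (- \<i> / 2) * pd \<i> f z)"
    by (auto simp: d_zbar_def d_z_def field_simps)
  then show "flat Y m (d_z f)" "flat Y m (d_zbar f)"
    using assms by (simp_all only: flat.simps) (intro flat_lincomb CC_pd1 CC_pdi; simp)+
qed

text \<open>
  The rotation field, the differential part of the angular momentum.
\<close>

definition th :: "oper" where
  "th f z = z * d_z f z - cnj z * d_zbar f z"

lemma CC_th: "f \<in> CC \<Longrightarrow> th f \<in> CC"
  unfolding th_def[abs_def] by (intro CC_diff CC_gens CC_d_z CC_d_zbar)

lemma th_pow_CC: "f \<in> CC \<Longrightarrow> (th ^^ m) f \<in> CC"
  by (induction m) (auto intro: CC_th)

lemma flat_th: "f \<in> CC \<Longrightarrow> flat Y (Suc m) f \<Longrightarrow> flat Y m (th f)"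
  unfolding th_def[abs_def]
  by (intro flat_diff flat_mult_linear[OF bounded_linear_ident] flat_mult_linear[OF bounded_linear_cnj]
     flat_d CC_gens CC_d_z CC_d_zbar)

lemma flat_th_pow: "f \<in> CC \<Longrightarrow> flat Y (m + k) f \<Longrightarrow> flat Y k ((th ^^ m) f)"
proof (induction m arbitrary: k)
  case (Suc m)
  have "flat Y (Suc k) ((th ^^ m) f)"
    using Suc.IH[of "Suc k"] Suc.prems by (simp del: flat.simps)
  then show ?case using flat_th[OF th_pow_CC[OF Suc.prems(1)], of Y k m] by (simp del: flat.simps)
qed simp

lemma d_lincomb:
  assumes "f \<in> CC" "g \<in> CC"
  shows "d_zbar (\<lambda>z. f z - g z) z = d_zbar f z - d_zbar g z" "d_z (\<lambda>z. f z - g z) z = d_z f z - d_z g z"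
  unfolding d_zbar_def d_z_def pd_diff[OF assms] by (simp_all add: field_simps)

lemma th_diff: "f \<in> CC \<Longrightarrow> g \<in> CC \<Longrightarrow> th (\<lambda>z. f z - g z) = (\<lambda>z. th f z - th g z)"
  by (rule ext) (simp add: th_def d_lincomb algebra_simps)

lemma CC_power_factor: "g \<in> CC \<Longrightarrow> (\<lambda>z. (z - y) ^ M * g z) \<in> CC"
proof (induction M)
  case (Suc M)
  have "(\<lambda>z. z * ((z - y) ^ M * g z) - y * ((z - y) ^ M * g z)) \<in> CC"
    by (intro CC_diff CC_gens Suc)
  moreover have "(\<lambda>z. z * ((z - y) ^ M * g z) - y * ((z - y) ^ M * g z)) = (\<lambda>z. (z - y) ^ Suc M * g z)"
    by (rule ext) (simp add: algebra_simps)
  ultimately show ?case by simp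
qed simp

lemma pd_factor: "g \<in> CC \<Longrightarrow> pd u (\<lambda>z. (z - y) * g z) = (\<lambda>z. u * g z + (z - y) * pd u g z)"
proof (rule ext)
  fix z assume g: "g \<in> CC"
  have "(\<lambda>z. (z - y) * g z) = (\<lambda>z. z * g z - y * g z)" by (simp add: algebra_simps)
  then have "pd u (\<lambda>z. (z - y) * g z) z = pd u (\<lambda>z. z * g z) z - y * pd u g z"
    using pd_diff[OF CC_gens(2)[OF g] CC_scale[OF g]] pd_scale[OF g] by simp
  then show "pd u (\<lambda>z. (z - y) * g z) z = u * g z + (z - y) * pd u g z"
    using pd_mult_linear[OF bounded_linear_ident g, of u z] by (simp add: algebra_simps)
qed

lemma flat_factor: "g \<in> CC \<Longrightarrow> flat {y} m g \<Longrightarrow> flat {y} (Suc m) (\<lambda>z. (z - y) * g z)"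
proof (induction m arbitrary: g)
  case 0
  then show ?case by simp
next
  case (Suc m)
  have C: "(\<lambda>z. (z - y) * pd u g z) \<in> CC" if "u \<in> {1, \<i>}" for u
    using CC_power_factor[OF CC_pd[OF Suc.prems(1) that], of y 1] by simp
  have "flat {y} (Suc m) (pd u (\<lambda>z. (z - y) * g z))" if u: "u \<in> {1, \<i>}" for u
    unfolding pd_factor[OF Suc.prems(1)]
    by (intro flat_add flat_scale CC_scale Suc.prems C u Suc.IH CC_pd flat_pd[OF Suc.prems(2)])
  then show ?case by simp
qed

lemma flat_power_factor: "g \<in> CC \<Longrightarrow> flat {y} M (\<lambda>z. (z - y) ^ M * g z)"
proof (induction M)
  case (Suc M)
  then show ?case using flat_factor[OF CC_power_factor[OF Suc.prems], of y M y M] by (simp add: mult.assoc)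
qed simp

lemma flat_points: "(\<And>y. y \<in> Y \<Longrightarrow> flat {y} m f) \<Longrightarrow> flat Y m f"
  by (induction m arbitrary: f) auto

lemma th_power_factor:
  assumes "g \<in> CC"
  shows "(th ^^ M) (\<lambda>z. (z - y) ^ M * g z) y = fact M * y ^ M * g y"
  using assms
proof (induction M arbitrary: g)
  case 0
  then show ?case by simp
next
  case (Suc M)
  let ?h = "\<lambda>z. of_nat (Suc M) * (z * g z) + (z * th g z - y * th g z)"
  have h: "?h \<in> CC" by (intro CC_add CC_scale CC_diff CC_gens CC_th Suc.prems)
  have one: "th (\<lambda>z. (z - y) * g z) z = z * g z + (z - y) * th g z" if "g \<in> CC" for g z
    unfolding th_def d_z_def d_zbar_def pd_factor[OF that] by (simp add: field_simps)
  have "th (\<lambda>z. (z - y) ^ k * g z) z = of_nat k * (z - y) ^ (k - 1) * (z * g z) + (z - y) ^ k * th g z" for k z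
  proof (induction k arbitrary: z)
    case 0
    then show ?case by simp
  next
    case (Suc k)
    have "th (\<lambda>z. (z - y) ^ Suc k * g z) z = th (\<lambda>z. (z - y) * ((z - y) ^ k * g z)) z" by (simp add: mult.assoc)
    also have "\<dots> = z * ((z - y) ^ k * g z) + (z - y) * th (\<lambda>z. (z - y) ^ k * g z) z"
      by (rule one[OF CC_power_factor[OF \<open>g \<in> CC\<close>]])
    also have "\<dots> = of_nat (Suc k) * (z - y) ^ (Suc k - 1) * (z * g z) + (z - y) ^ Suc k * th g z"
      unfolding Suc by (cases k) (simp_all add: algebra_simps)
    finally show ?case .
  qed
  note power_rule = this
  have "th (\<lambda>z. (z - y) ^ Suc M * g z) z = (z - y) ^ M * ?h z" for z
    unfolding power_rule by (simp add: algebra_simps)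
  then have "th (\<lambda>z. (z - y) ^ Suc M * g z) = (\<lambda>z. (z - y) ^ M * ?h z)"
    by (rule ext)
  then have "(th ^^ Suc M) (\<lambda>z. (z - y) ^ Suc M * g z) y = (th ^^ M) (\<lambda>z. (z - y) ^ M * ?h z) y"
    by (simp add: funpow_swap1 del: of_nat_Suc power_Suc)
  also have "\<dots> = fact M * y ^ M * ?h y" by (rule Suc.IH[OF h])
  finally show ?case by (simp add: algebra_simps)
qed

text \<open>
  Take \<open>(z - y0) ^ M\<close> times the product of \<open>(z - y) ^ (M + 1)\<close> over the other points \<open>y\<close>.
\<close>

lemma test_function:
  assumes "finite Y" "y0 \<in> Y" "0 \<notin> Y"
  obtains f where "f \<in> CC" "flat Y M f" "\<And>y. y \<in> Y \<Longrightarrow> (th ^^ M) f y = 0 \<longleftrightarrow> y \<noteq> y0"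
proof -
  define g where "g X z = (\<Prod>y\<in>X. (z - y) ^ Suc M)" for X :: "complex set" and z
  have g: "g X \<in> CC" if "finite X" for X
    using that
  proof (induction X)
    case empty
    have "g {} = (\<lambda>z. 1)" by (simp add: g_def fun_eq_iff)
    then show ?case by (simp only: CC_const)
  next
    case (insert y X)
    have "g (insert y X) = (\<lambda>z. (z - y) ^ Suc M * g X z)" using insert(1,2) by (simp add: g_def fun_eq_iff)
    then show ?case by (simp only: CC_power_factor[OF insert(3)])
  qed
  let ?g = "g (Y - {y0})"
  let ?f = "\<lambda>z. (z - y0) ^ M * ?g z"
  have gC: "?g \<in> CC" using assms(1) by (intro g) auto
  have f: "?f \<in> CC" by (rule CC_power_factor[OF gC])
  have other: "flat {y} (M + 1) ?f" if "y \<in> Y" "y \<noteq> y0" for y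
  proof -
    have h: "(\<lambda>z. (z - y0) ^ M * g (Y - {y0} - {y}) z) \<in> CC" 
      using assms(1) by (intro CC_power_factor g) auto
    have "?g z = (z - y) ^ Suc M * g (Y - {y0} - {y}) z" for z
      unfolding g_def by (rule prod.remove) (use assms(1) that in auto)
    then have "?f = (\<lambda>z. (z - y) ^ Suc M * ((z - y0) ^ M * g (Y - {y0} - {y}) z))"
      by (simp add: fun_eq_iff)
    then show ?thesis using flat_power_factor[OF h, of y "Suc M"] by simp
  qed
  have same: "flat {y0} M ?f" by (rule flat_power_factor[OF gC])
  have "flat Y M ?f"
  proof (rule flat_points)
    fix y assume "y \<in> Y"
    then show "flat {y} M ?f"
      using same other[of y] flat_mono[of M "M + 1" "{y}" ?f] by (cases "y = y0") auto
  qed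
  moreover have "(th ^^ M) ?f y = 0 \<longleftrightarrow> y \<noteq> y0" if y: "y \<in> Y" for y
  proof (cases "y = y0")
    case True
    have "y0 \<noteq> 0" using assms(2,3) by auto
    moreover have "?g y0 \<noteq> 0" using assms(1) by (auto simp: g_def)
    ultimately show ?thesis unfolding True th_power_factor[OF gC] by simp
  next
    case False
    then show ?thesis using flat_zero[OF flat_th_pow[OF f other[OF y False]], of y] by simp
  qed
  ultimately show thesis using that f by blast
qed

context
  fixes n :: nat and \<nu>0 \<nu>1 :: complex
  assumes n2: "n \<ge> 2" and \<nu>: "odd n \<Longrightarrow> \<nu>0 = \<nu>1"
begin

interpretation D: dunkl_algebra Lc Lz Lzb "Ld n \<nu>0 \<nu>1" "Ldb n \<nu>0 \<nu>1" "LS n" "LR n" n "cc \<nu>0 \<nu>1"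
  by (rule dunkl_algebra_lop[OF n2 \<nu>])

lemma bounded_linear_refl_map: "bounded_linear (refl_map n k)"
  unfolding refl_map_def by (rule bounded_linear_refl)

lemma ap_rho: "f \<in> CC \<Longrightarrow> ap D.rho f = (\<lambda>z. \<Sum>l\<in>{0..<int n}. cc \<nu>0 \<nu>1 l * f (refl_map n l z))"
  by (rule ext) (simp add: D.rho_def ap_simps)

lemma ap_sg: 
  assumes "f \<in> CC"
  shows "ap D.sg f = (\<lambda>z. th f z +
    (\<Sum>l\<in>{0..<int n}. cc \<nu>0 \<nu>1 l * ((z * cnj (rv n l) - cnj z * rv n l) * refl_quot (rv n l) f z)))"
proof (rule ext)
  fix z
  have 1: "cc \<nu>0 \<nu>1 l * ((z * cnj (rv n l) - cnj z * rv n l) * refl_quot (rv n l) f z) =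
    z * (cc \<nu>0 \<nu>1 l * cnj (rv n l) * refl_quot (rv n l) f z) - cnj z * (cc \<nu>0 \<nu>1 l * rv n l * refl_quot (rv n l) f z)" for l
    by (simp add: algebra_simps)
  have "ap D.sg f z = z * ddb n \<nu>0 \<nu>1 f z - cnj z * dd n \<nu>0 \<nu>1 f z"
    by (simp add: D.sg_def ap_simps assms)
  then show "ap D.sg f z = th f z +
    (\<Sum>l\<in>{0..<int n}. cc \<nu>0 \<nu>1 l * ((z * cnj (rv n l) - cnj z * rv n l) * refl_quot (rv n l) f z))"
    unfolding 1 sum_subtractf sum_distrib_left[symmetric] ddb_def dd_def th_def by (simp add: algebra_simps)
qed

text \<open>
  The operator \<open>x\<close> agrees with the \<open>m\<close>-th power of the rotation field up to terms that lower the order of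
  vanishing on \<open>Y\<close> by less than \<open>m\<close>.
\<close>

definition close :: "complex set \<Rightarrow> lop \<Rightarrow> nat \<Rightarrow> bool" where
  "close Y x m \<longleftrightarrow> (\<forall>f\<in>CC. \<forall>k. flat Y (m + k) f \<longrightarrow> flat Y (Suc k) (\<lambda>z. ap x f z - (th ^^ m) f z))"

lemma th_pow_diff: "f \<in> CC \<Longrightarrow> g \<in> CC \<Longrightarrow> (th ^^ m) (\<lambda>z. f z - g z) = (\<lambda>z. (th ^^ m) f z - (th ^^ m) g z)"
  by (induction m) (auto simp: th_diff th_pow_CC)

lemma close_flat:
  assumes "close Y x m" "f \<in> CC" "flat Y (m + k) f"
  shows "flat Y k (ap x f)"
proof -
  have "flat Y k (\<lambda>z. ap x f z - (th ^^ m) f z)"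
    using assms flat_Suc unfolding close_def by blast
  then have "flat Y k (\<lambda>z. (ap x f z - (th ^^ m) f z) + (th ^^ m) f z)"
    by (intro flat_add CC_diff ap_CC th_pow_CC assms flat_th_pow)
  then show ?thesis by simp
qed

lemma close_mult:
  assumes x: "close Y x m" and y: "close Y y k"
  shows "close Y (x * y) (m + k)"
  unfolding close_def
proof (intro ballI allI impI)
  fix f j assume f: "f \<in> CC" and fl: "flat Y (m + k + j) f"
  have kj: "k + (m + j) = m + k + j" by simp
  let ?y = "ap y f"
  have y1: "flat Y (Suc (m + j)) (\<lambda>z. ?y z - (th ^^ k) f z)" 
    using y f fl unfolding close_def kj[symmetric] by blast
  have y2: "flat Y (m + j) ?y" using close_flat[OF y f, of "m + j"] fl unfolding kj by blast
  have x1: "flat Y (Suc j) (\<lambda>z. ap x ?y z - (th ^^ m) ?y z)" 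
    using x ap_CC[OF f] y2 unfolding close_def by blast
  have "flat Y (Suc j) ((th ^^ m) (\<lambda>z. ?y z - (th ^^ k) f z))"
    using y1 by (intro flat_th_pow CC_diff ap_CC f th_pow_CC) simp
  then have x2: "flat Y (Suc j) (\<lambda>z. (th ^^ m) ?y z - (th ^^ (m + k)) f z)"
    by (simp add: th_pow_diff ap_CC f th_pow_CC funpow_add)
  have "flat Y (Suc j) (\<lambda>z. (ap x ?y z - (th ^^ m) ?y z) + ((th ^^ m) ?y z - (th ^^ (m + k)) f z))"
    by (intro flat_add x1 x2 CC_diff ap_CC th_pow_CC f)
  then show "flat Y (Suc j) (\<lambda>z. ap (x * y) f z - (th ^^ (m + k)) f z)"
    by (simp add: ap_simps f)
qed

lemma close_one: "close Y 1 0"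
  unfolding close_def by (simp add: ap_ring del: flat.simps) (auto simp: flat_const0 simp del: flat.simps)

lemma close_pow: "close Y x m \<Longrightarrow> close Y (x ^ k) (k * m)"
  by (induction k) (auto intro: close_one close_mult)

context
  fixes Y :: "complex set"
  assumes inv: "\<And>l y. y \<in> Y \<Longrightarrow> refl_map n l y \<in> Y" and reg: "\<And>l y. y \<in> Y \<Longrightarrow> den (rv n l) y \<noteq> 0"
begin

lemma flat_refl_map: "f \<in> CC \<Longrightarrow> flat Y k f \<Longrightarrow> flat Y k (\<lambda>z. f (refl_map n l z))"
  by (rule flat_compose[OF bounded_linear_refl_map inv])

text \<open>
  Away from the mirrors division by \<open>den\<close> does not change the order of vanishing.
\<close>

lemma flat_refl_quot:
  assumes f: "f \<in> CC" "flat Y k f"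
  shows "flat Y k (refl_quot (rv n l) f)"
proof (rule flat_divide[OF bounded_linear_den reg refl_quot_CC[OF norm_rv f(1)]])
  have "flat Y k (\<lambda>z. f z - f (refl_map n l z))"
    by (intro flat_diff f CC_gens flat_refl_map)
  moreover have "den (rv n l) z * refl_quot (rv n l) f z = f z - f (refl_map n l z)" for z
    using refl_quot_den[OF norm_rv f(1), of n l z] by (simp add: refl_map_def mult.commute)
  ultimately show "flat Y k (\<lambda>z. den (rv n l) z * refl_quot (rv n l) f z)" by simp
qed

lemma flat_rho: "f \<in> CC \<Longrightarrow> flat Y k f \<Longrightarrow> flat Y k (ap D.rho f)"
  unfolding ap_rho by (intro flat_sum flat_scale CC_scale CC_gens flat_refl_map)

lemma close_sg: "close Y D.sg 1"
  unfolding close_def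
proof (intro ballI allI impI)
  fix f k assume f: "f \<in> CC" and fl: "flat Y (1 + k) f"
  have lin: "bounded_linear (\<lambda>z. z * cnj (rv n l) - cnj z * rv n l)" for l
    by (intro bounded_linear_sub bounded_linear_mult_left
      bounded_linear_compose[OF bounded_linear_mult_left bounded_linear_cnj])
  have "flat Y (Suc k) (\<lambda>z. \<Sum>l\<in>{0..<int n}. cc \<nu>0 \<nu>1 l * ((z * cnj (rv n l) - cnj z * rv n l) * refl_quot (rv n l) f z))"
    using fl by (intro flat_sum flat_scale CC_scale CC_mult_linear[OF lin] flat_mult_linear[OF lin] 
      refl_quot_CC[OF norm_rv f] flat_refl_quot f) simp_all
  then show "flat Y (Suc k) (\<lambda>z. ap D.sg f z - (th ^^ 1) f z)"
    by (simp add: ap_sg[OF f] del: flat.simps)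
qed

lemma close_Cc: "close Y D.Cc 2"
  unfolding close_def
proof (intro ballI allI impI)
  fix f k assume f: "f \<in> CC" and fl: "flat Y (2 + k) f"
  have "close Y (D.sg * D.sg) 2" using close_mult[OF close_sg close_sg] by (simp add: numeral_2_eq_2)
  then have 1: "flat Y (Suc k) (\<lambda>z. ap (D.sg * D.sg) f z - (th ^^ 2) f z)"
    using f fl unfolding close_def by blast
  have "flat Y (Suc k) f" using flat_mono[OF _ fl, of "Suc k"] by simp
  then have 2: "flat Y (Suc k) (ap (D.rho * D.rho) f)" by (simp only: ap_ring f) (intro flat_rho ap_CC f)
  have "flat Y (Suc k) (\<lambda>z. (ap (D.sg * D.sg) f z - (th ^^ 2) f z) + ap (D.rho * D.rho) f z)"
    by (intro flat_add 1 2 CC_diff ap_CC th_pow_CC f)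
  then show "flat Y (Suc k) (\<lambda>z. ap D.Cc f z - (th ^^ 2) f z)"
    unfolding D.Cc_def ap_ring(3)[OF f] by (simp only: diff_add_eq)
qed

lemma close_invariant: "close Y (D.sg ^ (m mod 2) * D.Cc ^ (m div 2)) m"
  using close_mult[OF close_pow[OF close_sg, of "m mod 2"] close_pow[OF close_Cc, of "m div 2"]] by simp

text \<open>
  An operator of order less than the order of vanishing yields 0 on the orbit, and at equal order only the
  leading part contributes.
\<close>

lemma invariant_value:
  assumes f: "f \<in> CC" "flat Y M f" and y: "y \<in> Y" and m: "m \<le> M"
  shows "ap (D.sg ^ (m mod 2) * D.Cc ^ (m div 2)) f y = (if m = M then (th ^^ M) f y else 0)"
proof -
  have "flat Y (m + (M - m)) f" using f(2) m by simp
  then have "flat Y (Suc (M - m)) (\<lambda>z. ap (D.sg ^ (m mod 2) * D.Cc ^ (m div 2)) f z - (th ^^ m) f z)"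
    using close_invariant[of m] f(1) unfolding close_def by blast
  from flat_zero[OF this _ y] have 1: "ap (D.sg ^ (m mod 2) * D.Cc ^ (m div 2)) f y = (th ^^ m) f y" by simp
  show ?thesis
  proof (cases "m = M")
    case False
    have "flat Y (M - m) ((th ^^ m) f)" using f m by (intro flat_th_pow) simp_all
    from flat_zero[OF this _ y] show ?thesis using 1 False m by simp
  qed (use 1 in simp)
qed

end

section \<open>A free orbit\<close>

text \<open>
  The arguments of points on the mirrors are multiples of \<open>\<pi> / (2 n)\<close>, so this point lies on no mirror.
\<close>

definition "base_point = cis (pi / (4 * real n))"

definition orbit_pt :: "int \<times> bool \<Rightarrow> complex" where
  "orbit_pt = (\<lambda>(k, e). if e then om n (- k) * base_point else refl_map n k base_point)"

lemma om_power_n: "om n k ^ n = 1"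
proof -
  have "om n k ^ n = cis (2 * pi * of_int k)"
    using n2 by (simp add: om_def Complex.DeMoivre)
  then show ?thesis using cis_multiple_2pi[of "of_int k"] by simp
qed

text \<open>
  The \<open>n\<close>-th powers of the rotated base points are \<open>cis (\<pi> / 4)\<close>, and those of the reflected ones are
  \<open>cis (- \<pi> / 4)\<close> up to sign.
\<close>

lemma orbit_pt_mixed: "orbit_pt (k, True) \<noteq> orbit_pt (l, False)"
proof
  assume "orbit_pt (k, True) = orbit_pt (l, False)"
  then have "(om n (- k) * base_point) ^ n = (- 1 * om n l * cnj base_point) ^ n"
    by (simp add: orbit_pt_def refl_map_eq)
  then have "base_point ^ n = (- 1) ^ n * cnj (base_point ^ n)"
    unfolding power_mult_distrib om_power_n by simp
  moreover have "base_point ^ n = cis (pi / 4)"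
    using n2 by (simp add: base_point_def Complex.DeMoivre)
  ultimately have "cis (pi / 4) = (- 1) ^ n * cis (- (pi / 4))" by (simp add: cis_cnj)
  then show False by (cases "even n") (auto simp: complex_eq_iff cos_45 sin_45)
qed

lemma orbit_pt_inj: "inj_on orbit_pt ({0..<int n} \<times> UNIV)"
proof (rule inj_onI, clarify)
  fix k l e e' assume kl: "k \<in> {0..<int n}" "l \<in> {0..<int n}" and eq: "orbit_pt (k, e) = orbit_pt (l, e')"
  have z: "base_point \<noteq> 0" by (simp add: base_point_def)
  have e: "e = e'" using eq orbit_pt_mixed[of k l] orbit_pt_mixed[of l k] by (cases e; cases e') auto
  have "om n (k - l) = 1"
  proof (cases e')
    case True
    then have "om n (- k) = om n (- l)" using eq e z by (simp add: orbit_pt_def)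
    then show ?thesis using om_add[of n k "- l"] by (metis om_minus_right diff_conv_add_uminus)
  next
    case False
    then have "om n k = om n l" using eq e z by (simp add: orbit_pt_def refl_map_eq)
    then show ?thesis using om_add[of n k "- l"] by (metis om_minus_right diff_conv_add_uminus)
  qed
  then have "int n dvd k - l" using om_eq_1_iff[of n "k - l"] n2 by simp
  then have "k mod int n = l mod int n" by (simp add: mod_eq_dvd_iff)
  then show "k = l \<and> e = e'" using kl e by simp
qed

lemma orbit_pt_refl: "refl_map n l (orbit_pt (k, e)) = orbit_pt (if e then k + l else k - l, \<not> e)"
  by (simp add: orbit_pt_def refl_map_eq cnj_om om_add om_diff mult_ac)

lemma orbit_pt_mod: "orbit_pt (k mod int n, e) = orbit_pt (k, e)"
proof -
  have "orbit_pt (j + int n, e) = orbit_pt (j, e)" for j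
    using om_period[of n "- j - int n"] om_period[of n j] n2 by (simp add: orbit_pt_def refl_map_eq)
  then show ?thesis using mod_periodic[where f="\<lambda>j. orbit_pt (j, e)" and n=n and l=k] n2 by simp
qed

definition "orbit = orbit_pt ` ({0..<int n} \<times> UNIV)"

lemma orbit_pt_orbit: "orbit_pt (k, e) \<in> orbit"
proof -
  have "(k mod int n, e) \<in> {0..<int n} \<times> UNIV" using n2 by simp
  then show ?thesis unfolding orbit_def orbit_pt_mod[of k e, symmetric] by (rule imageI)
qed

lemma orbit_inv: "y \<in> orbit \<Longrightarrow> refl_map n l y \<in> orbit"
  unfolding orbit_def[symmetric] by (auto simp: orbit_def orbit_pt_refl intro: orbit_pt_orbit[unfolded orbit_def])

lemma orbit_reg: 
  assumes "y \<in> orbit"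
  shows "den (rv n l) y \<noteq> 0"
proof
  assume 0: "den (rv n l) y = 0"
  obtain k e where y: "y = orbit_pt (k, e)" using assms by (auto simp: orbit_def)
  have "refl_map n l y = y"
    using sub_reflection[OF norm_rv, of y n l] 0 by (simp add: refl_map_def)
  then show False unfolding y orbit_pt_refl
    using orbit_pt_mixed[of k "k + l"] orbit_pt_mixed[of "k - l" k] by (cases e) auto
qed

lemma orbit_0: "0 \<notin> orbit"
  using orbit_reg[of 0] by (auto simp: den_def)

lemma finite_orbit: "finite orbit"
  by (simp add: orbit_def)

lemma invariant_S: "D.sg ^ (m mod 2) * D.Cc ^ (m div 2) * LS n k = LS n k * (D.sg ^ (m mod 2) * D.Cc ^ (m div 2))"
  and invariant_R: "D.sg ^ (m mod 2) * D.Cc ^ (m div 2) * LR n k = Lc ((- 1) ^ m) * (LR n k * (D.sg ^ (m mod 2) * D.Cc ^ (m div 2)))"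
proof -
  have G: "LS n k \<in> D.G" "LR n k \<in> D.G" by (auto simp: D.G_def)
  have C: "D.Cc ^ j * LS n k = LS n k * D.Cc ^ j" "D.Cc ^ j * LR n k = LR n k * D.Cc ^ j" for j
    by (rule D.comm_pow[symmetric], rule D.G_Cc, rule G)+
  have s: "(D.sg * y) * LS n k = LS n k * (D.sg * y)" if "y * LS n k = LS n k * y" for y
    by (simp only: mult.assoc that) (simp only: D.S_sg flip: mult.assoc)
  have r: "(D.sg * y) * LR n k = - (LR n k * (D.sg * y))" if "y * LR n k = LR n k * y" for y
  proof -
    have "(D.sg * y) * LR n k = (D.sg * LR n k) * y" by (simp only: mult.assoc that)
    also have "D.sg * LR n k = - (LR n k * D.sg)" by (simp add: D.R_sg)
    finally show ?thesis by (simp add: mult.assoc)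
  qed
  consider "m mod 2 = 0" "even m" | "m mod 2 = 1" "odd m" 
    by (metis even_iff_mod_2_eq_zero odd_iff_mod_2_eq_one)
  then have "D.sg ^ (m mod 2) * D.Cc ^ (m div 2) * LS n k = LS n k * (D.sg ^ (m mod 2) * D.Cc ^ (m div 2)) \<and>
    D.sg ^ (m mod 2) * D.Cc ^ (m div 2) * LR n k = Lc ((- 1) ^ m) * (LR n k * (D.sg ^ (m mod 2) * D.Cc ^ (m div 2)))"
    using C s[OF C(1), of "m div 2"] r[OF C(2), of "m div 2"] by cases (simp_all add: D.cst_minus)
  then show "D.sg ^ (m mod 2) * D.Cc ^ (m div 2) * LS n k = LS n k * (D.sg ^ (m mod 2) * D.Cc ^ (m div 2))"
    "D.sg ^ (m mod 2) * D.Cc ^ (m div 2) * LR n k = Lc ((- 1) ^ m) * (LR n k * (D.sg ^ (m mod 2) * D.Cc ^ (m div 2)))"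
    by auto
qed

text \<open>
  Induction on the number of orders. A test function of order \<open>M\<close> of vanishing is blind to the invariants
  of smaller order. Its image at the base point under \<open>X g\<close>, for an invariant \<open>X\<close> of order \<open>M\<close>, is up to sign the
  value of \<open>th ^^ M\<close> at the translate of the base point by \<open>g\<close>, and that value can be made to vanish for all \<open>g\<close> but one.
\<close>

lemma invariants_independent:
  assumes "(\<Sum>m<M. \<Sum>k\<in>{0..<int n}. Lc (a m k) * (D.sg ^ (m mod 2) * D.Cc ^ (m div 2) * LS n k)
      + Lc (b m k) * (D.sg ^ (m mod 2) * D.Cc ^ (m div 2) * LR n k)) = 0" 
    and "m < M" "k \<in> {0..<int n}"
  shows "a m k = 0 \<and> b m k = 0"
  using assms
proof (induction M)
  case (Suc M)
  let ?X = "\<lambda>m. D.sg ^ (m mod 2) * D.Cc ^ (m div 2)"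
  let ?t = "\<lambda>m k. Lc (a m k) * (?X m * LS n k) + Lc (b m k) * (?X m * LR n k)"
  have t: "ap (?t m k) f base_point =
    a m k * ap (?X m) f (orbit_pt (k, True)) + b m k * (- 1) ^ m * ap (?X m) f (orbit_pt (k, False))" if "f \<in> CC" for f m k
  proof -
    have "?t m k = Lc (a m k) * (LS n k * ?X m) + Lc (b m k * (- 1) ^ m) * (LR n k * ?X m)"
      unfolding invariant_S invariant_R by (simp add: D.cst_cst)
    moreover have "ap (\<dots>) f base_point = a m k * ap (?X m) f (orbit_pt (k, True)) + b m k * (- 1) ^ m * ap (?X m) f (orbit_pt (k, False))"
      for x using ap_CC[OF that, of "?X m"] by (simp only: ap_ring(3,6) ap_gens CC_gens that orbit_pt_def) simp
    ultimately show ?thesis by simp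
  qed
  have last: "a M k = 0 \<and> b M k = 0" if k: "k \<in> {0..<int n}" for k
  proof -
    have c: "(if e then a M k else b M k * (- 1) ^ M) = 0" for e
    proof -
      let ?y = "orbit_pt (k, e)"
      obtain f where f: "f \<in> CC" "flat orbit M f" and th: "\<And>y. y \<in> orbit \<Longrightarrow> (th ^^ M) f y = 0 \<longleftrightarrow> y \<noteq> ?y"
        using test_function[OF finite_orbit orbit_pt_orbit orbit_0] by metis
      have val: "ap (?X m) f (orbit_pt i) = (if m = M \<and> i = (k, e) then (th ^^ M) f ?y else 0)" 
        if "m < Suc M" "i \<in> {0..<int n} \<times> UNIV" for m i
      proof -
        have i: "orbit_pt i \<in> orbit" using that by (auto simp: orbit_def)
        have "orbit_pt i = ?y \<longleftrightarrow> i = (k, e)" 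
          using inj_on_eq_iff[OF orbit_pt_inj that(2), of "(k, e)"] k by auto
        then show ?thesis 
          using invariant_value[OF orbit_inv orbit_reg f i, of m] that(1) th[OF i] by auto
      qed
      have "0 = ap (\<Sum>m<Suc M. \<Sum>j\<in>{0..<int n}. ?t m j) f base_point"
        unfolding Suc.prems(1) by (simp add: ap_ring f)
      also have "\<dots> = (\<Sum>m<Suc M. \<Sum>j\<in>{0..<int n}. ap (?t m j) f base_point)"
        by (simp only: ap_sum[OF f(1)])
      also have "\<dots> = (\<Sum>m<Suc M. \<Sum>j\<in>{0..<int n}. if m = M then (if j = k then 
          (if e then a M k else b M k * (- 1) ^ M) * (th ^^ M) f ?y else 0) else 0)"
        unfolding t[OF f(1)] by (intro sum.cong refl) (simp add: val)
      also have "\<dots> = (if e then a M k else b M k * (- 1) ^ M) * (th ^^ M) f ?y"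
      proof -
        have sw: "(\<Sum>j\<in>{0..<int n}. if m = M then h j else 0) = (if m = M then \<Sum>j\<in>{0..<int n}. h j else 0)" for m and h :: "int \<Rightarrow> complex"
          by simp
        show ?thesis unfolding sw using k by (simp only: sum.delta finite_lessThan finite_atLeastLessThan_int if_True lessThan_iff lessI)
      qed
      finally show ?thesis using th[OF orbit_pt_orbit, of k e] by simp
    qed
    show ?thesis using c[of True] c[of False] by simp
  qed
  have "(\<Sum>m<M. \<Sum>k\<in>{0..<int n}. ?t m k) + (\<Sum>k\<in>{0..<int n}. ?t M k) = 0" using Suc.prems(1) by simp
  moreover have "(\<Sum>k\<in>{0..<int n}. ?t M k) = 0" by (rule sum.neutral) (simp add: last)
  ultimately have "(\<Sum>m<M. \<Sum>k\<in>{0..<int n}. ?t m k) = 0" by simp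
  then show ?case using Suc.IH Suc.prems(2,3) last by (cases "m = M") auto
qed simp

lemma dunkl_algebra_indep_lop:
  "dunkl_algebra_indep Lc Lz Lzb (Ld n \<nu>0 \<nu>1) (Ldb n \<nu>0 \<nu>1) (LS n) (LR n) n (cc \<nu>0 \<nu>1)"
  by unfold_locales (rule invariants_independent)

end

section \<open>The grading\<close>

context dunkl_algebra
begin

text \<open>The homogeneous components of the grading, indexed by all naturals so that degrees add.\<close>

definition "Par p = V.span {x. \<exists>l w. (l, w, x) \<in> hom \<and> l mod 2 = p mod (2 :: nat)}"

lemma Par_mod: "Par (p mod 2) = Par p"
  by (simp add: Par_def)

lemma hom_Par: "(l, w, x) \<in> hom \<Longrightarrow> x \<in> Par l"
  unfolding Par_def by (rule V.span_base) blast

lemma Par_add: "x \<in> Par p \<Longrightarrow> y \<in> Par p \<Longrightarrow> x + y \<in> Par p"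
  and Par_cst: "x \<in> Par p \<Longrightarrow> cst a * x \<in> Par p"
  and Par_minus: "x \<in> Par p \<Longrightarrow> - x \<in> Par p"
  unfolding Par_def by (fact V.span_add V.span_scale V.span_neg)+

lemma Par_alg: "x \<in> Par p \<Longrightarrow> x \<in> alg"
  unfolding Par_def alg_def by (erule V.span_mono[THEN subsetD, rotated]) blast

lemma Par_letter:
  assumes "x \<in> Par p" "a \<in> {z, zb, d, db}"
  shows "a * x \<in> Par (Suc p)"
  using assms(1) unfolding Par_def
proof (rule span_linear_image)
  fix x assume "x \<in> {x. \<exists>l w. (l, w, x) \<in> hom \<and> l mod 2 = p mod 2}"
  then obtain l w where x: "(l, w, x) \<in> hom" "l mod 2 = p mod 2" by blast
  have "\<exists>w. (Suc l, w, a * x) \<in> hom" using x(1) assms(2) by (blast intro: hom.intros)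
  moreover have "Suc l mod 2 = Suc p mod 2" using x(2) by presburger
  ultimately show "a * x \<in> V.span {x. \<exists>l w. (l, w, x) \<in> hom \<and> l mod 2 = Suc p mod 2}"
    by (intro V.span_base) blast
qed (auto simp: algebra_simps cst_left)

lemma hom_G_Par:
  assumes "g \<in> G" "(l, w, x) \<in> hom"
  shows "g * x \<in> Par l"
  using assms(2,1)
proof (induction arbitrary: g rule: hom.induct)
  case (1 h)
  then show ?case using G_mult hom.intros(1) hom_Par by blast
next
  case (2 l w x)
  have "S k * x \<in> Par l" "R k * x \<in> Par l" for k using 2(2) by (auto simp: G_def)
  then show ?case using 2(3) unfolding G_def
    by (elim UnE rangeE; simp only: S_z[THEN rw_assoc] R_z[THEN rw_assoc] mult.assoc mult_minus_left)
      (intro Par_cst Par_minus Par_letter; simp)+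
next
  case (3 l w x)
  have "S k * x \<in> Par l" "R k * x \<in> Par l" for k using 3(2) by (auto simp: G_def)
  then show ?case using 3(3) unfolding G_def
    by (elim UnE rangeE; simp only: S_zb[THEN rw_assoc] R_zb[THEN rw_assoc] mult.assoc mult_minus_left)
      (intro Par_cst Par_minus Par_letter; simp)+
next
  case (4 l w x)
  have "S k * x \<in> Par l" "R k * x \<in> Par l" for k using 4(2) by (auto simp: G_def)
  then show ?case using 4(3) unfolding G_def
    by (elim UnE rangeE; simp only: S_d[THEN rw_assoc] R_d[THEN rw_assoc] mult.assoc mult_minus_left)
      (intro Par_cst Par_minus Par_letter; simp)+
next
  case (5 l w x)
  have "S k * x \<in> Par l" "R k * x \<in> Par l" for k using 5(2) by (auto simp: G_def)
  then show ?case using 5(3) unfolding G_def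
    by (elim UnE rangeE; simp only: S_db[THEN rw_assoc] R_db[THEN rw_assoc] mult.assoc mult_minus_left)
      (intro Par_cst Par_minus Par_letter; simp)+
qed

lemma Par_span: "x \<in> Par p \<Longrightarrow> x \<in> V.span {x. \<exists>l w. (l, w, x) \<in> hom \<and> l mod 2 = p mod 2}"
  by (simp add: Par_def)

lemma Par_G: 
  assumes "g \<in> G" "x \<in> Par p"
  shows "g * x \<in> Par p"
  using assms(2) unfolding Par_def
proof (rule span_linear_image)
  fix x assume "x \<in> {x. \<exists>l w. (l, w, x) \<in> hom \<and> l mod 2 = p mod 2}"
  then obtain l w where x: "(l, w, x) \<in> hom" "l mod 2 = p mod 2" by blast
  then show "g * x \<in> V.span {x. \<exists>l w. (l, w, x) \<in> hom \<and> l mod 2 = p mod 2}"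
    using hom_G_Par[OF assms(1) x(1)] by (simp add: Par_def)
qed (auto simp: algebra_simps cst_left)

lemma hom_mult_Par: "(l, w, x) \<in> hom \<Longrightarrow> y \<in> Par q \<Longrightarrow> x * y \<in> Par (l + q)"
  by (induction rule: hom.induct) (auto simp: mult.assoc intro: Par_letter Par_G)

lemma Par_mult: 
  assumes "x \<in> Par p" "y \<in> Par q"
  shows "x * y \<in> Par (p + q)"
  using assms(1) unfolding Par_def
proof (rule span_linear_image)
  fix x assume "x \<in> {x. \<exists>l w. (l, w, x) \<in> hom \<and> l mod 2 = p mod 2}"
  then obtain l w where x: "(l, w, x) \<in> hom" "l mod 2 = p mod 2" by blast
  have "(l + q) mod 2 = (p + q) mod 2" using x(2) by (rule mod_add_cong) simp
  then show "x * y \<in> V.span {x. \<exists>l w. (l, w, x) \<in> hom \<and> l mod 2 = (p + q) mod 2}"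
    using hom_mult_Par[OF x(1) assms(2)] by (simp add: Par_def)
qed (auto simp: algebra_simps)

lemma letter_Par: "a \<in> {z, zb, d, db} \<Longrightarrow> a \<in> Par (Suc 0)"
  using Par_letter[OF hom_Par[OF hom.intros(1)[OF one_G]], of a] by simp

text \<open>
  The anticommutation rules for the letters suffice: moving the letters of a homogeneous word one by
  one around the argument of \<open>h\<close> produces the sign of the superbracket when the total parity is even;
  otherwise both sides vanish.
\<close>

lemma anticyclic_supertrace:
  assumes h: "lin h" and hG: "\<forall>x\<in>alg. \<forall>g\<in>G. h (g * x) = h (x * g)"
    and ha: "\<forall>x\<in>alg. \<forall>a\<in>{z, zb, d, db}. h (a * x + x * a) = 0" 
    and odd: "\<forall>l w x. (l, w, x) \<in> hom \<longrightarrow> odd l \<longrightarrow> h x = 0"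
    and x: "x \<in> Par p" and y: "y \<in> Par q"
  shows "h (x * y) = (- 1) ^ (p * q) * h (y * x)"
proof -
  have zero: "h u = 0" if "u \<in> Par r" "odd r" for u r
  proof (rule lin_span_eq[of h "\<lambda>_. 0" u, OF h _ Par_span[OF that(1)]])
    fix x assume "x \<in> {x. \<exists>l w. (l, w, x) \<in> hom \<and> l mod 2 = r mod 2}"
    then obtain l w where "(l, w, x) \<in> hom" "l mod 2 = r mod 2" by blast
    moreover from this that(2) have "odd l" by presburger
    ultimately show "h x = 0" using odd by blast
  qed (simp add: lin_def)
  have sign: "- ((- 1) ^ (l * Suc q)) = (- 1 :: complex) ^ (Suc l * q)" if "even (Suc (q + l))" for l q
    using that by (cases "even l"; cases "even q") simp_all
  have step: "h ((a * x) * y) = (- 1) ^ (Suc l * q) * h (y * (a * x))"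
    if IH: "\<And>y q. y \<in> Par q \<Longrightarrow> h (x * y) = (- 1) ^ (l * q) * h (y * x)"
    and x: "x \<in> Par l" and a: "a \<in> {z, zb, d, db}" and y: "y \<in> Par q" for a x y l q
  proof -
    have ya: "y * a \<in> Par (Suc q)" using Par_mult[OF y letter_Par[OF a]] by simp
    have "x * y \<in> alg" using Par_alg[OF x] Par_alg[OF y] by (rule alg_mult)
    then have "h (a * (x * y)) + h ((x * y) * a) = 0" using ha a lin_add[OF h] by metis
    then have 1: "h ((a * x) * y) = - h (x * (y * a))" by (simp add: mult.assoc add_eq_0_iff2)
    have 2: "h (x * (y * a)) = (- 1) ^ (l * Suc q) * h (y * (a * x))"
      using IH[OF ya] by (simp add: mult.assoc)
    show ?thesis
    proof (cases "even (Suc (q + l))")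
      case True
      show ?thesis unfolding 1 2 sign[OF True, symmetric] by simp
    next
      case False
      have "y * (a * x) \<in> Par (Suc (q + l))" using Par_mult[OF ya x] by (simp add: mult.assoc)
      then have "h (y * (a * x)) = 0" using zero False by blast
      then show ?thesis unfolding 1 2 by simp
    qed
  qed
  have word: "h (x * y) = (- 1) ^ (l * q) * h (y * x)" if "(l, w, x) \<in> hom" "y \<in> Par q" for l w x y q
    using that
  proof (induction arbitrary: y q rule: hom.induct)
    case (1 g)
    then show ?case using hG[rule_format, OF Par_alg[OF 1(2)] 1(1)] by simp
  next
    case (2 l w x)
    show ?case by (rule step[OF 2(2) hom_Par[OF 2(1)] _ 2(3)]) simp_all
  next
    case (3 l w x)
    show ?case by (rule step[OF 3(2) hom_Par[OF 3(1)] _ 3(3)]) simp_all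
  next
    case (4 l w x)
    show ?case by (rule step[OF 4(2) hom_Par[OF 4(1)] _ 4(3)]) simp_all
  next
    case (5 l w x)
    show ?case by (rule step[OF 5(2) hom_Par[OF 5(1)] _ 5(3)]) simp_all
  qed
  show ?thesis
  proof (rule lin_span_eq[of "\<lambda>x. h (x * y)" "\<lambda>x. (- 1) ^ (p * q) * h (y * x)" x, OF _ _ Par_span[OF x]])
    fix x assume "x \<in> {x. \<exists>l w. (l, w, x) \<in> hom \<and> l mod 2 = p mod 2}"
    then obtain l w where l: "(l, w, x) \<in> hom" "l mod 2 = p mod 2" by blast
    have "even l \<longleftrightarrow> even p" using l(2) by presburger
    then have "even (l * q) \<longleftrightarrow> even (p * q)" by simp
    then have "(- 1 :: complex) ^ (l * q) = (- 1) ^ (p * q)" by (simp only: minus_one_power_iff)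
    then show "h (x * y) = (- 1) ^ (p * q) * h (y * x)" using word[OF l(1) y] by simp
  qed (auto simp: lin_def distrib_left distrib_right lin_add[OF h] lin_cst[OF h] cst_left[of y] mult.assoc mult.left_commute)
qed

end

section \<open>Observables\<close>

lemma on_CC_ap: "(\<And>f. f \<in> CC \<Longrightarrow> T f = ap x f) \<Longrightarrow> on_CC T = ap x"
  by (rule ext) (simp add: on_CC_def ap_outside)

lemma ap_zero_fun: "ap x 0 = 0"
  using ap_scale[OF CC_const[of 0], of x 0] by (simp add: zero_fun_def)

lemma op_scale_ap: "op_scale a (ap x) = ap (Lc a * x)"
proof (rule ext)
  fix f
  show "op_scale a (ap x) f = ap (Lc a * x) f"
    by (cases "f \<in> CC") (simp_all add: op_scale_def ap_simps ap_outside fun_eq_iff)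
qed

lemma plus_ap: "ap x + ap y = ap (x + y)"
proof (rule ext)
  fix f
  show "(ap x + ap y) f = ap (x + y) f"
    by (cases "f \<in> CC") (simp_all add: ap_simps ap_outside fun_eq_iff)
qed

lemma comp_ap: "ap x \<circ> ap y = ap (x * y)"
proof (rule ext)
  fix f
  show "(ap x \<circ> ap y) f = ap (x * y) f"
    by (cases "f \<in> CC") (simp_all add: ap_simps ap_outside ap_zero_fun)
qed

lemma inj_ap: "inj ap"
  by (rule injI) (rule ap_inject)

context
  fixes n :: nat and \<nu>0 \<nu>1 :: complex
  assumes n2: "n \<ge> 2" and \<nu>: "odd n \<Longrightarrow> \<nu>0 = \<nu>1"
begin

interpretation D: dunkl_algebra_indep Lc Lz Lzb "Ld n \<nu>0 \<nu>1" "Ldb n \<nu>0 \<nu>1" "LS n" "LR n" n "cc \<nu>0 \<nu>1"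
  by (rule dunkl_algebra_indep_lop[OF n2 \<nu>])

lemma a_op_ap: "a_op n \<nu>0 \<nu>1 \<alpha> = ap (Lc (1 / 2) * Lz + Lc ((- 1) ^ \<alpha>) * Ld n \<nu>0 \<nu>1)"
  and b_op_ap: "b_op n \<nu>0 \<nu>1 \<alpha> = ap (Lc (1 / 2) * Lzb + Lc ((- 1) ^ \<alpha>) * Ldb n \<nu>0 \<nu>1)"
proof -
  have n: "n > 0" using n2 by simp
  have dk: "dunkl_z n \<nu>0 \<nu>1 f z = 2 * dd n \<nu>0 \<nu>1 f z" "dunkl_zbar n \<nu>0 \<nu>1 f z = 2 * ddb n \<nu>0 \<nu>1 f z"
    if "f \<in> CC" for f z
    using dunkl_dd[OF n \<nu> that] by blast+
  show "a_op n \<nu>0 \<nu>1 \<alpha> = ap (Lc (1 / 2) * Lz + Lc ((- 1) ^ \<alpha>) * Ld n \<nu>0 \<nu>1)"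
    unfolding a_op_def 
    by (rule on_CC_ap, rule ext) (simp only: ap_simps dk, simp add: field_simps)
  show "b_op n \<nu>0 \<nu>1 \<alpha> = ap (Lc (1 / 2) * Lzb + Lc ((- 1) ^ \<alpha>) * Ldb n \<nu>0 \<nu>1)"
    unfolding b_op_def 
    by (rule on_CC_ap, rule ext) (simp only: ap_simps dk, simp add: field_simps)
qed

lemma grp_op_rot: "grp_op (\<lambda>z. om n (- k) * z) = ap (LS n k)"
  and grp_op_refl: "grp_op (refl_map n k) = ap (LR n k)"
  unfolding grp_op_def by (rule on_CC_ap, simp add: ap_gens)+

lemma refl_map_comp: "refl_map n k \<circ> (\<lambda>z. om n (- l) * z) = refl_map n (k + l)"
  "refl_map n k \<circ> refl_map n l = (\<lambda>z. om n (- (l - k)) * z)"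
  by (simp_all add: fun_eq_iff refl_map_eq cnj_om om_add om_diff mult_ac)

text \<open>
  A composition of two reflections is a rotation, and every rotation is a composition of two reflections.
\<close>

lemma coxeter_group_eq: "coxeter_group n = range (\<lambda>k z. om n (- k) * z) \<union> range (refl_map n)"
proof (intro equalityI subsetI)
  fix g assume "g \<in> coxeter_group n"
  then show "g \<in> range (\<lambda>k z. om n (- k) * z) \<union> range (refl_map n)"
  proof induction
    case one
    have "id = (\<lambda>z. om n (- 0) * z)" by auto
    then show ?case by blast
  next
    case (step g k)
    have eq: "reflection (root_vec n k) = refl_map n (int k)" by (simp add: refl_map_def root_vec_rv)
    from step.IH consider l where "g = (\<lambda>z. om n (- l) * z)" | l where "g = refl_map n l" by blast
    then show ?case
    proof cases
      case (1 l)
      show ?thesis unfolding eq 1 refl_map_comp by blast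
    next
      case (2 l)
      show ?thesis unfolding eq 2 refl_map_comp by (intro UnI1 image_eqI[where x="l - int k"]) simp_all
    qed
  qed
next
  have refl: "refl_map n k \<in> coxeter_group n" for k
  proof -
    have "reflection (root_vec n (nat (k mod int n))) \<circ> id \<in> coxeter_group n"
      by (intro coxeter_group.intros)
    moreover have "om n (k mod int n) = om n k"
      using n2 by (intro mod_periodic om_period) simp
    then have "refl_map n (k mod int n) = refl_map n k" by (simp add: refl_map_eq fun_eq_iff)
    ultimately show ?thesis using n2 by (simp add: refl_map_def root_vec_rv)
  qed
  have rot: "(\<lambda>z. om n (- k) * z) \<in> coxeter_group n" for k
    using coxeter_group.step[OF refl[of k], of 0] refl_map_comp(2)[of 0 k]
    by (simp add: root_vec_rv flip: refl_map_def)
  fix g assume "g \<in> range (\<lambda>k z. om n (- k) * z) \<union> range (refl_map n)"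
  then show "g \<in> coxeter_group n" using refl rot by auto
qed

lemma grp_op_G: "grp_op ` coxeter_group n = ap ` D.G"
  unfolding coxeter_group_eq D.G_def image_Un image_image
  by (simp add: grp_op_rot grp_op_refl image_image)

lemma has_parity_ap_G: "g \<in> D.G \<Longrightarrow> has_parity n \<nu>0 \<nu>1 (ap g) 0"
proof -
  assume "g \<in> D.G"
  then have "ap g \<in> grp_op ` coxeter_group n" unfolding grp_op_G by (rule imageI)
  then show ?thesis using has_parity.gen_grp by auto
qed

lemma has_parity_ap_letter:
  assumes "x \<in> {Lz, Lzb, Ld n \<nu>0 \<nu>1, Ldb n \<nu>0 \<nu>1}"
  shows "has_parity n \<nu>0 \<nu>1 (ap x) 1"
proof -
  have 1: "Lc (1 / 2) * u + Lc (1 / 2) * u = u" for u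
    by (simp flip: distrib_right Lc_algebra(1))
  have "a_op n \<nu>0 \<nu>1 0 + a_op n \<nu>0 \<nu>1 1 = ap Lz" "b_op n \<nu>0 \<nu>1 0 + b_op n \<nu>0 \<nu>1 1 = ap Lzb"
    "op_scale (1 / 2) (a_op n \<nu>0 \<nu>1 0 + op_scale (- 1) (a_op n \<nu>0 \<nu>1 1)) = ap (Ld n \<nu>0 \<nu>1)"
    "op_scale (1 / 2) (b_op n \<nu>0 \<nu>1 0 + op_scale (- 1) (b_op n \<nu>0 \<nu>1 1)) = ap (Ldb n \<nu>0 \<nu>1)"
    unfolding a_op_ap b_op_ap plus_ap op_scale_ap
    by (rule arg_cong[of _ _ ap]; simp add: 1 D.cst_minus distrib_left)+
  moreover have "has_parity n \<nu>0 \<nu>1 (a_op n \<nu>0 \<nu>1 0 + a_op n \<nu>0 \<nu>1 1) 1" 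
    "has_parity n \<nu>0 \<nu>1 (b_op n \<nu>0 \<nu>1 0 + b_op n \<nu>0 \<nu>1 1) 1"
    "has_parity n \<nu>0 \<nu>1 (op_scale (1 / 2) (a_op n \<nu>0 \<nu>1 0 + op_scale (- 1) (a_op n \<nu>0 \<nu>1 1))) 1"
    "has_parity n \<nu>0 \<nu>1 (op_scale (1 / 2) (b_op n \<nu>0 \<nu>1 0 + op_scale (- 1) (b_op n \<nu>0 \<nu>1 1))) 1"
    by (intro has_parity.intros; simp)+
  ultimately show ?thesis using assms by auto
qed

lemma has_parity_ap_mult: 
  "has_parity n \<nu>0 \<nu>1 (ap x) p \<Longrightarrow> has_parity n \<nu>0 \<nu>1 (ap y) q \<Longrightarrow> has_parity n \<nu>0 \<nu>1 (ap (x * y)) ((p + q) mod 2)"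
  unfolding comp_ap[symmetric] by (rule has_parity.mult)

lemma has_parity_ap_add: 
  "has_parity n \<nu>0 \<nu>1 (ap x) p \<Longrightarrow> has_parity n \<nu>0 \<nu>1 (ap y) p \<Longrightarrow> has_parity n \<nu>0 \<nu>1 (ap (x + y)) p"
  unfolding plus_ap[symmetric] by (rule has_parity.add)

lemma has_parity_ap_minus: 
  "has_parity n \<nu>0 \<nu>1 (ap x) p \<Longrightarrow> has_parity n \<nu>0 \<nu>1 (ap (- x)) p"
  using has_parity.scale[of n \<nu>0 \<nu>1 "ap x" p "- 1"] by (simp add: op_scale_ap D.cst_minus)

lemma has_parity_hom: "(l, w, x) \<in> D.hom \<Longrightarrow> has_parity n \<nu>0 \<nu>1 (ap x) (l mod 2)"
proof (induction rule: D.hom.induct)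
  case (1 g)
  then show ?case using has_parity_ap_G by simp
next
  case (2 l w x)
  from has_parity_ap_mult[OF has_parity_ap_letter this(2), of Lz] show ?case by (simp add: mod_Suc_eq)
next
  case (3 l w x)
  from has_parity_ap_mult[OF has_parity_ap_letter this(2), of Lzb] show ?case by (simp add: mod_Suc_eq)
next
  case (4 l w x)
  from has_parity_ap_mult[OF has_parity_ap_letter this(2), of "Ld n \<nu>0 \<nu>1"] show ?case by (simp add: mod_Suc_eq)
next
  case (5 l w x)
  from has_parity_ap_mult[OF has_parity_ap_letter this(2), of "Ldb n \<nu>0 \<nu>1"] show ?case by (simp add: mod_Suc_eq)
qed

lemma has_parity_even: "x \<in> {D.E, D.F, D.sg} \<Longrightarrow> has_parity n \<nu>0 \<nu>1 (ap x) 0"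
proof -
  have 2: "has_parity n \<nu>0 \<nu>1 (ap (x * y)) 0" if "x \<in> {Lz, Lzb, Ld n \<nu>0 \<nu>1, Ldb n \<nu>0 \<nu>1}" 
    "y \<in> {Lz, Lzb, Ld n \<nu>0 \<nu>1, Ldb n \<nu>0 \<nu>1}" for x y
    using has_parity_ap_mult[OF has_parity_ap_letter[OF that(1)] has_parity_ap_letter[OF that(2)]] by simp
  have "D.sg = Lz * Ldb n \<nu>0 \<nu>1 + - (Lzb * Ld n \<nu>0 \<nu>1)" by (simp add: D.sg_def)
  then have "has_parity n \<nu>0 \<nu>1 (ap D.sg) 0" by (simp only:) (intro has_parity_ap_add has_parity_ap_minus 2; simp)
  moreover have "has_parity n \<nu>0 \<nu>1 (ap D.E) 0" "has_parity n \<nu>0 \<nu>1 (ap D.F) 0"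
    unfolding D.E_def D.F_def by (intro has_parity_ap_minus 2; simp)+
  ultimately show "x \<in> {D.E, D.F, D.sg} \<Longrightarrow> has_parity n \<nu>0 \<nu>1 (ap x) 0" by blast
qed

lemma has_parity_Par: "has_parity n \<nu>0 \<nu>1 T p \<Longrightarrow> \<exists>x\<in>D.Par p. T = ap x"
proof (induction rule: has_parity.induct)
  case (gen_a \<alpha>)
  have "Lc (1 / 2) * Lz + Lc ((- 1) ^ \<alpha>) * Ld n \<nu>0 \<nu>1 \<in> D.Par 1"
    using D.letter_Par by (intro D.Par_add D.Par_cst) simp_all
  then show ?case unfolding a_op_ap by blast
next
  case (gen_b \<alpha>)
  have "Lc (1 / 2) * Lzb + Lc ((- 1) ^ \<alpha>) * Ldb n \<nu>0 \<nu>1 \<in> D.Par 1"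
    using D.letter_Par by (intro D.Par_add D.Par_cst) simp_all
  then show ?case unfolding b_op_ap by blast
next
  case (gen_grp g)
  then have "grp_op g \<in> ap ` D.G" unfolding grp_op_G[symmetric] by (rule imageI)
  then show ?case using D.hom_Par[OF D.hom.intros(1)] by blast
next
  case (scale S p c)
  then obtain x where "x \<in> D.Par p" "S = ap x" by blast
  then show ?case using D.Par_cst[of x p c] op_scale_ap[of c x] by auto
next
  case (add S p T)
  then obtain x y where "x \<in> D.Par p" "S = ap x" "y \<in> D.Par p" "T = ap y" by blast
  then show ?case using D.Par_add[of x p y] plus_ap[of x y] by auto
next
  case (mult S p T q)
  then obtain x y where "x \<in> D.Par p" "S = ap x" "y \<in> D.Par q" "T = ap y" by blast
  then show ?case using D.Par_mult[of x p y q] comp_ap[of x y] D.Par_mod[of "p + q"] by auto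
qed

text \<open>
  The algebra generated by \<open>a\<close>, \<open>b\<close> and the group is the span of words in the four letters, because
  \<open>z\<close> and \<open>d\<close> are linear combinations of the two operators \<open>a\<close>, and likewise for \<open>b\<close>.
\<close>

lemma observables_eq: "observables n \<nu>0 \<nu>1 = ap ` D.alg"
proof (intro equalityI subsetI)
  fix T assume "T \<in> observables n \<nu>0 \<nu>1"
  then show "T \<in> ap ` D.alg"
  proof induction
    case (gen_a \<alpha>)
    then show ?case using has_parity_Par[OF has_parity.gen_a[OF gen_a]] D.Par_alg by blast
  next
    case (gen_b \<alpha>)
    then show ?case using has_parity_Par[OF has_parity.gen_b[OF gen_b]] D.Par_alg by blast
  next
    case (gen_grp g)
    then show ?case using has_parity_Par[OF has_parity.gen_grp[OF gen_grp]] D.Par_alg by blast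
  next
    case (scale S c)
    then obtain x where "x \<in> D.alg" "S = ap x" by blast
    then show ?case using D.alg_cst[of x c] op_scale_ap[of c x] by auto
  next
    case (add S T)
    then obtain x y where "x \<in> D.alg" "S = ap x" "y \<in> D.alg" "T = ap y" by blast
    then show ?case using D.alg_add[of x y] plus_ap[of x y] by auto
  next
    case (mult S T)
    then obtain x y where "x \<in> D.alg" "S = ap x" "y \<in> D.alg" "T = ap y" by blast
    then show ?case using D.alg_mult[of x y] comp_ap[of x y] by auto
  qed
next
  fix T assume "T \<in> ap ` D.alg"
  then obtain x where x: "x \<in> D.alg" "T = ap x" by blast
  have "ap x \<in> observables n \<nu>0 \<nu>1" using x(1) unfolding D.alg_def
  proof (induction rule: D.V.span_induct_alt)
    case base
    have "op_scale 0 (ap 1) \<in> observables n \<nu>0 \<nu>1"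
      using has_parity_observables[OF has_parity_ap_G[OF D.one_G]] by (rule observables.scale)
    then show ?case by (simp add: op_scale_ap)
  next
    case (step c x y)
    then show ?case unfolding plus_ap[symmetric] op_scale_ap[symmetric]
      using has_parity_observables[OF has_parity_hom] by (blast intro: observables.intros)
  qed
  then show "T \<in> observables n \<nu>0 \<nu>1" using x(2) by simp
qed

section \<open>Supertraces\<close>

text \<open>
  A supertrace is linear only on the observables. It is extended to a linear functional on the whole ring
  of operators, where the results on admissible functionals apply.
\<close>

lemma supertrace_lin:
  assumes "is_supertrace n \<nu>0 \<nu>1 str"
  obtains h where "D.lin h" "\<And>x. x \<in> D.alg \<Longrightarrow> h x = str (ap x)"
proof -
  have add: "str (ap x + ap y) = str (ap x) + str (ap y)" "str (op_scale c (ap x)) = c * str (ap x)" 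
    if "x \<in> D.alg" "y \<in> D.alg" for x y c
    using assms that unfolding is_supertrace_def observables_eq by blast+
  obtain B where B: "B \<subseteq> D.alg" "D.V.independent B" "D.alg \<subseteq> D.V.span B"
    using D.V.maximal_independent_subset[of D.alg] by blast
  obtain h where h: "D.lin h" "\<forall>b\<in>B. h b = str (ap b)" using D.lin_extend[OF B(2), of "\<lambda>b. str (ap b)"] by blast
  have "x \<in> D.alg \<and> h x = str (ap x)" if "x \<in> D.V.span B" for x
    using that
  proof (induction rule: D.V.span_induct_alt)
    case base
    have "0 \<in> D.alg" by (rule D.V.subspace_0[OF D.subspace_alg])
    then show ?case using add(2)[of 0 0 0] D.lin_0[OF h(1)] by (simp add: op_scale_ap)
  next
    case (step c x y)
    have x: "x \<in> D.alg" "Lc c * x \<in> D.alg" using step(1) B(1) D.alg_cst by auto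
    have "str (ap (Lc c * x + y)) = c * str (ap x) + str (ap y)"
      using add(1)[OF x(2), of y] add(2)[OF x(1) x(1), of c] step(2) by (simp add: op_scale_ap plus_ap)
    then show ?case using step h x D.alg_add by (simp add: D.lin_add[OF h(1)] D.lin_cst[OF h(1)])
  qed
  then show thesis using that h(1) B(3) by blast
qed

lemma supertrace_determined:
  assumes str: "is_supertrace n \<nu>0 \<nu>1 str" and S: "\<And>k. om n k \<noteq> - 1 \<Longrightarrow> str (ap (LS n k)) = 0" and T: "T \<in> observables n \<nu>0 \<nu>1"
  shows "str T = 0"
proof -
  obtain h where h: "D.lin h" "\<And>x. x \<in> D.alg \<Longrightarrow> h x = str (ap x)" using supertrace_lin[OF str] by blast
  have comm: "h (a * x) = (- 1) ^ (p * q) * h (x * a)" 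
    if "has_parity n \<nu>0 \<nu>1 (ap a) p" "has_parity n \<nu>0 \<nu>1 (ap x) q" for a x p q
  proof -
    have ax: "a \<in> D.alg" "x \<in> D.alg"
      using has_parity_observables[OF that(1)] has_parity_observables[OF that(2)] inj_ap
      unfolding observables_eq by (auto dest: injD)
    have "str (ap a \<circ> ap x) = (- 1) ^ (p * q) * str (ap x \<circ> ap a)"
      using str that unfolding is_supertrace_def by blast
    then show ?thesis using h(2)[OF D.alg_mult[OF ax]] h(2)[OF D.alg_mult[OF ax(2,1)]] by (simp add: comp_ap)
  qed
  have even: "h (a * x) = h (x * a)" if "x \<in> D.alg" "has_parity n \<nu>0 \<nu>1 (ap a) 0" for a x
  proof (rule D.lin_span_eq[of "\<lambda>x. h (a * x)" "\<lambda>x. h (x * a)" x, OF _ _ that(1)[unfolded D.alg_def]])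
    fix x assume "x \<in> {x. \<exists>l w. (l, w, x) \<in> D.hom}"
    then show "h (a * x) = h (x * a)" using comm[OF that(2) has_parity_hom] by auto
  qed (auto simp: D.lin_def distrib_left distrib_right D.lin_add[OF h(1)] D.lin_cst[OF h(1)] D.cst_left[of a] mult.assoc)
  have odd: "h (a * x) = - h (x * a)" if "(l, w, x) \<in> D.hom" "odd l" "a \<in> {Lz, Lzb, Ld n \<nu>0 \<nu>1, Ldb n \<nu>0 \<nu>1}" for l w x a

  proof -
    have "l mod 2 = 1" using that(2) by presburger
    then show ?thesis using comm[OF has_parity_ap_letter[OF that(3)] has_parity_hom[OF that(1)]] by simp
  qed
  have hG: "h (g * x) = h (x * g)" if "x \<in> D.alg" "g \<in> D.G" for x g
    by (rule even[OF that(1) has_parity_ap_G[OF that(2)]])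
  have hE: "h (a * x) = h (x * a)" if "x \<in> D.alg" "a \<in> {D.E, D.F, D.sg}" for x a
    by (rule even[OF that(1) has_parity_even[OF that(2)]])
  have adm: "D.admissible h" by (rule D.supertrace_admissible(1)[OF h(1)]) (fact hG odd hE)+
  have PP: "h x = 0" if "x \<in> D.PP" for x by (rule D.supertrace_admissible(2)[OF h(1) _ _ _ that]) (fact hG odd hE)+
  have "h (LS n k) = 0" if "om n k \<noteq> - 1" for k
    using h(2)[OF D.alg_G[of "LS n k"]] S[OF that] by (simp add: D.G_def)
  then have AA: "h x = 0" if "x \<in> D.AA" for x
    using D.admissible_unique[OF adm _ that] by blast
  obtain x where x: "x \<in> D.alg" "T = ap x" using T unfolding observables_eq by blast
  obtain u v where "u \<in> D.AA" "v \<in> D.PP" "x = u + v" using D.PPall_split[OF D.alg_PPall[OF x(1)]] by blast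
  then have "h x = 0" using AA PP D.lin_add[OF h(1)] by simp
  then show ?thesis using h(2)[OF x(1)] x(2) by simp
qed

lemma supertrace_exists:
  assumes v: "\<And>k. v (k + int n) = v k" "\<And>k. v (- k) = v k"
  shows "\<exists>str\<in>supertraces n \<nu>0 \<nu>1. \<forall>k. om n k \<noteq> - 1 \<longrightarrow> str (ap (LS n k)) = v k"
proof -
  obtain f where f: "D.admissible f" "\<And>k. om n k \<noteq> - 1 \<Longrightarrow> f (LS n k) = v k" using D.admissible_exists[of v, OF v] by blast
  obtain h where h: "D.lin h" "\<forall>x\<in>D.AA. h x = f x" "\<forall>x\<in>D.alg. \<forall>g\<in>D.G. h (g * x) = h (x * g)"
    "\<forall>x\<in>D.alg. \<forall>a\<in>{Lz, Lzb, Ld n \<nu>0 \<nu>1, Ldb n \<nu>0 \<nu>1}. h (a * x + x * a) = 0" 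
    "\<forall>l w x. (l, w, x) \<in> D.hom \<longrightarrow> odd l \<longrightarrow> h x = 0"
    using D.admissible_extends[OF f(1)] by blast
  define str where "str T = (if T \<in> observables n \<nu>0 \<nu>1 then h (inv ap T) else 0)" for T
  have str: "str (ap x) = h x" if "x \<in> D.alg" for x
    using that by (simp add: str_def observables_eq inv_f_f[OF inj_ap])
  have "is_supertrace n \<nu>0 \<nu>1 str"
    unfolding is_supertrace_def
  proof (intro conjI ballI allI impI)
    fix S T assume "S \<in> observables n \<nu>0 \<nu>1" "T \<in> observables n \<nu>0 \<nu>1"
    then obtain x y where "x \<in> D.alg" "S = ap x" "y \<in> D.alg" "T = ap y" unfolding observables_eq by blast
    then show "str (S + T) = str S + str T" by (simp add: plus_ap str D.alg_add D.lin_add[OF h(1)])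
  next
    fix S c assume "S \<in> observables n \<nu>0 \<nu>1"
    then obtain x where "x \<in> D.alg" "S = ap x" unfolding observables_eq by blast
    then show "str (op_scale c S) = c * str S" by (simp add: op_scale_ap str D.alg_cst D.lin_cst[OF h(1)])
  next
    fix S T p q assume "has_parity n \<nu>0 \<nu>1 S p" "has_parity n \<nu>0 \<nu>1 T q"
    then obtain x y where xy: "x \<in> D.Par p" "S = ap x" "y \<in> D.Par q" "T = ap y" using has_parity_Par by metis
    then show "str (S \<circ> T) = (- 1) ^ (p * q) * str (T \<circ> S)"
      using D.anticyclic_supertrace[OF h(1,3,4,5) xy(1,3)] 
      by (simp only: comp_ap str D.alg_mult[OF D.Par_alg D.Par_alg])
  qed
  moreover have "str T = 0" if "T \<notin> observables n \<nu>0 \<nu>1" for T using that by (simp add: str_def)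
  moreover have "str (ap (LS n k)) = v k" if "om n k \<noteq> - 1" for k
    using f(2)[OF that] h(2) D.AA_S[of k] D.alg_G[of "LS n k"] by (simp add: str D.G_def)
  ultimately show ?thesis unfolding supertraces_def by blast
qed

lemma supertrace_S:
  assumes "is_supertrace n \<nu>0 \<nu>1 str"
  shows "str (ap (LS n (k + int n))) = str (ap (LS n k))" "str (ap (LS n (- k))) = str (ap (LS n k))"
proof -
  show "str (ap (LS n (k + int n))) = str (ap (LS n k))" by (simp add: D.S_period)
  have "has_parity n \<nu>0 \<nu>1 (ap (LR n 0)) 0" "has_parity n \<nu>0 \<nu>1 (ap (LR n (- k))) 0"
    by (rule has_parity_ap_G, simp add: D.G_def)+
  then have "str (ap (LR n (- k)) \<circ> ap (LR n 0)) = (- 1) ^ (0 * 0) * str (ap (LR n 0) \<circ> ap (LR n (- k)))"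
    using assms unfolding is_supertrace_def by blast
  then show "str (ap (LS n (- k))) = str (ap (LS n k))" by (simp add: comp_ap D.R_R)
qed

text \<open>
  For even \<open>n\<close> the rotation with index \<open>n div 2\<close> is \<open>- 1\<close>, where no value needs to be given.
\<close>

lemma supertrace_eq_0:
  assumes str: "str \<in> supertraces n \<nu>0 \<nu>1" and S: "\<And>k. k < (n + 1) div 2 \<Longrightarrow> str (ap (LS n (int k))) = 0"
  shows "str = 0"
proof
  fix T
  have st: "is_supertrace n \<nu>0 \<nu>1 str" using str by (simp add: supertraces_def)
  have "str (ap (LS n k)) = 0" if k: "om n k \<noteq> - 1" for k
  proof -
    define j where "j = k mod int n"
    have j: "0 \<le> j" "j < int n" using n2 by (simp_all add: j_def)
    have eq: "str (ap (LS n j)) = str (ap (LS n k))"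
      unfolding j_def by (rule mod_periodic[of "\<lambda>k. str (ap (LS n k))"]) (rule supertrace_S(1)[OF st])
    have om: "om n j = om n k" unfolding j_def using n2 by (intro mod_periodic om_period) simp
    have half: "str (ap (LS n i)) = 0" if "0 \<le> i" "i < int ((n + 1) div 2)" for i
      using S[of "nat i"] that by (simp add: nat_less_iff)
    show ?thesis
    proof (cases "j < int ((n + 1) div 2)")
      case True
      then show ?thesis using half j eq by simp
    next
      case False
      have "2 * j \<noteq> int n"
      proof
        assume 2: "2 * j = int n"
        have "2 * pi * of_int j / real n = pi"
        proof -
          have "real n = 2 * of_int j" using 2 by (metis of_int_mult of_int_numeral of_int_of_nat_eq)
          moreover have "of_int j \<noteq> (0 :: real)" using False j by (auto intro: ccontr)
          ultimately show ?thesis by simp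
        qed
        then show False using k om by (simp add: om_def)
      qed
      moreover have "int n \<le> 2 * int ((n + 1) div 2)" by linarith
      ultimately have "int n - j < int ((n + 1) div 2)" using False by linarith
      then have "str (ap (LS n (- j + int n))) = 0" using half[of "int n - j"] j by simp
      then show ?thesis using supertrace_S(1)[OF st, of "- j"] supertrace_S(2)[OF st, of j] eq by simp
    qed
  qed
  then have "str T = 0" if "T \<in> observables n \<nu>0 \<nu>1"
    using supertrace_determined[OF st _ that] by blast
  then show "str T = 0 T" using str by (auto simp: supertraces_def)
qed

text \<open>
  The initial values are the indicator functions of the classes \<open>{k, - k}\<close> modulo \<open>n\<close>.
\<close>

lemma dual_supertraces:
  "\<exists>\<tau>. \<forall>j<(n + 1) div 2. \<tau> j \<in> supertraces n \<nu>0 \<nu>1 \<and> 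
    (\<forall>i<(n + 1) div 2. \<tau> j (ap (LS n (int i))) = (if i = j then 1 else 0))"
proof -
  have "\<exists>str. str \<in> supertraces n \<nu>0 \<nu>1 \<and> (\<forall>i<(n + 1) div 2. str (ap (LS n (int i))) = (if i = j then 1 else 0))"
    if j: "j < (n + 1) div 2" for j
  proof -
    define v where "v k = (if int n dvd k - int j \<or> int n dvd k + int j then 1 else 0 :: complex)" for k
    have "v (k + int n) = v k" "v (- k) = v k" for k
    proof -
      have "k + int n - int j = (k - int j) + int n" "k + int n + int j = (k + int j) + int n" by simp_all
      then show "v (k + int n) = v k" unfolding v_def by (simp only: dvd_add_triv_right_iff)
      have "int n dvd - k - int j \<longleftrightarrow> int n dvd k + int j" "int n dvd - k + int j \<longleftrightarrow> int n dvd k - int j"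
        using dvd_minus_iff[of "int n" "k + int j"] dvd_minus_iff[of "int n" "k - int j"] by simp_all
      then show "v (- k) = v k" unfolding v_def by auto
    qed
    then obtain str where str: "str \<in> supertraces n \<nu>0 \<nu>1" "\<And>k. om n k \<noteq> - 1 \<Longrightarrow> str (ap (LS n k)) = v k"
      using supertrace_exists[of v] by blast
    have "str (ap (LS n (int i))) = (if i = j then 1 else 0)" if i: "i < (n + 1) div 2" for i
    proof -
      have small: "k = 0" if "int n dvd k" "\<bar>k\<bar> < int n" for k using that dvd_imp_le_int[of k "int n"] by auto
      have "om n (int i) \<noteq> - 1"
      proof
        assume 1: "om n (int i) = - 1"
        then have "om n (int i + int i) = 1" by (simp only: om_add 1) simp
        then have "int n dvd int i + int i" using om_eq_1_iff[of n "int i + int i"] n2 by simp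
        then have "int i + int i = 0" by (rule small) (use i n2 in linarith)
        then show False using 1 by simp
      qed
      moreover have "int i = int j" if "int n dvd int i - int j \<or> int n dvd int i + int j"
        using that
      proof
        assume "int n dvd int i - int j"
        then have "int i - int j = 0" by (rule small) (use i j n2 in linarith)
        then show ?thesis by simp
      next
        assume "int n dvd int i + int j"
        then have "int i + int j = 0" by (rule small) (use i j n2 in linarith)
        then show ?thesis by simp
      qed
      ultimately show ?thesis using str(2)[of "int i"] by (auto simp: v_def)
    qed
    then show ?thesis using str(1) by blast
  qed
  then have "\<forall>j. \<exists>str. j < (n + 1) div 2 \<longrightarrow> str \<in> supertraces n \<nu>0 \<nu>1 \<and> 
    (\<forall>i<(n + 1) div 2. str (ap (LS n (int i))) = (if i = j then 1 else 0))" by blast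
  from choice[OF this] show ?thesis by blast
qed

lemma sum_fun_scale: "(\<Sum>j\<in>J. fun_scale (a j) (\<tau> j)) x = (\<Sum>j\<in>J. a j * \<tau> j x)"
  by (induction J rule: infinite_finite_induct) (auto simp: fun_scale_def)

lemma dim_supertraces: "cfun.dim (supertraces n \<nu>0 \<nu>1) = (n + 1) div 2"
proof -
  let ?N = "(n + 1) div 2"
  let ?s = "\<lambda>i. ap (LS n (int i))"
  obtain \<tau> where \<tau>: "\<And>j. j < ?N \<Longrightarrow> \<tau> j \<in> supertraces n \<nu>0 \<nu>1" 
    and dual: "\<And>i j. i < ?N \<Longrightarrow> j < ?N \<Longrightarrow> \<tau> j (?s i) = (if i = j then 1 else 0)"
    using dual_supertraces by blast
  have inj: "inj_on \<tau> {..<?N}"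
  proof (rule inj_onI)
    fix i j assume "i \<in> {..<?N}" "j \<in> {..<?N}" "\<tau> i = \<tau> j"
    then show "i = j" using dual[of i i] dual[of i j] by (auto split: if_splits)
  qed
  let ?B = "\<tau> ` {..<?N}"
  have coeff: "(\<Sum>j<?N. a j * \<tau> j (?s i)) = a i" if "i < ?N" for i a
  proof -
    have "(\<Sum>j<?N. a j * \<tau> j (?s i)) = (\<Sum>j<?N. if j = i then a j else 0)"
      by (rule sum.cong) (use that dual in auto)
    then show ?thesis using that by simp
  qed
  have ind: "cfun.independent ?B"
  proof (rule notI)
    assume dep: "cfun.dependent ?B"
    have fin: "finite ?B" by simp
    obtain u x where x: "x \<in> ?B" and ux: "u x \<noteq> 0" and s: "(\<Sum>x\<in>?B. fun_scale (u x) x) = 0"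
      using dep unfolding cfun.dependent_finite[OF fin] by (elim exE conjE bexE)
    obtain i where i: "i < ?N" "x = \<tau> i" using x by blast
    have e: "(\<Sum>j<?N. fun_scale (u (\<tau> j)) (\<tau> j)) = 0"
      using s by (simp only: sum.reindex[OF inj] o_def)
    have z: "(\<Sum>j<?N. fun_scale (u (\<tau> j)) (\<tau> j)) (?s i) = 0" by (simp only: e zero_fun_apply)
    have d: "(\<Sum>j<?N. fun_scale (u (\<tau> j)) (\<tau> j)) (?s i) = (\<Sum>j<?N. u (\<tau> j) * \<tau> j (?s i))"
      by (rule sum_fun_scale[of "\<lambda>j. u (\<tau> j)" \<tau> "{..<?N}" "?s i"])
    have c: "(\<Sum>j<?N. u (\<tau> j) * \<tau> j (?s i)) = u (\<tau> i)"
      by (rule coeff[of i "\<lambda>j. u (\<tau> j)", OF i(1)])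
    have "u (\<tau> i) = 0" by (rule trans[OF sym[OF trans[OF d c]] z])
    then show False using ux unfolding i(2) by (rule notE[rotated])
  qed
  have span: "supertraces n \<nu>0 \<nu>1 \<subseteq> cfun.span ?B"
  proof
    fix str assume str: "str \<in> supertraces n \<nu>0 \<nu>1"
    let ?t = "\<Sum>j<?N. fun_scale (str (?s j)) (\<tau> j)"
    have t: "?t \<in> supertraces n \<nu>0 \<nu>1"
      by (rule cfun.subspace_sum[OF subspace_supertraces], rule cfun.subspace_scale[OF subspace_supertraces])
        (rule \<tau>, erule lessThan_iff[THEN iffD1])
    have diff: "str - ?t = 0"
    proof (rule supertrace_eq_0)
      show "str - ?t \<in> supertraces n \<nu>0 \<nu>1" by (rule cfun.subspace_diff[OF subspace_supertraces str t])
      show "(str - ?t) (?s i) = 0" if i: "i < ?N" for i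
      proof -
        have "?t (?s i) = (\<Sum>j<?N. str (?s j) * \<tau> j (?s i))"
          by (rule sum_fun_scale[of "\<lambda>j. str (?s j)" \<tau> "{..<?N}" "?s i"])
        also have "\<dots> = str (?s i)" by (rule coeff[of i "\<lambda>j. str (?s j)", OF i])
        finally have e: "?t (?s i) = str (?s i)" .
        show ?thesis by (simp only: minus_apply e diff_self)
      qed
    qed
    have eq: "str = ?t" by (rule eq_iff_diff_eq_0[THEN iffD2, OF diff])
    have mem: "?t \<in> cfun.span ?B" 
      by (rule cfun.span_sum, rule cfun.span_scale, rule cfun.span_base, erule imageI)
    show "str \<in> cfun.span ?B"
      by (rule back_subst[of "\<lambda>x. x \<in> cfun.span ?B", OF mem sym[OF eq]])
  qed
  have card: "card ?B = ?N" using card_image[OF inj] by (simp only: card_lessThan)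
  have sub: "?B \<subseteq> supertraces n \<nu>0 \<nu>1" using \<tau> by blast
  show ?thesis by (rule cfun.dim_unique[OF sub span ind card])
qed

end

theorem theorem2:
  fixes n :: nat and \<nu>0 \<nu>1 :: complex
  assumes "n \<ge> 2"
    and "odd n \<Longrightarrow> \<nu>0 = \<nu>1"
  shows "cfun.dim (supertraces n \<nu>0 \<nu>1) = (n + 1) div 2"
  by (rule dim_supertraces[OF assms(1)]) (rule assms(2))

end
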